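(* Let $n\ge3$, $2<p\le2^*=\frac{2n}{n-2}$ and $\alpha_n=e^{\frac{n-3}{n-2}}$. For any $0<\alpha\le\alpha_n$ and all $v\in C_c^\infty(\mathbb{H}^n)$ there holds $$\int_{\mathbb{H}^n}|\nabla_{\mathbb{H}^n}v|^2dV-\Big(\frac{n-2}{2}\Big)^2\int_{\mathbb{H}^n}\frac{v^2}{\rho^2}dV\ \ge\ (n-2)^{-\frac{p+2}{p}}S_{n,p}\Big(\int_{\mathbb{H}^n}(\sinh\rho)^{\frac{p(n-2)}{2}-n}X^{\frac{p+2}{2}}\big(\alpha\tanh(\rho/2)\big)|v|^pdV\Big)^{2/p}.$$ Moreover the constant $(n-2)^{-\frac{p+2}{p}}S_{n,p}$ is sharp for all values of $\alpha\in(0,\alpha_n]$.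
   Context: $\mathbb{H}^n$ is the $n$-dimensional hyperbolic space (curvature $-1$) with Riemannian gradient $\nabla_{\mathbb{H}^n}$ and volume element $dV$; $\rho=\rho(x)$ is the hyperbolic distance from $x$ to a fixed point $x_0\in\mathbb{H}^n$. (In the ball model $B_1$ with metric $\big(\frac{1-|x|^2}{2}\big)^{-2}dx^2$ and $x_0=0$, $\rho(x)=\ln\frac{1+|x|}{1-|x|}$.) Functions are real-valued. $X(t)=\frac{1}{1-\ln t}$ for $t\in(0,e)$, and $X^{q}(t)=(X(t))^q$. $S_{n,p}$ denotes the best (largest) constant in the inequality $\int_{\mathbb{R}^n}|\nabla u|^2dx\ge S_{n,p}\big(\int_{\mathbb{R}^n}|x|^{\frac{p(n-2)}{2}-n}|u|^pdx\big)^{2/p}$ for all $u\in C_c^\infty(\mathbb{R}^n)$. "Sharp" means that the constant cannot be replaced by a larger one. *)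

theory Defs
  imports "HOL-Analysis.Analysis"
begin

section \<open>Smooth functions with compact support\<close>

definition partial :: "'n \<Rightarrow> (real^'n \<Rightarrow> real) \<Rightarrow> real^'n \<Rightarrow> real" where
  "partial i f x = frechet_derivative f (at x) (axis i 1)"

primrec Ck :: "nat \<Rightarrow> (real^'n \<Rightarrow> real) \<Rightarrow> bool" where
  "Ck 0 f \<longleftrightarrow> continuous_on UNIV f"
| "Ck (Suc k) f \<longleftrightarrow> (\<forall>x. f differentiable (at x)) \<and> (\<forall>i. Ck k (partial i f))"

definition smooth :: "(real^'n \<Rightarrow> real) \<Rightarrow> bool" where
  "smooth f \<longleftrightarrow> (\<forall>k. Ck k f)"

text \<open>
  A smooth function with compact support in an open set \<open>\<Omega>\<close> is identified with its extension
  by zero, which is smooth on the whole space.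
\<close>

definition test_functions :: "(real^'n) set \<Rightarrow> (real^'n \<Rightarrow> real) set" where
  "test_functions \<Omega> =
     {f. smooth f \<and> compact (closure {x. f x \<noteq> 0}) \<and> closure {x. f x \<noteq> 0} \<subseteq> \<Omega>}"

definition grad :: "(real^'n \<Rightarrow> real) \<Rightarrow> real^'n \<Rightarrow> real^'n" where
  "grad f x = (\<chi> i. partial i f x)"

section \<open>The ball model of hyperbolic space\<close>

text \<open>
  The points are those of \<open>ball 0 1\<close>; the metric tensor is \<open>((1 - |x|\<^sup>2) / 2)\<^sup>-\<^sup>2 dx\<^sup>2\<close>,
  of curvature \<open>-1\<close>.
\<close>

definition hyp_metric :: "real^'n \<Rightarrow> real^'n \<Rightarrow> real^'n \<Rightarrow> real" where
  "hyp_metric x u w = (2 / (1 - (norm x)\<^sup>2))\<^sup>2 * (u \<bullet> w)"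

text \<open>The Riemannian gradient, characterised by lemma \<open>hyp_metric_hyp_grad\<close> below.\<close>

definition hyp_grad :: "(real^'n \<Rightarrow> real) \<Rightarrow> real^'n \<Rightarrow> real^'n" where
  "hyp_grad v x = ((1 - (norm x)\<^sup>2) / 2)\<^sup>2 *\<^sub>R grad v x"

definition hyp_norm :: "real^'n \<Rightarrow> real^'n \<Rightarrow> real" where
  "hyp_norm x u = sqrt (hyp_metric x u u)"

definition hyp_volume :: "(real^'n) measure" where
  "hyp_volume = density lborel
     (\<lambda>x. ennreal (indicator (ball 0 1) x * (2 / (1 - (norm x)\<^sup>2)) ^ CARD('n)))"

definition hyp_dist :: "real^'n \<Rightarrow> real^'n \<Rightarrow> real" where
  "hyp_dist x y =
     arcosh (1 + 2 * (norm (x - y))\<^sup>2 / ((1 - (norm x)\<^sup>2) * (1 - (norm y)\<^sup>2)))"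

lemma hyp_metric_hyp_grad:
  fixes v :: "real^'n \<Rightarrow> real"
  assumes x: "x \<in> ball 0 1" and v: "v differentiable (at x)"
  shows "hyp_metric x (hyp_grad v x) h = frechet_derivative v (at x) h"
proof -
  have "norm x < 1" using x by simp
  then have "(norm x)\<^sup>2 < 1" by (simp add: abs_square_less_1)
  then have nz: "1 - (norm x)\<^sup>2 \<noteq> 0" by simp
  have lin: "linear (frechet_derivative v (at x))"
    by (rule linear_frechet_derivative[OF v])
  have "frechet_derivative v (at x) h =
      frechet_derivative v (at x) (\<Sum>i\<in>UNIV. (h $ i) *\<^sub>R axis i 1)"
    by (simp only: basis_expansion scalar_mult_eq_scaleR[symmetric])
  also have "\<dots> = (\<Sum>i\<in>UNIV. (h $ i) * frechet_derivative v (at x) (axis i 1))"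
    by (simp only: linear_sum[OF lin] linear_cmul[OF lin] real_scaleR_def o_def)
  also have "\<dots> = grad v x \<bullet> h"
    by (simp add: inner_vec_def grad_def partial_def mult.commute)
  finally have "frechet_derivative v (at x) h = grad v x \<bullet> h" .
  moreover have "(2 / a)\<^sup>2 * (a / 2)\<^sup>2 = 1" if "a \<noteq> 0" for a :: real
    using that by (simp add: power_divide)
  note this[OF nz]
  ultimately show ?thesis
    by (simp add: hyp_metric_def hyp_grad_def mult.assoc[symmetric])
qed

lemma hyp_dist_zero:
  fixes x :: "real^'n"
  assumes "x \<in> ball 0 1"
  shows "hyp_dist x 0 = ln ((1 + norm x) / (1 - norm x))"
proof -
  define r where "r = norm x"
  have r: "0 \<le> r" "r < 1" using assms by (auto simp: r_def)
  define d where "d = 1 - r\<^sup>2"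
  have d: "d > 0" using r by (simp add: d_def abs_square_less_1)
  have d_fac: "d = (1 - r) * (1 + r)" by (simp add: d_def power2_eq_square algebra_simps)
  define c where "c = 1 + 2 * r\<^sup>2 / d"
  have c: "c = (1 + r\<^sup>2) / d"
    using d by (simp add: c_def d_def field_simps)
  have "(1 + r\<^sup>2)\<^sup>2 - d\<^sup>2 = (2 * r)\<^sup>2"
    by (simp add: d_def power2_eq_square algebra_simps)
  moreover have "c\<^sup>2 - 1 = ((1 + r\<^sup>2)\<^sup>2 - d\<^sup>2) / d\<^sup>2"
    using d by (simp add: c power_divide diff_divide_distrib)
  ultimately have "c\<^sup>2 - 1 = (2 * r / d)\<^sup>2" by (simp add: power_divide)
  moreover have "0 \<le> 2 * r / d" using r d by simp
  ultimately have sq: "sqrt (c\<^sup>2 - 1) = 2 * r / d" by (metis real_sqrt_unique)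
  have "1 \<le> c" using d by (simp add: c_def)
  have "hyp_dist x 0 = arcosh c"
    by (simp add: hyp_dist_def c_def d_def r_def)
  also have "\<dots> = ln (c + 2 * r / d)"
    using \<open>1 \<le> c\<close> by (simp only: arcosh_real_def sq)
  also have "c + 2 * r / d = (1 + r) * (1 + r) / d"
    by (simp add: c add_divide_distrib[symmetric] power2_eq_square algebra_simps)
  also have "\<dots> = (1 + r) / (1 - r)"
    using r by (simp add: d_fac)
  finally show ?thesis by (simp add: r_def)
qed

section \<open>The logarithmic weight and the Hardy--Sobolev constant\<close>

definition X :: "real \<Rightarrow> real" where
  "X t = 1 / (1 - ln t)"

text \<open>
  For dimension at least 3 and \<open>p > 2\<close>, every integrand below is integrable for test functions
  (the weight exponents exceed \<open>-2\<close>), so the value 0 that the Bochner integral gives to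
  non-integrable functions plays no role.
  The dimension is carried by the type argument, the index type of the vectors.
\<close>

definition S_const :: "'n::finite itself \<Rightarrow> real \<Rightarrow> real" where
  "S_const _ p = Sup {S. \<forall>u\<in>test_functions (UNIV :: (real^'n) set).
     (\<integral>x. (norm (grad u x))\<^sup>2 \<partial>lborel) \<ge>
     S * (\<integral>x. norm x powr (p * (real CARD('n) - 2) / 2 - real CARD('n)) *
                \<bar>u x\<bar> powr p \<partial>lborel) powr (2 / p)}"

section \<open>The two sides of the inequality\<close>

definition hardy_deficit :: "real^'n \<Rightarrow> (real^'n \<Rightarrow> real) \<Rightarrow> real" where
  "hardy_deficit x0 v =
     (\<integral>x. (hyp_norm x (hyp_grad v x))\<^sup>2 \<partial>hyp_volume) -
     ((real CARD('n) - 2) / 2)\<^sup>2 * (\<integral>x. (v x)\<^sup>2 / (hyp_dist x x0)\<^sup>2 \<partial>hyp_volume)"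

definition weighted_term :: "real \<Rightarrow> real \<Rightarrow> real^'n \<Rightarrow> (real^'n \<Rightarrow> real) \<Rightarrow> real" where
  "weighted_term p \<alpha> x0 v =
     (\<integral>x. sinh (hyp_dist x x0) powr (p * (real CARD('n) - 2) / 2 - real CARD('n)) *
           X (\<alpha> * tanh (hyp_dist x x0 / 2)) powr ((p + 2) / 2) *
           \<bar>v x\<bar> powr p \<partial>hyp_volume) powr (2 / p)"

end

theory Submission
  imports Defs
begin

text \<open>
  A hyperbolic isometry moves the base point to the origin of the ball. There the ground state
  substitution \<open>y = (sinh \<rho>)\<^bsup>(n-2)/2\<^esup> v\<close> turns the left-hand side into a weighted Dirichlet integral plus a
  nonnegative potential term, and the map \<open>z \<mapsto> exp (1 - |z|\<^bsup>2-n\<^esup>) / \<alpha> * z / |z|\<close> turns that integral into an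
  upper bound for the Dirichlet integral on \<open>\<real>\<^sup>n\<close>, with equality on radial functions, and the weighted norm
  into the norm that defines the Hardy--Sobolev constant. The bound on \<open>\<alpha>\<close> says that this map expands
  radial directions at least as much as tangential ones.

  For the sharpness, rearrangement shows that radial functions nearly attain the Hardy--Sobolev constant;
  scaling them towards the origin makes the potential term negligible. The rearrangement inequality is
  obtained from the Brunn--Minkowski inequality by way of the energy of slabs between level sets.
\<close>

text \<open>The map matches harmonic coordinates. After the substitution the energy density is
  \<open>|x|^(2-n) |grad y|^2\<close>, so radial functions carry the energy of a planar problem,
  with harmonic coordinate \<open>ln |x|\<close>; in Euclidean space this coordinate is
  \<open>|z|^(2-n)\<close>. The map solves \<open>1 - ln (\<alpha> |x|) = |z|^(2-n)\<close>, whose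
  left side is \<open>1 / X\<close>. From Euclidean space to the ball the radial energy is divided
  by \<open>n - 2\<close> and the weighted integral multiplied by it, whence the exponent
  \<open>-1 - 2/p\<close>. The substitution is singular at the base point, so functions are first
  cut off there, at a cost of order \<open>r^(n-2)\<close> for radius \<open>r\<close>. Transplanted
  functions are tracked only as C1 functions, while the Hardy--Sobolev constant is defined by smooth
  ones: rearrangement turns a C1 function violating the inequality into a smooth radial one. The
  rearrangement of a test function may fail to be smooth. It is replaced by a smoothed piecewise
  linear function of the harmonic coordinate, which is optimal between prescribed levels and depends
  only on the volumes of finitely many superlevel sets.\<close>

section \<open>The Brunn--Minkowski inequality by way of Prekopa--Leindler\<close>

text \<open>For compact sets, the scaled copy of \<open>K\<close> shifted by the least point of
  \<open>L\<close> and the scaled copy of \<open>L\<close> shifted by the greatest point of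
  \<open>K\<close> both lie in \<open>W\<close> and meet in at most one point, so their lengths add
  up. Inner regularity extends this to Borel sets.\<close>

lemma weighted_sum_measure_le_1D:
  fixes U V W :: "real set"
  assumes U: "U \<in> sets borel" "bounded U" "U \<noteq> {}" and V: "V \<in> sets borel" "bounded V" "V \<noteq> {}"
    and W: "W \<in> sets borel" "bounded W" and l: "0 < l" "l < 1"
    and sub: "\<And>u v. u \<in> U \<Longrightarrow> v \<in> V \<Longrightarrow> (1 - l) * u + l * v \<in> W"
  shows "(1 - l) * measure lborel U + l * measure lborel V \<le> measure lborel W"
proof -
  have inner: "\<exists>K. compact K \<and> K \<noteq> {} \<and> K \<subseteq> S \<and> measure lborel S - e \<le> measure lborel K"
    if S: "S \<in> sets borel" "bounded S" "S \<noteq> {}" and e: "0 < e" for S :: "real set" and e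
  proof -
    have leb: "S \<in> sets lebesgue" using S(1) by simp
    obtain T where T: "closed T" "T \<subseteq> S" "S - T \<in> lmeasurable" "emeasure lebesgue (S - T) < ennreal e"
      using sets_lebesgue_inner_closed[OF leb e] by blast
    obtain s where s: "s \<in> S" using S(3) by blast
    have cT: "compact T" using T(1,2) S(2) bounded_subset compact_eq_bounded_closed by blast
    have "S \<in> lmeasurable" using leb S(2) by (rule bounded_set_imp_lmeasurable[rotated])
    moreover have "T \<in> lmeasurable" using cT by (rule lmeasurable_compact)
    ultimately have "measure lebesgue (S - T) = measure lebesgue S - measure lebesgue T"
      using T(2) by (simp add: measurable_measure_Diff)
    moreover have "measure lebesgue (S - T) \<le> e"
      using T(3,4) e by (simp add: emeasure_eq_measure2 ennreal_less_iff less_imp_le)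
    moreover have "measure lebesgue S = measure lborel S" "measure lebesgue T = measure lborel T"
      using S(1) borel_closed[OF T(1)] by simp_all
    ultimately have *: "measure lborel S - e \<le> measure lborel T" by simp
    \<comment> \<open>The extra point \<open>s\<close> keeps the inner set nonempty even if
      \<open>T\<close> is empty; extreme points of the inner sets are taken below.\<close>
    also have "\<dots> \<le> measure lborel (insert s T)"
      using cT by (intro measure_mono_fmeasurable) (auto intro: fmeasurable_compact borel_compact)
    finally show ?thesis using cT T(2) s
      by (intro exI[of _ "insert s T"]) auto
  qed
  have cpt: "(1 - l) * measure lborel K + l * measure lborel L \<le> measure lborel W"
    if K: "compact K" "K \<noteq> {}" "K \<subseteq> U" and L: "compact L" "L \<noteq> {}" "L \<subseteq> V" for K L
  proof -
    obtain u where u: "u \<in> K" "\<And>x. x \<in> K \<Longrightarrow> x \<le> u" using compact_attains_sup[OF K(1,2)] by blast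
    obtain v where v: "v \<in> L" "\<And>x. x \<in> L \<Longrightarrow> v \<le> x" using compact_attains_inf[OF L(1,2)] by blast
    let ?A = "(\<lambda>x. l * v + (1 - l) * x) ` K" and ?B = "(\<lambda>x. (1 - l) * u + l * x) ` L"
    have cA: "compact ?A" by (intro compact_continuous_image continuous_intros K)
    have cB: "compact ?B" by (intro compact_continuous_image continuous_intros L)
    have mA: "measure lebesgue ?A = (1 - l) * measure lebesgue K"
      using measure_lebesgue_affine[of "1 - l" "l * v" K] l by (simp add: add.commute)
    have mB: "measure lebesgue ?B = l * measure lebesgue L"
      using measure_lebesgue_affine[of l "(1 - l) * u" L] l by (simp add: add.commute)
    have AB: "?A \<inter> ?B \<subseteq> {l * v + (1 - l) * u}"
    proof
      fix z assume "z \<in> ?A \<inter> ?B"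
      then obtain x y where xy: "x \<in> K" "y \<in> L" "z = l * v + (1 - l) * x" "z = (1 - l) * u + l * y" by auto
      have "(1 - l) * x \<le> (1 - l) * u" "l * v \<le> l * y" using u(2)[OF xy(1)] v(2)[OF xy(2)] l by auto
      then have "(1 - l) * x = (1 - l) * u" using xy(3,4) by linarith
      then show "z \<in> {l * v + (1 - l) * u}" using xy(3) by (simp only: singleton_iff)
    qed
    have ng: "negligible (?A \<inter> ?B)" using AB negligible_subset negligible_sing by blast
    have "measure lebesgue ?A + measure lebesgue ?B = measure lebesgue (?A \<union> ?B)"
      using measure_negligible_finite_Union[of "{?A,?B}"] cA cB ng
      by (subst measure_Un3) (auto simp: lmeasurable_compact negligible_imp_measure0)
    also have "\<dots> \<le> measure lebesgue W"
    proof (rule measure_mono_fmeasurable)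
      show "?A \<union> ?B \<subseteq> W" using sub K(3) L(3) u(1) v(1) by (auto simp: add.commute)
      show "W \<in> lmeasurable" using W by (simp add: bounded_set_imp_lmeasurable)
    qed (intro sets.Un fmeasurableD lmeasurable_compact cA cB)
    finally show ?thesis using mA mB K(1) L(1) W(1) by (simp add: borel_compact)
  qed
  show ?thesis
  proof (rule field_le_epsilon)
    fix e :: real assume e: "0 < e"
    obtain K where K: "compact K" "K \<noteq> {}" "K \<subseteq> U" "measure lborel U - e \<le> measure lborel K" using inner[OF U e] by blast
    obtain L where L: "compact L" "L \<noteq> {}" "L \<subseteq> V" "measure lborel V - e \<le> measure lborel L" using inner[OF V e] by blast
    have "(1 - l) * measure lborel U + l * measure lborel V
       \<le> (1 - l) * (measure lborel K + e) + l * (measure lborel L + e)"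
      using K(4) L(4) l by (intro add_mono mult_left_mono) auto
    also have "\<dots> = ((1 - l) * measure lborel K + l * measure lborel L) + e" by (simp add: algebra_simps)
    also have "\<dots> \<le> measure lborel W + e" using cpt[OF K(1-3) L(1-3)] by simp
    finally show "(1 - l) * measure lborel U + l * measure lborel V \<le> measure lborel W + e" .
  qed
qed

lemma nn_integral_layer_cake:
  fixes f :: "'a \<Rightarrow> real"
  assumes "sigma_finite_measure M" and f[measurable]: "f \<in> borel_measurable M" and nn: "\<And>x. 0 \<le> f x"
  shows "(\<integral>\<^sup>+x. ennreal (f x) \<partial>M) = (\<integral>\<^sup>+t. indicator {0..} t * emeasure M {x\<in>space M. t < f x} \<partial>lborel)"
proof -
  interpret sigma_finite_measure M by fact
  interpret pair_sigma_finite M lborel by unfold_locales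
  have "(\<integral>\<^sup>+x. ennreal (f x) \<partial>M) = (\<integral>\<^sup>+x. \<integral>\<^sup>+t. indicator {(x,t). 0 \<le> t \<and> t < f x} (x, t) \<partial>lborel \<partial>M)"
  proof (rule nn_integral_cong)
    fix x
    have "ennreal (f x) = emeasure lborel {0..<f x}" using nn[of x] by simp
    also have "\<dots> = (\<integral>\<^sup>+t. indicator {0..<f x} t \<partial>lborel)" by simp
    also have "\<dots> = (\<integral>\<^sup>+t. indicator {(x,t). 0 \<le> t \<and> t < f x} (x, t) \<partial>lborel)"
      by (intro nn_integral_cong) (auto simp: indicator_def)
    finally show "ennreal (f x) = (\<integral>\<^sup>+t. indicator {(x,t). 0 \<le> t \<and> t < f x} (x, t) \<partial>lborel)" .
  qed
  also have "\<dots> = (\<integral>\<^sup>+t. \<integral>\<^sup>+x. indicator {(x,t). 0 \<le> t \<and> t < f x} (x, t) \<partial>M \<partial>lborel)"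
    by (rule Fubini'[symmetric]) measurable
  also have "\<dots> = (\<integral>\<^sup>+t. indicator {0..} t * emeasure M {x\<in>space M. t < f x} \<partial>lborel)"
  proof (rule nn_integral_cong)
    fix t :: real
    have "(\<integral>\<^sup>+x. indicator {(x,t). 0 \<le> t \<and> t < f x} (x, t) \<partial>M)
       = (\<integral>\<^sup>+x. indicator {0..} t * indicator {x\<in>space M. t < f x} x \<partial>M)"
      by (intro nn_integral_cong) (auto simp: indicator_def)
    also have "\<dots> = indicator {0..} t * emeasure M {x\<in>space M. t < f x}"
      by (subst nn_integral_cmult_indicator) auto
    finally show "(\<integral>\<^sup>+x. indicator {(x,t). 0 \<le> t \<and> t < f x} (x, t) \<partial>M)
       = indicator {0..} t * emeasure M {x\<in>space M. t < f x}" .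
  qed
  finally show ?thesis .
qed

lemma powr_weighted_le:
  fixes a b l :: real
  assumes "0 \<le> a" "0 \<le> b" "0 < l" "l < 1"
  shows "a powr (1 - l) * b powr l \<le> (1 - l) * a + l * b"
  using Youngs_inequality_0[of "1 - l" l a b] assms by (cases "a = 0 \<or> b = 0") auto

text \<open>Dividing \<open>f\<close> and \<open>g\<close> by their suprema makes their superlevel
  sets nonempty at all heights in \<open>[0, 1)\<close> simultaneously, so the sum inequality for
  subsets of the line applies at each height. Integration over the heights gives an inequality
  between weighted arithmetic means, and the arithmetic-geometric mean inequality returns to
  products.\<close>

lemma prekopa_leindler_1D:
  fixes f g h :: "real \<Rightarrow> real"
  assumes [measurable]: "f \<in> borel_measurable borel" "g \<in> borel_measurable borel" "h \<in> borel_measurable borel"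
    and f: "\<And>x. 0 \<le> f x" "\<And>x. f x \<le> B" "\<And>x. x \<notin> {-R..R} \<Longrightarrow> f x = 0"
    and g: "\<And>x. 0 \<le> g x" "\<And>x. g x \<le> B" "\<And>x. x \<notin> {-R..R} \<Longrightarrow> g x = 0"
    and h: "\<And>x. 0 \<le> h x" "\<And>x. h x \<le> B" "\<And>x. x \<notin> {-R..R} \<Longrightarrow> h x = 0"
    and l: "0 < l" "l < 1"
    and le: "\<And>s t. f s powr (1 - l) * g t powr l \<le> h ((1 - l) * s + l * t)"
  shows "(\<integral>x. f x \<partial>lborel) powr (1 - l) * (\<integral>x. g x \<partial>lborel) powr l \<le> (\<integral>x. h x \<partial>lborel)"
proof -
  have int: "integrable lborel k"
    if [measurable]: "k \<in> borel_measurable borel" and k: "\<And>x. 0 \<le> k x" "\<And>x. k x \<le> B" "\<And>x. x \<notin> {-R..R} \<Longrightarrow> k x = 0" for k :: "real \<Rightarrow> real"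
  proof (rule Bochner_Integration.integrable_bound[of _ "\<lambda>x. B * indicator {-R..R} x"])
    show "integrable lborel (\<lambda>x. B * indicator {-R..R} x)"
      by (intro integrable_mult_right integrable_real_indicator) (auto simp: emeasure_lborel_Icc_eq)
    show "AE x in lborel. norm (k x) \<le> norm (B * indicator {- R..R} x)"
    proof (rule AE_I2)
      fix x show "norm (k x) \<le> norm (B * indicator {- R..R} x)"
        using k[of x] by (cases "x \<in> {-R..R}") auto
    qed
  qed (use that in auto)
  note intf = int[of f, OF _ f, simplified] and intg = int[of g, OF _ g, simplified] and inth = int[of h, OF _ h, simplified]
  define F where "F = (SUP x. f x)"
  define G where "G = (SUP x. g x)"
  have bdf: "bdd_above (range f)" using f(2) by (intro bdd_aboveI[of _ B]) auto
  have bdg: "bdd_above (range g)" using g(2) by (intro bdd_aboveI[of _ B]) auto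
  have fF: "f x \<le> F" for x unfolding F_def using bdf by (rule cSUP_upper2) auto
  have gG: "g x \<le> G" for x unfolding G_def using bdg by (rule cSUP_upper2) auto
  have F0: "0 \<le> F" using f(1)[of 0] fF[of 0] by linarith
  have G0: "0 \<le> G" using g(1)[of 0] gG[of 0] by linarith
  show ?thesis
  proof (cases "F = 0 \<or> G = 0")
    case True
    then have "(\<forall>x. f x = 0) \<or> (\<forall>x. g x = 0)" using f(1) fF g(1) gG by (metis order_antisym)
    then have "f = (\<lambda>x. 0) \<or> g = (\<lambda>x. 0)" by auto
    then have "(\<integral>x. f x \<partial>lborel) powr (1 - l) * (\<integral>x. g x \<partial>lborel) powr l = 0" by auto
    moreover have "0 \<le> (\<integral>x. h x \<partial>lborel)" using h(1) by (simp add: integral_nonneg_AE)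
    ultimately show ?thesis by (simp only:)
  next
    case False
    then have F: "0 < F" and G: "0 < G" using F0 G0 by auto
    define H where "H = F powr (1 - l) * G powr l"
    have H: "0 < H" using F G by (simp add: H_def)
    have lev: "(1 - l) * measure lborel {x. t < f x / F} + l * measure lborel {x. t < g x / G} \<le> measure lborel {x. t < h x / H}"
      if t: "0 \<le> t" "t < 1" for t
    proof (rule weighted_sum_measure_le_1D[OF _ _ _ _ _ _ _ _ l])
      show "{x. t < f x / F} \<in> sets borel" "{x. t < g x / G} \<in> sets borel" "{x. t < h x / H} \<in> sets borel" by measurable
      have "{x. t < f x / F} \<subseteq> {-R..R}" "{x. t < g x / G} \<subseteq> {-R..R}" "{x. t < h x / H} \<subseteq> {-R..R}"
        using t f(3) g(3) h(3) by (force simp: not_less)+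
      then show "bounded {x. t < f x / F}" "bounded {x. t < g x / G}" "bounded {x. t < h x / H}"
        using bounded_closed_interval bounded_subset by blast+
      have "t * F < F" "t * G < G" using t F G by auto
      then obtain a b where "t * F < f a" "t * G < g b"
        unfolding F_def G_def using less_cSUP_iff[OF _ bdf] less_cSUP_iff[OF _ bdg] by auto
      then show "{x. t < f x / F} \<noteq> {}" "{x. t < g x / G} \<noteq> {}" using F G by (auto simp: field_simps)
      fix u v assume "u \<in> {x. t < f x / F}" "v \<in> {x. t < g x / G}"
      then have u: "t < f u / F" and v: "t < g v / G" by auto
      have "t = t powr (1 - l) * t powr l" using t by (simp flip: powr_add)
      also have "\<dots> < (f u / F) powr (1 - l) * (g v / G) powr l"
        using u v t l by (intro mult_strict_mono' powr_less_mono2) auto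
      also have "\<dots> = f u powr (1 - l) * g v powr l / H"
        using f(1) g(1) F G by (simp add: powr_divide H_def)
      also have "\<dots> \<le> h ((1 - l) * u + l * v) / H" using le H by (intro divide_right_mono) auto
      finally show "(1 - l) * u + l * v \<in> {x. t < h x / H}" by simp
    qed
    have fin: "emeasure lborel {x. t < k x} = ennreal (measure lborel {x. t < k x})"
      if [measurable]: "k \<in> borel_measurable borel" and k: "\<And>x. 0 \<le> k x" "\<And>x. x \<notin> {-R..R} \<Longrightarrow> k x = 0" and "0 \<le> t" for k :: "real \<Rightarrow> real" and t
    proof (rule emeasure_eq_ennreal_measure)
      have "emeasure lborel {x. t < k x} \<le> emeasure lborel {-R..R}"
        using k \<open>0 \<le> t\<close> by (intro emeasure_mono) (force simp: not_less)+
      then show "emeasure lborel {x. t < k x} \<noteq> top" by (auto simp: emeasure_lborel_Icc_eq top_unique split: if_splits)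
    qed
    have cake1: "(\<integral>\<^sup>+x. ennreal (k x) \<partial>lborel) = (\<integral>\<^sup>+t. indicator {0..<1} t * ennreal (measure lborel {x. t < k x}) \<partial>lborel)"
      if [measurable]: "k \<in> borel_measurable borel" and k: "\<And>x. 0 \<le> k x" "\<And>x. x \<notin> {-R..R} \<Longrightarrow> k x = 0" "\<And>x. k x \<le> 1" for k :: "real \<Rightarrow> real"
    proof -
      have "(\<integral>\<^sup>+x. ennreal (k x) \<partial>lborel) = (\<integral>\<^sup>+t. indicator {0..} t * emeasure lborel {x\<in>space lborel. t < k x} \<partial>lborel)"
        using k by (intro nn_integral_layer_cake lborel.sigma_finite_measure_axioms) auto
      also have "\<dots> = (\<integral>\<^sup>+t. indicator {0..<1} t * ennreal (measure lborel {x. t < k x}) \<partial>lborel)"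
      proof (rule nn_integral_cong)
        fix t :: real
        have "t \<ge> 1 \<Longrightarrow> {x. t < k x} = {}" using k(3) by (force simp: not_less intro: order_trans)
        then show "indicator {0..} t * emeasure lborel {x \<in> space lborel. t < k x} = indicator {0..<1} t * ennreal (measure lborel {x. t < k x})"
          using fin[OF that(1) k(1,2)] by (auto simp: indicator_def)
      qed
      finally show ?thesis .
    qed
    have mm: "(\<lambda>t. measure lborel {x. t < k x}) \<in> borel_measurable borel" if [measurable]: "k \<in> borel_measurable borel" for k :: "real \<Rightarrow> real"
    proof -
      have "(\<lambda>t. emeasure lborel {x\<in>space lborel. t < k x}) \<in> borel_measurable borel" by measurable
      then show ?thesis unfolding measure_def by simp
    qed
    note [measurable] = mm
    have fF1: "f x / F \<le> 1" and gG1: "g x / G \<le> 1" for x using fF gG F G by (auto simp: field_simps)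
    have "(1 - l) * (\<integral>x. f x / F \<partial>lborel) + l * (\<integral>x. g x / G \<partial>lborel) \<le> (\<integral>x. h x / H \<partial>lborel)"
    proof -
      have "ennreal ((1 - l) * (\<integral>x. f x / F \<partial>lborel) + l * (\<integral>x. g x / G \<partial>lborel))
          = ennreal (1 - l) * (\<integral>\<^sup>+x. ennreal (f x / F) \<partial>lborel) + ennreal l * (\<integral>\<^sup>+x. ennreal (g x / G) \<partial>lborel)"
      proof -
        have e: "ennreal ((1 - l) * x + l * y) = ennreal (1 - l) * ennreal x + ennreal l * ennreal y"
          if "0 \<le> x" "0 \<le> y" for x y using that l by (simp add: ennreal_mult ennreal_plus)
        have "(\<integral>\<^sup>+x. ennreal (f x / F) \<partial>lborel) = ennreal (\<integral>x. f x / F \<partial>lborel)"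
          by (rule nn_integral_eq_integral) (use intf f(1) F in auto)
        moreover have "(\<integral>\<^sup>+x. ennreal (g x / G) \<partial>lborel) = ennreal (\<integral>x. g x / G \<partial>lborel)"
          by (rule nn_integral_eq_integral) (use intg g(1) G in auto)
        moreover have "0 \<le> (\<integral>x. f x / F \<partial>lborel)" "0 \<le> (\<integral>x. g x / G \<partial>lborel)"
          using f(1) g(1) F G by (auto intro!: integral_nonneg_AE divide_nonneg_pos)
        ultimately show ?thesis by (simp only: e)
      qed
      also have "\<dots> = ennreal (1 - l) * (\<integral>\<^sup>+t. indicator {0..<1} t * ennreal (measure lborel {x. t < f x / F}) \<partial>lborel)
          + ennreal l * (\<integral>\<^sup>+t. indicator {0..<1} t * ennreal (measure lborel {x. t < g x / G}) \<partial>lborel)"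
        using f g F G fF1 gG1 by (subst (1 2) cake1) auto
      also have "\<dots> = (\<integral>\<^sup>+t. indicator {0..<1} t * ennreal ((1 - l) * measure lborel {x. t < f x / F} + l * measure lborel {x. t < g x / G}) \<partial>lborel)"
        using l by (subst (1 2) nn_integral_cmult[symmetric]) (auto simp: ennreal_mult ennreal_plus nn_integral_add[symmetric] distrib_left mult_ac intro!: nn_integral_cong)
      \<comment> \<open>Heights from 1 on are dropped on the left, where the level sets of the
        normalised functions are empty; \<open>h / H\<close> may exceed 1, which only enlarges the
        right side.\<close>
      also have "\<dots> \<le> (\<integral>\<^sup>+t. indicator {0..} t * emeasure lborel {x\<in>space lborel. t < h x / H} \<partial>lborel)"
      proof (rule nn_integral_mono)
        fix t :: real
        show "indicator {0..<1} t * ennreal ((1 - l) * measure lborel {x. t < f x / F} + l * measure lborel {x. t < g x / G})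
           \<le> indicator {0..} t * emeasure lborel {x\<in>space lborel. t < h x / H}"
        proof (cases "t \<in> {0..<1}")
          case True
          then have "emeasure lborel {x. t < h x / H} = ennreal (measure lborel {x. t < h x / H})"
            using h H by (intro fin) auto
          then show ?thesis using True lev[of t] by (auto simp: ennreal_leI)
        qed auto
      qed
      also have "\<dots> = (\<integral>\<^sup>+x. ennreal (h x / H) \<partial>lborel)"
        using h H by (intro nn_integral_layer_cake[symmetric] lborel.sigma_finite_measure_axioms) auto
      also have "\<dots> = ennreal (\<integral>x. h x / H \<partial>lborel)"
        using inth h(1) H by (intro nn_integral_eq_integral) auto
      finally show ?thesis using h(1) H by (subst (asm) ennreal_le_iff) (auto intro!: integral_nonneg_AE)
    qed
    moreover have "((\<integral>x. f x \<partial>lborel) / F) powr (1 - l) * ((\<integral>x. g x \<partial>lborel) / G) powr l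
        \<le> (1 - l) * ((\<integral>x. f x \<partial>lborel) / F) + l * ((\<integral>x. g x \<partial>lborel) / G)"
      using l F G f(1) g(1) by (intro powr_weighted_le) (auto intro!: divide_nonneg_pos integral_nonneg_AE)
    ultimately have "((\<integral>x. f x \<partial>lborel) / F) powr (1 - l) * ((\<integral>x. g x \<partial>lborel) / G) powr l \<le> (\<integral>x. h x \<partial>lborel) / H"
      by simp
    then show ?thesis using H F G f(1) g(1)
      by (simp add: powr_divide integral_nonneg_AE H_def field_simps)
  qed
qed

interpretation lborel_PiM: product_sigma_finite "\<lambda>_::'i. lborel :: real measure"
  by standard

text \<open>Induction over the coordinates: by the induction hypothesis the slice measures of
  \<open>A\<close>, \<open>B\<close>, \<open>C\<close> satisfy the premise of the Prekopa--Leindler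
  inequality in the new coordinate. The multiplicative form passes through this induction unchanged
  and is also correct for empty sets.\<close>

lemma weighted_sum_measure_le_PiM:
  fixes I :: "'i set"
  assumes "finite I" and l: "0 < l" "l < 1"
  shows "A \<in> sets (PiM I (\<lambda>_. lborel)) \<Longrightarrow> B \<in> sets (PiM I (\<lambda>_. lborel)) \<Longrightarrow> C \<in> sets (PiM I (\<lambda>_. lborel)) \<Longrightarrow>
    A \<subseteq> PiE I (\<lambda>_. {-R..R}) \<Longrightarrow> B \<subseteq> PiE I (\<lambda>_. {-R..R}) \<Longrightarrow> C \<subseteq> PiE I (\<lambda>_. {-R..R}) \<Longrightarrow>
    (\<And>a b. a \<in> A \<Longrightarrow> b \<in> B \<Longrightarrow> (\<lambda>i\<in>I. (1 - l) * a i + l * b i) \<in> C) \<Longrightarrow>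
    measure (PiM I (\<lambda>_. lborel :: real measure)) A powr (1 - l) * measure (PiM I (\<lambda>_. lborel)) B powr l
      \<le> measure (PiM I (\<lambda>_. lborel)) C"
  using \<open>finite I\<close>
proof (induction I arbitrary: A B C rule: finite_induct)
  case empty
  show ?case
  proof (cases "A = {} \<or> B = {}")
    case False
    have "A \<subseteq> {\<lambda>_. undefined}" "B \<subseteq> {\<lambda>_. undefined}" "C \<subseteq> {\<lambda>_. undefined}"
      using empty.prems(4,5,6) by auto
    moreover from this False have "C \<noteq> {}" using empty.prems(7) by blast
    ultimately have "A = {\<lambda>_. undefined}" "B = {\<lambda>_. undefined}" "C = {\<lambda>_. undefined}" using False by auto
    then show ?thesis by (simp add: measure_def)
  qed auto
next
  case (insert i I)
  let ?M = "PiM I (\<lambda>_. lborel :: real measure)" and ?N = "PiM (insert i I) (\<lambda>_. lborel :: real measure)"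
  interpret fp: finite_product_sigma_finite "\<lambda>_::'i. lborel :: real measure" I by standard (use insert.hyps in auto)
  define sl where "sl S y = {x\<in>space ?M. x(i := y) \<in> S}" for S y
  define fm where "fm S y = measure ?M (sl S y)" for S y
  have upd[measurable]: "(\<lambda>(y, x). x(i := y)) \<in> borel \<Otimes>\<^sub>M ?M \<rightarrow>\<^sub>M ?N"
    using measurable_add_dim[of i I "\<lambda>_. lborel :: real measure"]
    by (subst measurable_cong_sets[OF sets_pair_measure_cong[OF sets_lborel refl, symmetric] refl])
      (auto intro: measurable_compose[OF measurable_pair_swap'] simp: split_beta comp_def)
  have box: "emeasure ?M (PiE I (\<lambda>_. {-R..R})) \<noteq> top"
    using insert.hyps(1) by (subst lborel_PiM.emeasure_PiM) (auto simp: emeasure_lborel_Icc_eq ennreal_prod_eq_top power_eq_top_ennreal)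
  have boxs: "PiE I (\<lambda>_. {-R..R}) \<in> sets ?M"
    using insert.hyps(1) by (intro sets_PiM_I_finite) auto
  have props: "sl S y \<in> sets ?M" "sl S y \<subseteq> PiE I (\<lambda>_. {-R..R})" "y \<notin> {-R..R} \<Longrightarrow> sl S y = {}"
     "emeasure ?M (sl S y) = ennreal (fm S y)"
     "fm S \<in> borel_measurable borel" "0 \<le> fm S y" "fm S y \<le> measure ?M (PiE I (\<lambda>_. {-R..R}))"
     "y \<notin> {-R..R} \<Longrightarrow> fm S y = 0"
     "measure ?N S = (\<integral>y. fm S y \<partial>lborel)"
    if S[measurable]: "S \<in> sets ?N" and SR: "S \<subseteq> PiE (insert i I) (\<lambda>_. {-R..R})" for S y
  proof -
    show sl[measurable]: "sl S y \<in> sets ?M" for y unfolding sl_def by measurable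
    have slsub: "sl S y \<subseteq> PiE I (\<lambda>_. {-R..R})" for y
    proof
      fix x assume x: "x \<in> sl S y"
      then have "x(i:=y) \<in> PiE (insert i I) (\<lambda>_. {-R..R})" "x \<in> extensional I" using SR by (auto simp: sl_def space_PiM PiE_def)
      then show "x \<in> PiE I (\<lambda>_. {-R..R})" using insert.hyps(2) by (auto simp: PiE_iff split: if_splits)
    qed
    then show "sl S y \<subseteq> PiE I (\<lambda>_. {-R..R})" .
    have sle: "y \<notin> {-R..R} \<Longrightarrow> sl S y = {}" for y
      using SR by (auto simp: sl_def PiE_iff split: if_splits)
    then show "y \<notin> {-R..R} \<Longrightarrow> sl S y = {}" .
    have em: "emeasure ?M (sl S y) = ennreal (fm S y)" for y
      unfolding fm_def
      by (intro emeasure_eq_ennreal_measure neq_top_trans[OF box emeasure_mono[OF slsub boxs]])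
    then show "emeasure ?M (sl S y) = ennreal (fm S y)" .
    have "(\<lambda>y. emeasure ?M {x\<in>space ?M. x(i := y) \<in> S}) \<in> borel_measurable borel" by measurable
    then show mfm: "fm S \<in> borel_measurable borel" unfolding fm_def sl_def measure_def by measurable
    show "0 \<le> fm S y" by (simp add: fm_def)
    have fmb: "fm S y \<le> measure ?M (PiE I (\<lambda>_. {-R..R}))" for y unfolding fm_def
      using box boxs slsub by (intro measure_mono_fmeasurable fmeasurableI) (auto simp: less_top)
    then show "fm S y \<le> measure ?M (PiE I (\<lambda>_. {-R..R}))" .
    have fm0: "y \<notin> {-R..R} \<Longrightarrow> fm S y = 0" for y using sle by (simp add: fm_def)
    then show "y \<notin> {-R..R} \<Longrightarrow> fm S y = 0" .
    have "emeasure ?N S = (\<integral>\<^sup>+x. indicator S x \<partial>?N)" by simp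
    also have "\<dots> = (\<integral>\<^sup>+y. (\<integral>\<^sup>+x. indicator S (x(i := y)) \<partial>?M) \<partial>lborel)"
      using insert.hyps by (intro lborel_PiM.product_nn_integral_insert_rev) auto
    also have "\<dots> = (\<integral>\<^sup>+y. ennreal (fm S y) \<partial>lborel)"
    proof (rule nn_integral_cong)
      fix y
      have "(\<integral>\<^sup>+x. indicator S (x(i := y)) \<partial>?M) = (\<integral>\<^sup>+x. indicator (sl S y) x \<partial>?M)"
        by (intro nn_integral_cong) (auto simp: sl_def indicator_def)
      also have "\<dots> = ennreal (fm S y)" using em by simp
      finally show "(\<integral>\<^sup>+x. indicator S (x(i := y)) \<partial>?M) = ennreal (fm S y)" .
    qed
    finally have "measure ?N S = enn2real (\<integral>\<^sup>+y. ennreal (fm S y) \<partial>lborel)" by (simp add: measure_def)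
    then show "measure ?N S = (\<integral>y. fm S y \<partial>lborel)"
      using mfm by (subst integral_eq_nn_integral) (auto simp: fm_def)
  qed
  have "(\<integral>x. fm A x \<partial>lborel) powr (1 - l) * (\<integral>x. fm B x \<partial>lborel) powr l \<le> (\<integral>x. fm C x \<partial>lborel)"
  proof (rule prekopa_leindler_1D[where R = R and B = "measure ?M (PiE I (\<lambda>_. {-R..R}))"])
    fix s t
    show "fm A s powr (1 - l) * fm B t powr l \<le> fm C ((1 - l) * s + l * t)"
      unfolding fm_def
    proof (rule insert.IH)
      fix a b assume a: "a \<in> sl A s" and b: "b \<in> sl B t"
      have "(\<lambda>j\<in>insert i I. (1 - l) * (a(i := s)) j + l * (b(i := t)) j) \<in> C"
        using a b by (intro insert.prems(7)) (simp_all only: sl_def mem_Collect_eq)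
      also have "(\<lambda>j\<in>insert i I. (1 - l) * (a(i := s)) j + l * (b(i := t)) j)
        = (\<lambda>j\<in>I. (1 - l) * a j + l * b j)(i := (1 - l) * s + l * t)"
        using insert.hyps(2) by (auto simp: fun_eq_iff restrict_def)
      finally have "(\<lambda>j\<in>I. (1 - l) * a j + l * b j)(i := (1 - l) * s + l * t) \<in> C" .
      moreover have "(\<lambda>j\<in>I. (1 - l) * a j + l * b j) \<in> space ?M" by (simp add: space_PiM)
      ultimately show "(\<lambda>j\<in>I. (1 - l) * a j + l * b j) \<in> sl C ((1 - l) * s + l * t)"
        unfolding sl_def by blast
    qed (use props insert.prems in auto)
  qed (use props insert.prems l in \<open>auto\<close>)
  then show ?case using props(9) insert.prems by simp
qed

lemma weighted_sum_measure_le: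
  fixes A B C :: "'a::euclidean_space set"
  assumes A[measurable]: "A \<in> sets borel" and "bounded A" and B[measurable]: "B \<in> sets borel" and "bounded B"
    and C[measurable]: "C \<in> sets borel" and "bounded C" and l: "0 < l" "l < 1"
    and sub: "\<And>a b. a \<in> A \<Longrightarrow> b \<in> B \<Longrightarrow> (1 - l) *\<^sub>R a + l *\<^sub>R b \<in> C"
  shows "measure lborel A powr (1 - l) * measure lborel B powr l \<le> measure lborel C"
proof -
  let ?M = "PiM (Basis :: 'a set) (\<lambda>_. lborel :: real measure)"
  define \<phi> where "\<phi> f = (\<Sum>b\<in>Basis. f b *\<^sub>R b)" for f :: "'a \<Rightarrow> real"
  have \<phi>b: "\<phi> f \<bullet> b = f b" if "b \<in> Basis" for f b using that by (simp add: \<phi>_def)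
  have m[measurable]: "\<phi> \<in> ?M \<rightarrow>\<^sub>M borel" unfolding \<phi>_def by measurable
  have lb: "(lborel :: 'a measure) = distr ?M borel \<phi>" by (subst lborel_eq) (simp add: \<phi>_def[abs_def])
  define P where "P S = {f\<in>space ?M. \<phi> f \<in> S}" for S
  have meas: "measure lborel S = measure ?M (P S)" "P S \<in> sets ?M" if [measurable]: "S \<in> sets borel" for S
  proof -
    have *: "P S = \<phi> -` S \<inter> space ?M" by (auto simp: P_def)
    show "P S \<in> sets ?M" unfolding * by measurable
    show "measure lborel S = measure ?M (P S)" unfolding * lb by (rule measure_distr) (use m that in auto)
  qed
  obtain R where R: "\<And>x. x \<in> A \<union> B \<union> C \<Longrightarrow> norm x \<le> R"
    using assms(2,4,6) bounded_Un[of "A \<union> B" C] bounded_Un[of A B] unfolding bounded_iff by metis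
  have box: "P S \<subseteq> PiE Basis (\<lambda>_. {-R..R})" if "S \<subseteq> A \<union> B \<union> C" for S
  proof
    fix f assume f: "f \<in> P S"
    then have "norm (\<phi> f) \<le> R" using R that by (auto simp: P_def)
    then have "\<bar>f b\<bar> \<le> R" if "b \<in> Basis" for b
      using Basis_le_norm[OF that, of "\<phi> f"] \<phi>b[OF that, of f] by linarith
    then show "f \<in> PiE Basis (\<lambda>_. {-R..R})" using f by (auto simp: P_def space_PiM PiE_iff abs_le_iff minus_le_iff)
  qed
  show ?thesis unfolding meas(1)[OF A] meas(1)[OF B] meas(1)[OF C]
  proof (rule weighted_sum_measure_le_PiM[where R = R])
    fix a b assume a: "a \<in> P A" and b: "b \<in> P B"
    have "\<phi> (\<lambda>i\<in>Basis. (1 - l) * a i + l * b i) = (1 - l) *\<^sub>R \<phi> a + l *\<^sub>R \<phi> b"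
      by (simp add: \<phi>_def scaleR_sum_right sum.distrib scaleR_add_left)
    then show "(\<lambda>i\<in>Basis. (1 - l) * a i + l * b i) \<in> P C"
      using sub a b by (auto simp: P_def space_PiM)
  qed (use meas box[of A] box[of B] box[of C] l in \<open>simp_all add: Un_assoc sup.coboundedI2\<close>)
qed

text \<open>Brunn--Minkowski for a set and a ball, with the $n$-th power expanded to first order.\<close>

lemma neighbourhood_measure_ge:
  fixes A C :: "'a::euclidean_space set"
  assumes A: "A \<in> sets borel" "bounded A" and C: "C \<in> sets borel" "bounded C" and e: "0 < e"
    and sub: "\<And>x y. x \<in> A \<Longrightarrow> norm y \<le> e \<Longrightarrow> x + y \<in> C"
  shows "measure lborel A + e * real DIM('a) * unit_ball_vol (real DIM('a)) powr (1 / real DIM('a))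
      * measure lborel A powr (1 - 1 / real DIM('a)) \<le> measure lborel C"
proof (cases "measure lborel A = 0")
  case False
  define n where "n = DIM('a)"
  have n: "0 < n" by (simp add: n_def)
  have A0: "0 < measure lborel A" using False by (simp add: zero_less_measure_iff)
  define w where "w = unit_ball_vol (real n)"
  have w: "0 < w" by (simp add: w_def)
  define t where "t = measure lborel A powr (1 / n)"
  define s where "s = e * w powr (1 / n)"
  have t: "0 < t" "t ^ n = measure lborel A" using A0 n by (auto simp: t_def simp flip: powr_realpow simp: powr_powr)
  have s: "0 < s" "s ^ n = e ^ n * w" using w e n by (auto simp: s_def power_mult_distrib simp flip: powr_realpow[of "w powr _"] simp: powr_powr)
  \<comment> \<open>With this weight the dilated set \<open>A / (1 - l)\<close> and the ball of
    radius \<open>e / l\<close> have the same measure \<open>(t + s)^n\<close>, so the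
    multiplicative inequality is as strong as the additive one for n-th roots.\<close>
  define l where "l = s / (t + s)"
  have l: "0 < l" "l < 1" using s t by (auto simp: l_def)
  have l1: "t / (1 - l) = t + s" "s / l = t + s" using s t by (auto simp: l_def field_simps)
  let ?A = "(\<lambda>x. (1 / (1 - l)) *\<^sub>R x) ` A" and ?B = "cball (0::'a) (e / l)"
  have A': "?A = (\<lambda>x. (1 - l) *\<^sub>R x) -` A"
  proof (intro set_eqI iffI)
    fix x assume "x \<in> (\<lambda>x. (1 - l) *\<^sub>R x) -` A"
    then show "x \<in> ?A" using l by (intro image_eqI[of _ _ "(1 - l) *\<^sub>R x"]) auto
  qed (use l in auto)
  have mA: "?A \<in> sets borel" unfolding A' using A(1)
    by (intro measurable_sets_borel[of _ borel, simplified]) auto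
  have "measure lborel ?A powr (1 - l) * measure lborel ?B powr l \<le> measure lborel C"
  proof (rule weighted_sum_measure_le[OF mA _ _ _ C l])
    show "bounded ?A" using A(2) by (rule bounded_scaling)
    fix a b assume "a \<in> ?A" "b \<in> ?B"
    then obtain x where x: "x \<in> A" "a = (1 / (1 - l)) *\<^sub>R x" and b: "norm b \<le> e / l" by auto
    have "(1 - l) *\<^sub>R a = x" using x(2) l by simp
    moreover have "norm (l *\<^sub>R b) \<le> e" using b l by (simp add: field_simps)
    ultimately show "(1 - l) *\<^sub>R a + l *\<^sub>R b \<in> C" using sub x(1) by blast
  qed (auto simp: borel_closed)
  also have "measure lborel ?A = (t + s) ^ n"
  proof -
    have "measure lborel ?A = measure lebesgue ?A" using mA by simp
    also have "\<dots> = \<bar>1 / (1 - l)\<bar> ^ n * measure lebesgue A"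
      using measure_lebesgue_affine[of "1 / (1 - l)" 0 A] by (simp add: n_def)
    also have "\<dots> = (t / (1 - l)) ^ n" using l t A(1) by (simp add: power_divide)
    finally show ?thesis by (simp add: l1)
  qed
  also have "measure lborel ?B = (t + s) ^ n"
  proof -
    have "measure lborel ?B = w * (e / l) ^ n" using e l by (simp add: content_cball w_def n_def)
    also have "\<dots> = (s / l) ^ n" using s by (simp add: power_divide)
    finally show ?thesis by (simp add: l1)
  qed
  also have "((t + s) ^ n) powr (1 - l) * ((t + s) ^ n) powr l = (t + s) ^ n"
    using t s by (simp flip: powr_add)
  finally have "(t + s) ^ n \<le> measure lborel C" .
  moreover have "t ^ n + n * s * t ^ (n - 1) \<le> (t + s) ^ n"
  proof -
    have "1 + n * (s / t) \<le> (1 + s / t) ^ n" using t s by (intro Bernoulli_inequality) (auto intro: order_trans[of _ 0])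
    then have "t ^ n * (1 + n * (s / t)) \<le> t ^ n * (1 + s / t) ^ n" using t by (intro mult_left_mono) auto
    also have "\<dots> = (t + s) ^ n" using t(1) by (simp add: distrib_left flip: power_mult_distrib)
    also have "t ^ n * (1 + n * (s / t)) = t ^ n + n * s * t ^ (n - 1)"
      using t n by (cases n) (auto simp: field_simps)
    finally show ?thesis .
  qed
  moreover have "t ^ (n - 1) = measure lborel A powr (1 - 1 / n)"
    using A0 n by (simp add: t_def powr_powr of_nat_diff field_simps flip: powr_realpow)
  ultimately show ?thesis using t by (simp add: s_def w_def n_def mult_ac)
qed (simp add: C)

section \<open>Total variation and energy between level sets of a compactly supported
  function\<close>

text \<open>The isoperimetric constant: a set of volume \<open>v\<close> has perimeter at least this
  number times \<open>v powr (1 - 1/n)\<close>, with equality for balls.\<close>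

definition iso_const :: "'a::euclidean_space itself \<Rightarrow> real" where
  "iso_const _ = real DIM('a) * unit_ball_vol (real DIM('a)) powr (1 / real DIM('a))"

lemma iso_const_pos: "0 < iso_const TYPE('a::euclidean_space)" unfolding iso_const_def
  using unit_ball_vol_pos[of "real DIM('a)"] by (intro mult_pos_pos) (auto simp del: unit_ball_vol_pos)

text \<open>Carrying the gradient as an explicit continuous field, together with any compact set
  outside which both vanish, allows functions to be composed with maps and extended by zero without
  returning to partial derivatives or to closures of supports.\<close>

locale compact_C1 =
  fixes u :: "'a::euclidean_space \<Rightarrow> real" and g :: "'a \<Rightarrow> 'a" and K :: "'a set"
  assumes deriv: "\<And>x. (u has_derivative (\<lambda>h. g x \<bullet> h)) (at x)"
    and cont_g: "continuous_on UNIV g"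
    and compact_K: "compact K"
    and u_0: "\<And>x. x \<notin> K \<Longrightarrow> u x = 0"
    and g_0: "\<And>x. x \<notin> K \<Longrightarrow> g x = 0"
begin

lemma cont_u: "continuous_on UNIV u"
  by (intro continuous_at_imp_continuous_on ballI has_derivative_continuous[OF deriv])

lemma u_measurable[measurable]: "u \<in> borel_measurable borel"
  using cont_u by (rule borel_measurable_continuous_onI)

lemma g_measurable[measurable]: "g \<in> borel_measurable borel"
  using cont_g by (rule borel_measurable_continuous_onI)

lemma compact_support_bounded:
  fixes f :: "'a \<Rightarrow> 'b::real_normed_vector"
  assumes "continuous_on UNIV f" "\<And>x. x \<notin> K \<Longrightarrow> f x = 0"
  shows "\<exists>B>0. \<forall>x. norm (f x) \<le> B"
proof -
  have "compact (f ` K)" by (rule compact_continuous_image[OF continuous_on_subset[OF assms(1) subset_UNIV] compact_K])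
  then obtain B where B: "\<And>x. x \<in> K \<Longrightarrow> norm (f x) \<le> B" using compact_imp_bounded[of "f ` K"] by (auto simp: bounded_iff)
  show ?thesis
  proof (intro exI[of _ "max B 1"] conjI allI)
    fix x show "norm (f x) \<le> max B 1" using B[of x] assms(2)[of x] by (cases "x \<in> K") auto
  qed auto
qed

lemma integrable_bounded_on_K:
  fixes f :: "'a \<Rightarrow> real"
  assumes [measurable]: "f \<in> borel_measurable borel" and B: "\<And>x. \<bar>f x\<bar> \<le> B" and z: "\<And>x. x \<notin> K \<Longrightarrow> f x = 0"
  shows "integrable lborel f"
proof (rule Bochner_Integration.integrable_bound[of _ "\<lambda>x. B * indicator K x"])
  have "emeasure lborel K < \<infinity>" using compact_K by (intro emeasure_compact_finite)
  then show "integrable lborel (\<lambda>x. B * indicator K x)"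
    using borel_compact[OF compact_K] by (intro integrable_mult_right integrable_real_indicator) simp_all
  show "AE x in lborel. norm (f x) \<le> norm (B * indicator K x)"
  proof (rule AE_I2)
    fix x show "norm (f x) \<le> norm (B * indicator K x)" using order_trans[OF B[of x] abs_ge_self] z[of x] by (cases "x \<in> K") simp_all
  qed
qed simp

text \<open>Uniform continuity of the compactly supported field \<open>g\<close> gives a Lipschitz
  bound at small scale whose constant is the slope at one of the two points, up to \<open>e\<close>.
  This is what relates the thickening of a level set to the local size of the gradient.\<close>

lemma first_order_modulus:
  assumes e: "0 < e"
  shows "\<exists>d>0. \<forall>x y. dist x y \<le> d \<longrightarrow> \<bar>u y - u x\<bar> \<le> dist x y * (norm (g x) + e)"
proof -
  \<comment> \<open>If one of two points at distance at most 1 lies in \<open>K\<close>, both lie in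
    the compact set \<open>K1\<close>; if neither does, \<open>g\<close> vanishes at both.\<close>
  define K1 where "K1 = {x + y |x y. x \<in> K \<and> y \<in> cball 0 1}"
  have K1: "compact K1" unfolding K1_def by (intro compact_sums compact_K compact_cball)
  have "uniformly_continuous_on K1 g"
    by (rule compact_uniformly_continuous[OF continuous_on_subset[OF cont_g subset_UNIV] K1])
  then obtain d where d: "d > 0" "\<And>x y. x \<in> K1 \<Longrightarrow> y \<in> K1 \<Longrightarrow> dist y x < d \<Longrightarrow> dist (g y) (g x) < e"
    unfolding uniformly_continuous_on_def using e by metis
  define r where "r = min (d/2) 1"
  have r: "0 < r" "r < d" "r \<le> 1" using d(1) by (auto simp: r_def)
  have inK1: "y \<in> K1" if "x \<in> K" "dist x y \<le> 1" for x y
    using that unfolding K1_def by (intro CollectI exI[of _ x] exI[of _ "y - x"]) (simp add: dist_norm norm_minus_commute)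
  have uc: "dist (g y) (g x) \<le> e" if "dist x y \<le> r" for x y
  proof (cases "x \<in> K \<or> y \<in> K")
    case True
    then have "x \<in> K1 \<and> y \<in> K1" using inK1[of x y] inK1[of y x] inK1[of x x] inK1[of y y] that r by (auto simp: dist_commute)
    then show ?thesis using d(2)[of x y] that r by (auto simp: dist_commute)
  qed (use e g_0 in auto)
  show ?thesis
  proof (intro exI[of _ r] conjI allI impI r(1))
    fix x y :: 'a assume xy: "dist x y \<le> r"
    have "norm (u y - u x - g x \<bullet> (y - x)) \<le> norm (y - x) * e"
    proof (rule differentiable_bound_linearization[where S = "cball x r" and f' = "\<lambda>x h. g x \<bullet> h" and ?x0.0 = x])
      fix t :: real assume t: "t \<in> {0..1}"
      have "t * norm (y - x) \<le> 1 * r" using t xy by (intro mult_mono) (auto simp: dist_norm norm_minus_commute)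
      then show "x + t *\<^sub>R (y - x) \<in> cball x r" using t by (simp add: dist_norm)
    next
      fix z :: 'a assume "z \<in> cball x r"
      show "(u has_derivative (\<lambda>h. g z \<bullet> h)) (at z within cball x r)" using deriv has_derivative_at_withinI by blast
      have "norm (g z - g x) \<le> e" using uc[of x z] \<open>z \<in> cball x r\<close> by (simp add: dist_norm)
      then show "onorm ((\<lambda>h. g z \<bullet> h) - (\<lambda>h. g x \<bullet> h)) \<le> e"
      proof (intro onorm_bound)
        fix i
        have "\<bar>(g z - g x) \<bullet> i\<bar> \<le> norm (g z - g x) * norm i" by (rule Cauchy_Schwarz_ineq2)
        also have "\<dots> \<le> e * norm i" using \<open>norm (g z - g x) \<le> e\<close> by (intro mult_right_mono) auto
        finally show "norm (((\<lambda>h. g z \<bullet> h) - (\<lambda>h. g x \<bullet> h)) i) \<le> e * norm i" by (simp add: inner_diff_left)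
      qed (use e in auto)
    qed (use r in auto)
    moreover have "\<bar>g x \<bullet> (y - x)\<bar> \<le> norm (g x) * norm (y - x)" by (rule Cauchy_Schwarz_ineq2)
    ultimately show "\<bar>u y - u x\<bar> \<le> dist x y * (norm (g x) + e)"
      by (simp add: dist_norm norm_minus_commute algebra_simps)
  qed
qed

text \<open>The distribution function of \<open>|u|\<close>. For \<open>t \<le> 0\<close> the set is
  the whole space, of infinite volume, and \<open>measure\<close> returns 0; hence the recurring
  hypothesis that levels are positive.\<close>

definition "V t = measure lborel {x. t \<le> \<bar>u x\<bar>}"

lemma level_compact:
  assumes "0 < t" shows "compact {x. t \<le> \<bar>u x\<bar>}" "{x. t \<le> \<bar>u x\<bar>} \<subseteq> K"
proof -
  show s: "{x. t \<le> \<bar>u x\<bar>} \<subseteq> K" using assms u_0 by force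
  have "closed {x. t \<le> \<bar>u x\<bar>}"
    by (intro closed_Collect_le continuous_intros cont_u)
  then show "compact {x. t \<le> \<bar>u x\<bar>}" using s compact_Int_closed[OF compact_K, of "{x. t \<le> \<bar>u x\<bar>}"] by (simp add: Int_absorb1)
qed

lemma V_nonneg: "0 \<le> V t" by (simp add: V_def)

lemma V_mono: "0 < s \<Longrightarrow> s \<le> t \<Longrightarrow> V t \<le> V s"
  unfolding V_def by (intro measure_mono_fmeasurable) (auto intro: fmeasurable_compact level_compact)

lemma V_slab: "0 < s \<Longrightarrow> s \<le> t \<Longrightarrow> measure lborel {x. s \<le> \<bar>u x\<bar> \<and> \<bar>u x\<bar> < t} = V s - V t"
proof -
  assume st: "0 < s" "s \<le> t"
  have "{x. s \<le> \<bar>u x\<bar> \<and> \<bar>u x\<bar> < t} = {x. s \<le> \<bar>u x\<bar>} - {x. t \<le> \<bar>u x\<bar>}" using st by auto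
  then show ?thesis unfolding V_def using st
    by (simp add: measurable_measure_Diff fmeasurable_compact level_compact fmeasurableD subset_iff)
qed

lemma slab_integrable:
  fixes f :: "'a \<Rightarrow> real"
  assumes "continuous_on UNIV f" "0 < a"
  shows "integrable lborel (\<lambda>x. indicator {x. a \<le> \<bar>u x\<bar> \<and> \<bar>u x\<bar> < b} x * f x)"
proof -
  have [measurable]: "f \<in> borel_measurable borel" using assms(1) by (rule borel_measurable_continuous_onI)
  have "compact (f ` K)" by (rule compact_continuous_image[OF continuous_on_subset[OF assms(1) subset_UNIV] compact_K])
  then obtain B where B: "\<And>x. x \<in> K \<Longrightarrow> norm (f x) \<le> B" using compact_imp_bounded[of "f ` K"] by (auto simp: bounded_iff)
  show ?thesis
  proof (rule integrable_bounded_on_K[of _ "max B 0"])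
    fix x show "\<bar>indicator {x. a \<le> \<bar>u x\<bar> \<and> \<bar>u x\<bar> < b} x * f x\<bar> \<le> max B 0"
      using level_compact(2)[OF assms(2)] B[of x] by (auto simp: indicator_def)
  qed (use u_0 assms(2) in \<open>auto simp: indicator_def\<close>)
qed

text \<open>A substitute for the coarea formula. By Brunn--Minkowski, thickening the superlevel set
  at \<open>t\<close> by \<open>r\<close> adds volume at least \<open>r * c\<close>. The thickened
  set lies in \<open>{x. t \<le> M x}\<close>, because \<open>M\<close> adds to \<open>|u|\<close>
  the largest increase possible within distance \<open>r\<close>. After integration over
  \<open>t\<close> and an exchange of integrals, each point contributes an interval of heights of
  length \<open>r * (norm (g x) + e)\<close>.\<close>

lemma slab_total_variation_aux:
  assumes ab: "0 < a'" "a' < a" "a < b" and e: "0 < e"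
  shows "iso_const TYPE('a) * (b - a) * V b powr (1 - 1 / (real DIM('a)))
    \<le> (\<integral>x. indicator {x. a' \<le> \<bar>u x\<bar> \<and> \<bar>u x\<bar> < b} x * (norm (g x) + e) \<partial>lborel)"
proof -
  let ?S = "{x. a' \<le> \<bar>u x\<bar> \<and> \<bar>u x\<bar> < b}"
  obtain L where L: "L > 0" "\<And>x. norm (g x) \<le> L" using compact_support_bounded[OF cont_g g_0] by blast
  obtain d where d: "d > 0" "\<And>x y. dist x y \<le> d \<Longrightarrow> \<bar>u y - u x\<bar> \<le> dist x y * (norm (g x) + e)"
    using first_order_modulus[OF e] by blast
  \<comment> \<open>This \<open>r\<close> makes \<open>M\<close> exceed \<open>|u|\<close> by at
    most \<open>a - a'\<close>. A point counted at a height above \<open>a\<close> then satisfies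
    \<open>|u x| > a'\<close>, which confines the final integral to the slab between
    \<open>a'\<close> and \<open>b\<close>.\<close>
  define r where "r = min d ((a - a') / (L + e))"
  have r: "0 < r" "r \<le> d" using d L e ab by (auto simp: r_def)
  have "r \<le> (a - a') / (L + e)" by (simp add: r_def)
  then have rL: "r * (L + e) \<le> a - a'" using L e by (simp add: pos_le_divide_eq)
  have rg: "r * (norm (g x) + e) \<le> a - a'" for x
    using L(2)[of x] r by (intro order_trans[OF mult_left_mono rL]) auto
  define M where "M x = \<bar>u x\<bar> + r * (norm (g x) + e)" for x
  have [measurable]: "M \<in> borel_measurable borel" unfolding M_def by measurable
  define c where "c = iso_const TYPE('a) * V b powr (1 - 1 / (real DIM('a)))"
  have c0: "0 \<le> c" using iso_const_pos[where 'a='a] by (simp add: c_def)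
  have lev: "ennreal (r * c) \<le> emeasure lborel {x. \<bar>u x\<bar> < t \<and> t \<le> M x}" if t: "a < t" "t < b" for t
  proof -
    have t0: "0 < t" using t ab by simp
    have sub: "{x. t \<le> M x} \<subseteq> K"
    proof (rule ccontr)
      assume "\<not> ?thesis"
      then obtain x where x: "x \<notin> K" "t \<le> M x" by auto
      then have "t \<le> a - a'" using rg[of x] u_0[OF x(1)] by (simp add: M_def)
      then show False using t ab by simp
    qed
    have bM: "{x. t \<le> M x} \<in> sets borel" "bounded {x. t \<le> M x}"
      using sub compact_K by (auto intro: bounded_subset compact_imp_bounded)
    have fmM: "{x. t \<le> M x} \<in> fmeasurable lborel"
      using bM emeasure_bounded_finite[of "{x. t \<le> M x}"] by (intro fmeasurableI) auto
    have "V t + r * (real DIM('a)) * unit_ball_vol (real DIM('a)) powr (1 / (real DIM('a))) * V t powr (1 - 1 / (real DIM('a))) \<le> measure lborel {x. t \<le> M x}"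
      unfolding V_def
    proof (rule neighbourhood_measure_ge[OF _ _ bM r(1)])
      show "{x. t \<le> \<bar>u x\<bar>} \<in> sets borel" "bounded {x. t \<le> \<bar>u x\<bar>}"
        using level_compact[OF t0] by (auto intro: borel_compact compact_imp_bounded)
      fix x y :: 'a assume x: "x \<in> {x. t \<le> \<bar>u x\<bar>}" and y: "norm y \<le> r"
      have "\<bar>u x - u (x + y)\<bar> \<le> dist (x + y) x * (norm (g (x + y)) + e)"
        using y r by (intro d(2)) (auto simp: dist_norm)
      also have "\<dots> \<le> r * (norm (g (x + y)) + e)"
        using y e by (intro mult_right_mono) (auto simp: dist_norm intro: add_nonneg_nonneg)
      finally show "x + y \<in> {x. t \<le> M x}" using x by (auto simp: M_def)
    qed
    moreover have "V b powr (1 - 1 / (real DIM('a))) \<le> V t powr (1 - 1 / (real DIM('a)))"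
      using V_mono[of t b] V_nonneg t t0 by (intro powr_mono2) (auto simp: DIM_ge_Suc0)
    then have "r * c \<le> r * iso_const TYPE('a) * V t powr (1 - 1 / (real DIM('a)))"
      using r iso_const_pos[where 'a='a] by (simp add: c_def)
    ultimately have "r * c \<le> measure lborel {x. t \<le> M x} - V t" by (simp add: iso_const_def mult_ac)
    also have "\<dots> = measure lborel ({x. t \<le> M x} - {x. t \<le> \<bar>u x\<bar>})"
      unfolding V_def
    proof (rule measurable_measure_Diff[symmetric])
      have "0 \<le> r * (norm (g x) + e)" for x using r e by simp
      then show "{x. t \<le> \<bar>u x\<bar>} \<subseteq> {x. t \<le> M x}" unfolding M_def by (smt (verit) Collect_mono)
    qed (use fmM level_compact[OF t0] in \<open>auto intro: borel_compact\<close>)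
    also have "{x. t \<le> M x} - {x. t \<le> \<bar>u x\<bar>} = {x. \<bar>u x\<bar> < t \<and> t \<le> M x}" by auto
    finally show ?thesis
      using fmM by (subst emeasure_eq_measure2) (auto intro!: ennreal_leI fmeasurableI2[OF fmM])
  qed
  have "ennreal (r * c * (b - a)) = (\<integral>\<^sup>+t. ennreal (r * c) * indicator {a<..<b} t \<partial>lborel)"
    using ab r c0 by (simp add: nn_integral_cmult_indicator ennreal_mult)
  also have "\<dots> \<le> (\<integral>\<^sup>+t. (\<integral>\<^sup>+x. indicator {(t, x). a < t \<and> t < b \<and> \<bar>u x\<bar> < t \<and> t \<le> M x} (t, x) \<partial>lborel) \<partial>lborel)"
  proof (rule nn_integral_mono)
    fix t :: real
    show "ennreal (r * c) * indicator {a<..<b} t \<le> (\<integral>\<^sup>+x. indicator {(t, x). a < t \<and> t < b \<and> \<bar>u x\<bar> < t \<and> t \<le> M x} (t, x) \<partial>lborel)"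
    proof (cases "a < t \<and> t < b")
      case True
      have "(\<integral>\<^sup>+x. indicator {(t, x). a < t \<and> t < b \<and> \<bar>u x\<bar> < t \<and> t \<le> M x} (t, x) \<partial>lborel)
          = (\<integral>\<^sup>+x. indicator {x. \<bar>u x\<bar> < t \<and> t \<le> M x} x \<partial>lborel)"
        using True by (intro nn_integral_cong) (auto simp: indicator_def)
      then show ?thesis using True lev[of t] by simp
    qed auto
  qed
  also have "\<dots> = (\<integral>\<^sup>+x. (\<integral>\<^sup>+t. indicator {(t, x). a < t \<and> t < b \<and> \<bar>u x\<bar> < t \<and> t \<le> M x} (t, x) \<partial>lborel) \<partial>lborel)"
    by (rule lborel_pair.Fubini'[symmetric]) measurable
  also have "\<dots> \<le> (\<integral>\<^sup>+x. ennreal (r * (indicator ?S x * (norm (g x) + e))) \<partial>lborel)"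
  proof (rule nn_integral_mono)
    fix x
    have "(\<integral>\<^sup>+t. indicator {(t, x). a < t \<and> t < b \<and> \<bar>u x\<bar> < t \<and> t \<le> M x} (t, x) \<partial>lborel)
       \<le> (\<integral>\<^sup>+t. indicator ?S x * indicator {\<bar>u x\<bar>..M x} t \<partial>lborel)"
      using rg[of x] by (intro nn_integral_mono) (auto simp: indicator_def M_def)
    also have "\<dots> = indicator ?S x * ennreal (M x - \<bar>u x\<bar>)"
      using r e by (subst nn_integral_cmult_indicator) (auto simp: M_def intro!: arg_cong2[where f = "(*)"] mult_nonneg_nonneg add_nonneg_nonneg)
    also have "\<dots> = ennreal (r * (indicator ?S x * (norm (g x) + e)))" by (auto simp: indicator_def M_def)
    finally show "(\<integral>\<^sup>+t. indicator {(t, x). a < t \<and> t < b \<and> \<bar>u x\<bar> < t \<and> t \<le> M x} (t, x) \<partial>lborel) \<le> ennreal (r * (indicator ?S x * (norm (g x) + e)))" .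
  qed
  also have "\<dots> = ennreal (\<integral>x. r * (indicator ?S x * (norm (g x) + e)) \<partial>lborel)"
    using r e ab by (intro nn_integral_eq_integral integrable_mult_right slab_integrable)
      (auto intro!: continuous_intros cont_g AE_I2)
  finally have "r * c * (b - a) \<le> (\<integral>x. r * (indicator ?S x * (norm (g x) + e)) \<partial>lborel)"
    using r e by (subst (asm) ennreal_le_iff) (auto intro!: integral_nonneg_AE AE_I2)
  then have "r * (c * (b - a)) \<le> r * (\<integral>x. indicator ?S x * (norm (g x) + e) \<partial>lborel)" by (simp add: mult.assoc)
  then show ?thesis using r by (simp add: c_def mult_ac)
qed

lemma slab_total_variation:
  assumes ab: "0 < a" "a < b"
  shows "iso_const TYPE('a) * (b - a) * V b powr (1 - 1 / (real DIM('a))) \<le> (\<integral>x. indicator {x. a \<le> \<bar>u x\<bar> \<and> \<bar>u x\<bar> < b} x * norm (g x) \<partial>lborel)"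
    (is "_ \<le> ?I")
proof (rule field_le_epsilon)
  fix e :: real assume e: "0 < e"
  let ?S = "{x. a \<le> \<bar>u x\<bar> \<and> \<bar>u x\<bar> < b}"
  define c where "c = iso_const TYPE('a) * V b powr (1 - 1 / (real DIM('a)))"
  have c: "0 \<le> c" using iso_const_pos[where 'a='a] by (simp add: c_def)
  define m where "m = measure lborel ?S"
  define k where "k = e / (c + m + 1)"
  have m: "0 \<le> m" by (simp add: m_def)
  have k: "0 < k" "k * (c + m) \<le> e" using e c m by (auto simp: k_def field_simps)
  \<comment> \<open>The same \<open>\<eta>\<close> serves as the margin between the bottom of the
    slab and the lowest height counted, and as the excess added to the gradient; \<open>k\<close> is
    chosen so that both errors together stay below \<open>e\<close>.\<close>
  define \<eta> where "\<eta> = min k ((b - a) / 2)"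
  have \<eta>: "0 < \<eta>" "\<eta> \<le> k" "\<eta> < b - a" using k ab by (auto simp: \<eta>_def min_less_iff_disj)
  have "iso_const TYPE('a) * (b - (a + \<eta>)) * V b powr (1 - 1 / (real DIM('a))) \<le> (\<integral>x. indicator ?S x * (norm (g x) + \<eta>) \<partial>lborel)"
    using ab \<eta> by (intro slab_total_variation_aux) auto
  also have "\<dots> = (\<integral>x. indicator ?S x * norm (g x) + indicator ?S x * \<eta> \<partial>lborel)" by (simp add: distrib_left)
  also have "\<dots> = ?I + (\<integral>x. indicator ?S x * \<eta> \<partial>lborel)"
    using ab by (intro Bochner_Integration.integral_add slab_integrable) (auto intro!: continuous_intros cont_g)
  also have "(\<integral>x. indicator ?S x * \<eta> \<partial>lborel) = \<eta> * m" by (simp add: m_def mult.commute)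
  finally have "c * (b - a) \<le> ?I + \<eta> * (c + m)" by (simp add: c_def algebra_simps)
  also have "\<eta> * (c + m) \<le> k * (c + m)" using \<eta> c m by (intro mult_right_mono) auto
  finally show "iso_const TYPE('a) * (b - a) * V b powr (1 - 1 / (real DIM('a))) \<le> ?I + e" using k by (simp add: c_def mult_ac)
qed

end

lemma powr_neg_diff_ge:
  fixes x y b :: real
  assumes "0 < x" "x \<le> y" "0 < b"
  shows "b * y powr (- b - 1) * (y - x) \<le> x powr (- b) - y powr (- b)"
proof (cases "x = y")
  case False
  then have xy: "x < y" using assms by simp
  have "\<exists>z. x < z \<and> z < y \<and> y powr (- b) - x powr (- b) = (y - x) * (- b * z powr (- b - 1))"
    using assms xy by (intro MVT2) (auto intro!: derivative_eq_intros)
  then obtain z where z: "x < z" "z < y" "y powr (- b) - x powr (- b) = (y - x) * (- b * z powr (- b - 1))" by blast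
  have "y powr (- b - 1) \<le> z powr (- b - 1)" using z assms by (intro powr_mono2') auto
  then have "(y - x) * (b * y powr (- b - 1)) \<le> (y - x) * (b * z powr (- b - 1))"
    using xy assms by (intro mult_left_mono) auto
  then show ?thesis using z(3) by (simp add: mult_ac)
qed simp

context compact_C1
begin

text \<open>
  The isoperimetric bound is applied on each of \<open>m\<close> equal subslabs and the resulting
  lower bounds for the $L^1$ norms are combined by duality;
  replacing \<open>V\<close> at the right end of a subslab by its value at the left end costs a telescoping logarithm.
\<close>

lemma slab_energy_ge:
  assumes dim: "3 \<le> DIM('a)" and ab: "0 < a" "a < b" and Vb: "0 < V b"
  defines "n \<equiv> real DIM('a)"
  shows "(iso_const TYPE('a) * (b - a))\<^sup>2 \<le> (\<integral>x. indicator {x. a \<le> \<bar>u x\<bar> \<and> \<bar>u x\<bar> < b} x * (norm (g x))\<^sup>2 \<partial>lborel) *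
     (n / (n - 2) * (V b powr (- (n - 2) / n) - V a powr (- (n - 2) / n)))"
proof -
  define S where "S s t = {x. s \<le> \<bar>u x\<bar> \<and> \<bar>u x\<bar> < t}" for s t
  define E where "E s t = (\<integral>x. indicator (S s t) x * (norm (g x))\<^sup>2 \<partial>lborel)" for s t
  define c where "c = iso_const TYPE('a)"
  have c: "0 < c" unfolding c_def by (rule iso_const_pos)
  define \<beta> where "\<beta> = 1 - 1 / n"
  have n: "3 \<le> n" using dim by (simp add: n_def)
  have \<beta>: "0 < \<beta>" "\<beta> \<le> 1" using n by (auto simp: \<beta>_def)
  define Q where "Q s t = n / (n - 2) * (V t powr (- (n - 2) / n) - V s powr (- (n - 2) / n))" for s t
  have Vpos: "0 < V t" if "0 < t" "t \<le> b" for t using Vb V_mono[OF that] by simp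
  have pt: "2 * k * c * (t - s) * (V t / V s) \<le> E s t + k\<^sup>2 * Q s t"
    if st: "a \<le> s" "s < t" "t \<le> b" and k: "0 < k" for s t k
  proof -
    have s0: "0 < s" using st ab by simp
    have V: "0 < V s" "0 < V t" "V t \<le> V s" using Vpos[of s] Vpos[of t] V_mono[of s t] st s0 by auto
    \<comment> \<open>The dual weight in Young's inequality: \<open>h^2\<close> times the volume of
      the subslab is dominated by the increment of \<open>V powr (-(n-2)/n)\<close>, by the mean
      value theorem, and such increments add up over subslabs.\<close>
    define h where "h = V s powr (- \<beta>)"
    have h: "0 < h" using V by (simp add: h_def)
    have "c * (t - s) * V t powr \<beta> \<le> (\<integral>x. indicator (S s t) x * norm (g x) \<partial>lborel)"
      using slab_total_variation[OF s0 st(2)] by (simp add: c_def \<beta>_def n_def S_def)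
    then have "2 * k * h * (c * (t - s) * V t powr \<beta>) \<le> 2 * k * h * (\<integral>x. indicator (S s t) x * norm (g x) \<partial>lborel)"
      using k h by (intro mult_left_mono) auto
    also have "\<dots> = (\<integral>x. indicator (S s t) x * (2 * k * h * norm (g x)) \<partial>lborel)"
      by (simp flip: integral_mult_right_zero add: mult_ac)
    also have "\<dots> \<le> (\<integral>x. indicator (S s t) x * ((norm (g x))\<^sup>2 + k\<^sup>2 * h\<^sup>2) \<partial>lborel)"
      unfolding S_def
    proof (intro integral_mono slab_integrable s0)
      fix x
      have "0 \<le> (norm (g x) - k * h)\<^sup>2" by simp
      then have "2 * k * h * norm (g x) \<le> (norm (g x))\<^sup>2 + k\<^sup>2 * h\<^sup>2" by (simp add: power2_eq_square algebra_simps)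
      then show "indicator {x. s \<le> \<bar>u x\<bar> \<and> \<bar>u x\<bar> < t} x * (2 * k * h * norm (g x)) \<le> indicator {x. s \<le> \<bar>u x\<bar> \<and> \<bar>u x\<bar> < t} x * ((norm (g x))\<^sup>2 + k\<^sup>2 * h\<^sup>2)"
        by (intro mult_left_mono) auto
    qed (auto intro!: continuous_intros cont_g)
    also have "\<dots> = (\<integral>x. indicator (S s t) x * (norm (g x))\<^sup>2 + indicator (S s t) x * (k\<^sup>2 * h\<^sup>2) \<partial>lborel)"
      by (simp add: distrib_left)
    also have "\<dots> = E s t + (\<integral>x. indicator (S s t) x * (k\<^sup>2 * h\<^sup>2) \<partial>lborel)"
      unfolding E_def S_def using s0
      by (intro Bochner_Integration.integral_add slab_integrable) (auto intro!: continuous_intros cont_g)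
    also have "(\<integral>x. indicator (S s t) x * (k\<^sup>2 * h\<^sup>2) \<partial>lborel) = k\<^sup>2 * (h\<^sup>2 * (V s - V t))"
      using V_slab[of s t] st s0 by (simp add: S_def mult_ac)
    also have "h\<^sup>2 * (V s - V t) \<le> Q s t"
    proof -
      have "h\<^sup>2 = V s powr (- ((n - 2) / n) - 1)"
      proof -
        have "- \<beta> + - \<beta> = - ((n - 2) / n) - 1" using n by (simp add: \<beta>_def field_simps)
        then show ?thesis by (simp only: h_def power2_eq_square powr_add[symmetric])
      qed
      then have "(n - 2) / n * (h\<^sup>2 * (V s - V t)) \<le> V t powr (- ((n - 2) / n)) - V s powr (- ((n - 2) / n))"
        using powr_neg_diff_ge[of "V t" "V s" "(n - 2) / n"] V n by (simp add: mult_ac)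
      then have "n / (n - 2) * ((n - 2) / n * (h\<^sup>2 * (V s - V t))) \<le> Q s t"
        unfolding Q_def using n by (intro mult_left_mono) (auto simp: minus_divide_left)
      then show ?thesis using n by simp
    qed
    finally have 1: "2 * k * h * (c * (t - s) * V t powr \<beta>) \<le> E s t + k\<^sup>2 * Q s t" by (simp add: mult_left_mono)
    have "V t / V s \<le> (V t / V s) powr \<beta>"
      using powr_mono'[of \<beta> 1 "V t / V s"] V \<beta> by simp
    also have "\<dots> = h * V t powr \<beta>" using V by (simp add: h_def powr_divide powr_minus field_simps)
    finally have "2 * k * c * (t - s) * (V t / V s) \<le> 2 * k * c * (t - s) * (h * V t powr \<beta>)"
      using k c st by (intro mult_left_mono) auto
    also have "\<dots> = 2 * k * h * (c * (t - s) * V t powr \<beta>)" by (simp only: mult_ac)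
    finally show ?thesis using 1 by linarith
  qed
  have Eadd: "E s t + E t r = E s r" if "0 < s" "s \<le> t" "t \<le> r" for s t r
  proof -
    have "E s t + E t r = (\<integral>x. indicator (S s t) x * (norm (g x))\<^sup>2 + indicator (S t r) x * (norm (g x))\<^sup>2 \<partial>lborel)"
      unfolding E_def S_def using that
      by (intro Bochner_Integration.integral_add[symmetric] slab_integrable) (auto intro!: continuous_intros cont_g)
    also have "\<dots> = E s r" unfolding E_def
      by (intro Bochner_Integration.integral_cong refl) (use that in \<open>auto simp: S_def indicator_def\<close>)
    finally show ?thesis .
  qed
  have key: "2 * k * c * ((b - a) - (b - a) / m * ln (V a / V b)) \<le> E a b + k\<^sup>2 * Q a b"
    if k: "0 < k" and m: "0 < m" for k and m :: nat
  proof -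
    define \<delta> where "\<delta> = (b - a) / m"
    have \<delta>: "0 < \<delta>" "m * \<delta> = b - a" using m ab by (auto simp: \<delta>_def)
    have "j \<le> m \<Longrightarrow> 2 * k * c * (\<delta> * j - \<delta> * ln (V a / V (a + j * \<delta>))) \<le> E a (a + j * \<delta>) + k\<^sup>2 * Q a (a + j * \<delta>)" for j :: nat
    proof (induction j)
      case 0
      have "S a a = {}" by (auto simp: S_def)
      then show ?case using Vpos[of a] ab by (simp add: E_def Q_def)
    next
      case (Suc j)
      define s where "s = a + j * \<delta>"
      define t where "t = a + Suc j * \<delta>"
      have "Suc j * \<delta> \<le> m * \<delta>" using Suc.prems \<delta> by (intro mult_right_mono) auto
      then have tb: "t \<le> b" using \<delta> by (simp add: t_def)
      have ts: "t - s = \<delta>" by (simp add: s_def t_def algebra_simps)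
      have st: "a \<le> s" "s < t" using \<delta> ts by (auto simp: s_def)
      have V: "0 < V a" "0 < V s" "0 < V t" using Vpos st tb ab by auto
      have "2 * k * c * (\<delta> * j - \<delta> * ln (V a / V s)) \<le> E a s + k\<^sup>2 * Q a s" using Suc by (simp add: s_def)
      moreover have "2 * k * c * \<delta> * (V t / V s) \<le> E s t + k\<^sup>2 * Q s t" using pt[OF st tb k] by (simp add: ts)
      moreover have "2 * k * c * (\<delta> * (1 - ln (V s / V t))) \<le> 2 * k * c * (\<delta> * (V t / V s))"
      proof -
        have "1 + ln (V t / V s) \<le> V t / V s" using ln_le_minus_one[of "V t / V s"] V by simp
        moreover have "ln (V t / V s) = - ln (V s / V t)" using V by (simp add: ln_div)
        ultimately have "1 - ln (V s / V t) \<le> V t / V s" by linarith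
        then show ?thesis using k c \<delta> by (intro mult_left_mono) auto
      qed
      moreover have "ln (V a / V s) + ln (V s / V t) = ln (V a / V t)" using V by (simp add: ln_div)
      then have "2 * k * c * (\<delta> * j - \<delta> * ln (V a / V s)) + 2 * k * c * (\<delta> * (1 - ln (V s / V t)))
         = 2 * k * c * (\<delta> * Suc j - \<delta> * ln (V a / V t))" by (simp flip: \<open>ln (V a / V s) + ln (V s / V t) = ln (V a / V t)\<close> add: algebra_simps)
      moreover have "E a s + E s t = E a t" using Eadd st ab by simp
      moreover have "k\<^sup>2 * Q a s + k\<^sup>2 * Q s t = k\<^sup>2 * Q a t" by (simp add: Q_def algebra_simps)
      ultimately have "2 * k * c * (\<delta> * Suc j - \<delta> * ln (V a / V t)) \<le> E a t + k\<^sup>2 * Q a t" by (simp add: mult.assoc)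
      then show ?case by (simp only: t_def)
    qed
    from this[of m] show ?thesis using \<delta> by (simp add: mult.commute[of \<delta>] \<delta>_def[symmetric])
  qed
  have lim: "2 * k * c * (b - a) \<le> E a b + k\<^sup>2 * Q a b" if k: "0 < k" for k
  proof (rule LIMSEQ_le_const2)
    have "(\<lambda>m. 2 * k * c * ((b - a) - (b - a) * ln (V a / V b) * inverse (real (Suc m)))) \<longlonglongrightarrow> 2 * k * c * ((b - a) - (b - a) * ln (V a / V b) * 0)"
      by (intro tendsto_intros LIMSEQ_inverse_real_of_nat)
    then show "(\<lambda>m. 2 * k * c * ((b - a) - (b - a) / Suc m * ln (V a / V b))) \<longlonglongrightarrow> 2 * k * c * (b - a)"
      by (simp add: divide_inverse mult_ac)
    show "\<exists>N. \<forall>m\<ge>N. 2 * k * c * ((b - a) - (b - a) / Suc m * ln (V a / V b)) \<le> E a b + k\<^sup>2 * Q a b"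
      using key[OF k] by blast
  qed
  have E0: "0 \<le> E a b" unfolding E_def by (intro integral_nonneg_AE AE_I2) auto
  \<comment> \<open>With \<open>Q a b \<le> 0\<close> the bound
    \<open>2 * k * c * (b - a) \<le> E a b + k^2 * Q a b\<close> would fail for large
    \<open>k\<close>. Its positivity says that the volume really drops across the slab.\<close>
  have Q0: "0 < Q a b"
  proof (rule ccontr)
    assume "\<not> 0 < Q a b"
    define k where "k = (E a b + 1) / (2 * c * (b - a))"
    have k: "0 < k" using E0 c ab by (auto simp: k_def)
    have "k\<^sup>2 * Q a b \<le> 0" using \<open>\<not> 0 < Q a b\<close> by (simp add: mult_nonneg_nonpos)
    moreover have "2 * k * c * (b - a) = E a b + 1"
    proof -
      have "2 * c * (b - a) \<noteq> 0" using c ab by simp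
      then have "k * (2 * c * (b - a)) = E a b + 1" using nonzero_eq_divide_eq k_def by blast
      then show ?thesis by (simp only: mult_ac)
    qed
    ultimately show False using lim[OF k] by linarith
  qed
  \<comment> \<open>The minimiser of \<open>E a b + k^2 * Q a b - 2 * k * c * (b - a)\<close>, which
    turns the family of linear bounds into the Cauchy--Schwarz form.\<close>
  define k where "k = c * (b - a) / Q a b"
  have k: "0 < k" using c ab Q0 by (auto simp: k_def)
  have "k * Q a b = c * (b - a)" using Q0 by (simp add: k_def)
  moreover have "2 * k * c * (b - a) * Q a b = 2 * (c * (b - a)) * (k * Q a b)" "k\<^sup>2 * Q a b * Q a b = (k * Q a b)\<^sup>2"
    by (simp_all only: power2_eq_square mult_ac)
  ultimately have "2 * k * c * (b - a) * Q a b = 2 * (c * (b - a))\<^sup>2" "k\<^sup>2 * Q a b * Q a b = (c * (b - a))\<^sup>2"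
    by (simp_all only: power2_eq_square mult_ac)
  moreover have "2 * k * c * (b - a) * Q a b \<le> (E a b + k\<^sup>2 * Q a b) * Q a b"
    using lim[OF k] Q0 by (intro mult_right_mono) auto
  ultimately have "(c * (b - a))\<^sup>2 \<le> E a b * Q a b" by (simp add: algebra_simps)
  then show ?thesis by (simp add: c_def E_def S_def Q_def)
qed

end

section \<open>Smooth functions on open sets\<close>

text \<open>A version of \<open>Ck\<close> relative to a set and over any Euclidean space, so that
  functions can be composed with one-variable functions on half-lines and glued from open pieces.
  Derivatives are taken in full neighbourhoods; the notion is meant for open sets.\<close>

primrec Ck_on :: "nat \<Rightarrow> 'a::euclidean_space set \<Rightarrow> ('a \<Rightarrow> real) \<Rightarrow> bool" where
  "Ck_on 0 S f \<longleftrightarrow> continuous_on S f"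
| "Ck_on (Suc k) S f \<longleftrightarrow> (\<forall>x\<in>S. f differentiable (at x)) \<and> (\<forall>b\<in>Basis. Ck_on k S (\<lambda>x. frechet_derivative f (at x) b))"

definition smooth_on :: "'a::euclidean_space set \<Rightarrow> ('a \<Rightarrow> real) \<Rightarrow> bool" where
  "smooth_on S f \<longleftrightarrow> (\<forall>k. Ck_on k S f)"

lemma Ck_iff_Ck_on:
  fixes f :: "real^'n \<Rightarrow> real"
  shows "Ck k f = Ck_on k UNIV f"
proof (induction k arbitrary: f)
  case (Suc k)
  show ?case by (auto simp: Suc partial_def[abs_def] Basis_vec_def)
qed simp

lemma smooth_iff_smooth_on: "smooth f = smooth_on UNIV f"
  by (simp add: smooth_def smooth_on_def Ck_iff_Ck_on)

lemma Ck_on_cong: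
  assumes "open S" "\<And>x. x \<in> S \<Longrightarrow> f x = g x"
  shows "Ck_on k S f = Ck_on k S g"
proof -
  have *: "Ck_on k S g" if "Ck_on k S f" "\<And>x. x \<in> S \<Longrightarrow> f x = g x" for f g
    using that
  proof (induction k arbitrary: f g)
    case 0
    then show ?case using continuous_on_cong[OF refl, of S f g] by simp
  next
    case (Suc k)
    have d: "(g has_derivative frechet_derivative f (at x)) (at x)" if "x \<in> S" for x
    proof (rule has_derivative_transform_within_open[OF _ \<open>open S\<close> that])
      show "(f has_derivative frechet_derivative f (at x)) (at x)"
        using Suc.prems(1) that by (simp flip: frechet_derivative_works)
    qed (use Suc.prems(2) in simp)
    have "g differentiable (at x)" if "x \<in> S" for x using d[OF that] by (rule differentiableI)
    moreover have "Ck_on k S (\<lambda>x. frechet_derivative g (at x) b)" if b: "b \<in> Basis" for b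
    proof (rule Suc.IH)
      show "Ck_on k S (\<lambda>x. frechet_derivative f (at x) b)" using Suc.prems(1) b by simp
      fix x assume "x \<in> S"
      then show "frechet_derivative f (at x) b = frechet_derivative g (at x) b"
        using frechet_derivative_at[OF d] by simp
    qed
    ultimately show ?case by simp
  qed
  show ?thesis by (intro iffI; erule *; simp add: assms(2))
qed

lemma smooth_on_cong:
  "open S \<Longrightarrow> (\<And>x. x \<in> S \<Longrightarrow> f x = g x) \<Longrightarrow> smooth_on S f = smooth_on S g"
  unfolding smooth_on_def using Ck_on_cong[of S f g] by simp

lemma Ck_on_Suc_derivI:
  assumes "open S" "\<And>x. x \<in> S \<Longrightarrow> (f has_derivative f' x) (at x)" "\<And>b. b \<in> Basis \<Longrightarrow> Ck_on k S (\<lambda>x. f' x b)"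
  shows "Ck_on (Suc k) S f"
proof -
  have "f' x = frechet_derivative f (at x)" if "x \<in> S" for x
    using assms(2)[OF that] by (rule frechet_derivative_at)
  then have "Ck_on k S (\<lambda>x. frechet_derivative f (at x) b)" if "b \<in> Basis" for b
    using assms(3)[OF that] Ck_on_cong[OF assms(1), of "\<lambda>x. f' x b"] by simp
  then show ?thesis using differentiableI[OF assms(2)] by simp
qed

lemma Ck_on_real_Suc_derivI:
  fixes f :: "real \<Rightarrow> real"
  assumes "open S" "\<And>x. x \<in> S \<Longrightarrow> (f has_real_derivative f' x) (at x)" "Ck_on k S f'"
  shows "Ck_on (Suc k) S f"
  using assms by (intro Ck_on_Suc_derivI[where f' = "\<lambda>x h. f' x * h"]) (auto simp: has_field_derivative_def)

lemma Ck_on_SucD: "Ck_on (Suc k) S f \<Longrightarrow> Ck_on k S f"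
proof (induction k arbitrary: f)
  case 0
  then show ?case by (auto intro!: continuous_at_imp_continuous_on differentiable_imp_continuous_within)
next
  case (Suc k)
  then show ?case by (metis Ck_on.simps(2))
qed

lemma Ck_on_deriv: "Ck_on (Suc k) S f \<Longrightarrow> x \<in> S \<Longrightarrow> (f has_derivative frechet_derivative f (at x)) (at x)"
  using frechet_derivative_works by auto

lemma Ck_on_subset: "Ck_on k S f \<Longrightarrow> T \<subseteq> S \<Longrightarrow> Ck_on k T f"
  by (induction k arbitrary: f) (auto intro: continuous_on_subset)

lemma smooth_on_subset: "smooth_on S f \<Longrightarrow> T \<subseteq> S \<Longrightarrow> smooth_on T f"
  unfolding smooth_on_def using Ck_on_subset by blast

lemma Ck_on_Un: "open S \<Longrightarrow> open T \<Longrightarrow> Ck_on k S f \<Longrightarrow> Ck_on k T f \<Longrightarrow> Ck_on k (S \<union> T) f"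
  by (induction k arbitrary: f) (auto intro: continuous_on_open_Un)

lemma smooth_on_Un: "open S \<Longrightarrow> open T \<Longrightarrow> smooth_on S f \<Longrightarrow> smooth_on T f \<Longrightarrow> smooth_on (S \<union> T) f"
  unfolding smooth_on_def using Ck_on_Un by blast

lemma Ck_on_const: "open S \<Longrightarrow> Ck_on k S (\<lambda>_. c)"
proof (induction k arbitrary: c)
  case (Suc k)
  show ?case by (rule Ck_on_Suc_derivI[where f' = "\<lambda>_ _. 0"]) (use Suc in auto)
qed simp

lemma Ck_on_linear: "open S \<Longrightarrow> bounded_linear f \<Longrightarrow> Ck_on k S f"
proof (cases k)
  case (Suc j)
  assume "open S" "bounded_linear f"
  then show ?thesis unfolding Suc
    by (intro Ck_on_Suc_derivI[where f' = "\<lambda>_. f"]) (auto simp: Ck_on_const bounded_linear_imp_has_derivative)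
qed (auto simp: linear_continuous_on)

lemma Ck_on_add: "open S \<Longrightarrow> Ck_on k S f \<Longrightarrow> Ck_on k S g \<Longrightarrow> Ck_on k S (\<lambda>x. f x + g x)"
proof (induction k arbitrary: f g)
  case (Suc k)
  show ?case
  proof (rule Ck_on_Suc_derivI[where f' = "\<lambda>x h. frechet_derivative f (at x) h + frechet_derivative g (at x) h"])
    fix x assume "x \<in> S"
    then show "((\<lambda>x. f x + g x) has_derivative (\<lambda>h. frechet_derivative f (at x) h + frechet_derivative g (at x) h)) (at x)"
      by (intro has_derivative_add Ck_on_deriv[OF Suc.prems(2)] Ck_on_deriv[OF Suc.prems(3)])
  next
    fix b :: 'a assume "b \<in> Basis"
    then show "Ck_on k S (\<lambda>x. frechet_derivative f (at x) b + frechet_derivative g (at x) b)"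
      using Suc.prems(2,3) by (intro Suc.IH[OF Suc.prems(1)]) simp_all
  qed (rule Suc.prems)
qed (auto intro: continuous_intros)

lemma Ck_on_mult: "open S \<Longrightarrow> Ck_on k S f \<Longrightarrow> Ck_on k S g \<Longrightarrow> Ck_on k S (\<lambda>x. f x * g x)"
proof (induction k arbitrary: f g)
  case (Suc k)
  have k: "Ck_on k S f" "Ck_on k S g" by (rule Ck_on_SucD[OF Suc.prems(2)], rule Ck_on_SucD[OF Suc.prems(3)])
  show ?case
  proof (rule Ck_on_Suc_derivI[where f' = "\<lambda>x h. f x * frechet_derivative g (at x) h + frechet_derivative f (at x) h * g x"])
    fix b :: 'a assume "b \<in> Basis"
    then show "Ck_on k S (\<lambda>x. f x * frechet_derivative g (at x) b + frechet_derivative f (at x) b * g x)"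
      using Suc.prems(2,3) by (intro Ck_on_add Suc.IH Suc.prems(1) k) simp_all
  next
    fix x assume "x \<in> S"
    then show "((\<lambda>x. f x * g x) has_derivative (\<lambda>h. f x * frechet_derivative g (at x) h + frechet_derivative f (at x) h * g x)) (at x)"
      by (intro has_derivative_mult Ck_on_deriv[OF Suc.prems(2)] Ck_on_deriv[OF Suc.prems(3)])
  qed (rule Suc.prems)
qed (auto intro: continuous_intros)

text \<open>As the inner function is real-valued, the chain rule is a product of scalars. The
  induction generalises over the outer function, whose derivative takes its place at the lower
  order.\<close>

lemma Ck_on_compose:
  fixes G :: "real \<Rightarrow> real"
  shows "open S \<Longrightarrow> open T \<Longrightarrow> Ck_on k T G \<Longrightarrow> Ck_on k S q \<Longrightarrow> q ` S \<subseteq> T \<Longrightarrow> Ck_on k S (\<lambda>x. G (q x))"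
proof (induction k arbitrary: G)
  case 0
  then show ?case using continuous_on_compose2[of T G S q] by simp
next
  case (Suc k)
  have k: "Ck_on k S q" by (rule Ck_on_SucD[OF Suc.prems(4)])
  define G' where "G' y = frechet_derivative G (at y) 1" for y
  have G': "(G has_real_derivative G' y) (at y)" if "y \<in> T" for y
  proof -
    have "(G has_derivative frechet_derivative G (at y)) (at y)" using Ck_on_deriv[OF Suc.prems(3) that] .
    moreover have "frechet_derivative G (at y) = (\<lambda>h. G' y * h)"
    proof (intro ext)
      fix h
      have "linear (frechet_derivative G (at y))" using calculation by (rule has_derivative_linear)
      from linear_cmul[OF this, of h 1] show "frechet_derivative G (at y) h = G' y * h" by (simp add: G'_def)
    qed
    ultimately show ?thesis by (simp add: has_field_derivative_def)
  qed
  show ?case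
  proof (rule Ck_on_Suc_derivI[where f' = "\<lambda>x h. G' (q x) * frechet_derivative q (at x) h"])
    fix x assume "x \<in> S"
    then show "((\<lambda>x. G (q x)) has_derivative (\<lambda>h. G' (q x) * frechet_derivative q (at x) h)) (at x)"
    proof (rule has_derivative_compose[OF Ck_on_deriv[OF Suc.prems(4)]])
      show "(G has_derivative (\<lambda>h. G' (q x) * h)) (at (q x))"
        using G'[of "q x"] Suc.prems(5) \<open>x \<in> S\<close> by (auto simp: has_field_derivative_def)
    qed
  next
    fix b :: 'a assume b: "b \<in> Basis"
    have "Ck_on k T G'" using Suc.prems(3) by (simp add: G'_def[abs_def])
    note Suc.IH[OF Suc.prems(1,2) this k Suc.prems(5)]
    moreover have "Ck_on k S (\<lambda>x. frechet_derivative q (at x) b)" using Suc.prems(4) b by simp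
    ultimately show "Ck_on k S (\<lambda>x. G' (q x) * frechet_derivative q (at x) b)"
      by (rule Ck_on_mult[OF Suc.prems(1)])
  qed (rule Suc.prems)
qed

lemma smooth_on_const: "open S \<Longrightarrow> smooth_on S (\<lambda>_. c)"
  by (simp add: smooth_on_def Ck_on_const)

lemma smooth_on_linear: "open S \<Longrightarrow> bounded_linear f \<Longrightarrow> smooth_on S f"
  by (simp add: smooth_on_def Ck_on_linear)

lemma smooth_on_add: "open S \<Longrightarrow> smooth_on S f \<Longrightarrow> smooth_on S g \<Longrightarrow> smooth_on S (\<lambda>x. f x + g x)"
  by (simp add: smooth_on_def Ck_on_add)

lemma smooth_on_mult: "open S \<Longrightarrow> smooth_on S f \<Longrightarrow> smooth_on S g \<Longrightarrow> smooth_on S (\<lambda>x. f x * g x)"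
  by (simp add: smooth_on_def Ck_on_mult)

lemma smooth_on_diff:
  "open S \<Longrightarrow> smooth_on S f \<Longrightarrow> smooth_on S g \<Longrightarrow> smooth_on S (\<lambda>x. f x - g x)"
  using smooth_on_add[of S f "\<lambda>x. (-1) * g x"] smooth_on_mult[of S "\<lambda>_. -1" g] smooth_on_const[of S "-1"] by simp

lemma smooth_on_sum:
  "open S \<Longrightarrow> (\<And>i. i \<in> I \<Longrightarrow> smooth_on S (f i)) \<Longrightarrow> smooth_on S (\<lambda>x. \<Sum>i\<in>I. f i x)"
  by (induction I rule: infinite_finite_induct) (auto intro: smooth_on_add smooth_on_const)

lemma smooth_on_compose:
  fixes G :: "real \<Rightarrow> real"
  shows "open S \<Longrightarrow> open T \<Longrightarrow> smooth_on T G \<Longrightarrow> smooth_on S q \<Longrightarrow> q ` S \<subseteq> T \<Longrightarrow> smooth_on S (\<lambda>x. G (q x))"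
  by (simp add: smooth_on_def Ck_on_compose)

lemma smooth_on_real_derivI:
  fixes f :: "real \<Rightarrow> real"
  assumes "open S" "\<And>x. x \<in> S \<Longrightarrow> (f has_real_derivative f' x) (at x)" "smooth_on S f'"
  shows "smooth_on S f"
  unfolding smooth_on_def
  using Ck_on_real_Suc_derivI[OF assms(1,2)] assms(3) Ck_on_SucD smooth_on_def by blast

lemma smooth_on_powr: "smooth_on {0<..} (\<lambda>x::real. x powr a)"
proof -
  have "Ck_on k {0<..} (\<lambda>x::real. x powr a)" for k
  proof (induction k arbitrary: a)
    case 0 then show ?case by (auto intro!: continuous_intros)
  next
    case (Suc k)
    show ?case
      by (rule Ck_on_real_Suc_derivI[where f' = "\<lambda>x. a * x powr (a - 1)"])
        (use Suc in \<open>auto intro!: derivative_eq_intros Ck_on_mult Ck_on_const simp del: Ck_on.simps\<close>)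
  qed
  then show ?thesis by (simp add: smooth_on_def)
qed

lemma smooth_on_ln: "smooth_on {0<..} (ln :: real \<Rightarrow> real)"
proof (rule smooth_on_real_derivI[OF _ _ smooth_on_powr[of "-1"]])
  fix x :: real assume "x \<in> {0<..}"
  then show "(ln has_real_derivative x powr -1) (at x)"
    using DERIV_ln_divide[of x] by (simp add: powr_minus_divide)
qed simp

lemma smooth_on_norm_sq: "smooth_on UNIV (\<lambda>x::'a::euclidean_space. (norm (x - a))\<^sup>2)"
proof -
  have "smooth_on UNIV (\<lambda>x::'a. \<Sum>b\<in>Basis. (x \<bullet> b + (- a \<bullet> b)) * (x \<bullet> b + (- a \<bullet> b)))"
    by (intro smooth_on_sum smooth_on_mult smooth_on_add smooth_on_const smooth_on_linear bounded_linear_inner_left) auto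
  moreover have "(norm (x - a))\<^sup>2 = (\<Sum>b\<in>Basis. (x \<bullet> b + (- a \<bullet> b)) * (x \<bullet> b + (- a \<bullet> b)))" for x :: 'a
    by (subst power2_norm_eq_inner, subst euclidean_inner) (simp add: inner_diff_left)
  ultimately show ?thesis by simp
qed

text \<open>The exponent \<open>m\<close> closes the family under differentiation up to linear
  combinations, so the smoothness of \<open>exp (-1/x)\<close> across 0 is an induction for all
  \<open>m\<close> at once.\<close>

definition flat_exp :: "nat \<Rightarrow> real \<Rightarrow> real" where
  "flat_exp m x = (if x \<le> 0 then 0 else exp (- inverse x) * inverse x ^ m)"

lemma flat_exp_tendsto: "(flat_exp m \<longlongrightarrow> 0) (at 0)"
proof -
  have "((\<lambda>x. flat_exp m x) \<longlongrightarrow> 0) (at_left 0)"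
    by (rule tendsto_eventually) (auto simp: eventually_at_filter flat_exp_def)
  moreover have "((\<lambda>x. flat_exp m x) \<longlongrightarrow> 0) (at_right 0)"
  proof -
    have "((\<lambda>y::real. y ^ m / exp y) \<longlongrightarrow> 0) at_top" by (rule tendsto_power_div_exp_0)
    then have "((\<lambda>x::real. inverse x ^ m / exp (inverse x)) \<longlongrightarrow> 0) (at_right 0)"
      by (rule filterlim_compose[OF _ filterlim_inverse_at_top_right])
    then show ?thesis
      by (rule Lim_transform_eventually) (auto simp: eventually_at_filter flat_exp_def exp_minus divide_inverse mult.commute)
  qed
  ultimately show ?thesis by (simp add: filterlim_split_at)
qed

lemma flat_exp_deriv:
  "(flat_exp m has_real_derivative flat_exp (m + 2) x - m * flat_exp (m + 1) x) (at x)"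
proof -
  consider "x < 0" | "x > 0" | "x = 0" by linarith
  then show ?thesis
  proof cases
    case 1
    have "((\<lambda>_. 0) has_real_derivative 0) (at x)" by simp
    then have "(flat_exp m has_real_derivative 0) (at x)"
      by (rule has_field_derivative_transform_within_open[of _ _ _ "{..<0}"]) (use 1 in \<open>auto simp: flat_exp_def\<close>)
    then show ?thesis using 1 by (simp add: flat_exp_def)
  next
    case 2
    have "((\<lambda>x. exp (- inverse x) * inverse x ^ m) has_real_derivative flat_exp (m + 2) x - m * flat_exp (m + 1) x) (at x)"
    proof (cases m)
      case (Suc j)
      show ?thesis unfolding Suc
        by (rule derivative_eq_intros refl | use 2 in \<open>simp add: flat_exp_def power2_eq_square algebra_simps\<close>)+
    qed (use 2 in \<open>auto intro!: derivative_eq_intros simp: flat_exp_def power2_eq_square algebra_simps\<close>)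
    then show ?thesis
      by (rule has_field_derivative_transform_within_open[of _ _ _ "{0<..}"]) (use 2 in \<open>auto simp: flat_exp_def\<close>)
  next
    case 3
    have "((\<lambda>h. (flat_exp m (0 + h) - flat_exp m 0) / h) \<longlongrightarrow> 0) (at 0)"
      by (rule Lim_transform_eventually[OF flat_exp_tendsto[of "Suc m"]])
        (auto simp: flat_exp_def eventually_at_filter field_simps)
    then show ?thesis using 3 by (simp add: DERIV_def flat_exp_def)
  qed
qed

lemma smooth_on_flat_exp: "smooth_on UNIV (flat_exp m)"
proof -
  have "Ck_on k UNIV (flat_exp m)" for k
  proof (induction k arbitrary: m)
    case 0
    show ?case using flat_exp_deriv by (auto intro!: continuous_at_imp_continuous_on DERIV_isCont)
  next
    case (Suc k)
    have "Ck_on k UNIV (\<lambda>x. flat_exp (m + 2) x + (- real m) * flat_exp (m + 1) x)"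
      by (intro Ck_on_add Ck_on_mult Ck_on_const Suc) auto
    then show ?case using flat_exp_deriv[of m]
      by (intro Ck_on_real_Suc_derivI[where f' = "\<lambda>x. flat_exp (m + 2) x - m * flat_exp (m + 1) x"]) auto
  qed
  then show ?thesis by (simp add: smooth_on_def)
qed

section \<open>Radial integration in the volume variable and the rearrangement of weights\<close>

text \<open>The volume of the centred ball through \<open>z\<close> as radial variable: it carries
  Lebesgue measure to Lebesgue measure on the half-line, so radial integrals become one-dimensional
  without a Jacobian, in the same variable in which superlevel sets are measured.\<close>

definition ball_vol :: "'a::euclidean_space \<Rightarrow> real" where
  "ball_vol z = unit_ball_vol (real DIM('a)) * norm z ^ DIM('a)"

lemma ball_vol_measurable[measurable]: "ball_vol \<in> borel_measurable borel"
  unfolding ball_vol_def by measurable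

lemma ball_vol_nonneg: "0 \<le> ball_vol z" by (simp add: ball_vol_def)

lemma unit_ball_vol_DIM_pos: "0 < unit_ball_vol (real DIM('a::euclidean_space))" by simp

lemma powr_inverse_power:
  fixes x :: real
  assumes "0 \<le> x" "0 < n"
  shows "(x powr (1 / real n)) ^ n = x"
proof (cases "x = 0")
  case False
  then have "(x powr (1 / real n)) ^ n = (x powr (1 / real n)) powr (real n)"
    using assms by (intro powr_realpow[symmetric]) simp
  also have "\<dots> = x" using assms False by (subst powr_powr) simp
  finally show ?thesis .
qed (use assms in auto)

lemma ball_vol_le_iff:
  assumes "0 \<le> v"
  shows "ball_vol (z::'a::euclidean_space) \<le> v \<longleftrightarrow> norm z \<le> (v / unit_ball_vol (real DIM('a))) powr (1 / real DIM('a))"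
proof -
  let ?w = "unit_ball_vol (real DIM('a))" and ?n = "real DIM('a)"
  have w: "0 < ?w" by simp
  have "ball_vol z \<le> v \<longleftrightarrow> norm z ^ DIM('a) \<le> v / ?w" by (simp add: ball_vol_def pos_le_divide_eq[OF w] mult.commute)
  also have "v / ?w = ((v / ?w) powr (1 / ?n)) ^ DIM('a)"
    using assms w by (intro powr_inverse_power[symmetric]) auto
  also have "norm z ^ DIM('a) \<le> \<dots> \<longleftrightarrow> norm z \<le> (v / ?w) powr (1 / ?n)"
    by (intro power_mono_iff) auto
  finally show ?thesis .
qed

lemma emeasure_ball_vol_le:
  assumes "0 \<le> v"
  shows "emeasure lborel {z::'a::euclidean_space. ball_vol z \<le> v} = ennreal v"
proof -
  define w where "w = unit_ball_vol (real DIM('a))"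
  have w: "0 < w" by (simp add: w_def)
  define R where "R = (v / w) powr (1 / real DIM('a))"
  have R: "0 \<le> R" "R ^ DIM('a) = v / w"
    unfolding R_def by (simp, rule powr_inverse_power) (use assms w in \<open>simp_all add: divide_nonneg_pos\<close>)
  have "ball_vol z \<le> v \<longleftrightarrow> norm z \<le> R" for z :: 'a
    unfolding R_def w_def by (rule ball_vol_le_iff[OF assms])
  then have "{z::'a. ball_vol z \<le> v} = cball 0 R" by (simp add: set_eq_iff)
  moreover have "emeasure lborel (cball (0::'a) R) = ennreal (w * R ^ DIM('a))"
    unfolding w_def by (rule emeasure_cball[OF R(1)])
  ultimately show ?thesis using w by (simp add: R(2))
qed

text \<open>Both measures give a half-line up to \<open>v\<close> the mass \<open>v\<close> (or 0
  for negative \<open>v\<close>), because the points with \<open>ball_vol\<close> at most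
  \<open>v\<close> form a ball of exactly that volume; half-lines generate the Borel sets.\<close>

lemma distr_ball_vol: "distr (lborel :: 'a::euclidean_space measure) borel ball_vol = density lborel (indicator {0..})"
proof (rule measure_eqI_generator_eq[of "range atMost" UNIV _ _ "\<lambda>i. {..real i}"])
  show "Int_stable (range (atMost :: real \<Rightarrow> _))" by (auto simp: Int_stable_def)
  show "sets (distr (lborel :: 'a measure) borel ball_vol) = sigma_sets UNIV (range atMost)"
    "sets (density lborel (indicator {0..})) = sigma_sets UNIV (range (atMost :: real \<Rightarrow> _))"
    by (simp_all, simp_all add: borel_eq_atMost)
  have em: "emeasure (distr (lborel :: 'a measure) borel ball_vol) {..v} = ennreal v" for v
  proof (cases "0 \<le> v")
    case True
    have "emeasure (distr (lborel :: 'a measure) borel ball_vol) {..v} = emeasure lborel {z::'a. ball_vol z \<le> v}"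
      by (subst emeasure_distr) (auto simp: vimage_def)
    then show ?thesis using emeasure_ball_vol_le[OF True, where 'a='a] by simp
  next
    case False
    then have "\<not> ball_vol z \<le> v" for z :: 'a using ball_vol_nonneg[of z] by linarith
    then have "ball_vol -` {..v} = ({} :: 'a set)" by auto
    then show ?thesis using False by (subst emeasure_distr) (auto simp: ennreal_neg)
  qed
  have em2: "emeasure (density lborel (indicator {0..})) {..v} = ennreal v" for v :: real
  proof -
    have "emeasure (density lborel (indicator {0..})) {..v} = (\<integral>\<^sup>+x. indicator {0..} x * indicator {..v} x \<partial>lborel)"
      by (subst emeasure_density) auto
    also have "\<dots> = (\<integral>\<^sup>+x. indicator {0..v} x \<partial>lborel)"
      by (intro nn_integral_cong) (auto simp: indicator_def)
    also have "\<dots> = ennreal v" by (cases "0 \<le> v") (auto simp: ennreal_neg)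
    finally show ?thesis .
  qed
  show "emeasure (distr (lborel :: 'a measure) borel ball_vol) {..real i} \<noteq> \<infinity>" for i by (simp add: em)
  show "(\<Union>i. {..real i}) = UNIV" using real_arch_simple by auto
  fix X assume "X \<in> range (atMost :: real \<Rightarrow> _)"
  then show "emeasure (distr (lborel :: 'a measure) borel ball_vol) X = emeasure (density lborel (indicator {0..})) X"
    using em em2 by auto
qed auto

lemma radial_integral:
  fixes F :: "real \<Rightarrow> real"
  assumes [measurable]: "F \<in> borel_measurable borel"
  shows "integrable lborel (\<lambda>z::'a::euclidean_space. F (ball_vol z)) \<longleftrightarrow> integrable lborel (\<lambda>v. indicator {0..} v * F v)"
    and "(\<integral>z. F (ball_vol (z::'a)) \<partial>lborel) = (\<integral>v. indicator {0..} v * F v \<partial>lborel)"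
proof -
  have d: "density lborel (indicator {0::real..}) = density lborel (\<lambda>v. ennreal (indicator {0..} v))"
    by (intro arg_cong2[where f = density] refl ext) (auto simp: indicator_def)
  have "integrable lborel (\<lambda>z::'a. F (ball_vol z)) \<longleftrightarrow> integrable (distr (lborel :: 'a measure) borel ball_vol) F"
    by (subst integrable_distr_eq) auto
  also have "\<dots> \<longleftrightarrow> integrable lborel (\<lambda>v. indicator {0..} v * F v)"
    unfolding distr_ball_vol d by (subst integrable_density) auto
  finally show "integrable lborel (\<lambda>z::'a. F (ball_vol z)) \<longleftrightarrow> integrable lborel (\<lambda>v. indicator {0..} v * F v)" .
  have "(\<integral>z. F (ball_vol (z::'a)) \<partial>lborel) = (\<integral>v. F v \<partial>distr (lborel :: 'a measure) borel ball_vol)"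
    by (subst integral_distr) auto
  also have "\<dots> = (\<integral>v. indicator {0..} v * F v \<partial>lborel)"
    unfolding distr_ball_vol d by (subst integral_density) auto
  finally show "(\<integral>z. F (ball_vol (z::'a)) \<partial>lborel) = (\<integral>v. indicator {0..} v * F v \<partial>lborel)" .
qed

lemma AE_lborel_neq_0: "AE x in lborel. x \<noteq> (0::'a::euclidean_space)"
  by (rule AE_lborel_singleton)

definition radial_weight :: "'a::euclidean_space itself \<Rightarrow> real \<Rightarrow> real \<Rightarrow> real" where
  "radial_weight _ e v = (v / unit_ball_vol (real DIM('a))) powr (e / real DIM('a))"

context
  fixes e :: real and T :: "'a::euclidean_space itself"
  assumes e: "- real DIM('a) < e" "e \<le> 0"
begin

lemma weight_eq: "norm z powr e = radial_weight TYPE('a) e (ball_vol (z::'a))"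
proof (cases "z = 0")
  case False
  then have "ball_vol z / unit_ball_vol (real DIM('a)) = norm z powr (real DIM('a))"
    using nonzero_mult_div_cancel_left[OF less_imp_neq[OF unit_ball_vol_DIM_pos[where 'a='a], symmetric]]
    by (simp add: ball_vol_def powr_realpow)
  then show ?thesis using False by (simp add: radial_weight_def powr_powr)
qed (simp add: radial_weight_def ball_vol_def)

lemma weight_measurable[measurable]: "radial_weight TYPE('a) e \<in> borel_measurable borel"
  unfolding radial_weight_def[abs_def] by measurable

lemma weight_nonneg: "0 \<le> radial_weight TYPE('a) e v" by (simp add: radial_weight_def)

lemma weight_antimono: "0 < v \<Longrightarrow> v \<le> w \<Longrightarrow> radial_weight TYPE('a) e w \<le> radial_weight TYPE('a) e v"
  unfolding radial_weight_def using e by (intro powr_mono2') (auto simp: divide_right_mono less_imp_le divide_nonpos_pos)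

text \<open>In the volume variable the weight is a power above -1. The second part keeps only that
  the integral is a positive power of \<open>b\<close>: the weighted mass of small balls tends to
  0.\<close>

lemma weight_integral:
  assumes "0 \<le> b"
  shows "integrable lborel (\<lambda>v. indicator {0..b} v * radial_weight TYPE('a) e v)"
    and "\<exists>C\<ge>0. \<exists>r>0. \<forall>b\<ge>0. (\<integral>v. indicator {0..b} v * radial_weight TYPE('a) e v \<partial>lborel) = C * b powr r"
proof -
  define w where "w = unit_ball_vol (real DIM('a))"
  have w: "0 < w" by (simp add: w_def)
  define r where "r = e / real DIM('a) + 1"
  have r: "0 < r" using e by (simp add: r_def field_simps)
  define C where "C = w powr (1 - r) / r"
  have C: "0 \<le> C" using r by (simp add: C_def)
  have hb: "has_bochner_integral lborel (\<lambda>v. indicator {0..b} v * radial_weight TYPE('a) e v) (C * b powr r)" if b: "0 \<le> b" for b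
  proof (rule has_bochner_integral_nn_integral)
    have "((\<lambda>v. radial_weight TYPE('a) e v) has_integral C * b powr r - C * 0 powr r) {0..b}"
    proof (rule fundamental_theorem_of_calculus_interior[OF b])
      show "continuous_on {0..b} (\<lambda>v. C * v powr r)" using r by (intro continuous_intros continuous_on_powr') auto
      fix v assume v: "v \<in> {0<..<b}"
      have "((\<lambda>v. C * v powr r) has_real_derivative C * (r * v powr (r - 1))) (at v)"
        using v by (auto intro!: derivative_eq_intros)
      also have "C * (r * v powr (r - 1)) = radial_weight TYPE('a) e v"
      proof -
        have e': "e / real DIM('a) = r - 1" by (simp add: r_def)
        have "radial_weight TYPE('a) e v = v powr (r - 1) * w powr (1 - r)"
          using v w by (simp add: radial_weight_def w_def[symmetric] e' powr_divide powr_diff)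
        then show ?thesis using r by (simp add: C_def)
      qed
      finally show "((\<lambda>v. C * v powr r) has_vector_derivative radial_weight TYPE('a) e v) (at v)"
        by (simp add: has_real_derivative_iff_has_vector_derivative)
    qed
    then have hi: "((\<lambda>v. radial_weight TYPE('a) e v) has_integral C * b powr r) {0..b}" by simp
    show "(\<integral>\<^sup>+v. ennreal (indicator {0..b} v * radial_weight TYPE('a) e v) \<partial>lborel) = ennreal (C * b powr r)"
      by (rule nn_integral_has_integral_lebesgue[OF weight_nonneg hi])
  qed (use C weight_nonneg in \<open>auto intro!: AE_I2\<close>)
  show "integrable lborel (\<lambda>v. indicator {0..b} v * radial_weight TYPE('a) e v)" using hb[OF assms] by (simp add: has_bochner_integral_iff)
  show "\<exists>C\<ge>0. \<exists>r>0. \<forall>b\<ge>0. (\<integral>v. indicator {0..b} v * radial_weight TYPE('a) e v \<partial>lborel) = C * b powr r"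
  proof (intro exI conjI allI impI)
    fix b :: real assume "0 \<le> b"
    then show "(\<integral>v. indicator {0..b} v * radial_weight TYPE('a) e v \<partial>lborel) = C * b powr r"
      by (rule has_bochner_integral_integral_eq[OF hb])
  qed (rule C r)+
qed

text \<open>The bathtub principle: \<open>(1\<^sub>L - 1\<^sub>B) (|x|\<^sup>e - k) \<le> 0\<close> when \<open>k\<close> is the value of the weight on the boundary of the ball \<open>B\<close>.\<close>

lemma weight_rearrange:
  assumes L: "L \<in> fmeasurable (lborel :: 'a measure)"
  shows "integrable lborel (\<lambda>x. indicator L x * norm x powr e)"
    and "(\<integral>x. indicator L x * norm x powr e \<partial>lborel) \<le> (\<integral>v. indicator {0..measure lborel L} v * radial_weight TYPE('a) e v \<partial>lborel)"
proof -
  define l where "l = measure lborel L"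
  have l: "0 \<le> l" by (simp add: l_def)
  have [measurable]: "L \<in> sets lborel" using L by (rule fmeasurableD)
  have "integrable lborel (\<lambda>x. indicator L x * norm x powr e) \<and>
    (\<integral>x. indicator L x * norm x powr e \<partial>lborel) \<le> (\<integral>v. indicator {0..l} v * radial_weight TYPE('a) e v \<partial>lborel)"
  proof (cases "l = 0")
    case True
    then have "L \<in> null_sets lborel" using L by (auto simp: null_sets_def l_def emeasure_eq_measure2)
    then have ae: "AE x in lborel. indicator L x * norm x powr e = 0" by (auto dest!: AE_not_in simp: indicator_def elim!: eventually_mono)
    have "integrable lborel (\<lambda>x. indicator L x * norm x powr e)"
      by (rule integrable_cong_AE_imp[of _ "\<lambda>_. 0"]) (use ae in auto)
    moreover have "(\<integral>x. indicator L x * norm x powr e \<partial>lborel) = 0"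
      using integral_cong_AE[OF _ _ ae] by simp
    ultimately show ?thesis using weight_nonneg by (simp add: integral_nonneg_AE)
  next
    case False
  then have l0: "0 < l" using l by simp
  define B where "B = {x::'a. ball_vol x \<le> l}"
  have [measurable]: "B \<in> sets borel" unfolding B_def by measurable
  have eqB: "indicator {0..l} (ball_vol x) * radial_weight TYPE('a) e (ball_vol x) = indicator B x * norm x powr e" for x :: 'a
    by (auto simp: indicator_def B_def ball_vol_nonneg weight_eq)
  have iv: "indicator {0..} v * (indicator {0..l} v * radial_weight TYPE('a) e v) = indicator {0..l} v * radial_weight TYPE('a) e v" for v
    by (auto simp: indicator_def)
  have iB: "integrable lborel (\<lambda>x. indicator B x * norm x powr e)"
    using radial_integral(1)[of "\<lambda>v. indicator {0..l} v * radial_weight TYPE('a) e v", where 'a='a] weight_integral(1)[OF l]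
    by (simp add: eqB iv)
  have vB: "(\<integral>x. indicator B x * norm x powr e \<partial>lborel) = (\<integral>v. indicator {0..l} v * radial_weight TYPE('a) e v \<partial>lborel)"
    using radial_integral(2)[of "\<lambda>v. indicator {0..l} v * radial_weight TYPE('a) e v", where 'a='a]
    by (simp add: eqB iv)
  have iL1: "integrable lborel (indicator L :: 'a \<Rightarrow> real)" using L by (simp add: fmeasurable_def)
  have "emeasure lborel B = ennreal l" unfolding B_def by (rule emeasure_ball_vol_le[OF l])
  then have mB: "measure lborel B = l" and iB1: "integrable lborel (indicator B :: 'a \<Rightarrow> real)"
    using l by (simp_all add: measure_def)
  define k where "k = radial_weight TYPE('a) e l"
  have k: "0 \<le> k" by (simp add: k_def weight_nonneg)
  have gt: "norm x powr e \<le> k" if "x \<notin> B" for x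
    using that weight_antimono[OF l0, of "ball_vol x"] by (simp add: B_def k_def weight_eq)
  have lt: "k \<le> norm x powr e" if "x \<in> B" "x \<noteq> 0" for x
  proof -
    have "0 < ball_vol x" using that by (simp add: ball_vol_def)
    then show ?thesis using that weight_antimono[of "ball_vol x" l] by (simp add: B_def k_def weight_eq)
  qed
  have pw: "AE x in lborel. indicator L x * norm x powr e \<le> indicator B x * norm x powr e + k * (indicator L x - indicator B x)"
    using AE_lborel_neq_0
  proof eventually_elim
    case (elim x)
    then show ?case using gt[of x] lt[of x] by (auto simp: indicator_def)
  qed
  have int: "integrable lborel (\<lambda>x. indicator B x * norm x powr e + k * (indicator L x - indicator B x))"
    using iB iL1 iB1 by auto
  have iL: "integrable lborel (\<lambda>x. indicator L x * norm x powr e)"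
    using pw by (intro Bochner_Integration.integrable_bound[OF int]) (auto elim!: eventually_mono)
  have "(\<integral>x. indicator L x * norm x powr e \<partial>lborel) \<le> (\<integral>x. indicator B x * norm x powr e + k * (indicator L x - indicator B x) \<partial>lborel)"
    by (rule integral_mono_AE[OF iL int pw])
  also have "\<dots> = (\<integral>v. indicator {0..l} v * radial_weight TYPE('a) e v \<partial>lborel) + k * (measure lborel L - measure lborel B)"
    using iB iL1 iB1 by (simp add: vB)
  finally show ?thesis using iL by (simp add: mB l_def)
  qed
  then show "integrable lborel (\<lambda>x. indicator L x * norm x powr e)"
    "(\<integral>x. indicator L x * norm x powr e \<partial>lborel) \<le> (\<integral>v. indicator {0..measure lborel L} v * radial_weight TYPE('a) e v \<partial>lborel)"
    by (simp_all add: l_def)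
qed

end

text \<open>The derivative of the step is a normalisation of the bump \<open>exp (-k / (x (1 - x)))\<close>, which is nearly \<open>1\<close> on \<open>(0,1)\<close>; thus the step is nearly linear in the sense of energy.\<close>

lemma smooth_step_exists:
  fixes e :: real
  assumes e: "0 < e"
  obtains \<sigma> s P :: "real \<Rightarrow> real" where
    "smooth_on UNIV \<sigma>" "continuous_on UNIV s" "\<And>x. (\<sigma> has_real_derivative s x) (at x)"
    "\<And>x. x \<le> 0 \<Longrightarrow> \<sigma> x = 0" "\<And>x. 1 \<le> x \<Longrightarrow> \<sigma> x = 1" "\<And>x. 0 \<le> \<sigma> x" "\<And>x. \<sigma> x \<le> 1"
    "\<And>x. x \<notin> {0<..<1} \<Longrightarrow> s x = 0"
    "\<And>x. (P has_real_derivative (s x)\<^sup>2) (at x)" "P 1 - P 0 \<le> 1 + e"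
proof -
  \<comment> \<open>With \<open>k = d^3\<close> the bump is at least
    \<open>exp (-d) \<ge> 1 - d\<close> on \<open>[d, 1 - d]\<close>, so its integral
    \<open>c\<close> is at least \<open>(1 - 2 d) (1 - d) \<ge> 1 - 3 d\<close>; the bound on
    \<open>d\<close> turns this into \<open>c \<ge> 1 / (1 + e)\<close>.\<close>
  define d where "d = min (1/8) (e / (8 * (1 + e)))"
  have d: "0 < d" "d \<le> 1/8" "d \<le> e / (8 * (1 + e))" using e by (auto simp: d_def)
  define k where "k = d * d * d"
  have k: "0 < k" using d by (simp add: k_def)
  define b where "b x = flat_exp 0 (x * (1 - x) / k)" for x
  have fl: "0 \<le> flat_exp 0 y" "flat_exp 0 y \<le> 1" for y by (auto simp: flat_exp_def)
  have b01: "0 \<le> b x" "b x \<le> 1" for x using fl by (auto simp: b_def)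
  have b0: "b x = 0" if "x \<notin> {0<..<1}" for x
  proof -
    have "x * (1 - x) \<le> 0" using that by (auto simp: mult_le_0_iff)
    then have "x * (1 - x) / k \<le> 0" using k by (simp add: divide_nonpos_pos)
    then show ?thesis by (simp add: b_def flat_exp_def)
  qed
  have bs: "smooth_on UNIV b"
  proof -
    have lin: "bounded_linear (\<lambda>x::real. x)" by (rule bounded_linear_ident)
    have "smooth_on UNIV (\<lambda>x::real. x * (1 - x) * (1 / k))"
      by (intro smooth_on_mult smooth_on_diff smooth_on_const smooth_on_linear[OF _ lin]) auto
    then have "smooth_on UNIV (\<lambda>x. flat_exp 0 (x * (1 - x) * (1 / k)))"
      by (intro smooth_on_compose[OF open_UNIV open_UNIV smooth_on_flat_exp]) auto
    then show ?thesis by (simp add: b_def[abs_def])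
  qed
  have bc: "continuous_on S b" for S
    using bs Ck_on.simps(1)[of UNIV b] continuous_on_subset[of UNIV b S] unfolding smooth_on_def by blast
  have antideriv: "\<exists>F. \<forall>x::real. (F has_real_derivative f x) (at x)" if f: "continuous_on UNIV f" for f :: "real \<Rightarrow> real"
  proof -
    have "isCont f x" for x using f by (simp add: continuous_on_eq_continuous_at)
    then have "\<exists>F. \<forall>x::real. -\<infinity> < ereal x \<longrightarrow> ereal x < \<infinity> \<longrightarrow> (F has_vector_derivative f x) (at x)"
      by (intro einterval_antiderivative) auto
    then show ?thesis by (simp add: has_real_derivative_iff_has_vector_derivative)
  qed
  obtain F where F: "\<And>x. (F has_real_derivative b x) (at x)" using antideriv[OF bc] by blast
  define c where "c = F 1 - F 0"
  have c: "1 / (1 + e) \<le> c"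
  proof -
    have mono: "F x \<le> F y" if "x \<le> y" for x y
      using F b01 that by (intro DERIV_nonneg_imp_nondecreasing[of x y F]) blast+
    have "\<exists>z. d < z \<and> z < 1 - d \<and> F (1 - d) - F d = (1 - d - d) * b z"
      using F d by (intro MVT2) auto
    then obtain z where z: "d < z" "z < 1 - d" "F (1 - d) - F d = (1 - d - d) * b z" by blast
    have "d * d \<le> z * (1 - z)" using z d by (intro mult_mono) auto
    then have dz: "1 / d \<le> z * (1 - z) / k" using d k by (simp add: k_def field_simps)
    have i: "inverse (z * (1 - z) / k) \<le> d"
    proof -
      have "inverse (z * (1 - z) / k) \<le> inverse (1 / d)" using dz d by (intro le_imp_inverse_le) auto
      then show ?thesis by (simp only: inverse_divide div_by_1)
    qed
    have "0 < 1 / d" using d by simp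
    then have pz: "0 < z * (1 - z) / k" using dz by linarith
    have "1 - d \<le> exp (- d)" using exp_ge_add_one_self[of "-d"] by simp
    also have "\<dots> \<le> b z" using i pz by (simp add: b_def flat_exp_def)
    finally have "(1 - d - d) * (1 - d) \<le> F (1 - d) - F d" unfolding z(3) using d by (intro mult_left_mono) auto
    moreover have "F (1 - d) - F d \<le> c" using mono[of 0 d] mono[of "1 - d" 1] d by (auto simp: c_def)
    moreover have "1 - 3 * d \<le> (1 - d - d) * (1 - d)" using d by (simp add: algebra_simps)
    moreover have "1 / (1 + e) \<le> 1 - 3 * d"
    proof -
      have "3 * d \<le> e / (1 + e)" using d(3) e by (simp add: field_simps)
      moreover have "1 / (1 + e) = 1 - e / (1 + e)" using e by (simp add: field_simps)
      ultimately show ?thesis by simp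
    qed
    ultimately show ?thesis by linarith
  qed
  have c0: "0 < c" using c e by (smt (verit) divide_pos_pos)
  have ic: "1 / c \<le> 1 + e" using c c0 e by (simp add: field_simps)
  define s where "s x = b x / c" for x
  define \<sigma> where "\<sigma> x = (F x - F 0) / c" for x
  have \<sigma>d: "(\<sigma> has_real_derivative s x) (at x)" for x
    unfolding \<sigma>_def s_def by (intro DERIV_cdivide) (auto intro!: derivative_eq_intros F)
  have sc: "continuous_on UNIV s" unfolding s_def using c0 by (intro continuous_intros bc) auto
  obtain P where P: "\<And>x. (P has_real_derivative (s x)\<^sup>2) (at x)"
    using antideriv[of "\<lambda>x. (s x)\<^sup>2"] sc by (auto intro: continuous_intros)
  have s01: "0 \<le> s x" for x using b01 c0 by (simp add: s_def)
  have \<sigma>mono: "\<sigma> x \<le> \<sigma> y" if "x \<le> y" for x y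
    using \<sigma>d s01 that by (intro DERIV_nonneg_imp_nondecreasing[of x y \<sigma>]) blast+
  have const: "\<sigma> x = \<sigma> y" if "x \<le> y" "\<And>z. x < z \<Longrightarrow> z < y \<Longrightarrow> s z = 0" for x y
  proof (cases "x = y")
    case False
    then have "\<exists>z. x < z \<and> z < y \<and> \<sigma> y - \<sigma> x = (y - x) * s z" using that(1) \<sigma>d by (intro MVT2) auto
    then show ?thesis using that(2) by auto
  qed simp
  have s0: "s x = 0" if "x \<notin> {0<..<1}" for x using b0[OF that] by (simp add: s_def)
  have z0: "\<sigma> 0 = 0" and z1: "\<sigma> 1 = 1" using c0 by (auto simp: \<sigma>_def c_def)
  have le0: "\<sigma> x = 0" if "x \<le> 0" for x using const[of x 0] that s0 z0 by auto
  have ge1: "\<sigma> x = 1" if "1 \<le> x" for x using const[of 1 x] that s0 z1 by auto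
  show ?thesis
  proof (rule that)
    show "smooth_on UNIV \<sigma>"
    proof (rule smooth_on_real_derivI[OF open_UNIV \<sigma>d])
      have "smooth_on UNIV (\<lambda>x. b x * (1 / c))" by (intro smooth_on_mult smooth_on_const bs open_UNIV)
      then show "smooth_on UNIV s" by (simp add: s_def[abs_def])
    qed
    show "0 \<le> \<sigma> x" for x using le0[of x] \<sigma>mono[of 0 x] z0 by (cases "x \<le> 0") auto
    show "\<sigma> x \<le> 1" for x using ge1[of x] \<sigma>mono[of x 1] z1 by (cases "1 \<le> x") auto
    \<comment> \<open>Since \<open>s \<le> 1 / c\<close> and \<open>s\<close> has integral 1, the
      integral of \<open>s^2\<close> is at most \<open>1 / c\<close>.\<close>
    have "(P 1 - (1 / c) * \<sigma> 1) \<le> (P 0 - (1 / c) * \<sigma> 0)"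
    proof (rule DERIV_nonpos_imp_nonincreasing[of 0 1 "\<lambda>x. P x - (1 / c) * \<sigma> x"])
      fix x :: real
      have "((\<lambda>x. P x - (1 / c) * \<sigma> x) has_real_derivative (s x)\<^sup>2 - (1 / c) * s x) (at x)"
        by (intro DERIV_diff P DERIV_cmult \<sigma>d)
      moreover have "s x \<le> 1 / c" using b01(2)[of x] c0 by (simp add: s_def divide_right_mono)
      then have "(s x)\<^sup>2 - (1 / c) * s x \<le> 0" using s01[of x] mult_right_mono[of "s x" "1 / c" "s x"] by (simp add: power2_eq_square)
      ultimately show "\<exists>y. ((\<lambda>x. P x - (1 / c) * \<sigma> x) has_real_derivative y) (at x) \<and> y \<le> 0" by blast
    qed simp
    then show "P 1 - P 0 \<le> 1 + e" using z0 z1 ic by simp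
  qed ((rule \<sigma>d sc P | (rule le0 ge1 s0, assumption))+)
qed

section \<open>Radial profiles assembled from smooth steps\<close>

text \<open>\<open>P\<close> is an antiderivative of \<open>s^2\<close>, so \<open>P 1 - P 0\<close>
  is the energy of the step; a linear step would have energy 1.\<close>

locale smooth_step =
  fixes \<sigma> s P :: "real \<Rightarrow> real"
  assumes smooth_\<sigma>: "smooth_on UNIV \<sigma>" and cont_s: "continuous_on UNIV s"
    and deriv_\<sigma>: "\<And>x. (\<sigma> has_real_derivative s x) (at x)"
    and \<sigma>_0: "\<And>x. x \<le> 0 \<Longrightarrow> \<sigma> x = 0" and \<sigma>_1: "\<And>x. 1 \<le> x \<Longrightarrow> \<sigma> x = 1"
    and \<sigma>_nonneg: "\<And>x. 0 \<le> \<sigma> x" and \<sigma>_le_1: "\<And>x. \<sigma> x \<le> 1"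
    and s_0: "\<And>x. x \<notin> {0<..<1} \<Longrightarrow> s x = 0"
    and deriv_P: "\<And>x. (P has_real_derivative (s x)\<^sup>2) (at x)"
begin

text \<open>In the variable \<open>t = v powr (- r)\<close> the weight is the length element, and
  the integral is the energy of one step stretched over \<open>[a, b]\<close>. For
  \<open>r = (n - 2) / n\<close> and \<open>v\<close> the volume of a ball, \<open>t\<close> is a
  multiple of \<open>|z|^(2-n)\<close>, the harmonic coordinate.\<close>

lemma bump_integral:
  assumes ab: "0 < a" "a < b" and r: "0 < r"
  shows "has_bochner_integral lborel (\<lambda>v. indicator {0..} v * ((s ((v powr (- r) - a) / (b - a)))\<^sup>2 * (r * v powr (- r - 1))))
    ((b - a) * (P 1 - P 0))"
proof -
  define va where "va = a powr (- (1 / r))"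
  define vb where "vb = b powr (- (1 / r))"
  have v0: "0 < vb" "vb < va" using ab r by (auto simp: va_def vb_def intro!: powr_less_mono2_neg)
  have A: "va powr (- r) = a" "vb powr (- r) = b" using ab r by (auto simp: va_def vb_def powr_powr)
  let ?f = "\<lambda>v. (s ((v powr (- r) - a) / (b - a)))\<^sup>2 * (r * v powr (- r - 1))"
  have zero: "?f v = 0" if "0 \<le> v" "v \<notin> {vb..va}" for v
  proof (cases "v = 0")
    case False
    then have v: "0 < v" using that by simp
    have "v powr (- r) \<le> a \<or> b \<le> v powr (- r)"
      using that(2) powr_mono2'[of "- r" v vb] powr_mono2'[of "- r" va v] v v0 r A by auto
    then have "(v powr (- r) - a) / (b - a) \<le> 0 \<or> 1 \<le> (v powr (- r) - a) / (b - a)"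
      using ab by (auto simp: divide_nonpos_pos)
    then show ?thesis using s_0 by fastforce
  qed (use r in simp)
  have hi: "(?f has_integral (- (b - a) * P ((va powr (- r) - a) / (b - a))) - (- (b - a) * P ((vb powr (- r) - a) / (b - a)))) {vb..va}"
  proof (rule fundamental_theorem_of_calculus)
    fix v assume v: "v \<in> {vb..va}"
    then have "0 < v" using v0 by simp
    have "((\<lambda>v. - (b - a) * P ((v powr (- r) - a) / (b - a))) has_real_derivative ?f v) (at v)"
    proof -
      have "((\<lambda>v. (v powr (- r) - a) / (b - a)) has_real_derivative (- r * v powr (- r - 1)) / (b - a)) (at v)"
        using \<open>0 < v\<close> by (intro DERIV_cdivide) (auto intro!: derivative_eq_intros)
      note D = DERIV_cmult[OF DERIV_chain2[OF deriv_P this], of "- (b - a)"]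
      have "- d * (x * ((- r * y) / d)) = x * (r * y)" if "d \<noteq> 0" for d x y :: real using that by simp
      from DERIV_cong[OF D this] show ?thesis using ab by simp
    qed
    then show "((\<lambda>v. - (b - a) * P ((v powr (- r) - a) / (b - a))) has_vector_derivative ?f v) (at v within {vb..va})"
      by (simp add: has_real_derivative_iff_has_vector_derivative has_vector_derivative_at_within)
  qed (use v0 in auto)
  have [measurable]: "s \<in> borel_measurable borel" using cont_s by (rule borel_measurable_continuous_onI)
  have P01: "0 \<le> P 1 - P 0"
    using DERIV_nonneg_imp_nondecreasing[of 0 1 P] deriv_P by (metis diff_ge_0_iff_ge zero_le_one zero_le_power2)
  show ?thesis
  proof (rule has_bochner_integral_nn_integral)
    have "(\<integral>\<^sup>+v. ennreal (indicator {vb..va} v * ?f v) \<partial>lborel)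
       = ennreal ((- (b - a) * P ((va powr (- r) - a) / (b - a))) - (- (b - a) * P ((vb powr (- r) - a) / (b - a))))"
      by (rule nn_integral_has_integral_lebesgue[OF _ hi]) (use r in auto)
    also have "(- (b - a) * P ((va powr (- r) - a) / (b - a))) - (- (b - a) * P ((vb powr (- r) - a) / (b - a))) = (b - a) * (P 1 - P 0)"
      using A ab by (simp add: algebra_simps)
    also have "(\<integral>\<^sup>+v. ennreal (indicator {vb..va} v * ?f v) \<partial>lborel) = (\<integral>\<^sup>+v. ennreal (indicator {0..} v * ?f v) \<partial>lborel)"
    proof (rule nn_integral_cong)
      fix v show "ennreal (indicator {vb..va} v * ?f v) = ennreal (indicator {0..} v * ?f v)"
        using zero[of v] v0 by (auto simp: indicator_def)
    qed
    finally show "(\<integral>\<^sup>+v. ennreal (indicator {0..} v * ?f v) \<partial>lborel) = ennreal ((b - a) * (P 1 - P 0))" .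
  qed (use ab P01 r in \<open>auto intro!: AE_I2\<close>)
qed

lemma bump_disjoint:
  assumes "b \<le> a'" "a < b" "a' < b'"
  shows "s ((t - a) / (b - a)) * s ((t - a') / (b' - a')) = 0"
proof (cases "t \<le> a'")
  case True
  then have "(t - a') / (b' - a') \<le> 0" using assms by (simp add: divide_nonpos_pos)
  then show ?thesis by (simp add: s_0)
next
  case False
  then have "1 \<le> (t - a) / (b - a)" using assms by simp
  then show ?thesis by (simp add: s_0)
qed

lemma sum_power2_orthogonal:
  fixes f :: "nat \<Rightarrow> real"
  assumes "\<And>i j. i < j \<Longrightarrow> j < m \<Longrightarrow> f i * f j = 0"
  shows "(\<Sum>i<m. f i)\<^sup>2 = (\<Sum>i<m. (f i)\<^sup>2)"
  using assms
proof (induction m)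
  case (Suc m)
  have "(\<Sum>i<m. f i) * f m = 0" unfolding sum_distrib_right using Suc.prems by (intro sum.neutral ballI) auto
  moreover have "(\<Sum>i<m. f i)\<^sup>2 = (\<Sum>i<m. (f i)\<^sup>2)" using Suc.prems by (intro Suc.IH) auto
  ultimately show ?case by (simp add: power2_sum mult.assoc)
qed simp

text \<open>With nearly linear steps on disjoint intervals this approximates a piecewise linear
  function of the harmonic coordinate; a negative height makes the profile come down again.\<close>

definition bumps :: "nat \<Rightarrow> (nat \<Rightarrow> real) \<Rightarrow> (nat \<Rightarrow> real) \<Rightarrow> (nat \<Rightarrow> real) \<Rightarrow> real \<Rightarrow> real" where
  "bumps m c a b t = (\<Sum>j<m. c j * \<sigma> ((t - a j) / (b j - a j)))"

definition bumps' :: "nat \<Rightarrow> (nat \<Rightarrow> real) \<Rightarrow> (nat \<Rightarrow> real) \<Rightarrow> (nat \<Rightarrow> real) \<Rightarrow> real \<Rightarrow> real" where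
  "bumps' m c a b t = (\<Sum>j<m. c j / (b j - a j) * s ((t - a j) / (b j - a j)))"

lemma smooth_bumps: "smooth_on UNIV (bumps m c a b)"
proof -
  have "smooth_on UNIV (\<lambda>t. (t - a j) * (1 / (b j - a j)))" for j
    by (intro smooth_on_mult smooth_on_diff smooth_on_const smooth_on_linear bounded_linear_ident open_UNIV)
  then have "smooth_on UNIV (\<lambda>t. (t - a j) / (b j - a j))" for j by simp
  then have "smooth_on UNIV (\<lambda>t. \<Sum>j<m. c j * \<sigma> ((t - a j) / (b j - a j)))"
    by (intro smooth_on_sum smooth_on_mult smooth_on_const smooth_on_compose[OF open_UNIV open_UNIV smooth_\<sigma>] open_UNIV) auto
  then show ?thesis by (simp add: bumps_def[abs_def])
qed

lemma deriv_bumps: "(bumps m c a b has_real_derivative bumps' m c a b t) (at t)"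
proof -
  have "((\<lambda>t. \<Sum>j<m. c j * \<sigma> ((t - a j) / (b j - a j))) has_real_derivative (\<Sum>j<m. c j * (s ((t - a j) / (b j - a j)) * (1 / (b j - a j))))) (at t)"
    by (intro DERIV_sum DERIV_cmult DERIV_chain2[OF deriv_\<sigma>]) (auto intro!: derivative_eq_intros DERIV_cdivide)
  then show ?thesis by (simp add: bumps_def[abs_def] bumps'_def mult_ac)
qed

lemma cont_bumps': "continuous_on UNIV (bumps' m c a b)"
  unfolding bumps'_def divide_inverse
  by (intro continuous_intros continuous_on_compose2[OF cont_s]) auto

text \<open>The steps have disjoint ranges, so the cross terms vanish. A linear rise by
  \<open>c\<close> over \<open>[a, b]\<close> has energy \<open>c^2 / (b - a)\<close>; the factor
  \<open>P 1 - P 0\<close> is the price of smoothing.\<close>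

lemma bumps_energy:
  assumes ab: "\<And>j. j < m \<Longrightarrow> 0 < a j \<and> a j < b j" and ord: "\<And>i j. i < j \<Longrightarrow> j < m \<Longrightarrow> b i \<le> a j" and r: "0 < r"
  shows "has_bochner_integral lborel (\<lambda>v. indicator {0..} v * ((bumps' m c a b (v powr (- r)))\<^sup>2 * (r * v powr (- r - 1))))
    ((\<Sum>j<m. (c j)\<^sup>2 / (b j - a j)) * (P 1 - P 0))"
proof -
  let ?B = "\<lambda>j v. indicator {0..} v * ((s ((v powr (- r) - a j) / (b j - a j)))\<^sup>2 * (r * v powr (- r - 1)))"
  have "has_bochner_integral lborel (\<lambda>v. \<Sum>j<m. (c j / (b j - a j))\<^sup>2 * ?B j v) (\<Sum>j<m. (c j / (b j - a j))\<^sup>2 * ((b j - a j) * (P 1 - P 0)))"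
    using ab r by (intro has_bochner_integral_sum has_bochner_integral_mult_right bump_integral) auto
  moreover have "(\<Sum>j<m. (c j / (b j - a j))\<^sup>2 * ?B j v) = indicator {0..} v * ((bumps' m c a b (v powr (- r)))\<^sup>2 * (r * v powr (- r - 1)))" for v
  proof -
    have "(bumps' m c a b t)\<^sup>2 = (\<Sum>j<m. (c j / (b j - a j) * s ((t - a j) / (b j - a j)))\<^sup>2)" for t
      unfolding bumps'_def
    proof (rule sum_power2_orthogonal)
      fix i j assume "i < j" "j < m"
      then show "c i / (b i - a i) * s ((t - a i) / (b i - a i)) * (c j / (b j - a j) * s ((t - a j) / (b j - a j))) = 0"
        using bump_disjoint[of "b i" "a j" "a i" "b j" t] ab[of i] ab[of j] ord[of i j] by auto
    qed
    then show ?thesis by (simp add: sum_distrib_left sum_distrib_right power_mult_distrib power_divide mult_ac)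
  qed
  moreover have "(\<Sum>j<m. (c j / (b j - a j))\<^sup>2 * ((b j - a j) * (P 1 - P 0))) = (\<Sum>j<m. (c j)\<^sup>2 / (b j - a j)) * (P 1 - P 0)"
    unfolding sum_distrib_right
  proof (intro sum.cong refl)
    fix j assume "j \<in> {..<m}"
    then have "b j - a j \<noteq> 0" using ab[of j] by auto
    then show "(c j / (b j - a j))\<^sup>2 * ((b j - a j) * (P 1 - P 0)) = (c j)\<^sup>2 / (b j - a j) * (P 1 - P 0)"
      by (simp add: power2_eq_square)
  qed
  ultimately show ?thesis by simp
qed

end

text \<open>Written through \<open>q = |z|^2\<close> the function is smooth at the origin too,
  because the profile vanishes for large \<open>t\<close>. The constant in the gradient identity is
  the one of \<open>slab_energy_ge\<close>: a profile linear in \<open>t\<close> attains the lower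
  bound for the energy between two level sets.\<close>

lemma radial_profile:
  fixes Y Y' :: "real \<Rightarrow> real" and l0 l1 :: real
  assumes Y: "smooth_on UNIV Y" "\<And>t. (Y has_real_derivative Y' t) (at t)" "continuous_on UNIV Y'"
    and supp: "0 < l0" "l0 < l1" "\<forall>t. t \<notin> {l0..l1} \<longrightarrow> Y t = 0"
    and dim: "3 \<le> DIM('a::euclidean_space)"
  defines "n \<equiv> real DIM('a)"
  defines "r \<equiv> (n - 2) / n"
  shows "\<exists>G G' Q1 Q2. smooth_on UNIV G \<and> (\<forall>q. (G has_real_derivative G' q) (at q)) \<and> continuous_on UNIV G' \<and>
     0 < Q1 \<and> Q1 < Q2 \<and> (\<forall>q. q \<notin> {Q1..Q2} \<longrightarrow> G q = 0) \<and>
     (\<forall>z::'a. z \<noteq> 0 \<longrightarrow> G ((norm z)\<^sup>2) = Y (ball_vol z powr (- r)) \<and>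
       (norm ((2 * G' ((norm z)\<^sup>2)) *\<^sub>R z))\<^sup>2 = (iso_const TYPE('a))\<^sup>2 * r * ((Y' (ball_vol z powr (- r)))\<^sup>2 * (r * ball_vol z powr (- r - 1))))"
proof -
  define w where "w = unit_ball_vol (real DIM('a))"
  have w: "0 < w" by (simp add: w_def)
  have n: "3 \<le> n" using dim by (simp add: n_def)
  have r: "0 < r" using n by (simp add: r_def)
  define h where "h = (n - 2) / 2"
  have h: "0 < h" using n by (simp add: h_def)
  \<comment> \<open>\<open>k\<close> and \<open>h\<close> convert the profile variable:
    \<open>ball_vol z powr (- r)\<close> equals \<open>k * q powr (- h)\<close> at
    \<open>q = |z|^2\<close>.\<close>
  define k where "k = w powr (- r)"
  have k: "0 < k" using w by (simp add: k_def)
  define G where "G q = (if 0 < q then Y (k * q powr (- h)) else 0)" for q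
  define G' where "G' q = (if 0 < q then Y' (k * q powr (- h)) * (k * (- h * q powr (- h - 1))) else 0)" for q
  define Q1 where "Q1 = (l1 / k) powr (- (1 / h))"
  define Q2 where "Q2 = (l0 / k) powr (- (1 / h))"
  have Q: "0 < Q1" "Q1 < Q2" using supp k h by (auto simp: Q1_def Q2_def divide_strict_right_mono intro!: powr_less_mono2_neg)
  have kQ: "k * Q1 powr (- h) = l1" "k * Q2 powr (- h) = l0" using supp k h by (auto simp: Q1_def Q2_def powr_powr)
  have G0: "G q = 0" if "q \<notin> {Q1..Q2}" for q
  proof (cases "0 < q")
    case True
    have "k * q powr (- h) \<notin> {l0..l1}"
      using that True Q h k kQ powr_less_mono2_neg[of "- h" q Q1] powr_less_mono2_neg[of "- h" Q2 q]
        mult_strict_left_mono[of "Q1 powr (- h)" "q powr (- h)" k] mult_strict_left_mono[of "q powr (- h)" "Q2 powr (- h)" k]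
      by auto
    then show ?thesis using supp(3)[rule_format] by (simp add: G_def)
  qed (simp add: G_def)
  \<comment> \<open>Below \<open>Q1\<close> the function is identically zero, so the two open
    half-lines cover the real line by pieces on which smoothness is clear.\<close>
  have Uni: "{0<..} \<union> {..<Q1} = (UNIV :: real set)" using Q by auto
  have "smooth_on ({0<..} \<union> {..<Q1}) G"
  proof (rule smooth_on_Un)
    have "smooth_on {0<..} (\<lambda>q. Y (k * q powr (- h)))"
      by (intro smooth_on_compose[OF _ open_UNIV Y(1)] smooth_on_mult smooth_on_const smooth_on_powr) auto
    then show "smooth_on {0<..} G" using smooth_on_cong[of "{0<..}" G "\<lambda>q. Y (k * q powr (- h))"] by (simp add: G_def)
    have "\<And>q. q \<in> {..<Q1} \<Longrightarrow> G q = 0" using G0 by auto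
    then show "smooth_on {..<Q1} G" using smooth_on_cong[of "{..<Q1}" G "\<lambda>_. 0"] smooth_on_const[of "{..<Q1}" 0] by simp
  qed auto
  then have sG: "smooth_on UNIV G" unfolding Uni .
  have dG1: "(G has_real_derivative G' q) (at q)" if q: "0 < q" for q
  proof -
    have "((\<lambda>q. Y (k * q powr (- h))) has_real_derivative G' q) (at q)"
    proof -
      have "((\<lambda>q. k * q powr (- h)) has_real_derivative k * (- h * q powr (- h - 1))) (at q)"
        using q by (intro DERIV_cmult) (auto intro!: derivative_eq_intros)
      from DERIV_chain2[OF Y(2) this] show ?thesis using q by (simp add: G'_def)
    qed
    then show ?thesis
      by (rule has_field_derivative_transform_within_open[of _ _ _ "{0<..}"]) (use q in \<open>auto simp: G_def\<close>)
  qed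
  have dG2: "(G has_real_derivative 0) (at q)" if q: "q < Q1" for q
    by (rule has_field_derivative_transform_within_open[of "\<lambda>_. 0" _ _ "{..<Q1}"]) (use q G0 in auto)
  have G'0: "G' q = 0" if "q < Q1" for q
  proof (cases "0 < q")
    case True show ?thesis by (rule DERIV_unique[OF dG1[OF True] dG2[OF that]])
  qed (simp add: G'_def)
  have dG: "(G has_real_derivative G' q) (at q)" for q using dG1[of q] dG2[of q] G'0[of q] Q by (cases "0 < q") auto
  have "continuous_on ({0<..} \<union> {..<Q1}) G'"
  proof (rule continuous_on_open_Un)
    have "continuous_on {0<..} (\<lambda>q. Y' (k * q powr (- h)) * (k * (- h * q powr (- h - 1))))"
      by (intro continuous_intros continuous_on_compose2[OF Y(3)]) auto
    then show "continuous_on {0<..} G'" by (rule continuous_on_eq) (auto simp: G'_def)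
    show "continuous_on {..<Q1} G'" by (rule continuous_on_eq[of _ "\<lambda>_. 0"]) (auto simp: G'0)
  qed auto
  then have cG': "continuous_on UNIV G'" unfolding Uni .
  have z: "G ((norm z)\<^sup>2) = Y (ball_vol z powr (- r)) \<and>
       (norm ((2 * G' ((norm z)\<^sup>2)) *\<^sub>R z))\<^sup>2 = (iso_const TYPE('a))\<^sup>2 * r * ((Y' (ball_vol z powr (- r)))\<^sup>2 * (r * ball_vol z powr (- r - 1)))"
    if z0: "z \<noteq> 0" for z :: 'a
  proof -
    define R where "R = norm z"
    have R: "0 < R" using z0 by (simp add: R_def)
    have q: "R\<^sup>2 = R powr 2" using R by simp
    have bv: "ball_vol z = w * R powr n" using R by (simp add: ball_vol_def w_def R_def n_def powr_realpow)
    have nr: "n * r = n - 2" using n by (simp add: r_def)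
    have e1: "ball_vol z powr (- r) = k * (R\<^sup>2) powr (- h)"
    proof -
      have "n * r = 2 * h" by (simp add: nr h_def)
      then show ?thesis using w R by (simp add: bv powr_mult powr_powr k_def q del: powr_numeral)
    qed
    have e2: "(2 * (k * (h * (R\<^sup>2) powr (- h - 1))))\<^sup>2 * R\<^sup>2 = (iso_const TYPE('a))\<^sup>2 * r * (r * ball_vol z powr (- r - 1))"
    proof -
      have nh: "2 * h = n - 2" by (simp add: h_def)
      have "((R\<^sup>2) powr (- h - 1))\<^sup>2 * R\<^sup>2 = R powr (2 * (- h - 1)) * R powr (2 * (- h - 1)) * R powr 2"
        unfolding q by (simp only: powr_powr power2_eq_square)
      also have "\<dots> = R powr (n * (- r - 1))"
      proof -
        have "2 * (- h - 1) + 2 * (- h - 1) + 2 = n * (- r - 1)" using nh nr by (simp add: algebra_simps)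
        then show ?thesis by (simp only: powr_add[symmetric])
      qed
      finally have R1: "((R\<^sup>2) powr (- h - 1))\<^sup>2 * R\<^sup>2 = R powr (n * (- r - 1))" .
      have c: "(iso_const TYPE('a))\<^sup>2 = n\<^sup>2 * (w powr (1 / n) * w powr (1 / n))"
        by (simp add: iso_const_def n_def w_def power2_eq_square)
      have b: "ball_vol z powr (- r - 1) = w powr (- r - 1) * R powr (n * (- r - 1))"
        using w R by (simp add: bv powr_mult powr_powr)
      have kk: "k * k = w powr (1 / n) * w powr (1 / n) * w powr (- r - 1)"
      proof -
        have "- r + - r = 1 / n + 1 / n + (- r - 1)" using n by (simp add: r_def field_simps)
        then show ?thesis unfolding k_def by (simp only: powr_add[symmetric])
      qed
      have "(2 * (k * (h * (R\<^sup>2) powr (- h - 1))))\<^sup>2 * R\<^sup>2 = (2 * h)\<^sup>2 * (k * k) * (((R\<^sup>2) powr (- h - 1))\<^sup>2 * R\<^sup>2)"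
        by (simp add: power2_eq_square mult_ac)
      also have "\<dots> = (n * r)\<^sup>2 * (k * k) * R powr (n * (- r - 1))" by (simp only: nh nr R1)
      also have "\<dots> = (iso_const TYPE('a))\<^sup>2 * r * (r * ball_vol z powr (- r - 1))"
        unfolding c b kk by (simp only: power2_eq_square mult_ac)
      finally show ?thesis .
    qed
    have "(norm ((2 * G' ((norm z)\<^sup>2)) *\<^sub>R z))\<^sup>2 = (2 * G' (R\<^sup>2))\<^sup>2 * R\<^sup>2"
      by (simp add: R_def power_mult_distrib)
    also have "\<dots> = (Y' (ball_vol z powr (- r)))\<^sup>2 * ((2 * (k * (h * (R\<^sup>2) powr (- h - 1))))\<^sup>2 * R\<^sup>2)"
      using R by (simp add: G'_def e1 power_mult_distrib mult_ac)
    also have "\<dots> = (iso_const TYPE('a))\<^sup>2 * r * ((Y' (ball_vol z powr (- r)))\<^sup>2 * (r * ball_vol z powr (- r - 1)))"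
      unfolding e2 by (simp add: mult_ac)
    finally show ?thesis using R by (simp add: G_def e1 R_def[symmetric])
  qed
  show ?thesis
    by (intro exI[of _ G] exI[of _ G'] exI[of _ Q1] exI[of _ Q2] conjI allI impI sG dG cG' Q G0 z[THEN conjunct1] z[THEN conjunct2])
qed

section \<open>Discrete rearrangement and nearly optimal radial competitors\<close>

lemma powr_add_le:
  fixes y d p :: real
  assumes "0 \<le> y" "0 < d" "1 \<le> p"
  shows "(y + d) powr p \<le> y powr p + d * p * (y + d) powr (p - 1)"
proof -
  have "continuous_on {y..y + d} (\<lambda>z. z powr p)"
    using assms by (intro continuous_on_powr' continuous_on_id continuous_on_const) auto
  moreover have "((\<lambda>z. z powr p) has_derivative (\<lambda>h. p * z powr (p - 1) * h)) (at z)" if "y < z" "z < y + d" for z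
    using that assms by (auto simp flip: has_field_derivative_def intro!: derivative_eq_intros)
  ultimately obtain z where z: "y < z" "z < y + d" "(y + d) powr p - y powr p = p * z powr (p - 1) * (y + d - y)"
    using assms(2) by (auto intro: mvt[of y "y + d" "\<lambda>z. z powr p" "\<lambda>z h. p * z powr (p - 1) * h"])
  have "z powr (p - 1) \<le> (y + d) powr (p - 1)" using z assms by (intro powr_mono2) auto
  then have "d * (p * z powr (p - 1)) \<le> d * (p * (y + d) powr (p - 1))" using assms by (intro mult_left_mono) auto
  then show ?thesis using z(3) by (simp add: mult_ac)
qed

text \<open>For nested sets, the indices of the sets containing a given point form an initial
  segment. Together with \<open>sum_prefix\<close> this collapses a staircase sum of increments to a
  single value.\<close>

lemma antitone_prefix:
  fixes M :: nat
  assumes "\<And>j. Q (Suc j) \<Longrightarrow> Q j"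
  shows "\<exists>i\<le>M. \<forall>j<M. Q j \<longleftrightarrow> j < i"
proof (induction M)
  case (Suc M)
  then obtain i where i: "i \<le> M" "\<And>j. j < M \<Longrightarrow> Q j \<longleftrightarrow> j < i" by blast
  show ?case
  proof (cases "Q M")
    case True
    have "Q j" if "j \<le> M" for j using that True
      by (induction rule: inc_induct) (auto intro: assms)
    then show ?thesis by (intro exI[of _ "Suc M"]) auto
  next
    case False
    then show ?thesis using i by (intro exI[of _ i]) (auto simp: less_Suc_eq)
  qed
qed simp

lemma sum_prefix:
  fixes \<phi> :: "nat \<Rightarrow> real"
  assumes "i \<le> M" "\<And>j. j < M \<Longrightarrow> Q j \<longleftrightarrow> j < i"
  shows "(\<Sum>j<M. (\<phi> (Suc j) - \<phi> j) * of_bool (Q j)) = \<phi> i - \<phi> 0"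
proof -
  have "(\<Sum>j<M. (\<phi> (Suc j) - \<phi> j) * of_bool (Q j)) = (\<Sum>j<i. \<phi> (Suc j) - \<phi> j)"
    using assms by (intro sum.mono_neutral_cong_right) auto
  then show ?thesis by (simp add: sum_lessThan_telescope)
qed

context compact_C1
begin

text \<open>Rearrangement of the weighted norm: the superlevel sets of \<open>u\<close> at the heights \<open>j \<delta>\<close> are replaced by centred balls of the same volume.\<close>

lemma weighted_norm_le_rearranged:
  assumes e: "- real DIM('a) < e" "e \<le> 0" and p: "1 \<le> p" and \<delta>: "0 < \<delta>"
    and m: "V (real (Suc m) * \<delta>) = 0"
  defines "v \<equiv> \<lambda>j. if j = 0 then measure lborel K else V (real j * \<delta>)"
  shows "(\<integral>x. norm x powr e * \<bar>u x\<bar> powr p \<partial>lborel)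
    \<le> (\<integral>t. radial_weight TYPE('a) e t * (\<Sum>j<Suc m. ((\<delta> * Suc j) powr p - (\<delta> * j) powr p) * indicator {0..v j} t) \<partial>lborel)"
    and "integrable lborel (\<lambda>t. radial_weight TYPE('a) e t * (\<Sum>j<Suc m. ((\<delta> * Suc j) powr p - (\<delta> * j) powr p) * indicator {0..v j} t))"
proof -
  define d where "d j = (\<delta> * Suc j) powr p - (\<delta> * j) powr p" for j :: nat
  have d: "0 \<le> d j" for j unfolding d_def using \<delta> p by (simp add: powr_mono2)
  \<comment> \<open>At index 0 the superlevel set would be the whole space, of infinite volume;
    \<open>K\<close> replaces it, as \<open>u\<close> vanishes elsewhere.\<close>
  define L where "L j = (if j = 0 then K else {x. real j * \<delta> \<le> \<bar>u x\<bar>})" for j :: nat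
  have Lf: "L j \<in> fmeasurable lborel" for j
    unfolding L_def using compact_K level_compact(1)[of "real j * \<delta>"] \<delta> by (auto intro: fmeasurable_compact)
  have [measurable]: "L j \<in> sets borel" for j using fmeasurableD[OF Lf[of j]] by simp
  have vL: "v j = measure lborel (L j)" for j by (simp add: v_def L_def V_def)
  have v0: "0 \<le> v j" for j by (simp add: vL)
  have Lanti: "x \<in> L (Suc j) \<Longrightarrow> x \<in> L j" for x j
    using level_compact(2)[of "real (Suc j) * \<delta>"] \<delta> by (auto simp: L_def algebra_simps)
  have null: "AE x in lborel. \<bar>u x\<bar> < real (Suc m) * \<delta>"
  proof -
    have t: "0 < real (Suc m) * \<delta>" using \<delta> by (intro mult_pos_pos) auto
    have "{x. real (Suc m) * \<delta> \<le> \<bar>u x\<bar>} \<in> null_sets lborel"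
      using level_compact(1)[OF t] m fmeasurable_compact[OF level_compact(1)[OF t]]
      by (auto simp: null_sets_def V_def emeasure_eq_measure2 intro: borel_compact)
    from AE_not_in[OF this] show ?thesis by (auto simp: not_le)
  qed
  have pw: "AE x in lborel. norm x powr e * \<bar>u x\<bar> powr p \<le> (\<Sum>j<Suc m. d j * (indicator (L j) x * norm x powr e))"
    using null
  proof eventually_elim
    case (elim x)
    obtain i where i: "i \<le> Suc m" "\<And>j. j < Suc m \<Longrightarrow> x \<in> L j \<longleftrightarrow> j < i"
      using antitone_prefix[of "\<lambda>j. x \<in> L j" "Suc m"] Lanti by blast
    have s: "(\<Sum>j<Suc m. d j * indicator (L j) x) = (\<delta> * i) powr p"
      using sum_prefix[OF i, of "\<lambda>j. (\<delta> * real j) powr p"] \<delta> p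
      by (simp add: d_def indicator_def[abs_def] del: sum.lessThan_Suc)
    have "\<bar>u x\<bar> \<le> \<delta> * i"
    proof (cases "i \<le> m")
      case True
      then have "x \<notin> L i" using i(2)[of i] by simp
      then have "\<bar>u x\<bar> < real i * \<delta> \<or> u x = 0" using u_0 by (auto simp: L_def split: if_splits)
      then show ?thesis using \<delta> by (auto simp: mult.commute)
    next
      case False
      then have "i = Suc m" using i(1) by simp
      then show ?thesis using elim by (simp add: mult.commute)
    qed
    then have "\<bar>u x\<bar> powr p \<le> (\<delta> * i) powr p" using p by (intro powr_mono2) auto
    then have "norm x powr e * \<bar>u x\<bar> powr p \<le> norm x powr e * (\<Sum>j<Suc m. d j * indicator (L j) x)"
      unfolding s by (intro mult_left_mono) auto
    also have "\<dots> = (\<Sum>j<Suc m. d j * (indicator (L j) x * norm x powr e))"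
      by (simp only: sum_distrib_left mult_ac)
    finally show ?case .
  qed
  have intR: "integrable lborel (\<lambda>x. \<Sum>j<Suc m. d j * (indicator (L j) x * norm x powr e))"
    using weight_rearrange(1)[OF e Lf] by (intro Bochner_Integration.integrable_sum integrable_mult_right)
  have "(\<integral>x. norm x powr e * \<bar>u x\<bar> powr p \<partial>lborel) \<le> (\<integral>x. (\<Sum>j<Suc m. d j * (indicator (L j) x * norm x powr e)) \<partial>lborel)"
  proof (rule integral_mono_AE[OF _ intR pw])
    show "integrable lborel (\<lambda>x. norm x powr e * \<bar>u x\<bar> powr p)"
      by (rule Bochner_Integration.integrable_bound[OF intR]) (use pw in \<open>auto elim!: eventually_mono simp del: sum.lessThan_Suc\<close>)
  qed
  also have "\<dots> = (\<Sum>j<Suc m. d j * (\<integral>x. indicator (L j) x * norm x powr e \<partial>lborel))"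
    using weight_rearrange(1)[OF e Lf] by (subst Bochner_Integration.integral_sum) (auto simp del: sum.lessThan_Suc)
  also have "\<dots> \<le> (\<Sum>j<Suc m. d j * (\<integral>t. indicator {0..v j} t * radial_weight TYPE('a) e t \<partial>lborel))"
    using weight_rearrange(2)[OF e Lf] d by (intro sum_mono mult_left_mono) (auto simp: vL)
  also have "\<dots> = (\<integral>t. (\<Sum>j<Suc m. d j * (indicator {0..v j} t * radial_weight TYPE('a) e t)) \<partial>lborel)"
    using weight_integral(1)[OF e v0] by (subst Bochner_Integration.integral_sum) (auto simp del: sum.lessThan_Suc)
  also have "\<dots> = (\<integral>t. radial_weight TYPE('a) e t * (\<Sum>j<Suc m. d j * indicator {0..v j} t) \<partial>lborel)"
    by (simp only: sum_distrib_left mult_ac)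
  finally show "(\<integral>x. norm x powr e * \<bar>u x\<bar> powr p \<partial>lborel)
    \<le> (\<integral>t. radial_weight TYPE('a) e t * (\<Sum>j<Suc m. ((\<delta> * Suc j) powr p - (\<delta> * j) powr p) * indicator {0..v j} t) \<partial>lborel)"
    by (simp only: d_def)
  have "integrable lborel (\<lambda>t. \<Sum>j<Suc m. d j * (indicator {0..v j} t * radial_weight TYPE('a) e t))"
    using weight_integral(1)[OF e v0] by (intro Bochner_Integration.integrable_sum integrable_mult_right)
  then show "integrable lborel (\<lambda>t. radial_weight TYPE('a) e t * (\<Sum>j<Suc m. ((\<delta> * Suc j) powr p - (\<delta> * j) powr p) * indicator {0..v j} t))"
    by (simp only: d_def sum_distrib_left mult_ac)
qed

lemma slab_energy_sum_le:
  assumes \<delta>: "0 < \<delta>"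
  shows "(\<Sum>j<k. \<integral>x. indicator {x. real (Suc j) * \<delta> \<le> \<bar>u x\<bar> \<and> \<bar>u x\<bar> < real (Suc (Suc j)) * \<delta>} x * (norm (g x))\<^sup>2 \<partial>lborel)
    \<le> (\<integral>x. (norm (g x))\<^sup>2 \<partial>lborel)"
proof -
  let ?S = "\<lambda>j. {x. real (Suc j) * \<delta> \<le> \<bar>u x\<bar> \<and> \<bar>u x\<bar> < real (Suc (Suc j)) * \<delta>}"
  have c: "continuous_on UNIV (\<lambda>x. (norm (g x))\<^sup>2)" by (intro continuous_intros cont_g)
  obtain L where L: "L > 0" "\<And>x. norm ((norm (g x))\<^sup>2) \<le> L" using compact_support_bounded[OF c] g_0 by auto
  have int: "integrable lborel (\<lambda>x. (norm (g x))\<^sup>2)"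
    using L g_0 by (intro integrable_bounded_on_K[of _ L]) auto
  have pos: "0 < real (Suc j) * \<delta>" for j using \<delta> by (intro mult_pos_pos) auto
  have ints: "integrable lborel (\<lambda>x. indicator (?S j) x * (norm (g x))\<^sup>2)" for j
    by (rule slab_integrable[OF c pos])
  have "(\<Sum>j<k. \<integral>x. indicator (?S j) x * (norm (g x))\<^sup>2 \<partial>lborel) = (\<integral>x. (\<Sum>j<k. indicator (?S j) x * (norm (g x))\<^sup>2) \<partial>lborel)"
    using ints by (subst Bochner_Integration.integral_sum) auto
  also have "\<dots> \<le> (\<integral>x. (norm (g x))\<^sup>2 \<partial>lborel)"
  proof (rule integral_mono)
    fix x
    have "(\<Sum>j<k. indicator (?S j) x) = (indicator {x. \<delta> \<le> \<bar>u x\<bar> \<and> \<bar>u x\<bar> < real (Suc k) * \<delta>} x :: real)"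
    proof (induction k)
      case (Suc k)
      have "\<delta> \<le> real (Suc k) * \<delta>" "real (Suc k) * \<delta> \<le> real (Suc (Suc k)) * \<delta>" using \<delta> by (auto simp: algebra_simps)
      then show ?case unfolding sum.lessThan_Suc Suc.IH by (auto simp: indicator_def simp del: of_nat_Suc)
    qed auto
    then have "(\<Sum>j<k. indicator (?S j) x) \<le> (1::real)" by (simp only: indicator_le_1)
    then have "(\<Sum>j<k. indicator (?S j) x) * (norm (g x))\<^sup>2 \<le> 1 * (norm (g x))\<^sup>2" by (rule mult_right_mono) simp
    then show "(\<Sum>j<k. indicator (?S j) x * (norm (g x))\<^sup>2) \<le> (norm (g x))\<^sup>2" by (simp add: sum_distrib_right)
  qed (rule Bochner_Integration.integrable_sum ints int)+
  finally show ?thesis .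
qed

text \<open>If every superlevel set at a positive level were null, \<open>u\<close> would vanish
  almost everywhere and so would the weighted integral.\<close>

lemma V_pos_exists:
  assumes "(\<integral>x. norm x powr e * \<bar>u x\<bar> powr p \<partial>lborel) \<noteq> 0"
  shows "\<exists>t>0. 0 < V t"
proof (rule ccontr)
  assume "\<not> ?thesis"
  then have V0: "V t = 0" if "0 < t" for t using V_nonneg[of t] that by force
  have "AE x in lborel. \<forall>k. \<bar>u x\<bar> < 1 / real (Suc k)"
    unfolding AE_all_countable
  proof
    fix k
    have t: "0 < 1 / real (Suc k)" by simp
    have "{x. 1 / real (Suc k) \<le> \<bar>u x\<bar>} \<in> null_sets lborel"
      using level_compact(1)[OF t] V0[OF t] fmeasurable_compact[OF level_compact(1)[OF t]]
      by (auto simp: null_sets_def V_def emeasure_eq_measure2 intro: borel_compact simp del: of_nat_Suc)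
    from AE_not_in[OF this] show "AE x in lborel. \<bar>u x\<bar> < 1 / real (Suc k)" by (simp add: not_le)
  qed
  then have "AE x in lborel. norm x powr e * \<bar>u x\<bar> powr p = 0"
  proof eventually_elim
    case (elim x)
    have "\<bar>u x\<bar> \<le> 0"
    proof (rule field_le_epsilon)
      fix d :: real assume "0 < d"
      then obtain k where "inverse (real (Suc k)) < d" using reals_Archimedean by blast
      then show "\<bar>u x\<bar> \<le> 0 + d" using elim[rule_format, of k] by (simp add: inverse_eq_divide)
    qed
    then show ?case by simp
  qed
  then have "(\<integral>x. norm x powr e * \<bar>u x\<bar> powr p \<partial>lborel) = (\<integral>x. 0 \<partial>(lborel :: 'a measure))"
    by (intro integral_cong_AE) auto
  then show False using assms by simp
qed

end

context compact_C1
begin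

text \<open>The competitor interpolates the rearrangement of \<open>u\<close>: between the volumes
  of consecutive superlevel sets it rises by \<open>\<delta>\<close>, almost linearly in
  \<open>t = volume powr (- r)\<close>. The slab estimate bounds the energy of each rise by that of
  \<open>u\<close> in the corresponding slab, up to the smoothing factor, and away from the origin
  the heights are too small by at most \<open>2 * \<delta>\<close>.\<close>

lemma radial_competitor_approx:
  assumes dim: "3 \<le> DIM('a)" and e: "- real DIM('a) < e" "e \<le> 0" and p: "1 \<le> p"
    and W0: "(\<integral>x. norm x powr e * \<bar>u x\<bar> powr p \<partial>lborel) \<noteq> 0" and \<eta>: "0 < \<eta>"
  shows "\<exists>G G' Q1 Q2. smooth_on UNIV G \<and> (\<forall>q. (G has_real_derivative G' q) (at q)) \<and> continuous_on UNIV G' \<and>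
     0 < Q1 \<and> Q1 < Q2 \<and> (\<forall>q. q \<notin> {Q1..Q2} \<longrightarrow> G q = 0) \<and>
     (\<integral>z. (norm ((2 * G' ((norm (z::'a))\<^sup>2)) *\<^sub>R z))\<^sup>2 \<partial>lborel) \<le> (1 + \<eta>) * ((\<integral>x. (norm (g x))\<^sup>2 \<partial>lborel) + \<eta>) \<and>
     (\<integral>x. norm x powr e * \<bar>u x\<bar> powr p \<partial>lborel) - \<eta> \<le> (\<integral>z. norm (z::'a) powr e * \<bar>G ((norm z)\<^sup>2)\<bar> powr p \<partial>lborel)"
proof -
  define n where "n = real DIM('a)"
  define r where "r = (n - 2) / n"
  have n: "3 \<le> n" using dim by (simp add: n_def)
  have r: "0 < r" using n by (simp add: r_def)
  define c where "c = iso_const TYPE('a)"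
  have c: "0 < c" unfolding c_def by (rule iso_const_pos)
  define E where "E = (\<integral>x. (norm (g x))\<^sup>2 \<partial>lborel)"
  define W where "W = (\<integral>x. norm x powr e * \<bar>u x\<bar> powr p \<partial>lborel)"
  define \<kappa> where "\<kappa> = radial_weight TYPE('a) e"
  have \<kappa>0: "0 \<le> \<kappa> t" for t unfolding \<kappa>_def by (rule weight_nonneg[OF e])
  have \<kappa>m[measurable]: "\<kappa> \<in> borel_measurable borel" unfolding \<kappa>_def by (rule weight_measurable[OF e])
  have \<kappa>int: "integrable lborel (\<lambda>t. indicator {0..b} t * \<kappa> t)" if "0 \<le> b" for b
    unfolding \<kappa>_def by (rule weight_integral(1)[OF e that])
  define J where "J b = (\<integral>t. indicator {0..b} t * \<kappa> t \<partial>lborel)" for b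
  obtain C1 r1 where C1: "0 \<le> C1" "0 < r1" "\<And>b. 0 \<le> b \<Longrightarrow> J b = C1 * b powr r1"
    using weight_integral(2)[OF e order_refl] unfolding J_def \<kappa>_def by blast
  define v0 where "v0 = measure lborel K"
  have v0: "0 \<le> v0" "0 \<le> J v0" using C1 by (auto simp: v0_def)
  obtain B where B: "0 < B" "\<And>x. \<bar>u x\<bar> \<le> B" using compact_support_bounded[OF cont_u u_0] by auto
  obtain \<sigma> s P where "smooth_on UNIV \<sigma>" "continuous_on UNIV s" "\<And>x. (\<sigma> has_real_derivative s x) (at x)"
    "\<And>x. x \<le> 0 \<Longrightarrow> \<sigma> x = 0" "\<And>x. 1 \<le> x \<Longrightarrow> \<sigma> x = 1" "\<And>x. 0 \<le> \<sigma> x" "\<And>x. \<sigma> x \<le> 1"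
    "\<And>x. x \<notin> {0<..<1} \<Longrightarrow> s x = 0"
    "\<And>x. (P has_real_derivative (s x)\<^sup>2) (at x)" and P: "P 1 - P 0 \<le> 1 + \<eta>"
    using smooth_step_exists[OF \<eta>] by metis
  then interpret smooth_step \<sigma> s P by unfold_locales
  obtain t0 where t0: "0 < t0" "0 < V t0" using V_pos_exists[OF W0] by blast
  \<comment> \<open>Raising heights by \<open>2 * \<delta>\<close> to values at most
    \<open>B + 1\<close> changes p-th powers by at most
    \<open>2 * \<delta> * p * (B + 1) powr (p - 1)\<close>. The choice
    \<open>\<delta> \<le> \<eta> / (2 * Z)\<close> makes this error, integrated against the weight
    over a ball of volume \<open>v0\<close>, at most \<open>\<eta> / 2\<close>.\<close>
  define Z where "Z = 2 * p * (B + 1) powr (p - 1) * J v0 + 1"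
  have Z: "0 < Z" using p v0 by (auto simp: Z_def intro!: add_nonneg_pos mult_nonneg_nonneg)
  define \<delta> where "\<delta> = min (min 1 t0) (\<eta> / (2 * Z))"
  have \<delta>: "0 < \<delta>" "\<delta> \<le> 1" "\<delta> \<le> t0" "\<delta> \<le> \<eta> / (2 * Z)" using t0 \<eta> Z by (auto simp: \<delta>_def)
  have \<delta>Z: "2 * \<delta> * p * (B + 1) powr (p - 1) * J v0 \<le> \<eta> / 2"
  proof -
    have "2 * \<delta> * p * (B + 1) powr (p - 1) * J v0 \<le> \<delta> * Z" using \<delta> by (simp add: Z_def algebra_simps)
    also have "\<dots> \<le> \<eta> / (2 * Z) * Z" using \<delta> Z by (intro mult_right_mono) auto
    finally show ?thesis using Z by simp
  qed
  have pos: "0 < real (Suc j) * \<delta>" for j using \<delta> by (intro mult_pos_pos) auto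
  define M where "M = {j. 0 < V (real (Suc j) * \<delta>)}"
  have M0: "0 \<in> M" using V_mono[of \<delta> t0] \<delta> t0 by (simp add: M_def)
  have Mle: "real (Suc j) * \<delta> \<le> B" if "j \<in> M" for j
  proof (rule ccontr)
    assume "\<not> ?thesis"
    then have "{x. real (Suc j) * \<delta> \<le> \<bar>u x\<bar>} = {}" using B(2) by (auto simp: not_le intro: le_less_trans)
    then show False using that by (simp add: M_def V_def)
  qed
  have "finite M"
  proof (rule finite_subset)
    show "M \<subseteq> {..nat \<lceil>B / \<delta>\<rceil>}"
    proof
      fix j assume "j \<in> M"
      then have "real (Suc j) \<le> B / \<delta>" using Mle \<delta> by (simp add: pos_le_divide_eq)
      then show "j \<in> {..nat \<lceil>B / \<delta>\<rceil>}" by (simp; linarith)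
    qed
  qed simp
  \<comment> \<open>The level \<open>(k + 1) * \<delta>\<close> is the highest multiple of
    \<open>\<delta>\<close> whose superlevel set has positive volume. Up to it the coordinates
    \<open>a j\<close> are powers of positive volumes; one level higher the volume is zero.\<close>
  define k where "k = Max M"
  have kM: "k \<in> M" unfolding k_def using \<open>finite M\<close> M0 by (intro Max_in) auto
  have "Suc k \<notin> M" using Max_ge[OF \<open>finite M\<close>, of "Suc k"] by (auto simp: k_def)
  then have Vm: "V (real (Suc (Suc k)) * \<delta>) = 0" using V_nonneg[of "real (Suc (Suc k)) * \<delta>"] by (simp add: M_def)
  have kB: "real (Suc k) * \<delta> \<le> B" using Mle[OF kM] .
  have Vpos: "0 < V (real (Suc j) * \<delta>)" if "j \<le> k" for j
  proof -
    have "real (Suc j) * \<delta> \<le> real (Suc k) * \<delta>" using that \<delta> by (intro mult_right_mono) auto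
    from V_mono[OF pos this] show ?thesis using kM by (simp add: M_def)
  qed
  define a where "a j = V (real (Suc j) * \<delta>) powr (- r)" for j
  have a0: "0 < a j" if "j \<le> k" for j using Vpos[OF that] by (simp add: a_def)
  define El where "El j = (\<integral>x. indicator {x. real (Suc j) * \<delta> \<le> \<bar>u x\<bar> \<and> \<bar>u x\<bar> < real (Suc (Suc j)) * \<delta>} x * (norm (g x))\<^sup>2 \<partial>lborel)" for j
  have El0: "0 \<le> El j" for j unfolding El_def by (intro integral_nonneg_AE AE_I2) auto
  have slab: "(c * \<delta>)\<^sup>2 \<le> El j * (1 / r * (a (Suc j) - a j))" if "j < k" for j
  proof -
    have st: "real (Suc j) * \<delta> < real (Suc (Suc j)) * \<delta>" "real (Suc (Suc j)) * \<delta> - real (Suc j) * \<delta> = \<delta>"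
      using \<delta> by (auto simp: algebra_simps)
    have "0 < V (real (Suc (Suc j)) * \<delta>)" using Vpos[of "Suc j"] that by simp
    from slab_energy_ge[OF dim pos st(1) this] show ?thesis
      unfolding st(2) El_def a_def c_def r_def n_def by (simp add: minus_divide_left)
  qed
  \<comment> \<open>If the coordinate did not increase, the slab estimate would bound the positive
    number \<open>(c * \<delta>)^2\<close> by a nonpositive one.\<close>
  have a_less: "a j < a (Suc j)" if "j < k" for j
  proof (rule ccontr)
    assume "\<not> ?thesis"
    then have "El j * (1 / r * (a (Suc j) - a j)) \<le> 0" using El0 r by (intro mult_nonneg_nonpos) auto
    then show False using slab[OF that] c \<delta> by (smt (verit) mult_pos_pos zero_less_power)
  qed
  have a_mono: "a i \<le> a j" if "i \<le> j" "j \<le> k" for i j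
    using that a_less by (induction j) (auto simp: le_Suc_eq intro: order_trans[OF _ less_imp_le])
  define Wf where "Wf b = (B + 1) powr p * (C1 * b powr r1)" for b
  \<comment> \<open>Near the origin, where \<open>t\<close> is large, the profile returns to zero
    between \<open>L\<close> and \<open>2 * L\<close>. For large \<open>L\<close> both the energy of
    this descent, of order \<open>1 / L\<close>, and the weighted mass of the ball that it affects
    are small.\<close>
  obtain L where L: "a k \<le> L" "c\<^sup>2 * r * (k * \<delta>)\<^sup>2 / L \<le> \<eta>" "Wf (L powr (- (1 / r))) \<le> \<eta> / 2"
  proof -
    have "((\<lambda>L. c\<^sup>2 * r * (k * \<delta>)\<^sup>2 / L) \<longlongrightarrow> 0) at_top"
      by (rule tendsto_divide_0[OF tendsto_const filterlim_at_top_imp_at_infinity[OF filterlim_ident]])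
    then have "\<forall>\<^sub>F L in at_top. c\<^sup>2 * r * (k * \<delta>)\<^sup>2 / L < \<eta>" using \<eta> by (rule order_tendstoD)
    moreover have "((\<lambda>L. Wf (L powr (- (1 / r)))) \<longlongrightarrow> 0) at_top"
    proof -
      have "((\<lambda>L::real. L powr (- (r1 / r))) \<longlongrightarrow> 0) at_top" using r C1 by (intro tendsto_neg_powr filterlim_ident) auto
      then have "((\<lambda>L. (B + 1) powr p * (C1 * L powr (- (r1 / r)))) \<longlongrightarrow> (B + 1) powr p * (C1 * 0)) at_top"
        by (intro tendsto_intros)
      then show ?thesis by (simp add: Wf_def powr_powr)
    qed
    then have "\<forall>\<^sub>F L in at_top. Wf (L powr (- (1 / r))) < \<eta> / 2" using \<eta> by (intro order_tendstoD) auto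
    ultimately have "\<forall>\<^sub>F L in at_top. a k \<le> L \<and> c\<^sup>2 * r * (k * \<delta>)\<^sup>2 / L < \<eta> \<and> Wf (L powr (- (1 / r))) < \<eta> / 2"
      using eventually_ge_at_top[of "a k"] by eventually_elim auto
    then obtain L where "a k \<le> L \<and> c\<^sup>2 * r * (k * \<delta>)\<^sup>2 / L < \<eta> \<and> Wf (L powr (- (1 / r))) < \<eta> / 2"
      using eventually_happens'[OF trivial_limit_at_top_linorder] by blast
    then show ?thesis using that by auto
  qed
  have L0: "0 < L" using a0[of k] L(1) by simp
  \<comment> \<open>The steps with index below \<open>k\<close> climb by \<open>\<delta>\<close>
    each; step \<open>k\<close> takes off the whole height \<open>k * \<delta>\<close>
    again.\<close>
  define aa where "aa j = (if j < k then a j else L)" for j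
  define bb where "bb j = (if j < k then a (Suc j) else 2 * L)" for j
  define cc where "cc j = (if j < k then \<delta> else - (k * \<delta>))" for j
  have ab: "0 < aa j \<and> aa j < bb j" if "j < Suc k" for j
    using that a0[of j] a_less[of j] L0 by (auto simp: aa_def bb_def)
  have ord: "bb i \<le> aa j" if "i < j" "j < Suc k" for i j
    using that a_mono[of "Suc i" j] a_mono[of "Suc i" k] L(1) by (auto simp: aa_def bb_def)
  define Y where "Y = bumps (Suc k) cc aa bb"
  define Y' where "Y' = bumps' (Suc k) cc aa bb"
  have Yeq: "Y t = \<delta> * (\<Sum>j<k. \<sigma> ((t - a j) / (a (Suc j) - a j))) - k * \<delta> * \<sigma> ((t - L) / L)" for t
    by (simp add: Y_def bumps_def cc_def aa_def bb_def sum_distrib_left)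
  have \<sigma>hi: "\<sigma> ((t - x) / (y - x)) = 1" if "y \<le> t" "x < y" for t x y using that by (intro \<sigma>_1) auto
  have \<sigma>lo: "\<sigma> ((t - x) / (y - x)) = 0" if "t \<le> x" "x < y" for t x y using that by (intro \<sigma>_0) (auto simp: divide_nonpos_pos)
  have \<sigma>L0: "\<sigma> ((t - L) / L) = 0" if "t \<le> L" for t using that L0 by (intro \<sigma>_0) (auto simp: divide_nonpos_pos)
  have Ylow: "Y t = 0" if "t \<le> a 0" for t
  proof -
    have "\<sigma> ((t - a j) / (a (Suc j) - a j)) = 0" if "j < k" for j
      using \<open>t \<le> a 0\<close> a_mono[of 0 j] a_less[OF that] that by (intro \<sigma>lo) auto
    moreover have "t \<le> L" using that a_mono[of 0 k] L(1) by simp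
    ultimately show ?thesis by (simp add: Yeq \<sigma>L0)
  qed
  have all1: "(\<Sum>j<k. \<sigma> ((t - a j) / (a (Suc j) - a j))) = k" if "a k \<le> t" for t
  proof -
    have "\<sigma> ((t - a j) / (a (Suc j) - a j)) = 1" if "j < k" for j
      using \<open>a k \<le> t\<close> a_mono[of "Suc j" k] a_less[OF that] that by (intro \<sigma>hi) auto
    then show ?thesis by simp
  qed
  have Yhigh: "Y t = 0" if "2 * L \<le> t" for t
  proof -
    have "\<sigma> ((t - L) / L) = 1" using that L0 by (intro \<sigma>_1) (simp add: field_simps)
    then show ?thesis using all1[of t] that L(1) L0 by (simp add: Yeq)
  qed
  have Ynn: "0 \<le> Y t" for t
  proof (cases "t \<le> L")
    case True
    then show ?thesis using \<delta> \<sigma>_nonneg by (simp add: Yeq \<sigma>L0 sum_nonneg)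
  next
    case False
    then have "Y t = k * \<delta> * (1 - \<sigma> ((t - L) / L))" using all1[of t] L(1) by (simp add: Yeq algebra_simps)
    then show ?thesis using \<sigma>_le_1 \<delta> by simp
  qed
  have Yle: "Y t \<le> k * \<delta>" for t
  proof -
    have "(\<Sum>j<k. \<sigma> ((t - a j) / (a (Suc j) - a j))) \<le> (\<Sum>j<k. 1)" by (intro sum_mono \<sigma>_le_1)
    then have "\<delta> * (\<Sum>j<k. \<sigma> ((t - a j) / (a (Suc j) - a j))) \<le> \<delta> * k" using \<delta> by (intro mult_left_mono) auto
    moreover have "0 \<le> k * \<delta> * \<sigma> ((t - L) / L)" using \<delta> \<sigma>_nonneg by simp
    ultimately show ?thesis by (simp add: Yeq mult.commute)
  qed
  have Yge: "i * \<delta> \<le> Y t" if "i \<le> k" "a i \<le> t" "t \<le> L" for i t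
  proof -
    have "real i = (\<Sum>j<i. \<sigma> ((t - a j) / (a (Suc j) - a j)))"
    proof -
      have "\<sigma> ((t - a j) / (a (Suc j) - a j)) = 1" if "j < i" for j
        using \<open>a i \<le> t\<close> \<open>i \<le> k\<close> a_mono[of "Suc j" i] a_less[of j] that by (intro \<sigma>hi) auto
      then show ?thesis by simp
    qed
    also have "\<dots> \<le> (\<Sum>j<k. \<sigma> ((t - a j) / (a (Suc j) - a j)))"
      using that(1) \<sigma>_nonneg by (intro sum_mono2) auto
    finally show ?thesis using \<delta> that(3) by (simp add: Yeq \<sigma>L0 mult.commute[of _ \<delta>])
  qed
  have a0L: "a 0 < 2 * L" using a_mono[of 0 k] L(1) L0 by simp
  have Ysupp: "Y t = 0" if "t \<notin> {a 0..2 * L}" for t using that Ylow[of t] Yhigh[of t] by fastforce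
  have bsupp: "\<forall>t. t \<notin> {a 0..2 * L} \<longrightarrow> bumps (Suc k) cc aa bb t = 0" using Ysupp unfolding Y_def by blast
  from radial_profile[OF smooth_bumps deriv_bumps cont_bumps' a0[OF le0] a0L bsupp dim]
  obtain G G' Q1 Q2 where G': "smooth_on UNIV G" "\<forall>q. (G has_real_derivative G' q) (at q)" "continuous_on UNIV G'"
     "0 < Q1" "Q1 < Q2" "\<forall>q. q \<notin> {Q1..Q2} \<longrightarrow> G q = 0"
     "\<forall>z::'a. z \<noteq> 0 \<longrightarrow> G ((norm z)\<^sup>2) = Y (ball_vol z powr (- r)) \<and>
       (norm ((2 * G' ((norm z)\<^sup>2)) *\<^sub>R z))\<^sup>2 = c\<^sup>2 * r * ((Y' (ball_vol z powr (- r)))\<^sup>2 * (r * ball_vol z powr (- r - 1)))"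
    unfolding Y_def[symmetric] Y'_def[symmetric] c_def[symmetric] n_def[symmetric] r_def[symmetric]
    by (elim exE conjE) (rule that; assumption)
  note G = G'(1) G'(2)[rule_format] G'(3-5) G'(6)[rule_format] G'(7)[rule_format, THEN conjunct1] G'(7)[rule_format, THEN conjunct2]
  have [measurable]: "G \<in> borel_measurable borel"
    by (intro borel_measurable_continuous_onI continuous_at_imp_continuous_on ballI DERIV_isCont[OF G(2)])
  have [measurable]: "G' \<in> borel_measurable borel" by (rule borel_measurable_continuous_onI[OF G(3)])
  have [measurable]: "Y \<in> borel_measurable borel" unfolding Y_def
    by (intro borel_measurable_continuous_onI continuous_at_imp_continuous_on ballI DERIV_isCont[OF deriv_bumps])
  have [measurable]: "Y' \<in> borel_measurable borel" unfolding Y'_def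
    by (rule borel_measurable_continuous_onI[OF cont_bumps'])
  have EG: "(\<integral>z. (norm ((2 * G' ((norm (z::'a))\<^sup>2)) *\<^sub>R z))\<^sup>2 \<partial>lborel) \<le> (1 + \<eta>) * (E + \<eta>)"
  proof -
    have "(\<integral>z. (norm ((2 * G' ((norm (z::'a))\<^sup>2)) *\<^sub>R z))\<^sup>2 \<partial>lborel)
      = (\<integral>z. c\<^sup>2 * r * ((Y' (ball_vol (z::'a) powr (- r)))\<^sup>2 * (r * ball_vol z powr (- r - 1))) \<partial>lborel)"
    proof (rule integral_cong_AE)
      show "AE z in lborel. (norm ((2 * G' ((norm (z::'a))\<^sup>2)) *\<^sub>R z))\<^sup>2 = c\<^sup>2 * r * ((Y' (ball_vol z powr (- r)))\<^sup>2 * (r * ball_vol z powr (- r - 1)))"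
        using AE_lborel_neq_0 by eventually_elim (rule G(8))
    qed measurable
    also have "\<dots> = c\<^sup>2 * r * (\<integral>z. (Y' (ball_vol (z::'a) powr (- r)))\<^sup>2 * (r * ball_vol z powr (- r - 1)) \<partial>lborel)"
      by (rule integral_mult_right_zero)
    also have "(\<integral>z. (Y' (ball_vol (z::'a) powr (- r)))\<^sup>2 * (r * ball_vol z powr (- r - 1)) \<partial>lborel)
      = (\<integral>v. indicator {0..} v * ((Y' (v powr (- r)))\<^sup>2 * (r * v powr (- r - 1))) \<partial>lborel)"
      by (subst radial_integral(2)) auto
    also have "\<dots> = (\<Sum>j<Suc k. (cc j)\<^sup>2 / (bb j - aa j)) * (P 1 - P 0)"
      unfolding Y'_def using ab ord r by (intro has_bochner_integral_integral_eq bumps_energy) auto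
    also have "(\<Sum>j<Suc k. (cc j)\<^sup>2 / (bb j - aa j)) = (\<Sum>j<k. \<delta>\<^sup>2 / (a (Suc j) - a j)) + (k * \<delta>)\<^sup>2 / L"
      by (simp add: cc_def aa_def bb_def)
    finally have 1: "(\<integral>z. (norm ((2 * G' ((norm (z::'a))\<^sup>2)) *\<^sub>R z))\<^sup>2 \<partial>lborel)
      = (c\<^sup>2 * r * (\<Sum>j<k. \<delta>\<^sup>2 / (a (Suc j) - a j)) + c\<^sup>2 * r * (k * \<delta>)\<^sup>2 / L) * (P 1 - P 0)" by (simp add: algebra_simps)
    have "c\<^sup>2 * r * (\<delta>\<^sup>2 / (a (Suc j) - a j)) \<le> El j" if "j < k" for j
    proof -
      have d: "0 < a (Suc j) - a j" using a_less[OF that] by simp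
      have "(c * \<delta>)\<^sup>2 * r \<le> El j * (1 / r * (a (Suc j) - a j)) * r" using slab[OF that] r by (intro mult_right_mono) auto
      then have "c\<^sup>2 * r * \<delta>\<^sup>2 \<le> El j * (a (Suc j) - a j)" using r by (simp add: power_mult_distrib mult_ac)
      then show ?thesis using d by (simp add: pos_divide_le_eq)
    qed
    then have "c\<^sup>2 * r * (\<Sum>j<k. \<delta>\<^sup>2 / (a (Suc j) - a j)) \<le> (\<Sum>j<k. El j)" unfolding sum_distrib_left by (intro sum_mono) auto
    also have "\<dots> \<le> E" unfolding El_def E_def by (rule slab_energy_sum_le[OF \<delta>(1)])
    finally have 2: "c\<^sup>2 * r * (\<Sum>j<k. \<delta>\<^sup>2 / (a (Suc j) - a j)) + c\<^sup>2 * r * (k * \<delta>)\<^sup>2 / L \<le> E + \<eta>" using L(2) by simp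
    have P0: "0 \<le> P 1 - P 0"
      using DERIV_nonneg_imp_nondecreasing[of 0 1 P] deriv_P by (metis diff_ge_0_iff_ge zero_le_one zero_le_power2)
    have E0: "0 \<le> E + \<eta>" using \<eta> unfolding E_def by (intro add_nonneg_nonneg integral_nonneg_AE) auto
    show ?thesis unfolding 1 using mult_mono[OF 2 P E0 P0] by (simp add: mult.commute)
  qed
  have WG: "W - \<eta> \<le> (\<integral>z. norm (z::'a) powr e * \<bar>G ((norm z)\<^sup>2)\<bar> powr p \<partial>lborel)"
  proof -
    define vL where "vL = L powr (- (1 / r))"
    have vL: "0 \<le> vL" by (simp add: vL_def)
    define F where "F t = \<kappa> t * Y (t powr (- r)) powr p" for t
    have [measurable]: "F \<in> borel_measurable borel" unfolding F_def by measurable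
    have intW: "(\<integral>z. norm (z::'a) powr e * \<bar>G ((norm z)\<^sup>2)\<bar> powr p \<partial>lborel) = (\<integral>t. indicator {0..} t * F t \<partial>lborel)"
    proof -
      have "(\<integral>z. norm (z::'a) powr e * \<bar>G ((norm z)\<^sup>2)\<bar> powr p \<partial>lborel) = (\<integral>z. F (ball_vol (z::'a)) \<partial>lborel)"
      proof (rule integral_cong_AE)
        show "AE z in lborel. norm (z::'a) powr e * \<bar>G ((norm z)\<^sup>2)\<bar> powr p = F (ball_vol z)"
          using AE_lborel_neq_0
        proof eventually_elim
          case (elim z)
          show ?case using Ynn by (simp only: G(7)[OF elim] F_def weight_eq[OF e] \<kappa>_def abs_of_nonneg)
        qed
      qed measurable
      also have "\<dots> = (\<integral>t. indicator {0..} t * F t \<partial>lborel)" by (rule radial_integral(2)) measurable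
      finally show ?thesis .
    qed
    define v where "v j = (if j = 0 then v0 else V (real j * \<delta>))" for j :: nat
    define D where "D t = (\<Sum>j<Suc (Suc k). ((\<delta> * Suc j) powr p - (\<delta> * j) powr p) * indicator {0..v j} t)" for t
    have WD: "W \<le> (\<integral>t. \<kappa> t * D t \<partial>lborel)" and intD: "integrable lborel (\<lambda>t. \<kappa> t * D t)"
      using weighted_norm_le_rearranged[OF e p \<delta>(1) Vm] unfolding W_def \<kappa>_def D_def v_def v0_def by auto
    have vanti: "v (Suc j) \<le> v j" for j
    proof (cases j)
      case 0
      have "V \<delta> \<le> v0" unfolding V_def v0_def using level_compact[of \<delta>] \<delta> compact_K
        by (intro measure_mono_fmeasurable) (auto intro: borel_compact fmeasurable_compact)
      then show ?thesis by (simp add: v_def 0)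
    next
      case (Suc i)
      then show ?thesis using V_mono[of "real (Suc i) * \<delta>" "real (Suc (Suc i)) * \<delta>"] pos[of i] \<delta> by (auto simp: v_def algebra_simps)
    qed
    have intF: "integrable lborel (\<lambda>t. indicator {0..} t * F t)"
    proof (rule Bochner_Integration.integrable_bound)
      define v1 where "v1 = a 0 powr (- (1 / r))"
      show "integrable lborel (\<lambda>t. (k * \<delta>) powr p * (indicator {0..v1} t * \<kappa> t))"
        by (intro integrable_mult_right \<kappa>int) (simp add: v1_def)
      show "AE t in lborel. norm (indicator {0..} t * F t) \<le> norm ((k * \<delta>) powr p * (indicator {0..v1} t * \<kappa> t))"
      proof (rule AE_I2)
        fix t :: real
        show "norm (indicator {0..} t * F t) \<le> norm ((k * \<delta>) powr p * (indicator {0..v1} t * \<kappa> t))"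
        proof (cases "0 \<le> t \<and> t \<le> v1")
          case True
          have "Y (t powr (- r)) powr p \<le> (k * \<delta>) powr p" using Ynn Yle p by (intro powr_mono2) auto
          then show ?thesis using True \<kappa>0[of t] by (simp add: F_def mult_left_mono mult.commute[of _ "\<kappa> t"])
        next
          case False
          have "t powr (- r) \<le> a 0" if "v1 < t"
          proof -
            have "t powr (- r) \<le> v1 powr (- r)" using that r a0[of 0] by (intro powr_mono2') (auto simp: v1_def)
            then show ?thesis using r a0[of 0] by (simp add: v1_def powr_powr)
          qed
          then have "0 \<le> t \<Longrightarrow> Y (t powr (- r)) = 0" using False Ylow by auto
          then show ?thesis using False by (auto simp: F_def indicator_def)
        qed
      qed
    qed measurable
    \<comment> \<open>Three contributions: the competitor itself, the error from heights short by up
      to \<open>2 * \<delta>\<close> within the volume \<open>v0\<close>, and the ball of volume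
      \<open>vL\<close> on which the profile comes down, where the heights are bounded by
      \<open>B + 1\<close>.\<close>
    have pw: "\<kappa> t * D t \<le> indicator {0..} t * F t + 2 * \<delta> * p * (B + 1) powr (p - 1) * (indicator {0..v0} t * \<kappa> t)
        + (B + 1) powr p * (indicator {0..vL} t * \<kappa> t)" for t
    proof -
      let ?R2 = "2 * \<delta> * p * (B + 1) powr (p - 1)"
      have R2: "0 \<le> ?R2" using \<delta> p by (intro mult_nonneg_nonneg) auto
      obtain i where i: "i \<le> Suc (Suc k)" "\<And>j. j < Suc (Suc k) \<Longrightarrow> t \<in> {0..v j} \<longleftrightarrow> j < i"
      proof -
        have "\<And>j. t \<in> {0..v (Suc j)} \<Longrightarrow> t \<in> {0..v j}" using vanti by (auto intro: order_trans)
        from antitone_prefix[of "\<lambda>j. t \<in> {0..v j}", OF this, of "Suc (Suc k)"] show ?thesis using that by blast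
      qed
      have Di: "D t = (\<delta> * i) powr p"
        using sum_prefix[OF i, of "\<lambda>j. (\<delta> * real j) powr p"] \<delta> p
        by (simp add: D_def indicator_def[abs_def] del: sum.lessThan_Suc)
      have "real i * \<delta> \<le> real (Suc (Suc k)) * \<delta>" using i(1) \<delta> by (intro mult_right_mono) auto
      then have iB: "real i * \<delta> \<le> B + 1" using kB \<delta> by (simp add: algebra_simps)
      show ?thesis
      proof (cases "i = 0")
        case True
        then have "D t = 0" using Di p by simp
        then show ?thesis using R2 \<kappa>0[of t] Ynn by (auto simp: F_def intro!: add_nonneg_nonneg mult_nonneg_nonneg)
      next
        case False
        then have tv0: "0 \<le> t" "t \<le> v0" using i(2)[of 0] by (auto simp: v_def)
        have D: "D t \<le> Y (t powr (- r)) powr p + ?R2 + (B + 1) powr p * indicator {0..vL} t"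
        proof (cases "t \<le> vL")
          case True
          have "D t \<le> (B + 1) powr p" unfolding Di using iB \<delta> p by (intro powr_mono2) (auto simp: mult.commute)
          then show ?thesis using True tv0 R2 by (simp add: add_increasing)
        next
          case False
          then have t0: "0 < t" using vL by simp
          have tL: "t powr (- r) \<le> L"
          proof -
            have "t powr (- r) \<le> vL powr (- r)" using False L0 r by (intro powr_mono2') (auto simp: vL_def)
            then show ?thesis using L0 r by (simp add: vL_def powr_powr)
          qed
          have "\<delta> * i \<le> Y (t powr (- r)) + 2 * \<delta>"
          proof (cases "i \<le> 2")
            case True
            then have "\<delta> * real i \<le> \<delta> * 2" using \<delta> by (intro mult_left_mono) auto
            then show ?thesis using Ynn[of "t powr (- r)"] by simp
          next
            case False
            \<comment> \<open>The level of index \<open>h + 1\<close> is reached at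
              \<open>t\<close>, so the profile is at least \<open>h * \<delta>\<close>. One
              \<open>\<delta>\<close> is lost because the profile starts from 0 at the first
              positive level, the other because the staircase rounds up.\<close>
            then obtain h where h: "i = Suc (Suc h)" "h \<le> k" using i(1) by (cases i; cases "i - 1") auto
            have "t \<le> v (Suc h)" using i(2)[of "Suc h"] h by auto
            then have "t \<le> V (real (Suc h) * \<delta>)" by (simp add: v_def)
            then have "a h \<le> t powr (- r)" unfolding a_def using r t0 by (intro powr_mono2') auto
            from Yge[OF h(2) this tL] show ?thesis by (simp add: h(1) algebra_simps)
          qed
          then have "D t \<le> (Y (t powr (- r)) + 2 * \<delta>) powr p" unfolding Di using \<delta> p by (intro powr_mono2) auto
          also have "\<dots> \<le> Y (t powr (- r)) powr p + 2 * \<delta> * p * (Y (t powr (- r)) + 2 * \<delta>) powr (p - 1)"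
            using powr_add_le[OF Ynn _ p, of "2 * \<delta>" "t powr (- r)"] \<delta> by simp
          also have "2 * \<delta> * p * (Y (t powr (- r)) + 2 * \<delta>) powr (p - 1) \<le> ?R2"
          proof -
            have "Y (t powr (- r)) + 2 * \<delta> \<le> B + 1" using Yle[of "t powr (- r)"] kB \<delta> by (simp add: algebra_simps)
            then show ?thesis using \<delta> p Ynn[of "t powr (- r)"] by (intro mult_left_mono powr_mono2) auto
          qed
          finally show ?thesis by (simp add: add_increasing2)
        qed
        from mult_left_mono[OF D \<kappa>0[of t]] show ?thesis using tv0 by (simp add: F_def algebra_simps)
      qed
    qed
    have "W \<le> (\<integral>t. indicator {0..} t * F t + 2 * \<delta> * p * (B + 1) powr (p - 1) * (indicator {0..v0} t * \<kappa> t)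
        + (B + 1) powr p * (indicator {0..vL} t * \<kappa> t) \<partial>lborel)"
      using intF \<kappa>int[OF v0(1)] \<kappa>int[OF vL]
      by (intro order_trans[OF WD] integral_mono intD pw Bochner_Integration.integrable_add integrable_mult_right)
    also have "\<dots> = (\<integral>t. indicator {0..} t * F t \<partial>lborel) + 2 * \<delta> * p * (B + 1) powr (p - 1) * J v0 + (B + 1) powr p * J vL"
      using intF \<kappa>int[OF v0(1)] \<kappa>int[OF vL] by (simp add: J_def)
    also have "(B + 1) powr p * J vL \<le> \<eta> / 2" using L(3) C1(3)[OF vL] by (simp add: Wf_def vL_def)
    finally show ?thesis unfolding intW using \<delta>Z by simp
  qed
  show ?thesis using G(1-6) EG WG unfolding E_def W_def by blast
qed

end

lemma grad_eqI:
  fixes f :: "real^'n \<Rightarrow> real"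
  assumes "(f has_derivative (\<lambda>h. d \<bullet> h)) (at x)"
  shows "grad f x = d"
  using frechet_derivative_at[OF assms, symmetric]
  by (simp add: grad_def partial_def vec_eq_iff inner_axis)

lemma has_derivative_grad:
  fixes f :: "real^'n \<Rightarrow> real"
  assumes "f differentiable (at x)"
  shows "(f has_derivative (\<lambda>h. grad f x \<bullet> h)) (at x)"
proof -
  have lin: "linear (frechet_derivative f (at x))" by (rule linear_frechet_derivative[OF assms])
  have "frechet_derivative f (at x) h = grad f x \<bullet> h" for h
  proof -
    have "frechet_derivative f (at x) h = frechet_derivative f (at x) (\<Sum>i\<in>UNIV. (h $ i) *\<^sub>R axis i 1)"
      by (simp only: basis_expansion scalar_mult_eq_scaleR[symmetric])
    also have "\<dots> = (\<Sum>i\<in>UNIV. (h $ i) * frechet_derivative f (at x) (axis i 1))"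
      by (simp only: linear_sum[OF lin] linear_cmul[OF lin] real_scaleR_def o_def)
    also have "\<dots> = grad f x \<bullet> h" by (simp add: inner_vec_def grad_def partial_def mult.commute)
    finally show ?thesis .
  qed
  then have "frechet_derivative f (at x) = (\<lambda>h. grad f x \<bullet> h)" by auto
  then show ?thesis using assms frechet_derivative_works[of f "at x"] by simp
qed

lemma test_function_compact_C1:
  fixes f :: "real^'n \<Rightarrow> real"
  assumes "f \<in> test_functions \<Omega>"
  shows "compact_C1 f (grad f) (closure {x. f x \<noteq> 0})"
proof
  have C: "Ck (Suc 0) f" using assms by (simp only: test_functions_def smooth_def mem_Collect_eq)
  then show "(f has_derivative (\<lambda>h. grad f x \<bullet> h)) (at x)" for x by (intro has_derivative_grad) simp
  show "continuous_on UNIV (grad f)" unfolding grad_def using C by (intro continuous_on_vec_lambda) simp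
  show "compact (closure {x. f x \<noteq> 0})" using assms by (simp add: test_functions_def)
  show "f x = 0" if "x \<notin> closure {x. f x \<noteq> 0}" for x using that closure_subset[of "{x. f x \<noteq> 0}"] by auto
  show "grad f x = 0" if "x \<notin> closure {x. f x \<noteq> 0}" for x
  proof (rule grad_eqI)
    have "((\<lambda>_. 0) has_derivative (\<lambda>_. 0)) (at x)" by simp
    then have "(f has_derivative (\<lambda>_. 0)) (at x)"
      by (rule has_derivative_transform_within_open[of _ _ _ _ "- closure {x. f x \<noteq> 0}"]) (use that closure_subset[of "{x. f x \<noteq> 0}"] in auto)
    then show "(f has_derivative (\<lambda>h. 0 \<bullet> h)) (at x)" by simp
  qed
qed

lemma test_functionI:
  assumes "smooth_on UNIV f" "compact K" "K \<subseteq> \<Omega>" "\<And>x. x \<notin> K \<Longrightarrow> f x = 0"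
  shows "f \<in> test_functions \<Omega>"
proof -
  have "closure {x. f x \<noteq> 0} \<subseteq> K" using assms(2,4) by (intro closure_minimal) (auto intro: compact_imp_closed)
  moreover from this have "compact (closure {x. f x \<noteq> 0})"
    using compact_Int_closed[OF assms(2) closed_closure, of "{x. f x \<noteq> 0}"] by (simp add: Int_absorb1)
  ultimately show ?thesis using assms by (auto simp: test_functions_def smooth_iff_smooth_on)
qed

text \<open>Functions of \<open>|z|^2\<close> supported in an annulus. The positive inner bound
  \<open>Q1\<close> later makes their images on the ball vanish near the base point.\<close>

locale radial_test =
  fixes G G' :: "real \<Rightarrow> real" and Q1 Q2 :: real
  assumes smooth_G: "smooth_on UNIV G" and deriv_G: "\<And>q. (G has_real_derivative G' q) (at q)"
    and cont_G': "continuous_on UNIV G'" and Q: "0 < Q1" "Q1 < Q2" and G_0: "\<And>q. q \<notin> {Q1..Q2} \<Longrightarrow> G q = 0"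
begin

lemma deriv_radial:
  "((\<lambda>z::'a::euclidean_space. G ((norm z)\<^sup>2)) has_derivative (\<lambda>h. ((2 * G' ((norm z)\<^sup>2)) *\<^sub>R z) \<bullet> h)) (at z)"
proof -
  have "((\<lambda>z::'a. (norm z)\<^sup>2) has_derivative (\<lambda>h. 2 * (z \<bullet> h))) (at z)"
    unfolding power2_norm_eq_inner by (auto intro!: derivative_eq_intros simp: inner_commute)
  from has_derivative_compose[OF this, of G "(*) (G' ((norm z)\<^sup>2))"] deriv_G[of "(norm z)\<^sup>2"]
  show ?thesis by (simp add: has_field_derivative_def mult_ac)
qed

lemma G'_0: "q \<notin> {Q1..Q2} \<Longrightarrow> G' q = 0"
proof -
  assume q: "q \<notin> {Q1..Q2}"
  have "((\<lambda>_. 0) has_real_derivative 0) (at q)" by simp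
  then have "(G has_real_derivative 0) (at q)"
    by (rule has_field_derivative_transform_within_open[of _ _ _ "- {Q1..Q2}"]) (use q G_0 in auto)
  then show "G' q = 0" using DERIV_unique deriv_G by blast
qed

lemma compact_C1_radial:
  "compact_C1 (\<lambda>z::'a::euclidean_space. G ((norm z)\<^sup>2)) (\<lambda>z. (2 * G' ((norm z)\<^sup>2)) *\<^sub>R z) (cball 0 (sqrt Q2))"
proof
  show "continuous_on UNIV (\<lambda>z::'a. (2 * G' ((norm z)\<^sup>2)) *\<^sub>R z)"
    by (intro continuous_intros continuous_on_compose2[OF cont_G']) auto
  fix z :: 'a assume "z \<notin> cball 0 (sqrt Q2)"
  then have "sqrt Q2 < norm z" by simp
  then have "(sqrt Q2)\<^sup>2 < (norm z)\<^sup>2" using Q by (intro power_strict_mono) auto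
  then have "(norm z)\<^sup>2 \<notin> {Q1..Q2}" using Q by simp
  then show "G ((norm z)\<^sup>2) = 0" "(2 * G' ((norm z)\<^sup>2)) *\<^sub>R z = 0" using G_0 G'_0 by auto
qed (simp_all only: compact_cball deriv_radial)

lemma smooth_radial: "smooth_on UNIV (\<lambda>z::'a::euclidean_space. G ((norm z)\<^sup>2))"
  using smooth_on_compose[OF open_UNIV open_UNIV smooth_G smooth_on_norm_sq[of 0]] by simp

lemma test_function_radial: "(\<lambda>z::real^'n. G ((norm z)\<^sup>2)) \<in> test_functions UNIV"
  using compact_C1.u_0[OF compact_C1_radial[where 'a = "real^'n"]]
  by (intro test_functionI[OF smooth_radial compact_cball, of 0 "sqrt Q2"]) auto

lemma grad_radial: "grad (\<lambda>z::real^'n. G ((norm z)\<^sup>2)) z = (2 * G' ((norm z)\<^sup>2)) *\<^sub>R z"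
  by (rule grad_eqI[OF deriv_radial])

end

text \<open>The strict inequality leaves room: the two bounds provided by the approximation depend
  continuously on \<open>\<eta>\<close> and reduce at \<open>\<eta> = 0\<close> to the quantities of
  \<open>u\<close>.\<close>

lemma radial_competitor:
  assumes "compact_C1 u g K" and dim: "3 \<le> DIM('a::euclidean_space)" and e: "- real DIM('a) < e" "e \<le> 0" and p: "1 \<le> p"
    and less: "(\<integral>x. (norm (g x))\<^sup>2 \<partial>lborel) < C * (\<integral>x. norm (x::'a) powr e * \<bar>u x\<bar> powr p \<partial>lborel) powr (2 / p)"
  obtains G G' Q1 Q2 where "radial_test G G' Q1 Q2"
    "(\<integral>z. (norm ((2 * G' ((norm (z::'a))\<^sup>2)) *\<^sub>R z))\<^sup>2 \<partial>lborel) < C * (\<integral>z. norm (z::'a) powr e * \<bar>G ((norm z)\<^sup>2)\<bar> powr p \<partial>lborel) powr (2 / p)"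
proof -
  interpret compact_C1 u g K by fact
  define E where "E = (\<integral>x. (norm (g x))\<^sup>2 \<partial>lborel)"
  define W where "W = (\<integral>x. norm (x::'a) powr e * \<bar>u x\<bar> powr p \<partial>lborel)"
  have E0: "0 \<le> E" unfolding E_def by (intro integral_nonneg_AE) auto
  have W0: "0 \<le> W" unfolding W_def by (intro integral_nonneg_AE) auto
  have l: "E < C * W powr (2 / p)" using less by (simp add: E_def W_def)
  then have "W \<noteq> 0" using E0 by auto
  then have W: "0 < W" using W0 by simp
  then have C: "0 < C" using l E0 by (smt (verit) mult_nonpos_nonneg powr_ge_zero)
  have "((\<lambda>\<eta>. C * (W - \<eta>) powr (2 / p) - (1 + \<eta>) * (E + \<eta>)) \<longlongrightarrow> C * (W - 0) powr (2 / p) - (1 + 0) * (E + 0)) (at_right 0)"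
    using W by (intro tendsto_intros) auto
  then have "\<forall>\<^sub>F \<eta> in at_right 0. 0 < C * (W - \<eta>) powr (2 / p) - (1 + \<eta>) * (E + \<eta>)"
    using l by (intro order_tendstoD) auto
  moreover have "\<forall>\<^sub>F \<eta> in at_right 0. \<eta> \<in> {0<..<W}" using W by (rule eventually_at_right_real)
  ultimately have "\<forall>\<^sub>F \<eta> in at_right 0. \<eta> \<in> {0<..<W} \<and> (1 + \<eta>) * (E + \<eta>) < C * (W - \<eta>) powr (2 / p)"
    by eventually_elim auto
  then obtain \<eta> where \<eta>: "0 < \<eta>" "\<eta> < W" "(1 + \<eta>) * (E + \<eta>) < C * (W - \<eta>) powr (2 / p)"
    using eventually_happens'[of "at_right (0::real)"] by (auto simp: trivial_limit_at_right_real)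
  from radial_competitor_approx[OF dim e p, of \<eta>] \<open>W \<noteq> 0\<close> \<eta>(1)
  obtain G G' Q1 Q2 where G: "smooth_on UNIV G \<and> (\<forall>q. (G has_real_derivative G' q) (at q)) \<and> continuous_on UNIV G' \<and>
     0 < Q1 \<and> Q1 < Q2 \<and> (\<forall>q. q \<notin> {Q1..Q2} \<longrightarrow> G q = 0) \<and>
     (\<integral>z. (norm ((2 * G' ((norm (z::'a))\<^sup>2)) *\<^sub>R z))\<^sup>2 \<partial>lborel) \<le> (1 + \<eta>) * (E + \<eta>) \<and>
     W - \<eta> \<le> (\<integral>z. norm (z::'a) powr e * \<bar>G ((norm z)\<^sup>2)\<bar> powr p \<partial>lborel)"
    unfolding E_def W_def by auto
  have "C * (W - \<eta>) powr (2 / p) \<le> C * (\<integral>z. norm (z::'a) powr e * \<bar>G ((norm z)\<^sup>2)\<bar> powr p \<partial>lborel) powr (2 / p)"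
    using G C \<eta> p by (intro mult_left_mono powr_mono2) auto
  then have "(\<integral>z. (norm ((2 * G' ((norm (z::'a))\<^sup>2)) *\<^sub>R z))\<^sup>2 \<partial>lborel) < C * (\<integral>z. norm (z::'a) powr e * \<bar>G ((norm z)\<^sup>2)\<bar> powr p \<partial>lborel) powr (2 / p)"
    using G \<eta>(3) by linarith
  moreover have "radial_test G G' Q1 Q2" using G by unfold_locales auto
  ultimately show ?thesis by (rule that[rotated])
qed

section \<open>The Hardy--Sobolev constant and its radial approximation\<close>

context
  fixes p :: real and T :: "'n::finite itself"
  assumes dim: "3 \<le> CARD('n)" and p: "2 < p" "p \<le> 2 * real CARD('n) / (real CARD('n) - 2)"
begin

text \<open>\<open>2 < p\<close> keeps the weight exponent above -2, hence above \<open>- n\<close>,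
  so the weight is locally integrable. The upper bound on \<open>p\<close> makes the exponent
  nonpositive, so the weight does not increase with the radius, as rearrangement requires.\<close>

lemma exponent_bounds:
  "- 2 < p * (real CARD('n) - 2) / 2 - real CARD('n)" "p * (real CARD('n) - 2) / 2 - real CARD('n) \<le> 0"
proof -
  have n: "0 < real CARD('n) - 2" using dim by simp
  have "2 * (real CARD('n) - 2) < p * (real CARD('n) - 2)" using p(1) n by (intro mult_strict_right_mono) auto
  then show "- 2 < p * (real CARD('n) - 2) / 2 - real CARD('n)" by simp
  have "p * (real CARD('n) - 2) \<le> 2 * real CARD('n)" using p(2) n by (simp add: pos_le_divide_eq)
  then show "p * (real CARD('n) - 2) / 2 - real CARD('n) \<le> 0" by simp
qed

end

definition Sobolev_bounds :: "'n::finite itself \<Rightarrow> real \<Rightarrow> real set" where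
  "Sobolev_bounds _ p = {S. \<forall>u\<in>test_functions (UNIV :: (real^'n) set).
     (\<integral>x. (norm (grad u x))\<^sup>2 \<partial>lborel) \<ge>
     S * (\<integral>x. norm x powr (p * (real CARD('n) - 2) / 2 - real CARD('n)) * \<bar>u x\<bar> powr p \<partial>lborel) powr (2 / p)}"

lemma S_const_eq: "S_const TYPE('n::finite) p = Sup (Sobolev_bounds TYPE('n) p)"
  by (simp only: S_const_def Sobolev_bounds_def)

lemma zero_in_Sobolev_bounds: "0 \<in> Sobolev_bounds TYPE('n::finite) p"
  by (auto simp: Sobolev_bounds_def intro!: integral_nonneg_AE)

lemma Sobolev_bounds_le:
  assumes S: "S \<in> Sobolev_bounds TYPE('n::finite) p"
    and u: "u \<in> test_functions (UNIV :: (real^'n) set)"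
    and less: "(\<integral>x. (norm (grad u x))\<^sup>2 \<partial>lborel) < C * (\<integral>x. norm x powr (p * (real CARD('n) - 2) / 2 - real CARD('n)) * \<bar>u x\<bar> powr p \<partial>lborel) powr (2 / p)"
  shows "S \<le> C"
proof -
  let ?w = "(\<integral>x. norm x powr (p * (real CARD('n) - 2) / 2 - real CARD('n)) * \<bar>u x\<bar> powr p \<partial>lborel) powr (2 / p)"
  have "S * ?w \<le> (\<integral>x. (norm (grad u x))\<^sup>2 \<partial>lborel)" using S u unfolding Sobolev_bounds_def by blast
  with less have "S * ?w < C * ?w" by linarith
  then show ?thesis by (smt (verit) mult_right_mono powr_ge_zero)
qed

text \<open>A single test function with nonzero weighted norm bounds all admissible constants, which
  is what gives the supremum in \<open>S_const\<close> its meaning. The function used vanishes in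
  the unit ball, away from the singularity of the weight.\<close>

lemma exists_Sobolev_upper_bound:
  assumes dim: "3 \<le> CARD('n::finite)" and p: "2 < p" "p \<le> 2 * real CARD('n) / (real CARD('n) - 2)"
  shows "bdd_above (Sobolev_bounds TYPE('n) p)"
proof -
  define e where "e = p * (real CARD('n) - 2) / 2 - real CARD('n)"
  define G where "G q = flat_exp 0 ((q - 1) * (2 - q))" for q :: real
  have G0: "G q = 0" if "q \<notin> {1..2}" for q
  proof -
    have "(q - 1) * (2 - q) \<le> 0" using that by (auto simp: mult_le_0_iff)
    then show ?thesis by (simp add: G_def flat_exp_def)
  qed
  have sG: "smooth_on UNIV G" unfolding G_def[abs_def]
    by (intro smooth_on_compose[OF open_UNIV open_UNIV smooth_on_flat_exp] smooth_on_mult smooth_on_diff smooth_on_const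
        smooth_on_linear bounded_linear_ident open_UNIV) auto
  define u where "u z = G ((norm (z::real^'n))\<^sup>2)" for z
  have su: "smooth_on UNIV u" unfolding u_def[abs_def]
    using smooth_on_compose[OF open_UNIV open_UNIV sG smooth_on_norm_sq[of "0 :: real^'n"]] by simp
  have u: "u \<in> test_functions UNIV"
  proof (rule test_functionI[OF su compact_cball[of 0 2]])
    fix z :: "real^'n" assume "z \<notin> cball 0 2"
    then have "2\<^sup>2 < (norm z)\<^sup>2" by (intro power_strict_mono) auto
    then show "u z = 0" using G0 by (simp add: u_def)
  qed simp
  interpret compact_C1 u "grad u" "closure {x. u x \<noteq> 0}" by (rule test_function_compact_C1[OF u])
  define W where "W = (\<integral>x. norm x powr e * \<bar>u x\<bar> powr p \<partial>lborel)"
  have "W \<noteq> 0"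
  proof
    assume W0: "W = 0"
    have out: "\<bar>u x\<bar> powr p = 0" if "norm x < 1" for x
    proof -
      have "(norm x)\<^sup>2 < 1\<^sup>2" using that by (intro power_strict_mono) auto
      then show ?thesis using G0 by (simp add: u_def)
    qed
    obtain B where B: "0 < B" "\<And>x. \<bar>u x\<bar> \<le> B" using compact_support_bounded[OF cont_u u_0] by auto
    have e0: "e \<le> 0" using exponent_bounds(2)[OF dim p] by (simp add: e_def)
    have "integrable lborel (\<lambda>x. norm x powr e * \<bar>u x\<bar> powr p)"
    proof (rule integrable_bounded_on_K[of _ "B powr p"])
      fix x
      show "\<bar>norm x powr e * \<bar>u x\<bar> powr p\<bar> \<le> B powr p"
      proof (cases "norm x < 1")
        case False
        then have "norm x powr e \<le> 1 powr e" using e0 by (intro powr_mono2') auto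
        moreover have "\<bar>u x\<bar> powr p \<le> B powr p" using B p by (intro powr_mono2) auto
        ultimately have "norm x powr e * \<bar>u x\<bar> powr p \<le> 1 * B powr p" by (intro mult_mono) auto
        then show ?thesis by simp
      qed (simp add: out)
    next
      fix x assume "x \<notin> closure {x. u x \<noteq> 0}"
      then have "u x = 0" by (rule u_0)
      then show "norm x powr e * \<bar>u x\<bar> powr p = 0" by simp
    qed measurable
    then have "AE x in lborel. norm x powr e * \<bar>u x\<bar> powr p = 0"
      using W0 integral_nonneg_eq_0_iff_AE[of lborel "\<lambda>x. norm x powr e * \<bar>u x\<bar> powr p"] unfolding W_def by simp
    then have ae: "AE x in lborel. x \<notin> {x. u x \<noteq> 0}" using AE_lborel_neq_0
    proof eventually_elim
      case (elim x)
      then show ?case by simp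
    qed
    have op: "open {x. u x \<noteq> 0}" by (intro open_Collect_neq continuous_on_const cont_u)
    then have "{x. u x \<noteq> 0} \<in> null_sets lborel" using ae AE_iff_null_sets[of "{x. u x \<noteq> 0}" lborel] by simp
    then have "negligible {x. u x \<noteq> 0}" unfolding negligible_iff_null_sets by (rule null_sets_completionI)
    then have em: "{x. u x \<noteq> 0} = {}" using open_not_negligible[OF op] by metis
    obtain y :: "real^'n" where y: "norm y = sqrt (3/2)" using vector_choose_size[of "sqrt (3/2)"] by auto
    have "u y \<noteq> 0" unfolding u_def y by (simp add: G_def flat_exp_def)
    then show False using em by blast
  qed
  have "0 \<le> W" unfolding W_def by (intro integral_nonneg_AE) auto
  with \<open>W \<noteq> 0\<close> have W: "0 < W powr (2 / p)" by simp
  define E where "E = (\<integral>x. (norm (grad u x))\<^sup>2 \<partial>lborel)"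
  have "E < (E / W powr (2 / p) + 1) * W powr (2 / p)" using W by (simp add: distrib_right)
  then have "S \<le> E / W powr (2 / p) + 1" if "S \<in> Sobolev_bounds TYPE('n) p" for S
    using Sobolev_bounds_le[OF that u] by (simp add: E_def W_def e_def)
  then show ?thesis by (intro bdd_aboveI)
qed

text \<open>The constant is defined by smooth functions, whereas the inequality is wanted for C1
  ones. If a C1 function violated it, it would violate it with some \<open>C\<close> below
  \<open>S_const\<close>; rearrangement would turn it into a smooth radial function doing the same,
  and then \<open>C\<close> would bound every admissible constant. No mollification enters.\<close>

theorem S_const_inequality:
  fixes u :: "real^'n \<Rightarrow> real"
  assumes u: "compact_C1 u g K" and dim: "3 \<le> CARD('n)" and p: "2 < p" "p \<le> 2 * real CARD('n) / (real CARD('n) - 2)"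
  shows "S_const TYPE('n) p * (\<integral>x. norm x powr (p * (real CARD('n) - 2) / 2 - real CARD('n)) * \<bar>u x\<bar> powr p \<partial>lborel) powr (2 / p)
    \<le> (\<integral>x. (norm (g x))\<^sup>2 \<partial>lborel)"
proof (rule ccontr)
  let ?e = "p * (real CARD('n) - 2) / 2 - real CARD('n)"
  define W where "W = (\<integral>x. norm x powr ?e * \<bar>u x\<bar> powr p \<partial>lborel) powr (2 / p)"
  define E where "E = (\<integral>x. (norm (g x))\<^sup>2 \<partial>lborel)"
  have e: "- real DIM(real^'n) < ?e" "?e \<le> 0" using exponent_bounds[OF dim p] dim by auto
  have d: "3 \<le> DIM(real^'n)" and p1: "1 \<le> p" using dim p by auto
  assume "\<not> ?thesis"
  then have l: "E < S_const TYPE('n) p * W" by (simp add: E_def W_def)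
  have "0 \<le> E" unfolding E_def by (intro integral_nonneg_AE) auto
  then have "W \<noteq> 0" using l by auto
  then have W: "0 < W" by (simp add: W_def)
  then have "E / W < S_const TYPE('n) p" using l by (simp add: pos_divide_less_eq)
  then obtain C where C: "E / W < C" "C < S_const TYPE('n) p" using dense by blast
  then have "E < C * W" using W by (simp add: pos_divide_less_eq)
  then obtain G G' Q1 Q2 where G: "radial_test G G' Q1 Q2"
    "(\<integral>z. (norm ((2 * G' ((norm (z::real^'n))\<^sup>2)) *\<^sub>R z))\<^sup>2 \<partial>lborel) < C * (\<integral>z. norm (z::real^'n) powr ?e * \<bar>G ((norm z)\<^sup>2)\<bar> powr p \<partial>lborel) powr (2 / p)"
    unfolding E_def W_def by (rule radial_competitor[OF u d e p1])
  interpret radial_test G G' Q1 Q2 by (rule G(1))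
  have "S \<le> C" if "S \<in> Sobolev_bounds TYPE('n) p" for S
    using Sobolev_bounds_le[OF that test_function_radial] G(2) by (simp add: grad_radial)
  then have "S_const TYPE('n) p \<le> C"
    unfolding S_const_eq using zero_in_Sobolev_bounds by (intro cSup_least) auto
  then show False using C by simp
qed

theorem S_const_radial_approx:
  assumes dim: "3 \<le> CARD('n::finite)" and p: "2 < p" "p \<le> 2 * real CARD('n) / (real CARD('n) - 2)"
    and C: "S_const TYPE('n) p < C"
  obtains G G' Q1 Q2 where "radial_test G G' Q1 Q2"
    "(\<integral>z. (norm ((2 * G' ((norm (z::real^'n))\<^sup>2)) *\<^sub>R z))\<^sup>2 \<partial>lborel) < C * (\<integral>z. norm (z::real^'n) powr (p * (real CARD('n) - 2) / 2 - real CARD('n)) * \<bar>G ((norm z)\<^sup>2)\<bar> powr p \<partial>lborel) powr (2 / p)"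
proof -
  let ?e = "p * (real CARD('n) - 2) / 2 - real CARD('n)"
  have e: "- real DIM(real^'n) < ?e" "?e \<le> 0" using exponent_bounds[OF dim p] dim by auto
  have "C \<notin> Sobolev_bounds TYPE('n) p"
    using C cSup_upper[OF _ exists_Sobolev_upper_bound[OF dim p], of C] by (auto simp: S_const_eq)
  then obtain u where u: "u \<in> test_functions (UNIV :: (real^'n) set)"
     "(\<integral>x. (norm (grad u x))\<^sup>2 \<partial>lborel) < C * (\<integral>x. norm x powr ?e * \<bar>u x\<bar> powr p \<partial>lborel) powr (2 / p)"
    unfolding Sobolev_bounds_def by (auto simp: not_le)
  have d: "3 \<le> DIM(real^'n)" and p1: "1 \<le> p" using dim p by auto
  show ?thesis by (rule radial_competitor[OF test_function_compact_C1[OF u(1)] d e p1 u(2)]) (rule that)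
qed

text \<open>
  The change-of-variables theorem of the library is stated for index types of class \<open>wellorder\<close>;
  an arbitrary finite index type is replaced by a well-ordered copy.
\<close>

typedef ('n::finite) ordered_copy = "{i::nat. i < CARD('n)}"
  by (rule exI[of _ 0]) simp

instantiation ordered_copy :: (finite) linorder
begin
definition "x \<le> y \<longleftrightarrow> Rep_ordered_copy x \<le> Rep_ordered_copy y"
definition "x < y \<longleftrightarrow> Rep_ordered_copy x < Rep_ordered_copy y"
instance
  by standard (auto simp: less_eq_ordered_copy_def less_ordered_copy_def Rep_ordered_copy_inject)
end

instance ordered_copy :: (finite) wellorder
proof
  fix P :: "'a ordered_copy \<Rightarrow> bool" and a :: "'a ordered_copy"
  assume step: "\<And>x. (\<And>y. y < x \<Longrightarrow> P y) \<Longrightarrow> P x"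
  show "P a"
  proof (induction a rule: measure_induct_rule[of Rep_ordered_copy])
    case (less x)
    show ?case
    proof (rule step)
      fix y assume "y < x"
      then show "P y" unfolding less_ordered_copy_def by (rule less)
    qed
  qed
qed

lemma bij_Rep_ordered_copy: "bij_betw (Rep_ordered_copy :: 'n::finite ordered_copy \<Rightarrow> nat) UNIV {i. i < CARD('n)}"
  using type_definition.Rep_range[OF type_definition_ordered_copy]
  by (simp add: bij_betw_def inj_on_def Rep_ordered_copy_inject)

instance ordered_copy :: (finite) finite
proof
  show "finite (UNIV :: 'a ordered_copy set)"
    using bij_betw_finite[OF bij_Rep_ordered_copy[where 'n='a]] by simp
qed

lemma CARD_ordered_copy [simp]: "CARD('n::finite ordered_copy) = CARD('n)"
  using bij_betw_same_card[OF bij_Rep_ordered_copy[where 'n='n]] by simp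

lemma ex_bij_ordered_copy: "\<exists>\<pi> :: 'n::finite ordered_copy \<Rightarrow> 'n. bij \<pi>"
  by (rule finite_same_card_bij) simp_all

section \<open>Change of variables for derivatives that are a multiple of the identity plus a
  rank-one term\<close>

text \<open>Conjugation with an orthogonal map that takes \<open>c\<close> to a multiple of a
  coordinate vector makes the matrix diagonal, with one exceptional entry.\<close>

lemma det_rank_one:
  fixes c :: "real^'n"
  shows "det (matrix (\<lambda>h. a *\<^sub>R h + (b * (c \<bullet> h)) *\<^sub>R c)) = a ^ (CARD('n) - 1) * (a + b * (norm c)\<^sup>2)"
proof -
  define i :: 'n where "i = undefined"
  have n: "norm c = norm (norm c *\<^sub>R (axis i 1 :: real^'n))" by simp
  have "\<exists>T. orthogonal_transformation T \<and> T c = norm c *\<^sub>R (axis i 1 :: real^'n)"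
    by (rule orthogonal_transformation_exists[OF n]) blast
  then obtain T where T: "orthogonal_transformation T" "T c = norm c *\<^sub>R (axis i 1 :: real^'n)" by blast
  have linT: "linear T" using T(1) by (rule orthogonal_transformation_linear)
  define D where "D h = a *\<^sub>R h + (b * (c \<bullet> h)) *\<^sub>R c" for h
  define D' where "D' h = a *\<^sub>R h + (b * (T c \<bullet> h)) *\<^sub>R T c" for h
  have lin: "linear (\<lambda>h. a *\<^sub>R h + (b * (d \<bullet> h)) *\<^sub>R d)" for d :: "real^'n"
    by (rule linearI) (simp_all add: inner_add_right scaleR_add_left scaleR_add_right distrib_left mult.left_commute)
  have "T \<circ> D = D' \<circ> T"
  proof
    fix h
    have "T c \<bullet> T h = c \<bullet> h" using T(1) by (simp add: orthogonal_transformation_def)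
    then show "(T \<circ> D) h = (D' \<circ> T) h"
      by (simp add: D_def D'_def linear_add[OF linT] linear_cmul[OF linT])
  qed
  moreover have "linear D" "linear D'" using lin[of c] lin[of "T c"] by (simp_all add: D_def[abs_def] D'_def[abs_def])
  ultimately have "matrix T ** matrix D = matrix D' ** matrix T"
    using matrix_compose[of D T] matrix_compose[of T D'] linT by simp
  then have "det (matrix T) * det (matrix D) = det (matrix D') * det (matrix T)"
    by (simp only: det_mul[symmetric])
  moreover have "det (matrix T) \<noteq> 0"
    using orthogonal_transformation_det[OF T(1)] by linarith
  ultimately have eq: "det (matrix D) = det (matrix D')" by simp
  have ent: "matrix D' $ j $ k = (if j = k then (if j = i then a + b * (norm c)\<^sup>2 else a) else 0)" for j k
  proof -
    have "T c \<bullet> axis k 1 = (if k = i then norm c else 0)" by (simp add: T(2) inner_axis_axis)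
    then have "matrix D' $ j $ k = a * axis k 1 $ j + (b * (if k = i then norm c else 0)) * (norm c * axis i 1 $ j)"
      by (simp add: matrix_def D'_def T(2))
    then show ?thesis by (simp add: axis_def power2_eq_square)
  qed
  have "det (matrix D') = (\<Prod>j\<in>UNIV. matrix D' $ j $ j)"
    by (rule det_diagonal) (simp add: ent)
  also have "\<dots> = (\<Prod>j\<in>UNIV. if j = i then a + b * (norm c)\<^sup>2 else a)" by (simp add: ent)
  also have "\<dots> = (a + b * (norm c)\<^sup>2) * (\<Prod>j\<in>UNIV - {i}. a)"
    by (subst prod.remove[of _ i]) (auto intro!: arg_cong2[where f = "(*)"] prod.cong)
  also have "(\<Prod>j\<in>UNIV - {i}. a) = a ^ (CARD('n) - 1)" by simp
  finally show ?thesis using eq by (simp add: D_def[abs_def] mult.commute)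
qed

text \<open>Putting the indicator of \<open>S\<close> inside \<open>J\<close> and inside the
  argument of \<open>f\<close> makes each factor measurable on the whole space without changing the
  product.\<close>

lemma borel_measurable_indicator_compose:
  fixes \<Phi> :: "'a::euclidean_space \<Rightarrow> 'b::euclidean_space" and J :: "'a \<Rightarrow> real" and f :: "'b \<Rightarrow> real"
  assumes S: "open S" and J: "continuous_on S J" and \<Phi>: "continuous_on S \<Phi>" and f: "f \<in> borel_measurable borel"
  shows "(\<lambda>x. indicator S x * (J x * f (\<Phi> x))) \<in> borel_measurable borel"
proof -
  note [measurable] = f
  have [measurable]: "S \<in> sets borel" using S by simp
  have 1[measurable]: "(\<lambda>x. indicator S x *\<^sub>R J x) \<in> borel_measurable borel"
    using J by (rule borel_measurable_continuous_on_indicator[rotated]) simp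
  have 2[measurable]: "(\<lambda>x. indicator S x *\<^sub>R \<Phi> x) \<in> borel_measurable borel"
    using \<Phi> by (rule borel_measurable_continuous_on_indicator[rotated]) simp
  have "(\<lambda>x. indicator S x * ((indicator S x *\<^sub>R J x) * f (indicator S x *\<^sub>R \<Phi> x))) \<in> borel_measurable borel"
    by measurable
  also have "(\<lambda>x. indicator S x * ((indicator S x *\<^sub>R J x) * f (indicator S x *\<^sub>R \<Phi> x))) = (\<lambda>x. indicator S x * (J x * f (\<Phi> x)))"
    by (auto simp: fun_eq_iff indicator_def)
  finally show ?thesis .
qed

lemma change_of_variables_wellorder:
  fixes \<Phi> :: "real^'m::{finite,wellorder} \<Rightarrow> real^'m::_" and f :: "real^'m::_ \<Rightarrow> real"
  assumes S: "open S" "open (\<Phi> ` S)" and inj: "inj_on \<Phi> S"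
    and der: "\<And>x. x \<in> S \<Longrightarrow> (\<Phi> has_derivative \<Phi>' x) (at x)"
    and J: "continuous_on S (\<lambda>x. det (matrix (\<Phi>' x)))"
    and f[measurable]: "f \<in> borel_measurable borel"
  shows "integrable lborel (\<lambda>y. indicator (\<Phi> ` S) y * f y) \<longleftrightarrow>
      integrable lborel (\<lambda>x. indicator S x * (\<bar>det (matrix (\<Phi>' x))\<bar> * f (\<Phi> x)))"
    and "(\<integral>y. indicator (\<Phi> ` S) y * f y \<partial>lborel) = (\<integral>x. indicator S x * (\<bar>det (matrix (\<Phi>' x))\<bar> * f (\<Phi> x)) \<partial>lborel)"
proof -
  have Sb[measurable]: "S \<in> sets borel" "\<Phi> ` S \<in> sets borel" using S by auto
  have c\<Phi>: "continuous_on S \<Phi>" using der by (auto intro!: continuous_at_imp_continuous_on has_derivative_continuous)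
  have m1: "(\<lambda>y. indicator (\<Phi> ` S) y * f y) \<in> borel_measurable borel" by measurable
  have m2: "(\<lambda>x. indicator S x * (\<bar>det (matrix (\<Phi>' x))\<bar> * f (\<Phi> x))) \<in> borel_measurable borel"
    by (intro borel_measurable_indicator_compose S c\<Phi> f continuous_intros J)
  have Sl: "S \<in> sets lebesgue" using Sb by simp
  have der': "(\<Phi> has_derivative \<Phi>' x) (at x within S)" if "x \<in> S" for x
    using der[OF that] has_derivative_at_withinI by blast
  have L: "h absolutely_integrable_on A \<longleftrightarrow> integrable lborel (\<lambda>x. indicator A x * h x)"
      "integrable lborel (\<lambda>x. indicator A x * h x) \<Longrightarrow> integral A h = (\<integral>x. indicator A x * h x \<partial>lborel)"
    if m: "(\<lambda>x. indicator A x * h x) \<in> borel_measurable borel" and A: "A \<in> sets borel" for A and h :: "real^'m::{finite,wellorder} \<Rightarrow> real"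
  proof -
    show i: "h absolutely_integrable_on A \<longleftrightarrow> integrable lborel (\<lambda>x. indicator A x * h x)"
      using m by (simp add: set_integrable_def integrable_completion)
    assume "integrable lborel (\<lambda>x. indicator A x * h x)"
    then have "h absolutely_integrable_on A" using i by simp
    from set_lebesgue_integral_eq_integral(2)[OF this] show "integral A h = (\<integral>x. indicator A x * h x \<partial>lborel)"
      using m by (simp add: set_lebesgue_integral_def integral_completion)
  qed
  have key: "(\<lambda>x. \<bar>det (matrix (\<Phi>' x))\<bar> * f (\<Phi> x)) absolutely_integrable_on S \<and> integral S (\<lambda>x. \<bar>det (matrix (\<Phi>' x))\<bar> * f (\<Phi> x)) = b
     \<longleftrightarrow> f absolutely_integrable_on (\<Phi> ` S) \<and> integral (\<Phi> ` S) f = b" for b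
  proof -
    have "(\<lambda>x. \<bar>det (matrix (\<Phi>' x))\<bar> *\<^sub>R vec (f (\<Phi> x)) :: real^1) absolutely_integrable_on S \<and>
        integral S (\<lambda>x. \<bar>det (matrix (\<Phi>' x))\<bar> *\<^sub>R vec (f (\<Phi> x))) = (vec b :: real^1)
       \<longleftrightarrow> (\<lambda>x. vec (f x) :: real^1) absolutely_integrable_on (\<Phi> ` S) \<and> integral (\<Phi> ` S) (\<lambda>x. vec (f x)) = (vec b :: real^1)"
      by (rule has_absolute_integral_change_of_variables[OF Sl der' inj])
    then show ?thesis by (simp add: absolutely_integrable_on_1_iff integral_on_1_eq)
  qed
  note L1 = L[OF m1 Sb(2)] and L2 = L[OF m2 Sb(1)]
  show iff: "integrable lborel (\<lambda>y. indicator (\<Phi> ` S) y * f y) \<longleftrightarrow>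
      integrable lborel (\<lambda>x. indicator S x * (\<bar>det (matrix (\<Phi>' x))\<bar> * f (\<Phi> x)))"
    using key L1(1) L2(1) by blast
  show "(\<integral>y. indicator (\<Phi> ` S) y * f y \<partial>lborel) = (\<integral>x. indicator S x * (\<bar>det (matrix (\<Phi>' x))\<bar> * f (\<Phi> x)) \<partial>lborel)"
  proof (cases "integrable lborel (\<lambda>y. indicator (\<Phi> ` S) y * f y)")
    case True
    then show ?thesis using key[of "integral (\<Phi> ` S) f"] L1 L2 iff by simp
  next
    case False
    then show ?thesis using iff by (simp add: not_integrable_integral_eq)
  qed
qed

lemma prod_Basis_vec: "(\<Prod>b\<in>(Basis :: (real^'n) set). f b) = (\<Prod>i\<in>UNIV. f (axis i 1))"
proof -
  have B: "(Basis :: (real^'n) set) = range (\<lambda>i. axis i 1)" by (auto simp: Basis_vec_def)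
  have "inj (\<lambda>i::'n. axis i (1::real))" by (rule injI) (simp add: axis_eq_axis)
  from prod.reindex[OF this, of f] show ?thesis unfolding B by (simp only: o_def)
qed

text \<open>The inversion and the radial map used below both have derivatives of this form. The
  statement for ordered index types is carried over by the renaming \<open>P\<close> of coordinates
  with inverse \<open>Q\<close>, a linear isometry, which preserves the form of the
  derivative.\<close>

lemma change_of_variables_rank_one:
  fixes \<Phi> c :: "real^'n \<Rightarrow> real^'n" and a b f :: "real^'n \<Rightarrow> real"
  assumes S: "open S" "open (\<Phi> ` S)" and inj: "inj_on \<Phi> S"
    and der: "\<And>x. x \<in> S \<Longrightarrow> (\<Phi> has_derivative (\<lambda>h. a x *\<^sub>R h + (b x * (c x \<bullet> h)) *\<^sub>R c x)) (at x)"
    and cont: "continuous_on S a" "continuous_on S b" "continuous_on S c"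
    and f: "f \<in> borel_measurable borel"
  defines "J \<equiv> \<lambda>x. \<bar>a x ^ (CARD('n) - 1) * (a x + b x * (norm (c x))\<^sup>2)\<bar>"
  shows "integrable lborel (\<lambda>y. indicator (\<Phi> ` S) y * f y) \<longleftrightarrow> integrable lborel (\<lambda>x. indicator S x * (J x * f (\<Phi> x)))"
    and "(\<integral>y. indicator (\<Phi> ` S) y * f y \<partial>lborel) = (\<integral>x. indicator S x * (J x * f (\<Phi> x)) \<partial>lborel)"
proof -
  note [measurable] = f
  obtain \<pi> :: "'n ordered_copy \<Rightarrow> 'n" where \<pi>: "bij \<pi>" using ex_bij_ordered_copy by blast
  define P :: "real^'n \<Rightarrow> real^('n ordered_copy)" where "P x = (\<chi> i. x $ \<pi> i)" for x
  define Q :: "real^('n ordered_copy) \<Rightarrow> real^'n" where "Q y = (\<chi> j. y $ inv \<pi> j)" for y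
  have pi1: "\<pi> (inv \<pi> j) = j" for j using \<pi> by (simp add: bij_is_surj surj_f_inv_f)
  have pi2: "inv \<pi> (\<pi> i) = i" for i using \<pi> by (simp add: bij_is_inj)
  have QP: "Q (P x) = x" for x by (simp add: P_def Q_def vec_eq_iff pi1)
  have PQ: "P (Q y) = y" for y by (simp add: P_def Q_def vec_eq_iff pi2)
  have inn: "P x \<bullet> P y = x \<bullet> y" for x y
    using sum.reindex_bij_betw[OF \<pi>, of "\<lambda>i. x $ i * y $ i"] by (simp add: inner_vec_def P_def)
  have nP: "norm (P x) = norm x" for x by (simp add: norm_eq_sqrt_inner inn)
  have linP: "linear P" by (rule linearI) (simp_all add: P_def vec_eq_iff)
  have linQ: "linear Q" by (rule linearI) (simp_all add: Q_def vec_eq_iff)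
  have blP: "bounded_linear P" "bounded_linear Q" using linP linQ by (simp_all add: linear_conv_bounded_linear)
  have cP: "continuous_on A P" "continuous_on A' Q" for A A' using blP by (simp_all add: linear_continuous_on)
  have [measurable]: "Q \<in> borel_measurable borel" using cP(2) by (rule borel_measurable_continuous_onI)
  have dQ: "distr lborel borel Q = lborel"
  proof (rule lborel_eqI[symmetric])
    fix l u :: "real^'n" assume le: "\<And>b. b \<in> Basis \<Longrightarrow> l \<bullet> b \<le> u \<bullet> b"
    have le': "l $ j \<le> u $ j" for j using le[of "axis j 1"] by (simp add: inner_axis)
    have "Q -` box l u = box (P l) (P u)"
    proof (intro set_eqI)
      fix y
      have "(\<forall>j. l $ j < y $ inv \<pi> j \<and> y $ inv \<pi> j < u $ j) \<longleftrightarrow> (\<forall>i. l $ \<pi> i < y $ i \<and> y $ i < u $ \<pi> i)"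
        using pi1 pi2 by metis
      then show "y \<in> Q -` box l u \<longleftrightarrow> y \<in> box (P l) (P u)" by (simp add: mem_box_cart Q_def P_def)
    qed
    then have "emeasure (distr lborel borel Q) (box l u) = emeasure lborel (box (P l) (P u))"
      by (subst emeasure_distr) simp_all
    also have "\<dots> = (\<Prod>b\<in>Basis. (P u - P l) \<bullet> b)"
    proof (rule emeasure_lborel_box)
      fix b :: "real^'n ordered_copy" assume "b \<in> Basis"
      then obtain i where "b = axis i 1" by (auto simp: Basis_vec_def)
      then show "P l \<bullet> b \<le> P u \<bullet> b" using le' by (simp add: inner_axis P_def)
    qed
    also have "(\<Prod>b\<in>Basis. (P u - P l) \<bullet> b) = (\<Prod>i\<in>UNIV. (u - l) $ \<pi> i)"
      by (simp add: prod_Basis_vec inner_axis P_def)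
    also have "\<dots> = (\<Prod>j\<in>UNIV. (u - l) $ j)" by (rule prod.reindex_bij_betw[OF \<pi>])
    also have "\<dots> = (\<Prod>b\<in>Basis. (u - l) \<bullet> b)" by (simp add: prod_Basis_vec inner_axis)
    finally show "emeasure (distr lborel borel Q) (box l u) = (\<Prod>b\<in>Basis. (u - l) \<bullet> b)" .
  qed simp
  have tr: "integrable lborel (\<lambda>y. F (Q y)) \<longleftrightarrow> integrable lborel F" "(\<integral>y. F (Q y) \<partial>lborel) = (\<integral>x. F x \<partial>lborel)"
    if [measurable]: "F \<in> borel_measurable borel" for F :: "real^'n \<Rightarrow> real"
  proof -
    have "integrable lborel (\<lambda>y. F (Q y)) \<longleftrightarrow> integrable (distr lborel borel Q) F" by (subst integrable_distr_eq) simp_all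
    then show "integrable lborel (\<lambda>y. F (Q y)) \<longleftrightarrow> integrable lborel F" by (simp only: dQ)
    have "(\<integral>x. F x \<partial>distr lborel borel Q) = (\<integral>y. F (Q y) \<partial>lborel)" by (rule integral_distr) simp_all
    then show "(\<integral>y. F (Q y) \<partial>lborel) = (\<integral>x. F x \<partial>lborel)" by (simp only: dQ)
  qed
  have img: "P ` A = Q -` A" for A
  proof (intro set_eqI iffI)
    fix y assume "y \<in> Q -` A"
    then show "y \<in> P ` A" using PQ[of y] by (intro image_eqI[of _ _ "Q y"]) simp_all
  qed (use QP in auto)
  have oP: "open (P ` A)" if "open A" for A
    unfolding img using that cP(2)[of UNIV] by (rule open_vimage)
  define \<Psi> where "\<Psi> y = P (\<Phi> (Q y))" for y
  define \<Psi>' where "\<Psi>' y k = a (Q y) *\<^sub>R k + (b (Q y) * (P (c (Q y)) \<bullet> k)) *\<^sub>R P (c (Q y))" for y k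
  have \<Psi>img: "\<Psi> ` (P ` S) = P ` (\<Phi> ` S)" by (simp add: image_image \<Psi>_def QP)
  have \<Psi>inj: "inj_on \<Psi> (P ` S)"
  proof (rule inj_onI)
    fix y z assume yz: "y \<in> P ` S" "z \<in> P ` S" "\<Psi> y = \<Psi> z"
    from yz(3) have "Q (\<Psi> y) = Q (\<Psi> z)" by simp
    then have "\<Phi> (Q y) = \<Phi> (Q z)" by (simp only: \<Psi>_def QP)
    moreover have "Q y \<in> S" "Q z \<in> S" using yz(1,2) by (simp_all add: img)
    ultimately have "Q y = Q z" by (rule inj_onD[OF inj])
    then have "P (Q y) = P (Q z)" by (rule arg_cong)
    then show "y = z" by (simp only: PQ)
  qed
  have \<Psi>der: "(\<Psi> has_derivative \<Psi>' y) (at y)" if y: "y \<in> P ` S" for y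
  proof -
    have Qy: "Q y \<in> S" using y QP by auto
    have "((\<lambda>y. \<Phi> (Q y)) has_derivative (\<lambda>k. a (Q y) *\<^sub>R Q k + (b (Q y) * (c (Q y) \<bullet> Q k)) *\<^sub>R c (Q y))) (at y)"
      by (rule has_derivative_compose[OF bounded_linear_imp_has_derivative[OF blP(2)] der[OF Qy]])
    from bounded_linear.has_derivative[OF blP(1) this]
    have "(\<Psi> has_derivative (\<lambda>k. P (a (Q y) *\<^sub>R Q k + (b (Q y) * (c (Q y) \<bullet> Q k)) *\<^sub>R c (Q y)))) (at y)"
      by (simp only: \<Psi>_def[abs_def])
    moreover have "P (a (Q y) *\<^sub>R Q k + (b (Q y) * (c (Q y) \<bullet> Q k)) *\<^sub>R c (Q y)) = \<Psi>' y k" for k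
    proof -
      have "c (Q y) \<bullet> Q k = P (c (Q y)) \<bullet> k" using inn[of "c (Q y)" "Q k"] by (simp add: PQ)
      then show ?thesis by (simp add: \<Psi>'_def linear_add[OF linP] linear_cmul[OF linP] PQ)
    qed
    ultimately show ?thesis by simp
  qed
  have det: "det (matrix (\<Psi>' y)) = a (Q y) ^ (CARD('n) - 1) * (a (Q y) + b (Q y) * (norm (c (Q y)))\<^sup>2)" for y
    unfolding \<Psi>'_def[abs_def] by (simp only: det_rank_one nP CARD_ordered_copy)
  have QS: "Q ` (P ` S) \<subseteq> S" using QP by auto
  have Jc: "continuous_on (P ` S) (\<lambda>y. det (matrix (\<Psi>' y)))"
    unfolding det by (intro continuous_intros continuous_on_compose2[OF cont(1) cP(2) QS]
      continuous_on_compose2[OF cont(2) cP(2) QS] continuous_on_compose2[OF cont(3) cP(2) QS])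
  have fQ: "(\<lambda>y. f (Q y)) \<in> borel_measurable borel" by measurable
  note CV = change_of_variables_wellorder[OF oP[OF S(1)] _ \<Psi>inj \<Psi>der Jc fQ, unfolded \<Psi>img, OF oP[OF S(2)]]
  have ind: "indicator (P ` A) y = (indicator A (Q y) :: real)" for A y by (simp add: img indicator_def)
  have c\<Phi>: "continuous_on S \<Phi>" using der by (auto intro!: continuous_at_imp_continuous_on has_derivative_continuous)
  have [measurable]: "\<Phi> ` S \<in> sets borel" using S(2) by simp
  have m1: "(\<lambda>y. indicator (\<Phi> ` S) y * f y) \<in> borel_measurable borel" by measurable
  have m2: "(\<lambda>x. indicator S x * (J x * f (\<Phi> x))) \<in> borel_measurable borel"
    unfolding J_def by (intro borel_measurable_indicator_compose S c\<Phi> f continuous_intros cont)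
  have e2: "indicator (P ` S) y * (\<bar>det (matrix (\<Psi>' y))\<bar> * f (Q (\<Psi> y))) = indicator S (Q y) * (J (Q y) * f (\<Phi> (Q y)))" for y
    by (simp add: ind det J_def \<Psi>_def QP)
  show "integrable lborel (\<lambda>y. indicator (\<Phi> ` S) y * f y) \<longleftrightarrow> integrable lborel (\<lambda>x. indicator S x * (J x * f (\<Phi> x)))"
    using CV(1)[unfolded e2, unfolded ind] tr(1)[OF m1] tr(1)[OF m2] by simp
  show "(\<integral>y. indicator (\<Phi> ` S) y * f y \<partial>lborel) = (\<integral>x. indicator S x * (J x * f (\<Phi> x)) \<partial>lborel)"
    using CV(2)[unfolded e2, unfolded ind] tr(2)[OF m1] tr(2)[OF m2] by simp
qed

section \<open>Extension by zero and the divergence theorem for compactly supported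
  functions\<close>

text \<open>On the open complement of \<open>K\<close> the extended function is zero, and uniqueness
  of derivatives forces \<open>d\<close> to vanish where that complement meets \<open>S\<close>. The
  two pieces of the gradient therefore agree and glue continuously.\<close>

lemma compact_C1_extend:
  fixes f :: "'a::euclidean_space \<Rightarrow> real"
  assumes S: "open S" and K: "compact K" "K \<subseteq> S"
    and der: "\<And>x. x \<in> S \<Longrightarrow> (f has_derivative (\<lambda>h. d x \<bullet> h)) (at x)"
    and cont: "continuous_on S d" and f0: "\<And>x. x \<in> S \<Longrightarrow> x \<notin> K \<Longrightarrow> f x = 0"
  shows "compact_C1 (\<lambda>x. if x \<in> S then f x else 0) (\<lambda>x. if x \<in> S then d x else 0) K"
proof -
  let ?f = "\<lambda>x. if x \<in> S then f x else 0" and ?d = "\<lambda>x. if x \<in> S then d x else 0"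
  have oK: "open (- K)" using K(1) by (simp add: compact_imp_closed open_Compl)
  have z: "?f x = 0" if "x \<notin> K" for x using f0 that by simp
  have d1: "(?f has_derivative (\<lambda>h. ?d x \<bullet> h)) (at x)" if x: "x \<in> S" for x
  proof (rule has_derivative_transform_within_open[OF _ S x])
    show "(f has_derivative (\<lambda>h. ?d x \<bullet> h)) (at x)" using der[OF x] x by simp
  qed simp
  have d2: "(?f has_derivative (\<lambda>h. 0)) (at x)" if x: "x \<in> - K" for x
  proof (rule has_derivative_transform_within_open[OF _ oK x])
    show "((\<lambda>_. 0) has_derivative (\<lambda>h. 0)) (at x)" by simp
  qed (use z in simp)
  have d0: "?d x = 0" if x: "x \<notin> K" for x
  proof (cases "x \<in> S")
    case True
    have "(\<lambda>h. ?d x \<bullet> h) = (\<lambda>h. 0)" using has_derivative_unique[OF d1[OF True] d2] x by simp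
    then have "?d x \<bullet> ?d x = 0" by (rule fun_cong)
    then show ?thesis by simp
  qed simp
  show ?thesis
  proof
    fix x show "(?f has_derivative (\<lambda>h. ?d x \<bullet> h)) (at x)"
    proof (cases "x \<in> S")
      case False
      then have xK: "x \<in> - K" using K(2) by auto
      have "(\<lambda>h. ?d x \<bullet> h) = (\<lambda>h. 0)" using False by simp
      then show ?thesis using d2[OF xK] by (simp only:)
    qed (rule d1)
  next
    have "continuous_on S ?d" using cont by (rule continuous_on_eq) simp
    moreover have "continuous_on (- K) ?d" by (rule continuous_on_eq[of _ "\<lambda>_. 0"]) (simp_all add: d0)
    ultimately have "continuous_on (S \<union> - K) ?d" using S oK by (intro continuous_on_open_Un)
    moreover have "S \<union> - K = UNIV" using K(2) by auto
    ultimately show "continuous_on UNIV ?d" by simp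
  qed (use K z d0 in \<open>simp_all\<close>)
qed

context compact_C1
begin

lemma integrable_continuous:
  assumes "continuous_on UNIV f" "\<And>x. x \<notin> K \<Longrightarrow> f x = 0"
  shows "integrable lborel (f :: 'a \<Rightarrow> real)"
proof -
  obtain B where "0 < B" "\<And>x. norm (f x) \<le> B" using compact_support_bounded[OF assms] by blast
  then show ?thesis using assms borel_measurable_continuous_onI[OF assms(1)]
    by (intro integrable_bounded_on_K[of f B]) simp_all
qed

text \<open>By translation invariance every difference quotient has integral 0. A Lipschitz bound
  and a common compact support allow dominated convergence to the directional derivative.\<close>

lemma integral_directional_derivative: "(\<integral>x. g x \<bullet> e \<partial>lborel) = 0"
proof -
  define t where "t k = inverse (real (Suc k))" for k
  have t: "0 < t k" "t k \<le> 1" for k by (simp_all add: t_def field_simps)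
  have t0: "t \<longlonglongrightarrow> 0" unfolding t_def by (rule LIMSEQ_inverse_real_of_nat)
  define F where "F k x = (u (x + t k *\<^sub>R e) - u x) / t k" for k x
  have iu: "integrable lborel u" using cont_u u_0 by (rule integrable_continuous)
  have ish: "integrable lborel (\<lambda>x. u (x + c))" "(\<integral>x. u (x + c) \<partial>lborel) = (\<integral>x. u x \<partial>lborel)" for c
  proof -
    have d: "distr lborel borel ((+) c) = (lborel :: 'a measure)" by (rule lborel_distr_plus)
    have "integrable (distr lborel borel ((+) c)) u" using iu d by simp
    then show "integrable lborel (\<lambda>x. u (x + c))" by (subst (asm) integrable_distr_eq) (simp_all add: add.commute)
    have "(\<integral>x. u x \<partial>distr lborel borel ((+) c)) = (\<integral>x. u (c + x) \<partial>lborel)" by (rule integral_distr) simp_all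
    then show "(\<integral>x. u (x + c) \<partial>lborel) = (\<integral>x. u x \<partial>lborel)" by (simp only: d add.commute)
  qed
  have F0: "(\<integral>x. F k x \<partial>lborel) = 0" for k
    unfolding F_def using ish iu by simp
  obtain L where L: "0 < L" "\<And>x. norm (g x) \<le> L" using compact_support_bounded[OF cont_g g_0] by blast
  define K1 where "K1 = {x + y |x y. x \<in> K \<and> y \<in> cball 0 (norm e)}"
  have K1: "compact K1" unfolding K1_def by (intro compact_sums compact_K compact_cball)
  have lip: "\<bar>u y - u x\<bar> \<le> L * norm (y - x)" for x y
  proof -
    have "norm (u y - u x) \<le> L * norm (y - x)"
    proof (rule differentiable_bound[of UNIV u "\<lambda>x h. g x \<bullet> h"])
      fix x :: 'a
      have "norm (g x \<bullet> h) \<le> L * norm h" for h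
        using Cauchy_Schwarz_ineq2[of "g x" h] mult_right_mono[OF L(2)[of x], of "norm h"] by simp
      then show "onorm (\<lambda>h. g x \<bullet> h) \<le> L" using L(1) by (intro onorm_bound) simp_all
    qed (simp_all add: deriv)
    then show ?thesis by simp
  qed
  have bound: "norm (F k x) \<le> L * norm e * indicator K1 x" for k x
  proof (cases "x \<in> K1")
    case True
    have "\<bar>u (x + t k *\<^sub>R e) - u x\<bar> \<le> L * norm e * t k" using lip[of "x + t k *\<^sub>R e" x] t[of k] by (simp add: mult_ac)
    then show ?thesis using True t[of k] by (simp add: F_def pos_divide_le_eq)
  next
    case False
    have "x \<notin> K" using False unfolding K1_def by (auto intro!: exI[of _ x] exI[of _ 0])
    moreover have "x + t k *\<^sub>R e \<notin> K"
    proof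
      assume "x + t k *\<^sub>R e \<in> K"
      then have "x + t k *\<^sub>R e + (- (t k *\<^sub>R e)) \<in> K1"
        using t[of k] unfolding K1_def
        by (intro CollectI exI[of _ "x + t k *\<^sub>R e"] exI[of _ "- (t k *\<^sub>R e)"] conjI refl) (simp_all add: mult_left_le_one_le)
      then show False using False by simp
    qed
    ultimately show ?thesis using False u_0 by (simp add: F_def)
  qed
  have lim: "(\<lambda>k. F k x) \<longlonglongrightarrow> g x \<bullet> e" for x
  proof -
    have l: "((\<lambda>s. s *\<^sub>R e) has_derivative (\<lambda>s. s *\<^sub>R e)) (at 0)" by (auto intro!: derivative_eq_intros)
    have "((\<lambda>s::real. x + s *\<^sub>R e) has_derivative (\<lambda>s. 0 + s *\<^sub>R e)) (at 0)" by (intro has_derivative_add has_derivative_const l)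
    from has_derivative_compose[OF this, of u "\<lambda>h. g x \<bullet> h"] deriv[of x]
    have "((\<lambda>s::real. u (x + s *\<^sub>R e)) has_real_derivative g x \<bullet> e) (at 0)"
      by (simp add: has_field_derivative_def mult.commute mult_commute_abs)
    then have "((\<lambda>s. (u (x + s *\<^sub>R e) - u x) / s) \<longlongrightarrow> g x \<bullet> e) (at 0)"
      by (simp add: DERIV_def)
    moreover have "filterlim t (at 0) sequentially" using t0 t by (intro filterlim_atI) (auto intro!: always_eventually simp: less_imp_neq[symmetric])
    ultimately show ?thesis unfolding F_def by (rule filterlim_compose)
  qed
  have "(\<lambda>k. \<integral>x. F k x \<partial>lborel) \<longlonglongrightarrow> (\<integral>x. g x \<bullet> e \<partial>lborel)"
  proof (rule integral_dominated_convergence[where w = "\<lambda>x. L * norm e * indicator K1 x"])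
    show "integrable lborel (\<lambda>x. L * norm e * indicator K1 x)"
      using K1 emeasure_compact_finite[OF K1] borel_compact[OF K1] by (intro integrable_mult_right integrable_real_indicator) simp_all
    have [measurable]: "u \<in> borel_measurable borel" by (rule u_measurable)
    show "F k \<in> borel_measurable lborel" for k unfolding F_def by measurable
  qed (use lim bound in simp_all)
  then show ?thesis using F0 by (simp add: LIMSEQ_const_iff)
qed

end

text \<open>The divergence theorem for the vector field \<open>\<psi> x\<close> times
  \<open>x\<close>, one coordinate at a time.\<close>

lemma integral_divergence_position:
  assumes "compact_C1 \<psi> d K"
  shows "(\<integral>x. real DIM('a) * \<psi> x + d x \<bullet> (x::'a::euclidean_space) \<partial>lborel) = 0"
    and "integrable lborel (\<lambda>x::'a. real DIM('a) * \<psi> x + d x \<bullet> x)"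
proof -
  interpret compact_C1 \<psi> d K by fact
  have b: "(\<integral>x. \<psi> x + (x \<bullet> b) * (d x \<bullet> b) \<partial>lborel) = 0" "integrable lborel (\<lambda>x. \<psi> x + (x \<bullet> b) * (d x \<bullet> b))" if "b \<in> Basis" for b
  proof -
    have C: "compact_C1 (\<lambda>x. \<psi> x * (x \<bullet> b)) (\<lambda>x. \<psi> x *\<^sub>R b + (x \<bullet> b) *\<^sub>R d x) K"
    proof
      fix x
      have D: "((\<lambda>x. \<psi> x * (x \<bullet> b)) has_derivative (\<lambda>h. \<psi> x * (h \<bullet> b) + (d x \<bullet> h) * (x \<bullet> b))) (at x)"
        by (intro has_derivative_mult deriv) (auto intro!: derivative_eq_intros)
      show "((\<lambda>x. \<psi> x * (x \<bullet> b)) has_derivative (\<lambda>h. (\<psi> x *\<^sub>R b + (x \<bullet> b) *\<^sub>R d x) \<bullet> h)) (at x)"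
      proof -
        have "(\<psi> x *\<^sub>R b + (x \<bullet> b) *\<^sub>R d x) \<bullet> h = \<psi> x * (h \<bullet> b) + (d x \<bullet> h) * (x \<bullet> b)" for h
          by (simp add: inner_add_left inner_commute[of b h])
        then show ?thesis using D by simp
      qed
    qed (use compact_K u_0 g_0 cont_u cont_g in \<open>auto intro!: continuous_intros\<close>)
    have e: "(\<psi> x *\<^sub>R b + (x \<bullet> b) *\<^sub>R d x) \<bullet> b = \<psi> x + (x \<bullet> b) * (d x \<bullet> b)" for x
      using that by (simp add: inner_add_left)
    show "(\<integral>x. \<psi> x + (x \<bullet> b) * (d x \<bullet> b) \<partial>lborel) = 0"
      using compact_C1.integral_directional_derivative[OF C, of b] by (simp only: e)
    show "integrable lborel (\<lambda>x. \<psi> x + (x \<bullet> b) * (d x \<bullet> b))"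
      by (rule integrable_continuous) (use u_0 g_0 cont_u cont_g in \<open>auto intro!: continuous_intros\<close>)
  qed
  have s: "real DIM('a) * \<psi> x + d x \<bullet> x = (\<Sum>b\<in>Basis. \<psi> x + (x \<bullet> b) * (d x \<bullet> b))" for x
    by (simp add: sum.distrib euclidean_inner[of "d x" x] mult.commute)
  show "(\<integral>x. real DIM('a) * \<psi> x + d x \<bullet> x \<partial>lborel) = 0" unfolding s using b by (subst Bochner_Integration.integral_sum) simp_all
  show "integrable lborel (\<lambda>x. real DIM('a) * \<psi> x + d x \<bullet> x)" unfolding s using b by (intro Bochner_Integration.integrable_sum)
qed

section \<open>The ball model and its isometries\<close>

definition conf :: "real^'n \<Rightarrow> real" where "conf x = 2 / (1 - (norm x)\<^sup>2)"

lemma in_unit_ball: "x \<in> ball 0 1 \<Longrightarrow> (norm (x::real^'n))\<^sup>2 < 1"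
  by (simp add: abs_square_less_1)

lemma conf_pos: "x \<in> ball 0 1 \<Longrightarrow> 0 < conf x"
  using in_unit_ball by (auto simp: conf_def)

lemma conf_measurable[measurable]: "conf \<in> borel_measurable borel" unfolding conf_def[abs_def] by measurable

lemma hyp_volume_integral:
  fixes F :: "real^'n \<Rightarrow> real"
  assumes [measurable]: "F \<in> borel_measurable borel"
  shows "(\<integral>x. F x \<partial>hyp_volume) = (\<integral>x. indicator (ball 0 1) x * (conf x ^ CARD('n) * F x) \<partial>lborel)"
    and "integrable hyp_volume F \<longleftrightarrow> integrable lborel (\<lambda>x. indicator (ball 0 1) x * (conf x ^ CARD('n) * F x))"
proof -
  have nn: "0 \<le> indicator (ball 0 1) x * conf x ^ CARD('n)" for x :: "real^'n"
    using conf_pos[of x] by (auto simp: indicator_def)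
  have d: "hyp_volume = density lborel (\<lambda>x::real^'n. ennreal (indicator (ball 0 1) x * conf x ^ CARD('n)))"
    by (simp add: hyp_volume_def conf_def)
  have [measurable]: "ball (0::real^'n) 1 \<in> sets borel" by simp
  have m: "(\<lambda>x::real^'n. indicator (ball 0 1) x * conf x ^ CARD('n)) \<in> borel_measurable borel" by measurable
  show "(\<integral>x. F x \<partial>hyp_volume) = (\<integral>x. indicator (ball 0 1) x * (conf x ^ CARD('n) * F x) \<partial>lborel)"
    unfolding d by (subst integral_density) (simp_all add: nn m mult.assoc)
  show "integrable hyp_volume F \<longleftrightarrow> integrable lborel (\<lambda>x. indicator (ball 0 1) x * (conf x ^ CARD('n) * F x))"
    unfolding d by (subst integrable_density) (simp_all add: nn m mult.assoc)
qed

lemma hyp_volume_integral_cong: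
  fixes F G :: "real^'n \<Rightarrow> real"
  assumes "F \<in> borel_measurable borel" "G \<in> borel_measurable borel" "\<And>x. x \<in> ball 0 1 \<Longrightarrow> F x = G x"
  shows "(\<integral>x. F x \<partial>hyp_volume) = (\<integral>x. G x \<partial>hyp_volume)"
  unfolding hyp_volume_integral(1)[OF assms(1)] hyp_volume_integral(1)[OF assms(2)]
  by (intro Bochner_Integration.integral_cong refl) (auto simp: indicator_def assms(3))

lemma hyp_dist_measurable[measurable]: "(\<lambda>x. hyp_dist x a) \<in> borel_measurable borel"
  unfolding hyp_dist_def arcosh_def by measurable

lemma hyp_norm_grad:
  assumes "x \<in> ball 0 1"
  shows "(hyp_norm x (hyp_grad v x))\<^sup>2 = ((norm (grad v x)) / conf x)\<^sup>2"
proof -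
  have c: "conf x \<noteq> 0" using conf_pos[OF assms] by simp
  have i: "(1 - (norm x)\<^sup>2) / 2 = inverse (conf x)" by (simp add: conf_def)
  have "hyp_metric x (hyp_grad v x) (hyp_grad v x) = (conf x)\<^sup>2 * ((inverse (conf x))\<^sup>2 * ((inverse (conf x))\<^sup>2 * (grad v x \<bullet> grad v x)))"
    unfolding hyp_metric_def hyp_grad_def i by (simp add: conf_def)
  also have "\<dots> = (norm (grad v x) / conf x)\<^sup>2"
    unfolding dot_square_norm using c by (simp add: power_divide power2_eq_square field_simps)
  finally show ?thesis by (simp add: hyp_norm_def power_divide)
qed

lemma hardy_deficit_eq:
  fixes v :: "real^'n \<Rightarrow> real"
  assumes "compact_C1 v g K"
  shows "hardy_deficit a v = (\<integral>x. (norm (g x) / conf x)\<^sup>2 \<partial>hyp_volume) - ((real CARD('n) - 2) / 2)\<^sup>2 * (\<integral>x. (v x)\<^sup>2 / (hyp_dist x a)\<^sup>2 \<partial>hyp_volume)"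
proof -
  interpret compact_C1 v g K by fact
  have [simp]: "grad v = g" using grad_eqI[OF deriv] by auto
  have m1: "(\<lambda>x. (norm (g x) / conf x)\<^sup>2) \<in> borel_measurable borel" by measurable
  have m2: "(\<lambda>x. (hyp_norm x (hyp_grad v x))\<^sup>2) \<in> borel_measurable borel"
    unfolding hyp_norm_def hyp_metric_def hyp_grad_def by simp
  show ?thesis unfolding hardy_deficit_def
    by (subst hyp_volume_integral_cong[OF m2 m1]) (simp_all add: hyp_norm_grad)
qed

definition weighted_density :: "real \<Rightarrow> real \<Rightarrow> real \<Rightarrow> nat \<Rightarrow> real \<Rightarrow> real" where
  "weighted_density p \<alpha> d n t = sinh d powr (p * (real n - 2) / 2 - real n) * X (\<alpha> * tanh (d / 2)) powr ((p + 2) / 2) * \<bar>t\<bar> powr p"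

lemma weighted_density_measurable[measurable]:
  "d \<in> borel_measurable M \<Longrightarrow> v \<in> borel_measurable M \<Longrightarrow> (\<lambda>x. weighted_density p \<alpha> (d x) n (v x)) \<in> borel_measurable M"
proof -
  have "sinh \<in> borel_measurable (borel :: real measure)" "tanh \<in> borel_measurable (borel :: real measure)"
    by (auto intro!: borel_measurable_continuous_onI continuous_intros)
  note [measurable] = this
  assume [measurable]: "d \<in> borel_measurable M" "v \<in> borel_measurable M"
  show ?thesis unfolding weighted_density_def X_def by measurable
qed

lemma weighted_term_eq:
  "weighted_term p \<alpha> a (v :: real^'n \<Rightarrow> real) = (\<integral>x. weighted_density p \<alpha> (hyp_dist x a) CARD('n) (v x) \<partial>hyp_volume) powr (2 / p)"
  by (simp add: weighted_term_def weighted_density_def)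

text \<open>Collects what the later arguments use of an isometry taking \<open>a\<close> to the
  origin. It is an involution, so one map transports in both directions. Invariance is asked for
  functions supported away from \<open>a\<close>; smoothness is asked for \<open>|I x|^2\<close>,
  through which radial functions are transported.\<close>

definition ball_isometry :: "(real^'n \<Rightarrow> real^'n) \<Rightarrow> real^'n \<Rightarrow> bool" where
  "ball_isometry I a \<longleftrightarrow> (\<forall>x\<in>ball 0 1. I x \<in> ball 0 1 \<and> I (I x) = x) \<and> continuous_on (ball 0 1) I \<and> I a = 0 \<and>
     smooth_on (ball 0 1) (\<lambda>x. (norm (I x))\<^sup>2) \<and>
     (\<forall>v g K. compact_C1 v g K \<longrightarrow> K \<subseteq> ball 0 1 - {a} \<longrightarrow>
       (\<exists>g'. compact_C1 (\<lambda>x. if x \<in> ball 0 1 then v (I x) else 0) g' (I ` K) \<and>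
         hardy_deficit a v = hardy_deficit 0 (\<lambda>x. if x \<in> ball 0 1 then v (I x) else 0) \<and>
         (\<forall>p \<alpha>. weighted_term p \<alpha> a v = weighted_term p \<alpha> 0 (\<lambda>x. if x \<in> ball 0 1 then v (I x) else 0))))"

lemma norm_add_sq: "(norm (x + y))\<^sup>2 = (norm x)\<^sup>2 + 2 * (x \<bullet> y) + (norm (y::'a::real_inner))\<^sup>2"
  by (simp add: power2_norm_eq_inner inner_add_left inner_add_right inner_commute)

lemma norm_diff_sq: "(norm (x - y))\<^sup>2 = (norm x)\<^sup>2 - 2 * (x \<bullet> y) + (norm (y::'a::real_inner))\<^sup>2"
  by (simp add: power2_norm_eq_inner inner_diff_left inner_diff_right inner_commute)

text \<open>The inversion in the sphere with centre \<open>a / |a|\<^sup>2\<close> orthogonal to the unit sphere is a hyperbolic isometry that exchanges \<open>a\<close> and the origin.\<close>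

locale inversion =
  fixes a :: "real^'n"
  assumes a: "a \<noteq> 0" "norm a < 1"
begin

definition "A = (norm a)\<^sup>2"
definition "b = (1 / A) *\<^sub>R a"
definition "\<rho> = (1 - A) / A"
definition "\<mu> x = \<rho> / (norm (x - b))\<^sup>2"
definition "I x = b + \<mu> x *\<^sub>R (x - b)"

lemma A: "0 < A" "A < 1" using a by (simp_all add: A_def abs_square_less_1)

lemma \<rho>_pos: "0 < \<rho>" using A by (simp add: \<rho>_def)

lemma norm_b: "(norm b)\<^sup>2 = 1 + \<rho>"
  unfolding b_def norm_scaleR power_mult_distrib A_def[symmetric]
  using A by (simp add: \<rho>_def field_simps power2_eq_square)

lemma b_notin: "x \<in> ball 0 1 \<Longrightarrow> x \<noteq> b"
proof
  assume "x \<in> ball 0 1" "x = b"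
  then have "(norm b)\<^sup>2 < 1" using in_unit_ball by blast
  then show False using norm_b \<rho>_pos by simp
qed

context
  fixes x assumes x: "x \<noteq> b"
begin

lemma N: "0 < (norm (x - b))\<^sup>2" using x by simp

lemma \<mu>_pos: "0 < \<mu> x" unfolding \<mu>_def using N \<rho>_pos by (intro divide_pos_pos)

lemma \<mu>N: "\<mu> x * (norm (x - b))\<^sup>2 = \<rho>" unfolding \<mu>_def using N by simp

lemma I_I: "I (I x) = x"
proof -
  have e: "I x - b = \<mu> x *\<^sub>R (x - b)" by (simp add: I_def)
  have "(norm (I x - b))\<^sup>2 = \<mu> x * \<rho>" unfolding e using \<mu>N by (simp add: power_mult_distrib power2_eq_square[of "\<mu> x"] mult.assoc)
  then have "\<mu> (I x) = 1 / \<mu> x" unfolding \<mu>_def[of "I x"] using \<rho>_pos by simp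
  then show ?thesis using \<mu>_pos by (simp add: I_def[of "I x"] e)
qed

text \<open>The relation \<open>|b|^2 = 1 + \<rho>\<close>, orthogonality of the two spheres,
  cancels the constant term and leaves a multiple of \<open>\<mu> x\<close>. The identity shows that
  the ball is preserved and that the conformal factor changes by \<open>\<mu>\<close>.\<close>

lemma one_minus_norm_I: "1 - (norm (I x))\<^sup>2 = \<mu> x * (1 - (norm x)\<^sup>2)"
proof -
  have x': "x = b + (x - b)" by simp
  have 1: "(norm (I x))\<^sup>2 = (1 + \<rho>) + 2 * \<mu> x * (b \<bullet> (x - b)) + \<mu> x * \<rho>"
    unfolding I_def norm_add_sq norm_b using \<mu>N by (simp add: power_mult_distrib power2_eq_square[of "\<mu> x"] mult.assoc)
  have 2: "(norm x)\<^sup>2 = (1 + \<rho>) + 2 * (b \<bullet> (x - b)) + (norm (x - b))\<^sup>2"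
    by (subst x', subst norm_add_sq) (simp add: norm_b)
  have "\<mu> x * (1 - (norm x)\<^sup>2) = - \<mu> x * \<rho> - 2 * \<mu> x * (b \<bullet> (x - b)) - \<mu> x * (norm (x - b))\<^sup>2"
    unfolding 2 by (simp add: algebra_simps)
  then show ?thesis unfolding 1 \<mu>N by simp
qed

lemma norm_I: "(norm (I x))\<^sup>2 = 1 - \<rho> * (1 - (norm x)\<^sup>2) * ((norm (x - b))\<^sup>2) powr (- 1)"
proof -
  have "\<mu> x = \<rho> * ((norm (x - b))\<^sup>2) powr (- 1)" using N by (simp add: \<mu>_def powr_minus divide_inverse)
  moreover have "(norm (I x))\<^sup>2 = 1 - \<mu> x * (1 - (norm x)\<^sup>2)" using one_minus_norm_I by linarith
  ultimately show ?thesis by (simp only: mult_ac)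
qed

text \<open>The derivative is \<open>\<mu> x\<close> times the reflection in the hyperplane
  orthogonal to \<open>x - b\<close>: its determinant is, up to sign, the n-th power of
  \<open>\<mu> x\<close>, and it scales gradients by \<open>\<mu> x\<close>.\<close>

lemma deriv_I:
  "(I has_derivative (\<lambda>h. \<mu> x *\<^sub>R h + ((- 2 * \<mu> x / (norm (x - b))\<^sup>2) * ((x - b) \<bullet> h)) *\<^sub>R (x - b))) (at x)"
proof -
  have d: "((\<lambda>x. (norm (x - b))\<^sup>2) has_derivative (\<lambda>h. 2 * ((x - b) \<bullet> h))) (at x)"
    unfolding power2_norm_eq_inner by (auto intro!: derivative_eq_intros simp: inner_commute)
  have "((\<lambda>s. \<rho> / s) has_real_derivative - \<rho> / ((norm (x - b))\<^sup>2)\<^sup>2) (at ((norm (x - b))\<^sup>2))"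
    using N by (auto intro!: derivative_eq_intros simp: power2_eq_square)
  from has_derivative_compose[OF d this[unfolded has_field_derivative_def]]
  have m: "(\<mu> has_derivative (\<lambda>h. - \<rho> / ((norm (x - b))\<^sup>2)\<^sup>2 * (2 * ((x - b) \<bullet> h)))) (at x)"
    by (simp add: \<mu>_def[abs_def])
  have "(I has_derivative (\<lambda>h. 0 + (\<mu> x *\<^sub>R (h - 0) + (- \<rho> / ((norm (x - b))\<^sup>2)\<^sup>2 * (2 * ((x - b) \<bullet> h))) *\<^sub>R (x - b)))) (at x)"
    unfolding I_def[abs_def] by (intro has_derivative_add has_derivative_const has_derivative_scaleR m has_derivative_diff has_derivative_ident)
  moreover have "- \<rho> / ((norm (x - b))\<^sup>2)\<^sup>2 * (2 * ((x - b) \<bullet> h)) = (- 2 * \<mu> x / (norm (x - b))\<^sup>2) * ((x - b) \<bullet> h)" for h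
    by (simp add: \<mu>_def power2_eq_square)
  ultimately show ?thesis by simp
qed

text \<open>Both distances are the same function of a quotient:
  \<open>|x - a|^2 / ((1 - |x|^2) (1 - |a|^2))\<close> equals
  \<open>|I x|^2 / (1 - |I x|^2)\<close>, as one sees after multiplying numerator and denominator by
  \<open>\<mu> x\<close>.\<close>

lemma hyp_dist_I:
  assumes "x \<in> ball 0 1"
  shows "hyp_dist x a = hyp_dist (I x) 0"
proof -
  have xb: "1 - (norm x)\<^sup>2 \<noteq> 0" using in_unit_ball[OF assms] by simp
  have "A * (norm (x - b))\<^sup>2 = A * (norm x)\<^sup>2 - 2 * (x \<bullet> a) + 1"
  proof -
    have "A * (x \<bullet> b) = x \<bullet> a" "A + A * \<rho> = 1" using A by (simp_all add: b_def \<rho>_def)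
    then show ?thesis unfolding norm_diff_sq norm_b by (simp add: algebra_simps)
  qed
  moreover have "(norm (x - a))\<^sup>2 = (norm x)\<^sup>2 - 2 * (x \<bullet> a) + A" by (simp add: norm_diff_sq A_def)
  ultimately have e: "(norm (x - a))\<^sup>2 = A * (norm (x - b))\<^sup>2 - (1 - A) * (1 - (norm x)\<^sup>2)" by (simp add: algebra_simps)
  have "A * \<rho> = 1 - A" using A by (simp add: \<rho>_def)
  have "\<mu> x * (norm (x - a))\<^sup>2 = (1 - A) * (1 - \<mu> x * (1 - (norm x)\<^sup>2))"
  proof -
    have "\<mu> x * (A * (norm (x - b))\<^sup>2 - (1 - A) * (1 - (norm x)\<^sup>2)) = A * (\<mu> x * (norm (x - b))\<^sup>2) - (1 - A) * (\<mu> x * (1 - (norm x)\<^sup>2))"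
      by (simp add: algebra_simps)
    then show ?thesis unfolding e \<mu>N \<open>A * \<rho> = 1 - A\<close> by (simp add: right_diff_distrib)
  qed
  also have "1 - \<mu> x * (1 - (norm x)\<^sup>2) = (norm (I x))\<^sup>2" using one_minus_norm_I by simp
  finally have k: "\<mu> x * (norm (x - a))\<^sup>2 = (1 - A) * (norm (I x))\<^sup>2" .
  have "(norm (x - a))\<^sup>2 / ((1 - (norm x)\<^sup>2) * (1 - A)) = (\<mu> x * (norm (x - a))\<^sup>2) / ((\<mu> x * (1 - (norm x)\<^sup>2)) * (1 - A))"
    using \<mu>_pos by simp
  also have "\<dots> = (norm (I x))\<^sup>2 / (1 - (norm (I x))\<^sup>2)" unfolding k one_minus_norm_I using A by simp
  finally show ?thesis by (simp add: hyp_dist_def A_def[symmetric] flip: times_divide_eq_right)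
qed

end

lemma I_ball: "x \<in> ball 0 1 \<Longrightarrow> I x \<in> ball 0 1"
proof -
  assume x: "x \<in> ball 0 1"
  have "0 < \<mu> x * (1 - (norm x)\<^sup>2)" using \<mu>_pos[OF b_notin[OF x]] in_unit_ball[OF x] by simp
  then have "(norm (I x))\<^sup>2 < 1\<^sup>2" using one_minus_norm_I[OF b_notin[OF x]] by simp
  then show ?thesis using power2_less_imp_less[of "norm (I x)" 1] by simp
qed

lemma I_I_ball: "x \<in> ball 0 1 \<Longrightarrow> I (I x) = x" by (rule I_I[OF b_notin])

lemma I_image: "I ` ball 0 1 = ball 0 1"
proof (intro equalityI subsetI)
  fix x :: "real^'n" assume "x \<in> I ` ball 0 1" then show "x \<in> ball 0 1" using I_ball by blast
next
  fix x :: "real^'n" assume x: "x \<in> ball 0 1"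
  then show "x \<in> I ` ball 0 1" using I_ball I_I_ball by (intro image_eqI[of _ _ "I x"]) simp_all
qed

lemma I_a: "I a = 0"
proof -
  have aA: "a \<in> ball 0 1" using a by simp
  have "hyp_dist a a = hyp_dist (I a) 0" by (rule hyp_dist_I[OF b_notin[OF aA] aA])
  have e: "a - b = (- \<rho>) *\<^sub>R a" using A by (simp add: b_def \<rho>_def scaleR_left_diff_distrib diff_divide_distrib)
  have "\<mu> a = 1 / (\<rho> * A)" unfolding \<mu>_def e using \<rho>_pos by (simp add: power_mult_distrib A_def power2_eq_square)
  then have "I a = (1 / A) *\<^sub>R a - (1 / (\<rho> * A) * \<rho>) *\<^sub>R a" unfolding I_def e by (simp add: b_def)
  then show ?thesis using \<rho>_pos by simp
qed

lemma conf_I: "x \<in> ball 0 1 \<Longrightarrow> \<mu> x * conf (I x) = conf x"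
proof -
  assume x: "x \<in> ball 0 1"
  have "\<mu> x \<noteq> 0" using \<mu>_pos[OF b_notin[OF x]] by simp
  then show ?thesis unfolding conf_def one_minus_norm_I[OF b_notin[OF x]] by simp
qed

lemma cont_\<mu>: "continuous_on (ball 0 1) \<mu>" unfolding \<mu>_def
  using b_notin by (intro continuous_intros) auto

lemma cont_I: "continuous_on (ball 0 1) I" unfolding I_def
  by (intro continuous_intros cont_\<mu>)

lemma I_measurable[measurable]: "I \<in> borel_measurable borel"
  unfolding I_def[abs_def] \<mu>_def[abs_def] by measurable

text \<open>The absolute Jacobian is \<open>\<mu> x ^ n\<close>, and by \<open>conf_I\<close> this
  is exactly the ratio of the volume densities at \<open>x\<close> and \<open>I x\<close>.\<close>

lemma hyp_integral_invariant:
  fixes F :: "real^'n \<Rightarrow> real"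
  assumes [measurable]: "F \<in> borel_measurable borel"
  shows "(\<integral>x. F x \<partial>hyp_volume) = (\<integral>x. F (I x) \<partial>hyp_volume)"
proof -
  let ?B = "ball 0 1 :: (real^'n) set"
  have inj: "inj_on I ?B" by (rule inj_on_inverseI[of _ I]) (rule I_I_ball)
  have f: "(\<lambda>y. conf y ^ CARD('n) * F y) \<in> borel_measurable borel" by measurable
  have c: "continuous_on ?B (\<lambda>x. - 2 * \<mu> x / (norm (x - b))\<^sup>2)" using b_notin by (intro continuous_intros cont_\<mu>) auto
  have o: "open (I ` ?B)" unfolding I_image by simp
  have c2: "continuous_on ?B (\<lambda>x. x - b)" by (intro continuous_intros)
  have CV: "(\<integral>y. indicator ?B y * (conf y ^ CARD('n) * F y) \<partial>lborel) = (\<integral>x. indicator ?B x * (\<bar>\<mu> x ^ (CARD('n) - 1) *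
      (\<mu> x + - 2 * \<mu> x / (norm (x - b))\<^sup>2 * (norm (x - b))\<^sup>2)\<bar> * (conf (I x) ^ CARD('n) * F (I x))) \<partial>lborel)"
    using change_of_variables_rank_one(2)[of ?B I \<mu> "\<lambda>x. - 2 * \<mu> x / (norm (x - b))\<^sup>2" "\<lambda>x. x - b",
      OF open_ball o inj deriv_I[OF b_notin] cont_\<mu> c c2 f]
    unfolding I_image .
  have FI: "(\<lambda>x. F (I x)) \<in> borel_measurable borel" by measurable
  have n: "CARD('n) = Suc (CARD('n) - 1)" by simp
  have "(\<integral>x. F x \<partial>hyp_volume) = (\<integral>y. indicator ?B y * (conf y ^ CARD('n) * F y) \<partial>lborel)"
    by (rule hyp_volume_integral(1)) fact
  also have "\<dots> = (\<integral>x. indicator ?B x * (conf x ^ CARD('n) * F (I x)) \<partial>lborel)"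
    unfolding CV
  proof (intro Bochner_Integration.integral_cong refl)
    fix x
    show "indicator ?B x * (\<bar>\<mu> x ^ (CARD('n) - 1) * (\<mu> x + - 2 * \<mu> x / (norm (x - b))\<^sup>2 * (norm (x - b))\<^sup>2)\<bar> * (conf (I x) ^ CARD('n) * F (I x)))
       = indicator ?B x * (conf x ^ CARD('n) * F (I x))"
    proof (cases "x \<in> ?B")
      case True
      note xb = b_notin[OF True]
      have "\<mu> x + - 2 * \<mu> x / (norm (x - b))\<^sup>2 * (norm (x - b))\<^sup>2 = - \<mu> x" using N[OF xb] by simp
      then have "\<bar>\<mu> x ^ (CARD('n) - 1) * (\<mu> x + - 2 * \<mu> x / (norm (x - b))\<^sup>2 * (norm (x - b))\<^sup>2)\<bar> = \<mu> x ^ CARD('n)"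
        using \<mu>_pos[OF xb] by (subst (2) n) (simp only: abs_mult abs_minus_cancel power_Suc mult.commute power_abs abs_of_pos)
      then show ?thesis using conf_I[OF True] by (simp flip: power_mult_distrib mult.assoc)
    qed simp
  qed
  also have "\<dots> = (\<integral>x. F (I x) \<partial>hyp_volume)" by (rule hyp_volume_integral(1)[OF FI, symmetric])
  finally show ?thesis .
qed

lemma ball_isometry_inversion: "ball_isometry I a"
  unfolding ball_isometry_def
proof (intro conjI ballI allI impI)
  let ?B = "ball 0 1 :: (real^'n) set"
  have lin: "smooth_on ?B (\<lambda>x. (norm (x - c))\<^sup>2)" for c :: "real^'n"
    using smooth_on_norm_sq[of c] smooth_on_subset by blast
  have pos: "(\<lambda>x. (norm (x - b))\<^sup>2) ` ?B \<subseteq> {0<..}" using N[OF b_notin] by auto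
  have "smooth_on ?B (\<lambda>x. 1 - \<rho> * (1 - (norm (x - 0))\<^sup>2) * ((norm (x - b))\<^sup>2) powr (- 1))"
    by (rule smooth_on_diff[OF open_ball smooth_on_const[OF open_ball]], rule smooth_on_mult[OF open_ball],
      rule smooth_on_mult[OF open_ball smooth_on_const[OF open_ball]], rule smooth_on_diff[OF open_ball smooth_on_const[OF open_ball] lin],
      rule smooth_on_compose[OF open_ball open_greaterThan smooth_on_powr lin pos])
  then show "smooth_on ?B (\<lambda>x. (norm (I x))\<^sup>2)"
    using smooth_on_cong[OF open_ball, of 0 1 "\<lambda>x. (norm (I x))\<^sup>2" "\<lambda>x. 1 - \<rho> * (1 - (norm (x - 0))\<^sup>2) * ((norm (x - b))\<^sup>2) powr (- 1)"]
      norm_I[OF b_notin] by simp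
  fix v g K assume C: "compact_C1 v g K" and K: "K \<subseteq> ?B - {a}"
  interpret compact_C1 v g K by (rule C)
  define d where "d x = \<mu> x *\<^sub>R g (I x) + ((- 2 * \<mu> x / (norm (x - b))\<^sup>2) * ((x - b) \<bullet> g (I x))) *\<^sub>R (x - b)" for x
  define v' where "v' x = (if x \<in> ?B then v (I x) else 0)" for x
  define g' where "g' x = (if x \<in> ?B then d x else 0)" for x
  have C': "compact_C1 v' g' (I ` K)" unfolding v'_def[abs_def] g'_def[abs_def]
  proof (rule compact_C1_extend)
    show "compact (I ` K)" using compact_K K by (intro compact_continuous_image continuous_on_subset[OF cont_I]) auto
    show "I ` K \<subseteq> ?B" using K I_ball by auto
    fix x assume x: "x \<in> ?B"
    have "((\<lambda>x. v (I x)) has_derivative (\<lambda>h. g (I x) \<bullet> (\<mu> x *\<^sub>R h + ((- 2 * \<mu> x / (norm (x - b))\<^sup>2) * ((x - b) \<bullet> h)) *\<^sub>R (x - b)))) (at x)"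
      by (rule has_derivative_compose[OF deriv_I[OF b_notin[OF x]] deriv])
    moreover have "g (I x) \<bullet> (\<mu> x *\<^sub>R h + ((- 2 * \<mu> x / (norm (x - b))\<^sup>2) * ((x - b) \<bullet> h)) *\<^sub>R (x - b)) = d x \<bullet> h" for h
      unfolding d_def inner_add_left inner_add_right inner_scaleR_left inner_scaleR_right inner_commute[of "g (I x)" "x - b"] by (simp only: mult_ac)
    ultimately show "((\<lambda>x. v (I x)) has_derivative (\<lambda>h. d x \<bullet> h)) (at x)" by simp
    assume "x \<notin> I ` K"
    then have "I x \<notin> K" using I_I_ball[OF x] by (metis image_eqI)
    then show "v (I x) = 0" by (rule u_0)
  next
    have gI: "continuous_on ?B (\<lambda>x. g (I x))" by (rule continuous_on_compose2[OF cont_g cont_I]) simp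
    show "continuous_on ?B d" unfolding d_def using b_notin by (intro continuous_intros gI cont_\<mu>) auto
  qed simp
  interpret C': compact_C1 v' g' "I ` K" by (rule C')
  have ng: "norm (g' x) / conf x = norm (g (I x)) / conf (I x)" if x: "x \<in> ?B" for x
  proof -
    note xb = b_notin[OF x]
    have "(norm (d x))\<^sup>2 = (\<mu> x)\<^sup>2 * (norm (g (I x)))\<^sup>2"
    proof -
      define y where "y = x - b"
      define t where "t = y \<bullet> g (I x)"
      define M where "M = (norm y)\<^sup>2"
      have M: "M \<noteq> 0" using N[OF xb] by (simp add: M_def y_def)
      \<comment> \<open>The reflection at work: in the expansion of the squared norm the cross term
        and the square of the second summand cancel, since
        \<open>k * M = - 2 * \<mu> x * t\<close>.\<close>
      define k where "k = - 2 * \<mu> x / M * t"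
      have kM: "k * M = - 2 * \<mu> x * t" using M by (simp add: k_def)
      have dd: "d x = \<mu> x *\<^sub>R g (I x) + k *\<^sub>R y" by (simp add: d_def y_def t_def M_def k_def)
      have "(norm (d x))\<^sup>2 = (\<mu> x)\<^sup>2 * (norm (g (I x)))\<^sup>2 + (2 * \<mu> x * t * k + k * (k * M))"
        unfolding dd norm_add_sq by (simp add: power_mult_distrib M_def t_def inner_commute power2_eq_square[of k])
      also have "2 * \<mu> x * t * k + k * (k * M) = 0" unfolding kM by simp
      finally show ?thesis by simp
    qed
    then have "(norm (d x))\<^sup>2 = (\<mu> x * norm (g (I x)))\<^sup>2" by (simp add: power_mult_distrib)
    then have "norm (d x) = \<mu> x * norm (g (I x))" using \<mu>_pos[OF xb] by (simp add: power2_eq_iff_nonneg)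
    then show ?thesis using \<mu>_pos[OF xb] x by (simp add: g'_def flip: conf_I[OF x])
  qed
  have m1: "(\<lambda>x. (norm (g x) / conf x)\<^sup>2) \<in> borel_measurable borel" "(\<lambda>x. (norm (g' x) / conf x)\<^sup>2) \<in> borel_measurable borel"
    "(\<lambda>x. (norm (g (I x)) / conf (I x))\<^sup>2) \<in> borel_measurable borel" by measurable
  have m2: "(\<lambda>x. (v x)\<^sup>2 / (hyp_dist x a)\<^sup>2) \<in> borel_measurable borel" "(\<lambda>x. (v' x)\<^sup>2 / (hyp_dist x 0)\<^sup>2) \<in> borel_measurable borel"
    "(\<lambda>x. (v (I x))\<^sup>2 / (hyp_dist (I x) a)\<^sup>2) \<in> borel_measurable borel" by measurable
  have dI: "hyp_dist (I x) a = hyp_dist x 0" if "x \<in> ?B" for x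
    using hyp_dist_I[OF b_notin[OF I_ball[OF that]] I_ball[OF that]] I_I_ball[OF that] by simp
  have h: "hardy_deficit a v = hardy_deficit 0 v'"
    unfolding hardy_deficit_eq[OF C] hardy_deficit_eq[OF C'] hyp_integral_invariant[OF m1(1)] hyp_integral_invariant[OF m2(1)]
    using hyp_volume_integral_cong[OF m1(3) m1(2)] hyp_volume_integral_cong[OF m2(3) m2(2)] ng dI
    by (simp add: v'_def)
  have w: "weighted_term p \<alpha> a v = weighted_term p \<alpha> 0 v'" for p \<alpha>
  proof -
    have m3: "(\<lambda>x. weighted_density p \<alpha> (hyp_dist x a) CARD('n) (v x)) \<in> borel_measurable borel"
      "(\<lambda>x. weighted_density p \<alpha> (hyp_dist (I x) a) CARD('n) (v (I x))) \<in> borel_measurable borel"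
      "(\<lambda>x. weighted_density p \<alpha> (hyp_dist x 0) CARD('n) (v' x)) \<in> borel_measurable borel" by measurable
    show ?thesis unfolding weighted_term_eq hyp_integral_invariant[OF m3(1)]
      using hyp_volume_integral_cong[OF m3(2) m3(3)] dI by (simp add: v'_def)
  qed
  show "\<exists>g'. compact_C1 (\<lambda>x. if x \<in> ?B then v (I x) else 0) g' (I ` K) \<and>
         hardy_deficit a v = hardy_deficit 0 (\<lambda>x. if x \<in> ?B then v (I x) else 0) \<and>
         (\<forall>p \<alpha>. weighted_term p \<alpha> a v = weighted_term p \<alpha> 0 (\<lambda>x. if x \<in> ?B then v (I x) else 0))"
    using C' h w unfolding v'_def[abs_def] by blast
qed (use I_ball I_I_ball cont_I I_a in simp_all)

end

lemma ball_isometry_exists: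
  fixes a :: "real^'n"
  assumes "a \<in> ball 0 1"
  obtains I where "ball_isometry I a"
proof (cases "a = 0")
  case True
  have "ball_isometry (\<lambda>x. x) (0 :: real^'n)" unfolding ball_isometry_def
  proof (intro conjI ballI allI impI)
    show "smooth_on (ball 0 1) (\<lambda>x::real^'n. (norm x)\<^sup>2)"
      using smooth_on_norm_sq[of "0::real^'n"] smooth_on_subset[of UNIV _ "ball 0 1"] by simp
    fix v g K assume C: "compact_C1 v g K" and K: "K \<subseteq> ball (0 :: real^'n) 1 - {0}"
    have "v x = 0" if "x \<notin> ball 0 1" for x using compact_C1.u_0[OF C, of x] K that by blast
    then have e: "(\<lambda>x. if x \<in> ball 0 1 then v x else 0) = v" by (simp add: fun_eq_iff)
    show "\<exists>g'. compact_C1 (\<lambda>x. if x \<in> ball 0 1 then v x else 0) g' ((\<lambda>x. x) ` K) \<and>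
         hardy_deficit 0 v = hardy_deficit 0 (\<lambda>x. if x \<in> ball 0 1 then v x else 0) \<and>
         (\<forall>p \<alpha>. weighted_term p \<alpha> 0 v = weighted_term p \<alpha> 0 (\<lambda>x. if x \<in> ball 0 1 then v x else 0))"
      unfolding e using C by (intro exI[of _ g]) simp
  qed simp_all
  then show ?thesis using that True by simp
next
  case False
  then interpret inversion a by unfold_locales (use assms in simp_all)
  show ?thesis using that ball_isometry_inversion by blast
qed

section \<open>The ground state substitution and the Hardy potential\<close>

text \<open>The ground state substitution \<open>y = (sinh \<rho>)\<^bsup>(n-2)/2\<^esup> v\<close>, with gradient \<open>(sinh \<rho>)\<^bsup>(n-2)/2\<^esup> (\<nabla>v + v k x)\<close>, in terms of \<open>q = |x|\<^sup>2\<close>.\<close>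

definition gs_coeff :: "real \<Rightarrow> real \<Rightarrow> real" where
  "gs_coeff h q = h * (1 + q) / (q * (1 - q))"

text \<open>As a function of the distance this is \<open>h^2 * coth^2 + h\<close>. The ground state
  \<open>f = sinh powr (- h)\<close> of the distance satisfies
  \<open>- Laplacian f = gs_potential * f\<close> in dimension \<open>2 * h + 2\<close>.\<close>

definition gs_potential :: "real \<Rightarrow> real \<Rightarrow> real" where
  "gs_potential h q = h\<^sup>2 * (1 + q)\<^sup>2 / (4 * q) + h"

lemma has_derivative_norm_sq_comp:
  fixes x :: "'a::real_inner"
  assumes "(\<phi> has_real_derivative D) (at ((norm x)\<^sup>2))"
  shows "((\<lambda>x. \<phi> ((norm x)\<^sup>2)) has_derivative (\<lambda>h. (2 * D) * (x \<bullet> h))) (at x)"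
proof -
  have "((\<lambda>x::'a. (norm x)\<^sup>2) has_derivative (\<lambda>h. 2 * (x \<bullet> h))) (at x)"
    unfolding power2_norm_eq_inner by (auto intro!: derivative_eq_intros simp: inner_commute)
  from has_derivative_compose[OF this assms[unfolded has_field_derivative_def]] show ?thesis by (simp add: mult_ac)
qed

text \<open>The Riccati identity of the ground state. The first two terms are the divergence of the
  flux \<open>\<beta> (|x|^2)\<close> times \<open>x\<close> at \<open>q = |x|^2\<close>; the
  subtracted square is what completing the square leaves over. The identity is verified after
  multiplication by \<open>q * (1 - q)^2\<close>.\<close>

lemma ground_state_flux_divergence:
  fixes q h :: real and n :: nat
  assumes q: "0 < q" "q < 1" and n: "real n = 2 * h + 2" "2 \<le> n"
  defines "\<beta> \<equiv> \<lambda>q. (2 / (1 - q)) ^ (n - 2) * gs_coeff h q"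
  shows "\<exists>D. (\<beta> has_real_derivative D) (at q) \<and>
     real n * \<beta> q + 2 * q * D - (2 / (1 - q)) ^ (n - 2) * (gs_coeff h q)\<^sup>2 * q = (2 / (1 - q)) ^ n * gs_potential h q"
proof -
  define m where "m = (2 / (1 - q)) ^ (n - 2)"
  define k' where "k' = h * (q\<^sup>2 + 2 * q - 1) / (q\<^sup>2 * (1 - q)\<^sup>2)"
  have nz: "q \<noteq> 0" "1 - q \<noteq> 0" using q by auto
  have dk: "(gs_coeff h has_real_derivative k') (at q)"
  proof -
    have "((\<lambda>q. h * (1 + q) / (q * (1 - q))) has_real_derivative (h * (q * (1 - q)) - h * (1 + q) * (1 * (1 - q) + q * (- 1))) / (q * (1 - q))\<^sup>2) (at q)"
      using nz by (auto intro!: derivative_eq_intros simp: power2_eq_square)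
    also have "(h * (q * (1 - q)) - h * (1 + q) * (1 * (1 - q) + q * (- 1))) / (q * (1 - q))\<^sup>2 = k'"
      by (simp add: k'_def power_mult_distrib) (simp add: algebra_simps power2_eq_square)
    finally show ?thesis by (simp add: gs_coeff_def[abs_def])
  qed
  have dm: "((\<lambda>q. (2 / (1 - q)) ^ (n - 2)) has_real_derivative m * (2 * h / (1 - q))) (at q)"
  proof -
    have d1: "((\<lambda>q. 2 / (1 - q)) has_real_derivative (2 / (1 - q)) * (1 / (1 - q))) (at q)"
      using nz by (auto intro!: derivative_eq_intros simp: power2_eq_square)
    have "((\<lambda>q. (2 / (1 - q)) ^ (n - 2)) has_real_derivative real (n - 2) * (((2 / (1 - q)) * (1 / (1 - q))) * (2 / (1 - q)) ^ (n - 2 - Suc 0))) (at q)"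
      by (rule DERIV_power[OF d1])
    moreover have "real (n - 2) * (((2 / (1 - q)) * (1 / (1 - q))) * (2 / (1 - q)) ^ (n - 2 - Suc 0)) = m * (2 * h / (1 - q))"
    proof (cases "n - 2")
      case 0
      then have "h = 0" using n by simp
      then show ?thesis by (simp add: 0)
    next
      case (Suc j)
      have "real (n - 2) = 2 * h" using n by (simp add: of_nat_diff)
      moreover have "m = (2 / (1 - q)) * (2 / (1 - q)) ^ (n - 2 - Suc 0)" unfolding m_def Suc by simp
      ultimately show ?thesis by simp
    qed
    ultimately show ?thesis by simp
  qed
  define k where "k = gs_coeff h q"
  have "(\<beta> has_real_derivative m * (2 * h / (1 - q)) * k + k' * m) (at q)"
    unfolding \<beta>_def k_def m_def by (rule DERIV_mult[OF dm[unfolded m_def] dk])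
  moreover have "real n * \<beta> q + 2 * q * (m * (2 * h / (1 - q)) * k + k' * m) - (2 / (1 - q)) ^ (n - 2) * (gs_coeff h q)\<^sup>2 * q = (2 / (1 - q)) ^ n * gs_potential h q"
  proof -
    have mn: "(2 / (1 - q)) ^ n = m * (4 / (1 - q)\<^sup>2)"
    proof -
      have "n = (n - 2) + 2" using n(2) by simp
      then have "(2 / (1 - q)) ^ n = m * (2 / (1 - q))\<^sup>2" unfolding m_def by (metis power_add)
      then show ?thesis by (simp add: power_divide)
    qed
    define w where "w = 1 - q"
    have w: "w \<noteq> 0" "q = 1 - w" "w \<noteq> 1" using nz by (auto simp: w_def)
    have "(2 * h + 2) * k + 2 * q * (2 * h / w * k + k') - k\<^sup>2 * q = 4 / w\<^sup>2 * gs_potential h q"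
    proof -
      have k: "k = h * (1 + q) / (q * w)" by (simp add: k_def gs_coeff_def w_def)
      have k'w: "k' = h * (q\<^sup>2 + 2 * q - 1) / (q\<^sup>2 * w\<^sup>2)" by (simp add: k'_def w_def)
      have e1: "q * w\<^sup>2 * ((2 * h + 2) * k) = (2 * h + 2) * h * (1 + q) * w" using nz w(1) by (simp add: k power2_eq_square)
      have e2: "q * w\<^sup>2 * (2 * q * (2 * h / w * k)) = 4 * h\<^sup>2 * q * (1 + q)" using nz w(1) by (simp add: k power2_eq_square)
      have e3: "q * w\<^sup>2 * (2 * q * k') = 2 * h * (q\<^sup>2 + 2 * q - 1)" using nz w(1) by (simp add: k'w power2_eq_square)
      have e4: "q * w\<^sup>2 * (k\<^sup>2 * q) = h\<^sup>2 * (1 + q)\<^sup>2" using nz w(1) by (simp add: k power2_eq_square)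
      have e5: "q * w\<^sup>2 * (4 / w\<^sup>2 * gs_potential h q) = h\<^sup>2 * (1 + q)\<^sup>2 + 4 * h * q" using nz w(1) by (simp add: gs_potential_def distrib_left)
      have "q * w\<^sup>2 * ((2 * h + 2) * k + 2 * q * (2 * h / w * k + k') - k\<^sup>2 * q)
         = (2 * h + 2) * h * (1 + q) * w + 4 * h\<^sup>2 * q * (1 + q) + 2 * h * (q\<^sup>2 + 2 * q - 1) - h\<^sup>2 * (1 + q)\<^sup>2"
        unfolding e1[symmetric] e2[symmetric] e3[symmetric] e4[symmetric] by (simp only: right_diff_distrib distrib_left add.assoc)
      also have "\<dots> = h\<^sup>2 * (1 + q)\<^sup>2 + 4 * h * q" unfolding w_def by (simp add: power2_eq_square algebra_simps)
      finally have "q * w\<^sup>2 * ((2 * h + 2) * k + 2 * q * (2 * h / w * k + k') - k\<^sup>2 * q) = q * w\<^sup>2 * (4 / w\<^sup>2 * gs_potential h q)" unfolding e5 .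
      moreover have "q * w\<^sup>2 \<noteq> 0" using nz w(1) by simp
      ultimately show ?thesis by (metis mult_left_cancel)
    qed
    then have "m * ((2 * h + 2) * k + 2 * q * (2 * h / w * k + k') - k\<^sup>2 * q) = m * (4 / w\<^sup>2 * gs_potential h q)" by simp
    moreover have "(2 / w) ^ n = m * (4 / w\<^sup>2)" "(2 / w) ^ (n - 2) = m" using mn by (simp_all add: m_def w_def)
    ultimately show ?thesis unfolding \<beta>_def k_def[symmetric] n(1) w_def[symmetric]
      by (simp add: algebra_simps)
  qed
  ultimately show ?thesis by blast
qed

lemma integrable_compact_in_open:
  fixes F :: "'a::euclidean_space \<Rightarrow> real"
  assumes S: "open S" and K: "compact K" "K \<subseteq> S" and F: "continuous_on S F" "\<And>x. x \<in> S \<Longrightarrow> x \<notin> K \<Longrightarrow> F x = 0"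
  shows "integrable lborel (\<lambda>x. indicator S x * F x)"
proof -
  have "compact (F ` K)" by (rule compact_continuous_image[OF continuous_on_subset[OF F(1) K(2)] K(1)])
  then obtain B where B: "\<And>x. x \<in> K \<Longrightarrow> norm (F x) \<le> B" using compact_imp_bounded[of "F ` K"] by (auto simp: bounded_iff)
  have m: "(\<lambda>x. indicator S x * F x) \<in> borel_measurable borel"
    using borel_measurable_continuous_on_indicator[OF _ F(1)] S by simp
  show ?thesis
  proof (rule Bochner_Integration.integrable_bound[of _ "\<lambda>x. B * indicator K x"])
    show "integrable lborel (\<lambda>x. B * indicator K x)"
      using borel_compact[OF K(1)] emeasure_compact_finite[OF K(1)] by (intro integrable_mult_right integrable_real_indicator) simp_all
    show "AE x in lborel. norm (indicator S x * F x) \<le> norm (B * indicator K x)"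
    proof (rule AE_I2)
      fix x
      show "norm (indicator S x * F x) \<le> norm (B * indicator K x)"
        using order_trans[OF B[of x] abs_ge_self] F(2)[of x] K(2) by (cases "x \<in> K"; cases "x \<in> S") auto
    qed
  qed (use m in simp)
qed

definition punctured :: "(real^'n) set" where "punctured = ball 0 1 - {0}"

lemma open_punctured: "open punctured" by (simp add: punctured_def open_delete)

lemma punctured_norm: "x \<in> punctured \<Longrightarrow> 0 < (norm x)\<^sup>2 \<and> (norm x)\<^sup>2 < 1 \<and> 0 < norm x \<and> norm x < 1"
  using in_unit_ball[of x] by (auto simp: punctured_def)

lemma conf_continuous: "continuous_on (punctured :: (real^'n) set) conf"
  unfolding conf_def by (intro continuous_intros) (use punctured_norm in force)

lemma gs_coeff_continuous: "continuous_on (punctured :: (real^'n) set) (\<lambda>x. gs_coeff h ((norm x)\<^sup>2))"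
  unfolding gs_coeff_def by (intro continuous_intros) (use punctured_norm in force)

lemma gs_potential_continuous: "continuous_on (punctured :: (real^'n) set) (\<lambda>x. gs_potential h ((norm x)\<^sup>2))"
  unfolding gs_potential_def by (intro continuous_intros) (use punctured_norm in force)

lemma hyp_volume_integral_punctured:
  fixes F :: "real^'n \<Rightarrow> real"
  assumes "F \<in> borel_measurable borel" "F 0 = 0"
  shows "(\<integral>x. F x \<partial>hyp_volume) = (\<integral>x. indicator punctured x * (conf x ^ CARD('n) * F x) \<partial>lborel)"
    and "integrable hyp_volume F \<longleftrightarrow> integrable lborel (\<lambda>x. indicator punctured x * (conf x ^ CARD('n) * F x))"
proof -
  have e: "indicator (ball 0 1) x * (conf x ^ CARD('n) * F x) = indicator punctured x * (conf x ^ CARD('n) * F x)" for x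
    using assms(2) by (auto simp: indicator_def punctured_def)
  show "(\<integral>x. F x \<partial>hyp_volume) = (\<integral>x. indicator punctured x * (conf x ^ CARD('n) * F x) \<partial>lborel)"
    using hyp_volume_integral(1)[OF assms(1)] by (simp only: e)
  show "integrable hyp_volume F \<longleftrightarrow> integrable lborel (\<lambda>x. indicator punctured x * (conf x ^ CARD('n) * F x))"
    using hyp_volume_integral(2)[OF assms(1)] by (simp only: e)
qed

text \<open>For the last two claims, \<open>h^2 * (coth^2 - 1 / d^2)\<close> at distance
  \<open>d\<close> lies between 0 and \<open>h^2\<close>, by \<open>sinh d \<le> d * cosh d\<close>
  and \<open>d \<le> sinh d\<close>. The lower bound serves the inequality; the upper one bounds the
  error in the sharpness argument by a multiple of the square integral.\<close>

lemma hyp_dist_bounds: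
  fixes x :: "real^'n"
  assumes x: "x \<in> punctured"
  shows "0 < hyp_dist x 0" "sinh (hyp_dist x 0) = norm x * conf x" "tanh (hyp_dist x 0 / 2) = norm x"
    "0 \<le> gs_potential h ((norm x)\<^sup>2) - h\<^sup>2 / (hyp_dist x 0)\<^sup>2 - h"
    "gs_potential h ((norm x)\<^sup>2) - h\<^sup>2 / (hyp_dist x 0)\<^sup>2 \<le> h\<^sup>2 + h"
proof -
  define r where "r = norm x"
  have r: "0 < r" "r < 1" using punctured_norm[OF x] by (simp_all add: r_def)
  have r2: "r\<^sup>2 < 1" using r by (simp add: abs_square_less_1)
  define \<rho> where "\<rho> = hyp_dist x 0"
  have \<rho>: "\<rho> = ln ((1 + r) / (1 - r))" using hyp_dist_zero[of x] x by (simp add: \<rho>_def r_def punctured_def)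
  have "1 < (1 + r) / (1 - r)" using r by simp
  then show p: "0 < hyp_dist x 0" using \<rho> by (simp add: \<rho>_def)
  have ep: "exp \<rho> = (1 + r) / (1 - r)" using r by (simp add: \<rho>)
  have em: "exp (- \<rho>) = (1 - r) / (1 + r)" by (simp add: exp_minus ep)
  have f: "1 - r\<^sup>2 = (1 - r) * (1 + r)" by (simp add: power2_eq_square algebra_simps)
  have sh: "sinh \<rho> = 2 * r / (1 - r\<^sup>2)"
    unfolding sinh_field_def ep em f using r by (simp add: divide_simps) (simp add: algebra_simps)
  have ch: "cosh \<rho> = (1 + r\<^sup>2) / (1 - r\<^sup>2)"
    unfolding cosh_field_def ep em f using r by (simp add: divide_simps) (simp add: power2_eq_square algebra_simps)
  show "sinh (hyp_dist x 0) = norm x * conf x" using sh by (simp add: \<rho>_def r_def conf_def)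
  have "tanh (\<rho> / 2) = (exp \<rho> - 1) / (exp \<rho> + 1)"
  proof -
    define E where "E = exp (\<rho> / 2)"
    have E: "0 < E" by (simp add: E_def)
    have e1: "exp \<rho> = E * E" by (simp add: E_def flip: exp_add)
    have e2: "exp (- (\<rho> / 2)) = 1 / E" by (simp add: E_def exp_minus inverse_eq_divide)
    have "tanh (\<rho> / 2) = ((E - 1 / E) / 2) / ((E + 1 / E) / 2)"
      unfolding tanh_def sinh_field_def cosh_field_def e2 E_def ..
    also have "\<dots> = (E * (E - 1 / E)) / (E * (E + 1 / E))"
    proof -
      have "(a / 2) / (b / 2) = (E * a) / (E * b)" for a b using E by simp
      then show ?thesis .
    qed
    also have "\<dots> = (E * E - 1) / (E * E + 1)" using E by (simp add: distrib_left right_diff_distrib)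
    finally show ?thesis unfolding e1 .
  qed
  also have "\<dots> = r" unfolding ep using r by (simp add: divide_simps)
  finally show "tanh (hyp_dist x 0 / 2) = norm x" by (simp add: \<rho>_def r_def)
  have \<rho>0: "0 < \<rho>" using p by (simp add: \<rho>_def)
  have s: "0 < sinh \<rho>" using \<rho>0 by simp
  have s1: "\<rho> \<le> sinh \<rho>"
  proof -
    have "sinh 0 - 0 \<le> sinh \<rho> - \<rho>"
    proof (rule DERIV_nonneg_imp_nondecreasing[of 0 \<rho> "\<lambda>t. sinh t - t"])
      fix t :: real
      have "((\<lambda>t. sinh t - t) has_real_derivative cosh t - 1) (at t)" by (auto intro!: derivative_eq_intros)
      then show "\<exists>y. ((\<lambda>t. sinh t - t) has_real_derivative y) (at t) \<and> 0 \<le> y" using cosh_real_ge_1[of t] by auto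
    qed (use \<rho>0 in simp)
    then show ?thesis by simp
  qed
  have s2: "sinh \<rho> \<le> \<rho> * cosh \<rho>"
  proof -
    have "0 * cosh 0 - sinh 0 \<le> \<rho> * cosh \<rho> - sinh \<rho>"
    proof (rule DERIV_nonneg_imp_nondecreasing[of 0 \<rho> "\<lambda>t. t * cosh t - sinh t"])
      fix t :: real assume t: "0 \<le> t"
      have "((\<lambda>t. t * cosh t - sinh t) has_real_derivative t * sinh t) (at t)" by (auto intro!: derivative_eq_intros)
      then show "\<exists>y. ((\<lambda>t. t * cosh t - sinh t) has_real_derivative y) (at t) \<and> 0 \<le> y" using t by auto
    qed (use \<rho>0 in simp)
    then show ?thesis by simp
  qed
  have g: "gs_potential h (r\<^sup>2) = h\<^sup>2 * ((cosh \<rho>)\<^sup>2 / (sinh \<rho>)\<^sup>2) + h"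
    using r r2 by (simp add: gs_potential_def sh ch power_divide power_mult_distrib)
  have cs: "(cosh \<rho>)\<^sup>2 = (sinh \<rho>)\<^sup>2 + 1" by (rule cosh_square_eq)
  have "1 / \<rho>\<^sup>2 \<le> (cosh \<rho>)\<^sup>2 / (sinh \<rho>)\<^sup>2"
  proof -
    have "1 / \<rho> \<le> cosh \<rho> / sinh \<rho>" using s2 s \<rho>0 by (simp add: divide_simps mult.commute)
    then have "(1 / \<rho>)\<^sup>2 \<le> (cosh \<rho> / sinh \<rho>)\<^sup>2" using \<rho>0 by (intro power_mono) auto
    then show ?thesis by (simp add: power_divide)
  qed
  then have "h\<^sup>2 * (1 / \<rho>\<^sup>2) \<le> h\<^sup>2 * ((cosh \<rho>)\<^sup>2 / (sinh \<rho>)\<^sup>2)" by (rule mult_left_mono) simp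
  then show "0 \<le> gs_potential h ((norm x)\<^sup>2) - h\<^sup>2 / (hyp_dist x 0)\<^sup>2 - h"
    unfolding r_def[symmetric] \<rho>_def[symmetric] g by simp
  have "(cosh \<rho>)\<^sup>2 / (sinh \<rho>)\<^sup>2 = 1 + 1 / (sinh \<rho>)\<^sup>2" unfolding cs using s by (simp add: add_divide_distrib)
  moreover have "1 / (sinh \<rho>)\<^sup>2 \<le> 1 / \<rho>\<^sup>2" using s1 \<rho>0 by (intro divide_left_mono power_mono) auto
  ultimately have "(cosh \<rho>)\<^sup>2 / (sinh \<rho>)\<^sup>2 \<le> 1 + 1 / \<rho>\<^sup>2" by simp
  then have "h\<^sup>2 * ((cosh \<rho>)\<^sup>2 / (sinh \<rho>)\<^sup>2) \<le> h\<^sup>2 * (1 + 1 / \<rho>\<^sup>2)" by (rule mult_left_mono) simp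
  then show "gs_potential h ((norm x)\<^sup>2) - h\<^sup>2 / (hyp_dist x 0)\<^sup>2 \<le> h\<^sup>2 + h"
    unfolding r_def[symmetric] \<rho>_def[symmetric] g by (simp add: distrib_left)
qed

lemma hyp_dist_continuous: "continuous_on (punctured :: (real^'n) set) (\<lambda>x. hyp_dist x 0)"
proof -
  have "continuous_on (punctured :: (real^'n) set) (\<lambda>x. ln ((1 + norm x) / (1 - norm x)))"
  proof -
    have p: "norm x \<noteq> 1" "1 + norm x \<noteq> 0" if "x \<in> punctured" for x :: "real^'n"
      using punctured_norm[OF that] by linarith+
    show ?thesis by (intro continuous_intros) (simp_all add: p)
  qed
  then show ?thesis by (rule continuous_on_eq) (simp add: hyp_dist_zero punctured_def)
qed

text \<open>Completing the square writes the gradient density as the substituted energy, minus a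
  divergence, plus potential times \<open>v^2\<close>. The divergence has integral zero because
  \<open>v\<close> vanishes near the origin, where the flux is singular.\<close>

lemma hardy_deficit_ground_state:
  fixes v :: "real^'n \<Rightarrow> real"
  assumes C: "compact_C1 v g K" and K: "K \<subseteq> punctured" and dim: "3 \<le> CARD('n)"
  defines "h \<equiv> (real CARD('n) - 2) / 2"
  defines "k \<equiv> \<lambda>x::real^'n. gs_coeff h ((norm x)\<^sup>2)"
  defines "E \<equiv> (\<integral>x. indicator punctured x * (conf x ^ (CARD('n) - 2) * (norm (g x + (v x * k x) *\<^sub>R x))\<^sup>2) \<partial>lborel)"
  shows "E \<le> hardy_deficit 0 v" "hardy_deficit 0 v \<le> E + (h\<^sup>2 + h) * (\<integral>x. indicator punctured x * (conf x ^ CARD('n) * (v x)\<^sup>2) \<partial>lborel)"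
proof -
  interpret compact_C1 v g K by (rule C)
  define n where "n = CARD('n)"
  have h2: "2 * h = real n - 2" by (simp add: h_def n_def)
  have n: "3 \<le> n" "real n = 2 * h + 2" using dim h2 by (simp_all add: n_def)
  have h0: "0 < h" using n by simp
  have v0: "v 0 = 0" "g 0 = 0" using K u_0[of 0] g_0[of 0] by (auto simp: punctured_def)
  define P where "P x = gs_potential h ((norm x)\<^sup>2)" for x :: "real^'n"
  define \<beta> where "\<beta> q = (2 / (1 - q)) ^ (n - 2) * gs_coeff h q" for q
  define D where "D q = ((2 / (1 - q)) ^ n * gs_potential h q + (2 / (1 - q)) ^ (n - 2) * (gs_coeff h q)\<^sup>2 * q - real n * \<beta> q) / (2 * q)" for q
  have dB: "(\<beta> has_real_derivative D q) (at q)" if q: "0 < q" "q < 1" for q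
  proof -
    have "2 \<le> n" using n by simp
    from ground_state_flux_divergence[OF q n(2) this]
    obtain D0 where D0: "(\<beta> has_real_derivative D0) (at q)"
      "real n * \<beta> q + 2 * q * D0 - (2 / (1 - q)) ^ (n - 2) * (gs_coeff h q)\<^sup>2 * q = (2 / (1 - q)) ^ n * gs_potential h q"
      unfolding \<beta>_def[abs_def] by blast
    have "2 * q * D0 = (2 / (1 - q)) ^ n * gs_potential h q + (2 / (1 - q)) ^ (n - 2) * (gs_coeff h q)\<^sup>2 * q - real n * \<beta> q"
      using D0(2) by linarith
    then have "D q = D0" using q by (simp add: D_def flip: \<open>2 * q * D0 = _\<close>)
    then show ?thesis using D0(1) by simp
  qed
  have Dx: "2 * (norm x)\<^sup>2 * D ((norm x)\<^sup>2) = conf x ^ n * P x + conf x ^ (n - 2) * (k x)\<^sup>2 * (norm x)\<^sup>2 - real n * \<beta> ((norm x)\<^sup>2)"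
    if "x \<in> punctured" for x
    using punctured_norm[OF that] by (simp add: D_def conf_def P_def k_def)
  have \<beta>x: "\<beta> ((norm x)\<^sup>2) = conf x ^ (n - 2) * k x" for x :: "real^'n" by (simp add: \<beta>_def conf_def k_def)
  note cs = conf_continuous gs_coeff_continuous gs_potential_continuous continuous_on_subset[OF cont_u subset_UNIV] continuous_on_subset[OF cont_g subset_UNIV] hyp_dist_continuous
  have ck: "continuous_on punctured k" unfolding k_def by (rule gs_coeff_continuous)
  have cP: "continuous_on punctured P" unfolding P_def by (rule gs_potential_continuous)
  define \<psi> where "\<psi> x = \<beta> ((norm x)\<^sup>2) * (v x)\<^sup>2" for x
  define d where "d x = (2 * D ((norm x)\<^sup>2) * (v x)\<^sup>2) *\<^sub>R x + (\<beta> ((norm x)\<^sup>2) * (2 * v x)) *\<^sub>R g x" for x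
  have c\<beta>: "continuous_on punctured (\<lambda>x::real^'n. \<beta> ((norm x)\<^sup>2))" unfolding \<beta>x by (intro continuous_intros conf_continuous ck)
  have cD: "continuous_on punctured (\<lambda>x::real^'n. D ((norm x)\<^sup>2))"
  proof (rule continuous_on_eq)
    show "continuous_on punctured (\<lambda>x::real^'n. (conf x ^ n * P x + conf x ^ (n - 2) * (k x)\<^sup>2 * (norm x)\<^sup>2 - real n * \<beta> ((norm x)\<^sup>2)) / (2 * (norm x)\<^sup>2))"
      by (intro continuous_intros conf_continuous ck cP c\<beta>) (use punctured_norm in force)
  qed (simp add: D_def conf_def P_def k_def)
  have Cpsi: "compact_C1 (\<lambda>x. if x \<in> punctured then \<psi> x else 0) (\<lambda>x. if x \<in> punctured then d x else 0) K"
  proof (rule compact_C1_extend[OF open_punctured compact_K K])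
    fix x assume x: "x \<in> (punctured :: (real^'n) set)"
    have "(\<psi> has_derivative (\<lambda>h. \<beta> ((norm x)\<^sup>2) * (2 * v x * (g x \<bullet> h)) + (2 * D ((norm x)\<^sup>2)) * (x \<bullet> h) * (v x)\<^sup>2)) (at x)"
      unfolding \<psi>_def[abs_def]
    proof (rule has_derivative_mult)
      show "((\<lambda>x. \<beta> ((norm x)\<^sup>2)) has_derivative (\<lambda>h. (2 * D ((norm x)\<^sup>2)) * (x \<bullet> h))) (at x)"
        using dB punctured_norm[OF x] by (intro has_derivative_norm_sq_comp) simp
      have "((\<lambda>x. v x * v x) has_derivative (\<lambda>h. v x * (g x \<bullet> h) + (g x \<bullet> h) * v x)) (at x)" by (rule has_derivative_mult[OF deriv deriv])
      moreover have "(\<lambda>h. v x * (g x \<bullet> h) + (g x \<bullet> h) * v x) = (\<lambda>h. 2 * v x * (g x \<bullet> h))" by (simp add: fun_eq_iff)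
      ultimately show "((\<lambda>x. (v x)\<^sup>2) has_derivative (\<lambda>h. 2 * v x * (g x \<bullet> h))) (at x)" by (simp only: power2_eq_square)
    qed
    then show "(\<psi> has_derivative (\<lambda>h. d x \<bullet> h)) (at x)" by (simp add: d_def inner_add_left mult_ac add.commute)
  next
    show "continuous_on punctured d" unfolding d_def by (intro continuous_intros cD c\<beta> cs)
  qed (use u_0 in \<open>simp add: \<psi>_def\<close>)
  define dv where "dv x = indicator punctured x * (real n * \<psi> x + d x \<bullet> x)" for x
  have dveq: "real DIM(real^'n) * (if x \<in> punctured then \<psi> x else 0) + (if x \<in> punctured then d x else 0) \<bullet> x = dv x" for x
    by (simp add: dv_def n_def)
  have dv0: "(\<integral>x. dv x \<partial>lborel) = 0" and dvi: "integrable lborel dv"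
    using integral_divergence_position[OF Cpsi] unfolding dveq by simp_all
  define F1 where "F1 x = indicator punctured x * (conf x ^ (n - 2) * (norm (g x + (v x * k x) *\<^sub>R x))\<^sup>2)" for x
  define F2 where "F2 x = indicator punctured x * (conf x ^ n * (P x * (v x)\<^sup>2))" for x
  define F3 where "F3 x = indicator punctured x * (conf x ^ n * ((v x)\<^sup>2 / (hyp_dist x 0)\<^sup>2))" for x
  define F4 where "F4 x = indicator punctured x * (conf x ^ n * (v x)\<^sup>2)" for x
  have i1: "integrable lborel F1" unfolding F1_def
    by (rule integrable_compact_in_open[OF open_punctured compact_K K]) (use u_0 g_0 in \<open>auto intro!: continuous_intros cs ck\<close>)
  have i2: "integrable lborel F2" unfolding F2_def
    by (rule integrable_compact_in_open[OF open_punctured compact_K K]) (use u_0 g_0 in \<open>auto intro!: continuous_intros cs cP\<close>)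
  have i3: "integrable lborel F3" unfolding F3_def
    by (rule integrable_compact_in_open[OF open_punctured compact_K K]) (use u_0 hyp_dist_bounds(1) in \<open>force intro!: continuous_intros cs\<close>)+
  have i4: "integrable lborel F4" unfolding F4_def
    by (rule integrable_compact_in_open[OF open_punctured compact_K K]) (use u_0 g_0 in \<open>auto intro!: continuous_intros cs\<close>)
  have pw: "indicator punctured x * (conf x ^ n * (norm (g x) / conf x)\<^sup>2) = F1 x - dv x + F2 x" for x
  proof (cases "x \<in> punctured")
    case True
    have c: "conf x \<noteq> 0" using conf_pos[of x] True by (auto simp: punctured_def)
    have cn: "conf x ^ n = conf x ^ (n - 2) * (conf x)\<^sup>2" 
    proof -
      have "n = (n - 2) + 2" using n(1) by simp
      then show ?thesis by (metis power_add)
    qed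
    define m where "m = conf x ^ (n - 2)"
    have l: "conf x ^ n * (norm (g x) / conf x)\<^sup>2 = m * (norm (g x))\<^sup>2" unfolding cn m_def using c by (simp add: power_divide)
    have y: "(norm (g x + (v x * k x) *\<^sub>R x))\<^sup>2 = (norm (g x))\<^sup>2 + 2 * (v x * k x * (g x \<bullet> x)) + (v x * k x)\<^sup>2 * (norm x)\<^sup>2"
      unfolding norm_add_sq by (simp add: power_mult_distrib)
    have dx: "d x \<bullet> x = (2 * (norm x)\<^sup>2 * D ((norm x)\<^sup>2)) * (v x)\<^sup>2 + m * k x * (2 * v x) * (g x \<bullet> x)"
      by (simp add: d_def inner_add_left \<beta>x m_def flip: power2_norm_eq_inner)
    show ?thesis using True unfolding F1_def F2_def dv_def l y dx Dx[OF True] \<psi>_def \<beta>x m_def[symmetric]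
      by (simp add: power_mult_distrib algebra_simps)
  qed (simp add: F1_def F2_def dv_def)
  have mg: "(\<lambda>x. (norm (g x) / conf x)\<^sup>2) \<in> borel_measurable borel" "(\<lambda>x. (v x)\<^sup>2 / (hyp_dist x 0)\<^sup>2) \<in> borel_measurable borel" by measurable
  have EH: "(\<integral>x. (norm (g x) / conf x)\<^sup>2 \<partial>hyp_volume) = E + (\<integral>x. F2 x \<partial>lborel)"
  proof -
    have "(\<integral>x. (norm (g x) / conf x)\<^sup>2 \<partial>hyp_volume) = (\<integral>x. F1 x - dv x + F2 x \<partial>lborel)"
      using hyp_volume_integral_punctured(1)[OF mg(1)] v0 pw by (simp add: n_def)
    also have "\<dots> = (\<integral>x. F1 x \<partial>lborel) + (\<integral>x. F2 x \<partial>lborel)" using i1 dvi i2 dv0 by simp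
    finally show ?thesis by (simp add: E_def F1_def[abs_def] n_def)
  qed
  have HH: "(\<integral>x. (v x)\<^sup>2 / (hyp_dist x 0)\<^sup>2 \<partial>hyp_volume) = (\<integral>x. F3 x \<partial>lborel)"
    using hyp_volume_integral_punctured(1)[OF mg(2)] v0 by (simp add: F3_def n_def)
  have def: "hardy_deficit 0 v = E + (\<integral>x. F2 x - h\<^sup>2 * F3 x \<partial>lborel)"
    unfolding hardy_deficit_eq[OF C] EH HH using i2 i3 by (simp add: h_def)
  have pb: "0 \<le> F2 x - h\<^sup>2 * F3 x" "F2 x - h\<^sup>2 * F3 x \<le> (h\<^sup>2 + h) * F4 x" for x
  proof -
    have e: "F2 x - h\<^sup>2 * F3 x = (P x - h\<^sup>2 / (hyp_dist x 0)\<^sup>2) * F4 x" by (simp add: F2_def F3_def F4_def algebra_simps)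
    have "0 \<le> F2 x - h\<^sup>2 * F3 x \<and> F2 x - h\<^sup>2 * F3 x \<le> (h\<^sup>2 + h) * F4 x"
    proof (cases "x \<in> punctured")
      case True
      have "0 \<le> F4 x" using True conf_pos[of x] by (simp add: F4_def punctured_def)
      then show ?thesis
        unfolding e using hyp_dist_bounds(4,5)[OF True, of h] h0 by (auto simp: P_def intro!: mult_right_mono)
    qed (simp add: F2_def F3_def F4_def)
    then show "0 \<le> F2 x - h\<^sup>2 * F3 x" "F2 x - h\<^sup>2 * F3 x \<le> (h\<^sup>2 + h) * F4 x" by simp_all
  qed
  have "0 \<le> (\<integral>x. F2 x - h\<^sup>2 * F3 x \<partial>lborel)" using pb(1) by (intro integral_nonneg_AE AE_I2) simp
  then show "E \<le> hardy_deficit 0 v" by (simp add: def)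
  have "(\<integral>x. F2 x - h\<^sup>2 * F3 x \<partial>lborel) \<le> (\<integral>x. (h\<^sup>2 + h) * F4 x \<partial>lborel)"
    using i2 i3 i4 pb(2) by (intro integral_mono Bochner_Integration.integrable_diff integrable_mult_right) simp_all
  also have "\<dots> = (h\<^sup>2 + h) * (\<integral>x. F4 x \<partial>lborel)" by simp
  finally show "hardy_deficit 0 v \<le> E + (h\<^sup>2 + h) * (\<integral>x. indicator punctured x * (conf x ^ CARD('n) * (v x)\<^sup>2) \<partial>lborel)"
    by (simp add: def F4_def n_def)
qed

section \<open>Transplantation of the punctured ball to Euclidean space\<close>

text \<open>The factor \<open>sinh powr h\<close> of the distance as a function of
  \<open>q = |x|^2\<close>, written through logarithms so that its logarithmic derivative is visibly
  \<open>gs_coeff h q / 2\<close>.\<close>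

definition gs_factor :: "real \<Rightarrow> real \<Rightarrow> real" where
  "gs_factor h q = exp (h * (ln q / 2 + ln 2 - ln (1 - q)))"

lemma gs_factor_deriv:
  assumes "0 < q" "q < 1"
  shows "(gs_factor h has_real_derivative gs_factor h q * gs_coeff h q / 2) (at q)"
proof -
  define w where "w = 1 - q"
  have nz: "q \<noteq> 0" "w \<noteq> 0" using assms by (simp_all add: w_def)
  have l1: "(ln has_real_derivative 1 / q) (at q)" by (rule DERIV_ln_divide[OF assms(1)])
  have l0: "((\<lambda>q. 1 - q) has_real_derivative 0 - 1) (at q)" by (rule DERIV_diff[OF DERIV_const DERIV_ident])
  have l2: "((\<lambda>q. ln (1 - q)) has_real_derivative (1 / (1 - q)) * (0 - 1)) (at q)"
    by (rule DERIV_chain2[OF DERIV_ln_divide l0]) (use assms in simp)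
  have "((\<lambda>q. h * (ln q / 2 + ln 2 - ln (1 - q))) has_real_derivative h * ((1 / q) / 2 + 0 - (1 / (1 - q)) * (0 - 1))) (at q)"
    by (intro DERIV_cmult DERIV_diff DERIV_add DERIV_cdivide l1 l2 DERIV_const)
  from DERIV_chain2[OF DERIV_exp this]
  have "(gs_factor h has_real_derivative gs_factor h q * (h * ((1 / q) / 2 + 0 - (1 / (1 - q)) * (0 - 1)))) (at q)"
    by (simp only: gs_factor_def[abs_def])
  moreover have "h * ((1 / q) / 2 + 0 - (1 / (1 - q)) * (0 - 1)) = gs_coeff h q / 2"
  proof -
    have "1 + q = w + 2 * q" by (simp add: w_def)
    then have "gs_coeff h q / 2 = h * (w + 2 * q) / (q * w) / 2" by (simp add: gs_coeff_def w_def)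
    also have "\<dots> = h * (1 / q / 2 + 1 / w)" using nz by (simp add: distrib_left add_divide_distrib)
    finally show ?thesis by (simp add: w_def)
  qed
  ultimately show ?thesis by (simp only: times_divide_eq_right)
qed

lemma gs_factor_eq:
  assumes "x \<in> punctured"
  shows "gs_factor h ((norm x)\<^sup>2) = (norm x * conf x) powr h" "0 < norm x * conf x"
proof -
  note b = punctured_norm[OF assms]
  have c: "0 < conf x" using b by (simp add: conf_def)
  then show p: "0 < norm x * conf x" using b by simp
  have "ln (norm x * conf x) = ln (norm x) + (ln 2 - ln (1 - (norm x)\<^sup>2))"
    using b c by (simp add: ln_mult ln_div conf_def)
  moreover have "ln ((norm x)\<^sup>2) = 2 * ln (norm x)" using b by (simp add: ln_realpow)
  ultimately show "gs_factor h ((norm x)\<^sup>2) = (norm x * conf x) powr h"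
    using p b c by (simp add: gs_factor_def powr_def)
qed

locale transplant =
  fixes \<alpha> h :: real and T :: "'n::finite itself"
  assumes dim: "3 \<le> CARD('n)" and h: "2 * h = real CARD('n) - 2" and \<alpha>: "0 < \<alpha>" "\<alpha> \<le> exp ((real CARD('n) - 3) / (real CARD('n) - 2))"
begin

text \<open>Here \<open>q = |z|^2\<close>. \<open>Gam\<close> is the tangential and
  \<open>sig\<close> the radial stretch of \<open>Psi\<close>, \<open>kap\<close> the coefficient of
  the rank-one part of its derivative, and \<open>Theta\<close> its inverse. \<open>Dom\<close> is
  where \<open>|Psi z| < 1\<close>. On the ball \<open>tau\<close> is
  \<open>1 / X (\<alpha> * tanh (d / 2))\<close> for the distance \<open>d\<close> from the origin,
  and along the map it becomes \<open>|z|^(2-n)\<close>.\<close>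

definition "Gam q = exp (1 - q powr (- h)) / \<alpha> * q powr (- (1/2))"
definition "kap q = Gam q * (2 * h * q powr (- h - 1) - 1 / q)"
definition "sig q = Gam q * (2 * h) * q powr (- h)"
definition "Psi (z::real^'n) = Gam ((norm z)\<^sup>2) *\<^sub>R z"
definition "Dom = {z::real^'n. z \<noteq> 0 \<and> 1 - ln \<alpha> < ((norm z)\<^sup>2) powr (- h)}"
definition "tau (x::real^'n) = 1 - ln (\<alpha> * norm x)"
definition "Theta (x::real^'n) = (tau x powr (- (1 / (2 * h))) / norm x) *\<^sub>R x"

lemma h_ge: "1/2 \<le> h" using dim h by simp
lemma h_pos: "0 < h" using h_ge by simp

text \<open>The bound on \<open>\<alpha>\<close> in the form in which it is applied: on
  \<open>Dom\<close> the number \<open>|z|^(2-n)\<close> exceeds \<open>1 - ln \<alpha>\<close>,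
  hence \<open>1 / (n - 2)\<close>.\<close>

lemma ln_\<alpha>: "1 / (2 * h) \<le> 1 - ln \<alpha>"
proof -
  have "ln \<alpha> \<le> (real CARD('n) - 3) / (real CARD('n) - 2)" 
    using \<alpha> ln_le_cancel_iff[of \<alpha> "exp ((real CARD('n) - 3) / (real CARD('n) - 2))"] by simp
  also have "\<dots> = (2 * h - 1) / (2 * h)" using h by simp
  also have "\<dots> = 1 - 1 / (2 * h)" using h_pos by (simp add: diff_divide_distrib)
  finally show ?thesis by simp
qed

lemma open_Dom: "open Dom"
proof -
  have c: "continuous_on (- {0::real^'n}) (\<lambda>z. ((norm z)\<^sup>2) powr (- h))" by (intro continuous_intros) simp
  have "open ((\<lambda>z. ((norm z)\<^sup>2) powr (- h)) -` {1 - ln \<alpha><..} \<inter> - {0::real^'n})"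
  proof -
    have o: "open (- {0::real^'n})" by (simp add: open_Compl)
    from continuous_on_open_vimage[OF o, THEN iffD1, OF c] show ?thesis by (rule allE[of _ "{1 - ln \<alpha><..}"]) (simp add: open_greaterThan)
  qed
  moreover have "(\<lambda>z. ((norm z)\<^sup>2) powr (- h)) -` {1 - ln \<alpha><..} \<inter> - {0::real^'n} = Dom" by (auto simp: Dom_def)
  ultimately show ?thesis by simp
qed

context
  fixes z :: "real^'n" and q assumes z: "z \<in> Dom" and q_def: "q = (norm z)\<^sup>2"
begin

lemma q_pos: "0 < q" using z by (simp add: Dom_def q_def)
lemma sqrt_q: "norm z = q powr (1/2)" using z by (simp add: q_def powr_half_sqrt)
lemma tau_gt: "1 - ln \<alpha> < q powr (- h)" using z by (simp add: Dom_def q_def)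
lemma Gam_pos: "0 < Gam q" using \<alpha> q_pos by (simp add: Gam_def)
lemma norm_Psi_q: "norm (Psi z) = Gam q * norm z" using Gam_pos by (simp add: Psi_def q_def)

lemma norm_Psi: "norm (Psi z) = exp (1 - q powr (- h)) / \<alpha>"
proof -
  have "q powr (- (1/2)) * q powr (1/2) = 1" using q_pos by (simp flip: powr_add)
  then show ?thesis unfolding norm_Psi_q sqrt_q Gam_def by (simp add: mult.assoc)
qed

lemma Psi_punctured: "Psi z \<in> punctured"
proof -
  have "exp (1 - q powr (- h)) < exp (ln \<alpha>)" using tau_gt by (subst exp_less_cancel_iff) simp
  then have "norm (Psi z) < 1" unfolding norm_Psi using \<alpha> by simp
  moreover have "0 < norm (Psi z)" unfolding norm_Psi using \<alpha> by simp
  ultimately show ?thesis by (simp add: punctured_def)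
qed

lemma tau_Psi: "tau (Psi z) = q powr (- h)" unfolding tau_def norm_Psi using \<alpha> by simp

lemma Theta_Psi: "Theta (Psi z) = z"
proof -
  have "(q powr (- h)) powr (- (1 / (2 * h))) = norm z" unfolding sqrt_q using h_pos by (simp add: powr_powr)
  then have "Theta (Psi z) = (norm z / (Gam q * norm z) * Gam q) *\<^sub>R z"
    unfolding Theta_def tau_Psi norm_Psi_q by (simp add: Psi_def q_def)
  then show ?thesis using Gam_pos z by (simp add: Dom_def)
qed

lemma kap_sig: "Gam q + kap q * q = sig q"
proof -
  have "q powr (- h - 1) * q = q powr (- h)" using q_pos by (simp add: powr_diff)
  then have "kap q * q = Gam q * (2 * h * q powr (- h) - 1)" using q_pos by (simp add: kap_def algebra_simps)
  then show ?thesis by (simp add: sig_def algebra_simps)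
qed

lemma sig_pos: "0 < sig q" using Gam_pos h_pos q_pos by (simp add: sig_def)

text \<open>The condition on \<open>\<alpha>\<close> enters here: the map expands the radial direction at least as much as the tangential ones.\<close>

lemma kap_nonneg: "0 \<le> kap q"
proof -
  have "2 * h * (1 / (2 * h)) \<le> 2 * h * q powr (- h)" using tau_gt ln_\<alpha> h_pos by (intro mult_left_mono) auto
  then have "1 \<le> 2 * h * q powr (- h)" using h_pos by simp
  then have "0 \<le> Gam q * (2 * h * q powr (- h) - 1)" using Gam_pos by simp
  moreover have "kap q * q = Gam q * (2 * h * q powr (- h) - 1)" using kap_sig by (simp add: sig_def algebra_simps)
  ultimately have "0 \<le> kap q * q" by simp
  then show ?thesis using q_pos by (simp add: zero_le_mult_iff)
qed

lemma deriv_Psi: "(Psi has_derivative (\<lambda>k. Gam q *\<^sub>R k + (kap q * (z \<bullet> k)) *\<^sub>R z)) (at z)"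
proof -
  have "((\<lambda>q. exp (1 - q powr (- h)) / \<alpha> * q powr (- (1/2))) has_real_derivative
      (exp (1 - q powr (- h)) * (0 - (- h) * q powr (- h - 1))) / \<alpha> * q powr (- (1/2)) + (- (1/2)) * q powr (- (1/2) - 1) * (exp (1 - q powr (- h)) / \<alpha>)) (at q)"
    using q_pos \<alpha>(1) by (auto intro!: derivative_eq_intros simp: diff_divide_distrib)
  moreover have "(exp (1 - q powr (- h)) * (0 - (- h) * q powr (- h - 1))) / \<alpha> * q powr (- (1/2)) + (- (1/2)) * q powr (- (1/2) - 1) * (exp (1 - q powr (- h)) / \<alpha>) = kap q / 2"
  proof -
    have aux: "(A * (0 - (- h) * Q)) / \<alpha> * r + (- (1/2)) * (r / q) * (A / \<alpha>) = A / \<alpha> * r * (2 * h * Q - 1 / q) / 2" for A r Q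
      using q_pos \<alpha>(1) by (simp add: field_simps)
    have pw: "q powr (- (1/2) - 1) = q powr (- (1/2)) / q" using powr_diff[of q "- (1/2)" 1] q_pos by simp
    show ?thesis unfolding pw kap_def Gam_def by (rule aux)
  qed
  ultimately have "(Gam has_real_derivative kap q / 2) (at q)" by (metis (lifting) Gam_def ext)
  then have "((\<lambda>z. Gam ((norm z)\<^sup>2)) has_derivative (\<lambda>k. (2 * (kap q / 2)) * (z \<bullet> k))) (at z)"
    unfolding q_def by (rule has_derivative_norm_sq_comp)
  then have "((\<lambda>z. Gam ((norm z)\<^sup>2) *\<^sub>R z) has_derivative (\<lambda>k. Gam ((norm z)\<^sup>2) *\<^sub>R k + ((2 * (kap q / 2)) * (z \<bullet> k)) *\<^sub>R z)) (at z)"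
    by (intro has_derivative_scaleR has_derivative_ident)
  then show ?thesis by (simp add: Psi_def[abs_def] q_def)
qed

lemma jacobian: "\<bar>Gam q ^ (CARD('n) - 1) * (Gam q + kap q * (norm z)\<^sup>2)\<bar> = Gam q ^ (CARD('n) - 1) * sig q"
  unfolding q_def[symmetric] kap_sig using Gam_pos sig_pos by simp

lemma norm_pow: "norm z ^ CARD('n) = q powr (h + 1)"
proof -
  have "norm z ^ CARD('n) = norm z powr real CARD('n)" using z by (simp add: powr_realpow Dom_def)
  also have "real CARD('n) = 2 * (h + 1)" using h by simp
  finally have "norm z ^ CARD('n) = q powr ((1/2) * (2 * (h + 1)))" by (simp only: sqrt_q powr_powr)
  moreover have "(1/2) * (2 * (h + 1)) = h + 1" by simp
  ultimately show ?thesis by (simp only:)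
qed

lemma jacobian_radius: "Gam q ^ (CARD('n) - 1) * sig q = 2 * h * q powr (- (2 * h + 1)) * norm (Psi z) ^ CARD('n)"
proof -
  have "Gam q ^ CARD('n) = Gam q ^ (CARD('n) - 1) * Gam q" using power_minus_mult[of "CARD('n)" "Gam q"] by simp
  then have "2 * h * q powr (- (2 * h + 1)) * norm (Psi z) ^ CARD('n) = Gam q ^ (CARD('n) - 1) * (Gam q * (2 * h) * (q powr (- (2 * h + 1)) * q powr (h + 1)))"
    unfolding norm_Psi_q power_mult_distrib norm_pow by (simp add: mult_ac)
  also have "q powr (- (2 * h + 1)) * q powr (h + 1) = q powr (- h)" by (simp flip: powr_add)
  also have "Gam q ^ (CARD('n) - 1) * (Gam q * (2 * h) * q powr (- h)) = Gam q ^ (CARD('n) - 1) * sig q" by (simp only: sig_def)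
  finally show ?thesis by (rule sym)
qed

text \<open>The identity that determines the map: the squared radial stretch times the squared
  ground state factor is the energy density of the ball times the Jacobian, up to
  \<open>2 * h = n - 2\<close>. Radial gradients thus keep their energy apart from that
  factor.\<close>

lemma jacobian_energy:
  "Gam q ^ (CARD('n) - 1) * sig q * conf (Psi z) ^ (CARD('n) - 2) * (2 * h) = (sig q)\<^sup>2 * (gs_factor h ((norm (Psi z))\<^sup>2))\<^sup>2"
proof -
  define R where "R = norm (Psi z) * conf (Psi z)"
  have R: "0 < R" and f: "gs_factor h ((norm (Psi z))\<^sup>2) = R powr h" using gs_factor_eq[OF Psi_punctured] by (simp_all add: R_def)
  have n2: "real (CARD('n) - 2) = 2 * h" using h dim by (simp add: of_nat_diff)
  have "(R powr h)\<^sup>2 = R powr (2 * h)" using R by (simp add: power2_eq_square flip: powr_add)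
  also have "\<dots> = R ^ (CARD('n) - 2)" using R by (simp add: powr_realpow flip: n2)
  finally have RR: "(R powr h)\<^sup>2 = R ^ (CARD('n) - 2)" .
  have f2: "(gs_factor h ((norm (Psi z))\<^sup>2))\<^sup>2 = Gam q ^ (CARD('n) - 2) * norm z ^ (CARD('n) - 2) * conf (Psi z) ^ (CARD('n) - 2)"
    unfolding f RR unfolding R_def norm_Psi_q power_mult_distrib ..
  have zz: "q powr (- h) * norm z ^ (CARD('n) - 2) = 1"
  proof -
    have "norm z ^ (CARD('n) - 2) = norm z powr (2 * h)" using z by (simp add: powr_realpow Dom_def flip: n2)
    also have "\<dots> = q powr h" unfolding sqrt_q powr_powr by simp
    finally show ?thesis using q_pos by (simp flip: powr_add)
  qed
  have "Gam q ^ (CARD('n) - 1) = Gam q ^ (CARD('n) - 2) * Gam q"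
    using dim power_minus_mult[of "CARD('n) - 1" "Gam q"] by (simp add: numeral_2_eq_2)
  then have "Gam q ^ (CARD('n) - 1) * sig q * conf (Psi z) ^ (CARD('n) - 2) * (2 * h)
     = sig q * (Gam q * (2 * h) * (q powr (- h) * norm z ^ (CARD('n) - 2))) * (Gam q ^ (CARD('n) - 2) * conf (Psi z) ^ (CARD('n) - 2))"
    unfolding zz by (simp add: mult_ac)
  then show ?thesis unfolding f2 by (simp add: sig_def power2_eq_square mult_ac)
qed

text \<open>The Jacobian contributes \<open>q powr (- (2 * h + 1))\<close> and the logarithmic
  weight \<open>q powr (h * ((p + 2) / 2))\<close>; the exponent \<open>(p + 2) / 2\<close> is the
  one for which the product is the Euclidean weight. The power of \<open>sinh\<close> and the volume
  density combine to the p-th power of the ground state factor.\<close>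

lemma jacobian_weight:
  assumes p: "0 < p"
  shows "Gam q ^ (CARD('n) - 1) * sig q * (conf (Psi z) ^ CARD('n) * weighted_density p \<alpha> (hyp_dist (Psi z) 0) CARD('n) t)
    = 2 * h * (norm z powr (p * (real CARD('n) - 2) / 2 - real CARD('n)) * \<bar>gs_factor h ((norm (Psi z))\<^sup>2) * t\<bar> powr p)"
proof -
  define R where "R = norm (Psi z) * conf (Psi z)"
  have R: "0 < R" and f: "gs_factor h ((norm (Psi z))\<^sup>2) = R powr h" using gs_factor_eq[OF Psi_punctured] by (simp_all add: R_def)
  define e where "e = p * (real CARD('n) - 2) / 2 - real CARD('n)"
  have e: "e = h * p - real CARD('n)" "e = h * p - 2 * (h + 1)"
  proof -
    show ee: "e = h * p - real CARD('n)" unfolding e_def h[symmetric] by simp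
    have "real CARD('n) = 2 * (h + 1)" using h by simp
    then show "e = h * p - 2 * (h + 1)" using ee by simp
  qed
  have XX: "X (\<alpha> * tanh (hyp_dist (Psi z) 0 / 2)) = q powr h"
    unfolding hyp_dist_bounds(3)[OF Psi_punctured] X_def using tau_Psi q_pos by (simp add: tau_def powr_minus inverse_eq_divide)
  have wd: "weighted_density p \<alpha> (hyp_dist (Psi z) 0) CARD('n) t = R powr e * q powr (h * ((p + 2) / 2)) * \<bar>t\<bar> powr p"
    unfolding weighted_density_def XX hyp_dist_bounds(2)[OF Psi_punctured] R_def[symmetric] e_def[symmetric] powr_powr ..
  have Rn: "norm (Psi z) ^ CARD('n) * conf (Psi z) ^ CARD('n) = R powr real CARD('n)"
    using R by (simp add: powr_realpow R_def power_mult_distrib)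
  have "Gam q ^ (CARD('n) - 1) * sig q * (conf (Psi z) ^ CARD('n) * weighted_density p \<alpha> (hyp_dist (Psi z) 0) CARD('n) t)
     = 2 * h * (q powr (- (2 * h + 1)) * q powr (h * ((p + 2) / 2))) * ((norm (Psi z) ^ CARD('n) * conf (Psi z) ^ CARD('n)) * R powr e) * \<bar>t\<bar> powr p"
    unfolding jacobian_radius wd by (simp add: mult_ac)
  also have "(norm (Psi z) ^ CARD('n) * conf (Psi z) ^ CARD('n)) * R powr e = R powr (h * p)"
    unfolding Rn powr_add[symmetric] e(1) by simp
  also have "q powr (- (2 * h + 1)) * q powr (h * ((p + 2) / 2)) = norm z powr e"
  proof -
    have "- (2 * h + 1) + h * ((p + 2) / 2) = 1 / 2 * (h * p - 2 * (h + 1))" by (simp add: field_simps)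
    then show ?thesis unfolding powr_add[symmetric] sqrt_q powr_powr e(2) by (simp only:)
  qed
  also have "2 * h * (norm z powr e) * R powr (h * p) * \<bar>t\<bar> powr p = 2 * h * (norm z powr e * \<bar>R powr h * t\<bar> powr p)"
    using R by (simp add: abs_mult powr_mult powr_powr)
  finally show ?thesis unfolding f e_def .
qed

lemma jacobian_square:
  "Gam q ^ (CARD('n) - 1) * sig q * (conf (Psi z) ^ CARD('n) * t\<^sup>2)
    = 2 * h * (q powr (- (2 * h + 1)) * (norm (Psi z) * conf (Psi z))\<^sup>2 * (gs_factor h ((norm (Psi z))\<^sup>2) * t)\<^sup>2)"
proof -
  define R where "R = norm (Psi z) * conf (Psi z)"
  have R: "0 < R" and f: "gs_factor h ((norm (Psi z))\<^sup>2) = R powr h" using gs_factor_eq[OF Psi_punctured] by (simp_all add: R_def)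
  have Rn: "norm (Psi z) ^ CARD('n) * conf (Psi z) ^ CARD('n) = R powr real CARD('n)"
    using R by (simp add: powr_realpow R_def power_mult_distrib)
  also have "\<dots> = R\<^sup>2 * (R powr h)\<^sup>2"
  proof -
    have "R powr real CARD('n) = R powr (2 + (h + h))" using h by simp
    also have "\<dots> = R powr 2 * (R powr h * R powr h)" by (simp only: powr_add)
    finally show ?thesis using R by (simp add: power2_eq_square[of "R powr h"])
  qed
  finally have Rn: "norm (Psi z) ^ CARD('n) * conf (Psi z) ^ CARD('n) = R\<^sup>2 * (R powr h)\<^sup>2" .
  have "Gam q ^ (CARD('n) - 1) * sig q * (conf (Psi z) ^ CARD('n) * t\<^sup>2) = 2 * h * q powr (- (2 * h + 1)) * (norm (Psi z) ^ CARD('n) * conf (Psi z) ^ CARD('n)) * t\<^sup>2"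
    unfolding jacobian_radius by (simp add: mult_ac)
  then show ?thesis unfolding Rn f R_def[symmetric] by (simp add: power_mult_distrib mult_ac)
qed

text \<open>As \<open>kap q\<close> is nonnegative, Cauchy--Schwarz shows that radial vectors are
  stretched most. The second claim applies to radial functions, whose pulled-back gradient is
  parallel to \<open>z\<close>.\<close>

lemma norm_pullback:
  fixes d :: "real^'n"
  shows "(norm (Gam q *\<^sub>R d + (kap q * (z \<bullet> d)) *\<^sub>R z))\<^sup>2 \<le> (sig q)\<^sup>2 * (norm d)\<^sup>2"
    and "(\<exists>c. Gam q *\<^sub>R d + (kap q * (z \<bullet> d)) *\<^sub>R z = c *\<^sub>R z) \<Longrightarrow>
      (norm (Gam q *\<^sub>R d + (kap q * (z \<bullet> d)) *\<^sub>R z))\<^sup>2 = (sig q)\<^sup>2 * (norm d)\<^sup>2"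
proof -
  have "\<bar>z \<bullet> d\<bar> \<le> norm z * norm d" by (rule Cauchy_Schwarz_ineq2)
  then have "norm ((kap q * (z \<bullet> d)) *\<^sub>R z) \<le> (kap q * (norm z * norm d)) * norm z"
    using kap_nonneg by (simp add: abs_mult mult_left_mono mult_right_mono)
  then have "norm (Gam q *\<^sub>R d + (kap q * (z \<bullet> d)) *\<^sub>R z) \<le> Gam q * norm d + (kap q * (norm z * norm d)) * norm z"
    using Gam_pos by (intro order_trans[OF norm_triangle_ineq] add_mono) simp_all
  also have "\<dots> = (Gam q + kap q * q) * norm d" by (simp add: q_def power2_eq_square algebra_simps)
  also have "\<dots> = sig q * norm d" unfolding kap_sig ..
  finally show "(norm (Gam q *\<^sub>R d + (kap q * (z \<bullet> d)) *\<^sub>R z))\<^sup>2 \<le> (sig q)\<^sup>2 * (norm d)\<^sup>2"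
    unfolding power_mult_distrib[symmetric] by (intro power_mono) simp_all
  assume "\<exists>c. Gam q *\<^sub>R d + (kap q * (z \<bullet> d)) *\<^sub>R z = c *\<^sub>R z"
  then obtain c where "Gam q *\<^sub>R d = (c - kap q * (z \<bullet> d)) *\<^sub>R z" by (auto simp: scaleR_left_diff_distrib algebra_simps)
  then have "(1 / Gam q) *\<^sub>R (Gam q *\<^sub>R d) = (1 / Gam q) *\<^sub>R ((c - kap q * (z \<bullet> d)) *\<^sub>R z)" by simp
  then obtain c' where c': "d = c' *\<^sub>R z" using Gam_pos by auto
  have "Gam q *\<^sub>R d + (kap q * (z \<bullet> d)) *\<^sub>R z = (sig q * c') *\<^sub>R z"
    unfolding c' kap_sig[symmetric] by (simp add: q_def power2_norm_eq_inner algebra_simps)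
  then show "(norm (Gam q *\<^sub>R d + (kap q * (z \<bullet> d)) *\<^sub>R z))\<^sup>2 = (sig q)\<^sup>2 * (norm d)\<^sup>2"
    unfolding c' by (simp add: power_mult_distrib)
qed

end

lemma Theta_inverse:
  assumes x: "x \<in> punctured"
  shows "Theta x \<in> Dom" "Psi (Theta x) = x" "0 < tau x"
proof -
  define r where "r = norm x"
  have r: "0 < r" "r < 1" using punctured_norm[OF x] by (simp_all add: r_def)
  define t where "t = tau x"
  have "ln (\<alpha> * r) < ln \<alpha>" using \<alpha> r by (subst ln_less_cancel_iff) simp_all
  then have t: "1 - ln \<alpha> < t" by (simp add: t_def tau_def r_def)
  have "0 < 1 / (2 * h)" using h_pos by simp
  then have t0: "0 < t" using t ln_\<alpha> by linarith
  then show "0 < tau x" by (simp add: t_def)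
  have nT: "norm (Theta x) = t powr (- (1 / (2 * h)))" using r by (simp add: Theta_def r_def t_def)
  have nT2: "(norm (Theta x))\<^sup>2 = t powr (- (1 / h))"
    unfolding nT power2_eq_square powr_add[symmetric] using h_pos by (simp add: field_simps)
  have nTh: "((norm (Theta x))\<^sup>2) powr (- h) = t" unfolding nT2 powr_powr using h_pos t0 by simp
  have "0 < norm (Theta x)" unfolding nT using t0 by simp
  then show TD: "Theta x \<in> Dom" using t by (simp add: Dom_def nTh)
  have "norm (Psi (Theta x)) = exp (1 - t) / \<alpha>" using norm_Psi[OF TD refl] by (simp add: nTh)
  also have "\<dots> = r" using \<alpha> r by (simp add: t_def tau_def r_def)
  finally have nr: "Gam ((norm (Theta x))\<^sup>2) * norm (Theta x) = r" using norm_Psi_q[OF TD refl] by simp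
  have "Theta x = (norm (Theta x) / r) *\<^sub>R x" unfolding nT by (simp add: Theta_def t_def r_def)
  then have "Psi (Theta x) = Gam ((norm (Theta x))\<^sup>2) *\<^sub>R ((norm (Theta x) / r) *\<^sub>R x)" unfolding Psi_def by simp
  also have "\<dots> = (Gam ((norm (Theta x))\<^sup>2) * norm (Theta x) / r) *\<^sub>R x" by simp
  finally show "Psi (Theta x) = x" unfolding nr using r by simp
qed

lemma Psi_image: "Psi ` Dom = punctured"
proof (intro equalityI subsetI)
  fix x :: "real^'n" assume "x \<in> Psi ` Dom" then show "x \<in> punctured" using Psi_punctured by blast
next
  fix x :: "real^'n" assume "x \<in> punctured"
  then show "x \<in> Psi ` Dom" using Theta_inverse by (intro image_eqI[of _ _ "Theta x"]) simp_all
qed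

lemma Theta_continuous: "continuous_on punctured Theta"
proof -
  have "continuous_on (punctured :: (real^'n) set) tau" unfolding tau_def using \<alpha> punctured_norm
    by (intro continuous_intros) (auto simp: less_imp_neq[symmetric])
  then show ?thesis unfolding Theta_def using Theta_inverse(3) punctured_norm by (intro continuous_intros) (auto simp: less_imp_neq[symmetric])
qed

lemma Gam_continuous: "continuous_on Dom (\<lambda>z. Gam ((norm z)\<^sup>2))"
  unfolding Gam_def by (intro continuous_intros) (use \<alpha>(1) in \<open>auto simp: Dom_def\<close>)

lemma kap_continuous: "continuous_on Dom (\<lambda>z. kap ((norm z)\<^sup>2))"
  unfolding kap_def by (intro continuous_intros Gam_continuous) (auto simp: Dom_def)

lemma Psi_continuous: "continuous_on Dom Psi"
  unfolding Psi_def by (intro continuous_intros Gam_continuous)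

lemma Psi_change_of_variables:
  fixes F :: "real^'n \<Rightarrow> real"
  assumes "F \<in> borel_measurable borel"
  shows "(\<integral>x. indicator punctured x * F x \<partial>lborel) =
    (\<integral>z. indicator Dom z * (Gam ((norm z)\<^sup>2) ^ (CARD('n) - 1) * sig ((norm z)\<^sup>2) * F (Psi z)) \<partial>lborel)"
proof -
  have inj: "inj_on Psi Dom" by (rule inj_on_inverseI[of _ Theta]) (rule Theta_Psi[OF _ refl])
  have o: "open (Psi ` Dom)" unfolding Psi_image by (rule open_punctured)
  have "(\<integral>x. indicator (Psi ` Dom) x * F x \<partial>lborel) = (\<integral>z. indicator Dom z *
      (\<bar>Gam ((norm z)\<^sup>2) ^ (CARD('n) - 1) * (Gam ((norm z)\<^sup>2) + kap ((norm z)\<^sup>2) * (norm z)\<^sup>2)\<bar> * F (Psi z)) \<partial>lborel)"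
    by (rule change_of_variables_rank_one(2)[OF open_Dom o inj deriv_Psi[OF _ refl] Gam_continuous kap_continuous continuous_on_id assms])
  also have "\<dots> = (\<integral>z. indicator Dom z * (Gam ((norm z)\<^sup>2) ^ (CARD('n) - 1) * sig ((norm z)\<^sup>2) * F (Psi z)) \<partial>lborel)"
  proof (intro Bochner_Integration.integral_cong refl)
    fix z
    show "indicator Dom z * (\<bar>Gam ((norm z)\<^sup>2) ^ (CARD('n) - 1) * (Gam ((norm z)\<^sup>2) + kap ((norm z)\<^sup>2) * (norm z)\<^sup>2)\<bar> * F (Psi z))
      = indicator Dom z * (Gam ((norm z)\<^sup>2) ^ (CARD('n) - 1) * sig ((norm z)\<^sup>2) * F (Psi z))"
      using jacobian[OF _ refl, of z] by (cases "z \<in> Dom") simp_all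
  qed
  finally show ?thesis unfolding Psi_image .
qed

end

context transplant
begin

text \<open>\<open>w_of\<close> is the substituted function read in Euclidean coordinates,
  \<open>d_of\<close> the gradient of \<open>gs_factor\<close> times \<open>v\<close>, and
  \<open>gw_of\<close> the gradient of \<open>w_of\<close>. The derivative of \<open>Psi\<close> is
  symmetric, so its adjoint, which acts on gradients, is given by the same formula.\<close>

definition "w_of v z = (if z \<in> Dom then gs_factor h ((norm (Psi z))\<^sup>2) * v (Psi z) else (0::real))"
definition "d_of v g x = gs_factor h ((norm x)\<^sup>2) *\<^sub>R (g x + (v x * gs_coeff h ((norm x)\<^sup>2)) *\<^sub>R x)"
  for v :: "real^'n \<Rightarrow> real" and g :: "real^'n \<Rightarrow> real^'n"
definition "gw_of v g z = (if z \<in> Dom then Gam ((norm z)\<^sup>2) *\<^sub>R d_of v g (Psi z) + (kap ((norm z)\<^sup>2) * (z \<bullet> d_of v g (Psi z))) *\<^sub>R z else 0)"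

context
  fixes v :: "real^'n \<Rightarrow> real" and g K
  assumes C: "compact_C1 v g K" and K: "K \<subseteq> punctured"
begin

lemma d_of_continuous: "continuous_on punctured (d_of v g)"
proof -
  have n0: "(norm x)\<^sup>2 \<noteq> 0" "1 - (norm x)\<^sup>2 \<noteq> 0" if "x \<in> punctured" for x :: "real^'n" using punctured_norm[OF that] by auto
  have gf: "continuous_on punctured (\<lambda>x::real^'n. gs_factor h ((norm x)\<^sup>2))"
    unfolding gs_factor_def by (intro continuous_intros) (use n0 in auto)
  show ?thesis unfolding d_of_def
    by (intro continuous_intros gf gs_coeff_continuous continuous_on_subset[OF compact_C1.cont_u[OF C] subset_UNIV] continuous_on_subset[OF compact_C1.cont_g[OF C] subset_UNIV])
qed

lemma Theta_K: "compact (Theta ` K)" "Theta ` K \<subseteq> Dom"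
proof -
  show "compact (Theta ` K)"
    by (rule compact_continuous_image[OF continuous_on_subset[OF Theta_continuous K] compact_C1.compact_K[OF C]])
  show "Theta ` K \<subseteq> Dom" using Theta_inverse(1) K by blast
qed

lemma not_in_Theta_K: "z \<in> Dom \<Longrightarrow> z \<notin> Theta ` K \<Longrightarrow> Psi z \<notin> K"
  using Theta_Psi[OF _ refl, of z] by (metis image_eqI)

lemma compact_C1_transplant: "compact_C1 (w_of v) (gw_of v g) (Theta ` K)"
  unfolding w_of_def[abs_def] gw_of_def[abs_def]
proof (rule compact_C1_extend[OF open_Dom Theta_K])
  fix z assume z: "z \<in> Dom"
  let ?x = "Psi z" and ?d = "d_of v g (Psi z)"
  have "((\<lambda>x. gs_factor h ((norm x)\<^sup>2)) has_derivative (\<lambda>k. (2 * (gs_factor h ((norm ?x)\<^sup>2) * gs_coeff h ((norm ?x)\<^sup>2) / 2)) * (?x \<bullet> k))) (at ?x)"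
    using punctured_norm[OF Psi_punctured[OF z refl]] by (intro has_derivative_norm_sq_comp gs_factor_deriv) auto
  from has_derivative_mult[OF this compact_C1.deriv[OF C]]
  have D: "((\<lambda>x. gs_factor h ((norm x)\<^sup>2) * v x) has_derivative (\<lambda>k. ?d \<bullet> k)) (at ?x)"
    by (simp add: d_of_def inner_add_left mult_ac distrib_left)
  have "((\<lambda>z. gs_factor h ((norm (Psi z))\<^sup>2) * v (Psi z)) has_derivative
      (\<lambda>k. ?d \<bullet> (Gam ((norm z)\<^sup>2) *\<^sub>R k + (kap ((norm z)\<^sup>2) * (z \<bullet> k)) *\<^sub>R z))) (at z)"
    by (rule has_derivative_compose[OF deriv_Psi[OF z refl] D])
  moreover have "?d \<bullet> (Gam ((norm z)\<^sup>2) *\<^sub>R k + (kap ((norm z)\<^sup>2) * (z \<bullet> k)) *\<^sub>R z)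
     = (Gam ((norm z)\<^sup>2) *\<^sub>R ?d + (kap ((norm z)\<^sup>2) * (z \<bullet> ?d)) *\<^sub>R z) \<bullet> k" for k
    unfolding inner_add_left inner_add_right inner_scaleR_left inner_scaleR_right inner_commute[of ?d z] by (simp only: mult_ac)
  ultimately show "((\<lambda>z. gs_factor h ((norm (Psi z))\<^sup>2) * v (Psi z)) has_derivative
     (\<lambda>k. (Gam ((norm z)\<^sup>2) *\<^sub>R ?d + (kap ((norm z)\<^sup>2) * (z \<bullet> ?d)) *\<^sub>R z) \<bullet> k)) (at z)" by simp
  assume "z \<notin> Theta ` K"
  then show "gs_factor h ((norm (Psi z))\<^sup>2) * v (Psi z) = 0" using compact_C1.u_0[OF C not_in_Theta_K[OF z]] by simp
next
  have "continuous_on Dom (\<lambda>z. d_of v g (Psi z))"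
    by (rule continuous_on_compose2[OF d_of_continuous Psi_continuous]) (use Psi_punctured in blast)
  then show "continuous_on Dom (\<lambda>z. Gam ((norm z)\<^sup>2) *\<^sub>R d_of v g (Psi z) + (kap ((norm z)\<^sup>2) * (z \<bullet> d_of v g (Psi z))) *\<^sub>R z)"
    by (intro continuous_intros Gam_continuous kap_continuous)
qed

definition "gs_energy = (\<integral>x. indicator punctured x * (conf x ^ (CARD('n) - 2) * (norm (g x + (v x * gs_coeff h ((norm x)\<^sup>2)) *\<^sub>R x))\<^sup>2) \<partial>lborel)"

text \<open>The change of variables and \<open>jacobian_energy\<close> turn the energy on the ball
  into the integral of \<open>sig^2 * |d_of|^2\<close> over \<open>Dom\<close>; the comparison with
  \<open>|gw_of|^2\<close> is then pointwise.\<close>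

lemma energy_transplant:
  shows "(\<integral>z. (norm (gw_of v g z))\<^sup>2 \<partial>lborel) \<le> 2 * h * gs_energy"
    and "(\<And>z. z \<in> Dom \<Longrightarrow> \<exists>c. gw_of v g z = c *\<^sub>R z) \<Longrightarrow> (\<integral>z. (norm (gw_of v g z))\<^sup>2 \<partial>lborel) = 2 * h * gs_energy"
proof -
  interpret compact_C1 v g K by (rule C)
  interpret W: compact_C1 "w_of v" "gw_of v g" "Theta ` K" by (rule compact_C1_transplant)
  define H where "H z = indicator Dom z * ((sig ((norm z)\<^sup>2))\<^sup>2 * (norm (d_of v g (Psi z)))\<^sup>2)" for z
  have m: "(\<lambda>x. conf x ^ (CARD('n) - 2) * (norm (g x + (v x * gs_coeff h ((norm x)\<^sup>2)) *\<^sub>R x))\<^sup>2) \<in> borel_measurable borel"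
    unfolding gs_coeff_def by measurable
  have "2 * h * gs_energy = (\<integral>z. H z \<partial>lborel)"
    unfolding gs_energy_def Psi_change_of_variables[OF m] integral_mult_right_zero[symmetric]
  proof (intro Bochner_Integration.integral_cong refl)
    fix z :: "real^'n"
    show "2 * h * (indicator Dom z * (Gam ((norm z)\<^sup>2) ^ (CARD('n) - 1) * sig ((norm z)\<^sup>2) *
        (conf (Psi z) ^ (CARD('n) - 2) * (norm (g (Psi z) + (v (Psi z) * gs_coeff h ((norm (Psi z))\<^sup>2)) *\<^sub>R Psi z))\<^sup>2))) = H z"
    proof (cases "z \<in> Dom")
      case True
      define Y where "Y = (norm (g (Psi z) + (v (Psi z) * gs_coeff h ((norm (Psi z))\<^sup>2)) *\<^sub>R Psi z))\<^sup>2"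
      have "2 * h * (Gam ((norm z)\<^sup>2) ^ (CARD('n) - 1) * sig ((norm z)\<^sup>2) * (conf (Psi z) ^ (CARD('n) - 2) * Y))
         = (Gam ((norm z)\<^sup>2) ^ (CARD('n) - 1) * sig ((norm z)\<^sup>2) * conf (Psi z) ^ (CARD('n) - 2) * (2 * h)) * Y" by (simp only: mult_ac)
      also have "\<dots> = (sig ((norm z)\<^sup>2))\<^sup>2 * ((gs_factor h ((norm (Psi z))\<^sup>2))\<^sup>2 * Y)"
        unfolding jacobian_energy[OF True refl] by (simp only: mult.assoc)
      also have "(gs_factor h ((norm (Psi z))\<^sup>2))\<^sup>2 * Y = (norm (d_of v g (Psi z)))\<^sup>2"
        by (simp add: d_of_def Y_def power_mult_distrib)
      finally show ?thesis using True by (simp add: H_def Y_def)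
    qed (simp add: H_def)
  qed
  note E = this
  have cs: "continuous_on Dom (\<lambda>z. sig ((norm z)\<^sup>2))"
    unfolding sig_def by (intro continuous_intros Gam_continuous) (auto simp: Dom_def)
  have cd: "continuous_on Dom (\<lambda>z. d_of v g (Psi z))"
    by (rule continuous_on_compose2[OF d_of_continuous Psi_continuous]) (use Psi_punctured in blast)
  have iH: "integrable lborel H" unfolding H_def
  proof (rule integrable_compact_in_open[OF open_Dom Theta_K])
    show "continuous_on Dom (\<lambda>z. (sig ((norm z)\<^sup>2))\<^sup>2 * (norm (d_of v g (Psi z)))\<^sup>2)" by (intro continuous_intros cs cd)
    fix z assume "z \<in> Dom" "z \<notin> Theta ` K"
    then have "Psi z \<notin> K" by (rule not_in_Theta_K)
    then show "(sig ((norm z)\<^sup>2))\<^sup>2 * (norm (d_of v g (Psi z)))\<^sup>2 = 0" using u_0 g_0 by (simp add: d_of_def)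
  qed
  have iW: "integrable lborel (\<lambda>z. (norm (gw_of v g z))\<^sup>2)"
    by (rule W.integrable_continuous) (simp_all add: W.g_0 continuous_intros W.cont_g)
  have le: "(norm (gw_of v g z))\<^sup>2 \<le> H z" for z
    using norm_pullback(1)[OF _ refl, of z] by (cases "z \<in> Dom") (simp_all add: gw_of_def H_def)
  show "(\<integral>z. (norm (gw_of v g z))\<^sup>2 \<partial>lborel) \<le> 2 * h * gs_energy"
    unfolding E by (rule integral_mono[OF iW iH le])
  assume par: "\<And>z. z \<in> Dom \<Longrightarrow> \<exists>c. gw_of v g z = c *\<^sub>R z"
  have "(norm (gw_of v g z))\<^sup>2 = H z" for z
  proof (cases "z \<in> Dom")
    case True
    from par[OF True] norm_pullback(2)[OF True refl, of "d_of v g (Psi z)"] True show ?thesis by (simp add: gw_of_def H_def)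
  qed (simp add: gw_of_def H_def)
  then show "(\<integral>z. (norm (gw_of v g z))\<^sup>2 \<partial>lborel) = 2 * h * gs_energy" unfolding E by simp
qed

lemma v_zero: "v 0 = 0" using compact_C1.u_0[OF C, of 0] K by (auto simp: punctured_def)

lemma weighted_transplant:
  assumes p: "0 < p"
  shows "(\<integral>x. weighted_density p \<alpha> (hyp_dist x 0) CARD('n) (v x) \<partial>hyp_volume)
    = 2 * h * (\<integral>z. norm z powr (p * (real CARD('n) - 2) / 2 - real CARD('n)) * \<bar>w_of v z\<bar> powr p \<partial>lborel)"
proof -
  interpret compact_C1 v g K by (rule C)
  have m: "(\<lambda>x. weighted_density p \<alpha> (hyp_dist x 0) CARD('n) (v x)) \<in> borel_measurable borel" by measurable
  have m': "(\<lambda>x. conf x ^ CARD('n) * weighted_density p \<alpha> (hyp_dist x 0) CARD('n) (v x)) \<in> borel_measurable borel" by measurable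
  have z: "weighted_density p \<alpha> (hyp_dist 0 0) CARD('n) (v 0) = 0" by (simp add: weighted_density_def v_zero)
  show ?thesis unfolding hyp_volume_integral_punctured(1)[OF m z] Psi_change_of_variables[OF m'] integral_mult_right_zero[symmetric]
  proof (intro Bochner_Integration.integral_cong refl)
    fix y :: "real^'n"
    show "indicator Dom y * (Gam ((norm y)\<^sup>2) ^ (CARD('n) - 1) * sig ((norm y)\<^sup>2) *
       (conf (Psi y) ^ CARD('n) * weighted_density p \<alpha> (hyp_dist (Psi y) 0) CARD('n) (v (Psi y)))) =
      2 * h * (norm y powr (p * (real CARD('n) - 2) / 2 - real CARD('n)) * \<bar>w_of v y\<bar> powr p)"
      using jacobian_weight[OF _ refl p, of y] by (cases "y \<in> Dom") (simp_all add: w_of_def)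
  qed
qed

lemma square_transplant:
  "(\<integral>x. indicator punctured x * (conf x ^ CARD('n) * (v x)\<^sup>2) \<partial>lborel)
    = 2 * h * (\<integral>z. ((norm z)\<^sup>2) powr (- (2 * h + 1)) * (norm (Psi z) * conf (Psi z))\<^sup>2 * (w_of v z)\<^sup>2 \<partial>lborel)"
proof -
  interpret compact_C1 v g K by (rule C)
  have m: "(\<lambda>x. conf x ^ CARD('n) * (v x)\<^sup>2) \<in> borel_measurable borel" by measurable
  show ?thesis unfolding Psi_change_of_variables[OF m] integral_mult_right_zero[symmetric]
  proof (intro Bochner_Integration.integral_cong refl)
    fix y :: "real^'n"
    show "indicator Dom y * (Gam ((norm y)\<^sup>2) ^ (CARD('n) - 1) * sig ((norm y)\<^sup>2) * (conf (Psi y) ^ CARD('n) * (v (Psi y))\<^sup>2)) =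
      2 * h * (((norm y)\<^sup>2) powr (- (2 * h + 1)) * (norm (Psi y) * conf (Psi y))\<^sup>2 * (w_of v y)\<^sup>2)"
      using jacobian_square[OF _ refl, of y] by (cases "y \<in> Dom") (simp_all add: w_of_def)
  qed
qed

lemma deficit_lower_origin:
  assumes p: "2 < p" "p \<le> 2 * real CARD('n) / (real CARD('n) - 2)"
  shows "(2 * h) powr (- (p + 2) / p) * S_const TYPE('n) p * weighted_term p \<alpha> 0 v \<le> hardy_deficit 0 v"
proof -
  define W where "W = (\<integral>z. norm z powr (p * (real CARD('n) - 2) / 2 - real CARD('n)) * \<bar>w_of v z\<bar> powr p \<partial>lborel)"
  have W0: "0 \<le> W" unfolding W_def by (intro integral_nonneg_AE AE_I2) simp
  have hh: "(real CARD('n) - 2) / 2 = h" using h by simp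
  have "S_const TYPE('n) p * W powr (2 / p) \<le> (\<integral>z. (norm (gw_of v g z))\<^sup>2 \<partial>lborel)"
    unfolding W_def by (rule S_const_inequality[OF compact_C1_transplant dim p])
  also have "\<dots> \<le> 2 * h * gs_energy" by (rule energy_transplant(1))
  also have "gs_energy \<le> hardy_deficit 0 v"
    using hardy_deficit_ground_state(1)[OF C K dim] unfolding hh gs_energy_def .
  then have "2 * h * gs_energy \<le> 2 * h * hardy_deficit 0 v" using h_pos by simp
  finally have le: "S_const TYPE('n) p * W powr (2 / p) \<le> 2 * h * hardy_deficit 0 v" .
  have wt: "weighted_term p \<alpha> 0 v = (2 * h) powr (2 / p) * W powr (2 / p)"
    unfolding weighted_term_eq using weighted_transplant[of p] p W0 h_pos by (simp add: W_def powr_mult)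
  \<comment> \<open>The factor \<open>2 * h\<close> in the energy and the factor
    \<open>(2 * h) powr (2 / p)\<close> in the weighted term together account for the exponent
    \<open>- (p + 2) / p\<close>.\<close>
  have e: "(2 * h) powr (- (p + 2) / p) * (2 * h) powr (2 / p) = 1 / (2 * h)"
  proof -
    have "- (p + 2) / p + 2 / p = - 1" using p by (simp add: field_simps)
    then have "(2 * h) powr (- (p + 2) / p) * (2 * h) powr (2 / p) = (2 * h) powr (- 1)" by (simp only: powr_add[symmetric])
    then show ?thesis using h_pos by fastforce
  qed
  have "(2 * h) powr (- (p + 2) / p) * S_const TYPE('n) p * weighted_term p \<alpha> 0 v
     = ((2 * h) powr (- (p + 2) / p) * (2 * h) powr (2 / p)) * (S_const TYPE('n) p * W powr (2 / p))" unfolding wt by (simp only: mult_ac)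
  also have "\<dots> \<le> 1 / (2 * h) * (2 * h * hardy_deficit 0 v)" unfolding e using le h_pos by (intro mult_left_mono) auto
  also have "\<dots> = hardy_deficit 0 v" using h_pos by simp
  finally show ?thesis .
qed

end

lemma deficit_lower_off_center:
  fixes v :: "real^'n \<Rightarrow> real"
  assumes C: "compact_C1 v g K" and a: "a \<in> ball 0 1" and K: "K \<subseteq> ball 0 1 - {a}"
    and p: "2 < p" "p \<le> 2 * real CARD('n) / (real CARD('n) - 2)"
  shows "(2 * h) powr (- (p + 2) / p) * S_const TYPE('n) p * weighted_term p \<alpha> a v \<le> hardy_deficit a v"
proof -
  obtain I where I: "ball_isometry I a" using ball_isometry_exists[OF a] .
  define v' where "v' x = (if x \<in> ball 0 1 then v (I x) else 0)" for x
  from I C K obtain g' where C': "compact_C1 v' g' (I ` K)" and e: "hardy_deficit a v = hardy_deficit 0 v'" "weighted_term p \<alpha> a v = weighted_term p \<alpha> 0 v'"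
    unfolding ball_isometry_def v'_def[abs_def] by blast
  have "I x \<in> punctured" if "x \<in> K" for x
  proof -
    have x: "x \<in> ball 0 1" "x \<noteq> a" using that K by auto
    then have "I x \<in> ball 0 1" "I (I x) = x" "I (I a) = a" "I a = 0" using I a unfolding ball_isometry_def by blast+
    then show ?thesis using x by (auto simp: punctured_def)
  qed
  then have "I ` K \<subseteq> punctured" by blast
  from deficit_lower_origin[OF C' this p] show ?thesis unfolding e .
qed

end

lemma integral_scale:
  fixes f :: "'a::euclidean_space \<Rightarrow> real"
  assumes [measurable]: "f \<in> borel_measurable borel" and c: "0 < c"
  shows "(\<integral>x. f (c *\<^sub>R x) \<partial>lborel) = (\<integral>x. f x \<partial>lborel) / c ^ DIM('a)"
proof -
  have "(\<integral>x. f x \<partial>lborel) = (\<integral>x. f x \<partial>density (distr lborel borel (\<lambda>x. 0 + c *\<^sub>R x)) (\<lambda>_. ennreal (\<bar>c\<bar> ^ DIM('a))))"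
    by (rule arg_cong[where f = "\<lambda>M. integral\<^sup>L M f"], rule lborel_affine) (use c in simp)
  also have "\<dots> = (\<integral>x. c ^ DIM('a) * f x \<partial>distr lborel borel (\<lambda>x. 0 + c *\<^sub>R x))"
    using c by (subst integral_density) simp_all
  also have "\<dots> = (\<integral>x. c ^ DIM('a) * f (c *\<^sub>R x) \<partial>lborel)"
    by (subst integral_distr) simp_all
  also have "\<dots> = c ^ DIM('a) * (\<integral>x. f (c *\<^sub>R x) \<partial>lborel)" by simp
  finally show ?thesis using c by simp
qed

section \<open>Cutting out the base point and passing to the limit\<close>

text \<open>Dominated convergence if \<open>F\<close> is integrable. Otherwise the Bochner integral
  of \<open>F\<close> is 0 by convention, and the zero sequence lies below the integrals and
  converges to it; both cases reach the limit argument in one form.\<close>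

lemma exists_lower_sequence:
  fixes F :: "'b \<Rightarrow> real"
  assumes m: "F \<in> borel_measurable M" "\<And>k::nat. Fk k \<in> borel_measurable M" and nn: "\<And>k x. 0 \<le> Fk k x" and le: "\<And>k x. Fk k x \<le> F x"
    and lim: "\<And>x. (\<lambda>k. Fk k x) \<longlonglongrightarrow> F x"
  obtains s where "\<And>k. s k \<le> (\<integral>x. Fk k x \<partial>M)" "s \<longlonglongrightarrow> (\<integral>x. F x \<partial>M)" "\<And>k. 0 \<le> s k"
proof (cases "integrable M F")
  case True
  have "(\<lambda>k. \<integral>x. Fk k x \<partial>M) \<longlonglongrightarrow> (\<integral>x. F x \<partial>M)"
  proof (rule integral_dominated_convergence[where w = F, OF m True])
    show "AE x in M. (\<lambda>k. Fk k x) \<longlonglongrightarrow> F x" using lim by simp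
    fix k show "AE x in M. norm (Fk k x) \<le> F x" using nn[of k] le[of k] by simp
  qed
  then show ?thesis by (rule that[OF order_refl]) (simp add: nn)
next
  case False
  then have "(\<integral>x. F x \<partial>M) = 0" by (rule not_integrable_integral_eq)
  then show ?thesis using nn by (intro that[of "\<lambda>_. 0"]) simp_all
qed

text \<open>A cutoff at radius \<open>r\<close> adds a gradient of order \<open>1 / r\<close> on a
  ball of volume of order \<open>r^n\<close>, hence energy of order \<open>r^(n-2)\<close>, which
  tends to 0 for \<open>n \<ge> 3\<close>. The conformal factor is bounded on the compact set
  \<open>K\<close>.\<close>

lemma cutoff_sequence:
  fixes v :: "real^'n \<Rightarrow> real" and a :: "real^'n"
  assumes C: "compact_C1 v g K" and K: "K \<subseteq> ball 0 1" and dim: "3 \<le> CARD('n)"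
  obtains vk gk r e where "\<And>k::nat. compact_C1 (vk k) (gk k) (K - ball a (r k))" "\<And>k. 0 < r k"
    "\<And>k x. \<bar>vk k x\<bar> \<le> \<bar>v x\<bar>" "\<And>x. x \<noteq> a \<Longrightarrow> eventually (\<lambda>k. vk k x = v x) sequentially" "\<And>k. vk k a = 0"
    "\<And>k. (\<integral>x. (norm (gk k x) / conf x)\<^sup>2 \<partial>hyp_volume) \<le> (\<integral>x. (norm (g x) / conf x)\<^sup>2 \<partial>hyp_volume) + e k" "e \<longlonglongrightarrow> 0"
proof -
  interpret compact_C1 v g K by (rule C)
  obtain \<sigma> s P :: "real \<Rightarrow> real" where st: "smooth_on UNIV \<sigma>" "continuous_on UNIV s" "\<And>x. (\<sigma> has_real_derivative s x) (at x)"
    "\<And>x. x \<le> 0 \<Longrightarrow> \<sigma> x = 0" "\<And>x. 1 \<le> x \<Longrightarrow> \<sigma> x = 1" "\<And>x. 0 \<le> \<sigma> x" "\<And>x. \<sigma> x \<le> 1"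
    "\<And>x. x \<notin> {0<..<1} \<Longrightarrow> s x = 0" "\<And>x. (P has_real_derivative (s x)\<^sup>2) (at x)" "P 1 - P 0 \<le> 1 + 1"
    by (rule smooth_step_exists[of 1, OF zero_less_one]) (rule that)
  have cs: "continuous_on UNIV \<sigma>" by (intro continuous_at_imp_continuous_on ballI DERIV_isCont[OF st(3)])
  have "compact (s ` {0..1})" by (rule compact_continuous_image[OF continuous_on_subset[OF st(2) subset_UNIV] compact_Icc])
  then obtain L0 where L0: "\<And>x. x \<in> {0..1} \<Longrightarrow> norm (s x) \<le> L0" using compact_imp_bounded[of "s ` {0..1}"] by (meson bounded_iff image_iff)
  define L where "L = max L0 0"
  have L: "\<bar>s x\<bar> \<le> L" "0 \<le> L" for x
  proof -
    show "0 \<le> L" by (simp add: L_def)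
    show "\<bar>s x\<bar> \<le> L" using L0[of x] st(8)[of x] by (cases "x \<in> {0<..<1}") (auto simp: L_def)
  qed
  obtain B where B: "0 < B" "\<And>x. norm (v x) \<le> B" using compact_support_bounded[OF cont_u u_0] by blast
  obtain B' where B': "0 < B'" "\<And>x. norm (g x) \<le> B'" using compact_support_bounded[OF cont_g g_0] by blast
  define r where "r k = inverse (real (Suc k))" for k
  have r: "0 < r k" "r k \<le> 1" for k by (simp_all add: r_def field_simps)
  have r0: "r \<longlonglongrightarrow> 0" unfolding r_def by (rule LIMSEQ_inverse_real_of_nat)
  \<comment> \<open>\<open>t k\<close> is at most 0 within distance \<open>r k\<close> of
    \<open>a\<close> and at least 1 once \<open>|x - a|^2 \<ge> 2 * (r k)^2\<close>, so the step
    acts strictly between. The squared distance keeps the cutoff differentiable at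
    \<open>a\<close>.\<close>
  define t where "t k x = (norm (x - a))\<^sup>2 / (r k)\<^sup>2 - 1" for k and x :: "real^'n"
  define vk where "vk k x = v x * \<sigma> (t k x)" for k x
  define gk where "gk k x = \<sigma> (t k x) *\<^sub>R g x + (v x * (s (t k x) * (2 / (r k)\<^sup>2))) *\<^sub>R (x - a)" for k x
  have tneg: "t k x \<le> 0" if "norm (x - a) \<le> r k" for k x
  proof -
    have "(norm (x - a))\<^sup>2 \<le> (r k)\<^sup>2" using that by (intro power_mono) simp_all
    then show ?thesis using r[of k] by (simp add: t_def)
  qed
  have tbig: "1 \<le> t k x" if "2 * (r k)\<^sup>2 \<le> (norm (x - a))\<^sup>2" for k x
    using that r[of k] by (simp add: t_def pos_le_divide_eq)
  have CC: "compact_C1 (vk k) (gk k) (K - ball a (r k))" for k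
  proof
    fix x
    have "((\<lambda>q. \<sigma> (q / (r k)\<^sup>2 - 1)) has_real_derivative s ((norm (x - a))\<^sup>2 / (r k)\<^sup>2 - 1) * (1 / (r k)\<^sup>2 - 0)) (at ((norm (x - a))\<^sup>2))"
      by (rule DERIV_chain2[OF st(3) DERIV_diff[OF DERIV_cdivide[OF DERIV_ident] DERIV_const]])
    from has_derivative_norm_sq_comp[OF this]
    have d1: "((\<lambda>y. \<sigma> ((norm y)\<^sup>2 / (r k)\<^sup>2 - 1)) has_derivative (\<lambda>y. (2 * (s (t k x) * (1 / (r k)\<^sup>2 - 0))) * ((x - a) \<bullet> y))) (at (x - a))"
      by (simp only: t_def)
    have d0: "((\<lambda>x. x - a) has_derivative (\<lambda>y. y)) (at x)" by (auto intro!: derivative_eq_intros)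
    have d2: "((\<lambda>x. \<sigma> (t k x)) has_derivative (\<lambda>y. (2 * (s (t k x) * (1 / (r k)\<^sup>2 - 0))) * ((x - a) \<bullet> y))) (at x)"
      using has_derivative_compose[OF d0 d1] by (simp only: t_def)
    have "(vk k has_derivative (\<lambda>y. v x * ((2 * (s (t k x) * (1 / (r k)\<^sup>2 - 0))) * ((x - a) \<bullet> y)) + (g x \<bullet> y) * \<sigma> (t k x))) (at x)"
      unfolding vk_def[abs_def] by (rule has_derivative_mult[OF deriv d2])
    moreover have "v x * ((2 * (s (t k x) * (1 / (r k)\<^sup>2 - 0))) * ((x - a) \<bullet> y)) + (g x \<bullet> y) * \<sigma> (t k x) = gk k x \<bullet> y" for y
      unfolding gk_def inner_add_left inner_scaleR_left by (simp add: mult_ac)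
    ultimately show "(vk k has_derivative (\<lambda>y. gk k x \<bullet> y)) (at x)" by simp
    assume "x \<notin> K - ball a (r k)"
    then have x: "x \<notin> K \<or> norm (x - a) \<le> r k" by (auto simp: dist_norm norm_minus_commute)
    have "\<sigma> (t k x) = 0 \<and> s (t k x) = 0" if "x \<in> K"
      using x that tneg[of x k] st(4)[of "t k x"] st(8)[of "t k x"] by auto
    then show "vk k x = 0" "gk k x = 0" using u_0[of x] g_0[of x] by (cases "x \<in> K"; simp add: vk_def gk_def)+
  next
    show "continuous_on UNIV (gk k)" unfolding gk_def[abs_def] t_def
      by (intro continuous_intros continuous_on_compose2[OF cs] continuous_on_compose2[OF st(2)] cont_g cont_u) (use r[of k] in auto)
    show "compact (K - ball a (r k))" by (rule compact_diff[OF compact_K open_ball])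
  qed
  have le: "\<bar>vk k x\<bar> \<le> \<bar>v x\<bar>" for k x
    using st(6)[of "t k x"] st(7)[of "t k x"] by (simp add: vk_def abs_mult mult_left_le)
  have ev: "eventually (\<lambda>k. vk k x = v x) sequentially" if "x \<noteq> a" for x
  proof -
    have "(\<lambda>k. 2 * (r k)\<^sup>2) \<longlonglongrightarrow> 2 * 0\<^sup>2" by (intro tendsto_intros r0)
    moreover have "2 * 0\<^sup>2 < (norm (x - a))\<^sup>2" using that by simp
    ultimately have "eventually (\<lambda>k. 2 * (r k)\<^sup>2 < (norm (x - a))\<^sup>2) sequentially" by (rule order_tendstoD(2))
    then show ?thesis
    proof eventually_elim
      case (elim k)
      then have "1 \<le> t k x" by (intro tbig) simp
      then show ?case using st(5) by (simp add: vk_def)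
    qed
  qed
  have va: "vk k a = 0" for k using st(4)[of "t k a"] tneg[of a k] r[of k] by (simp add: vk_def)
  define n where "n = CARD('n)"
  have cb: "continuous_on (ball 0 1) (conf :: real^'n \<Rightarrow> real)"
    unfolding conf_def by (intro continuous_intros) (use in_unit_ball in force)
  have "compact ((\<lambda>x. conf x ^ (n - 2)) ` K)"
    by (rule compact_continuous_image[OF continuous_on_subset[OF continuous_on_power[OF cb] K] compact_K])
  then obtain c0 where c0: "\<And>x. x \<in> K \<Longrightarrow> norm (conf x ^ (n - 2)) \<le> c0" using compact_imp_bounded[of "(\<lambda>x. conf x ^ (n - 2)) ` K"] by (auto simp: bounded_iff)
  define c where "c = max c0 0"
  have c: "conf x ^ (n - 2) \<le> c" if "x \<in> K" for x using c0[OF that] by (simp add: c_def)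
  have cn: "0 \<le> c" by (simp add: c_def)
  define M where "M = B' + 4 * B * L"
  have M: "0 \<le> M" using B B' L by (simp add: M_def)
  define Fg where "Fg \<gamma> x = indicator (ball 0 1) x * (conf x ^ CARD('n) * (norm (\<gamma> x) / conf x)\<^sup>2)" for \<gamma> :: "real^'n \<Rightarrow> real^'n" and x
  have Fi: "integrable lborel (Fg \<gamma>)" "(\<integral>x. (norm (\<gamma> x) / conf x)\<^sup>2 \<partial>hyp_volume) = (\<integral>x. Fg \<gamma> x \<partial>lborel)"
    if "continuous_on UNIV \<gamma>" "\<And>x. x \<notin> K \<Longrightarrow> \<gamma> x = 0" for \<gamma>
  proof -
    show "integrable lborel (Fg \<gamma>)" unfolding Fg_def[abs_def]
    proof (rule integrable_compact_in_open[OF open_ball compact_K K])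
      show "continuous_on (ball 0 1) (\<lambda>x. conf x ^ CARD('n) * (norm (\<gamma> x) / conf x)\<^sup>2)"
        by (intro continuous_intros cb continuous_on_subset[OF that(1) subset_UNIV]) (use conf_pos in force)
    qed (use that(2) in simp)
    have [measurable]: "\<gamma> \<in> borel_measurable borel" using that(1) by (rule borel_measurable_continuous_onI)
    have "(\<lambda>x. (norm (\<gamma> x) / conf x)\<^sup>2) \<in> borel_measurable borel" by measurable
    from hyp_volume_integral(1)[OF this] show "(\<integral>x. (norm (\<gamma> x) / conf x)\<^sup>2 \<partial>hyp_volume) = (\<integral>x. Fg \<gamma> x \<partial>lborel)"
      by (simp only: Fg_def)
  qed
  have FK: "Fg \<gamma> x = conf x ^ (n - 2) * (norm (\<gamma> x))\<^sup>2" if "x \<in> K" for \<gamma> x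
  proof -
    have x: "x \<in> ball 0 1" using that K by blast
    have cx: "conf x \<noteq> 0" using conf_pos[OF x] by simp
    have "CARD('n) = (n - 2) + 2" using dim by (simp add: n_def)
    then have "conf x ^ CARD('n) = conf x ^ (n - 2) * (conf x)\<^sup>2" by (metis power_add)
    then show ?thesis using x cx by (simp add: Fg_def power_divide)
  qed
  have gkb: "norm (gk k x) \<le> M / r k" if x: "norm (x - a) \<le> 2 * r k" for k x
  proof -
    have "norm (gk k x) \<le> norm (\<sigma> (t k x) *\<^sub>R g x) + norm ((v x * (s (t k x) * (2 / (r k)\<^sup>2))) *\<^sub>R (x - a))"
      unfolding gk_def by (rule norm_triangle_ineq)
    moreover have "norm (\<sigma> (t k x) *\<^sub>R g x) \<le> B' / r k"
    proof -
      have "norm (\<sigma> (t k x) *\<^sub>R g x) \<le> 1 * B'" unfolding norm_scaleR using st(6)[of "t k x"] st(7)[of "t k x"] B' by (intro mult_mono) auto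
      also have "\<dots> \<le> B' / r k" using r[of k] B' by (simp add: pos_le_divide_eq mult_left_le)
      finally show ?thesis .
    qed
    moreover have "norm ((v x * (s (t k x) * (2 / (r k)\<^sup>2))) *\<^sub>R (x - a)) \<le> 4 * B * L / r k"
    proof -
      have "norm ((v x * (s (t k x) * (2 / (r k)\<^sup>2))) *\<^sub>R (x - a)) = \<bar>v x\<bar> * (\<bar>s (t k x)\<bar> * (2 / (r k)\<^sup>2)) * norm (x - a)"
        by (simp add: abs_mult)
      also have "\<dots> \<le> B * (L * (2 / (r k)\<^sup>2)) * (2 * r k)"
        using B(1) B(2)[of x] L x r[of k] by (intro mult_mono) auto
      also have "\<dots> = 4 * B * L / r k" using r[of k] by (simp add: power2_eq_square)
      finally show ?thesis .
    qed
    ultimately have "norm (gk k x) \<le> B' / r k + 4 * B * L / r k" by linarith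
    then show ?thesis by (simp add: M_def add_divide_distrib)
  qed
  have gke: "gk k x = g x" if "2 * r k < norm (x - a)" for k x
  proof -
    have "(2 * r k)\<^sup>2 \<le> (norm (x - a))\<^sup>2" using that r[of k] by (intro power_mono) auto
    moreover have "2 * (r k)\<^sup>2 \<le> (2 * r k)\<^sup>2" by (simp add: power_mult_distrib)
    ultimately have "1 \<le> t k x" by (intro tbig) linarith
    then show ?thesis using st(5)[of "t k x"] st(8)[of "t k x"] by (simp add: gk_def)
  qed
  define Vn where "Vn = unit_ball_vol (real CARD('n))"
  define e where "e k = c * M\<^sup>2 * Vn * 2 ^ CARD('n) * r k" for k
  have Vn: "0 \<le> Vn" by (simp add: Vn_def)
  have en: "(\<integral>x. (norm (gk k x) / conf x)\<^sup>2 \<partial>hyp_volume) \<le> (\<integral>x. (norm (g x) / conf x)\<^sup>2 \<partial>hyp_volume) + e k" for k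
  proof -
    interpret k: compact_C1 "vk k" "gk k" "K - ball a (r k)" by (rule CC)
    have z: "gk k x = 0" if "x \<notin> K" for x using k.g_0 that by blast
    define d where "d = c * (M / r k)\<^sup>2"
    have d: "0 \<le> d" using cn by (simp add: d_def)
    have fin: "emeasure lborel (cball a (2 * r k)) < \<infinity>" using emeasure_compact_finite[OF compact_cball] .
    have ii: "integrable lborel (\<lambda>x. d * indicator (cball a (2 * r k)) x)"
      using fin by (intro integrable_mult_right integrable_real_indicator) simp_all
    have pw: "Fg (gk k) x \<le> Fg g x + d * indicator (cball a (2 * r k)) x" for x
    proof (cases "x \<in> K")
      case True
      have cx: "0 \<le> conf x ^ (n - 2)" using conf_pos[of x] True K by (intro zero_le_power) auto
      show ?thesis
      proof (cases "norm (x - a) \<le> 2 * r k")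
        case T2: True
        have "Fg (gk k) x = conf x ^ (n - 2) * (norm (gk k x))\<^sup>2" by (rule FK[OF True])
        also have "\<dots> \<le> c * (M / r k)\<^sup>2" using gkb[OF T2] c[OF True] cn by (intro mult_mono power_mono) auto
        finally have "Fg (gk k) x \<le> d" by (simp add: d_def)
        moreover have "0 \<le> Fg g x" unfolding FK[OF True] using cx by simp
        moreover have "x \<in> cball a (2 * r k)" using T2 by (simp add: dist_norm norm_minus_commute)
        ultimately show ?thesis by simp
      next
        case False
        then have "Fg (gk k) x = Fg g x" using gke[of k x] by (simp add: Fg_def)
        then show ?thesis using d by simp
      qed
    next
      case False
      then show ?thesis using z[OF False] g_0[OF False] d by (simp add: Fg_def)
    qed
    have "(\<integral>x. (norm (gk k x) / conf x)\<^sup>2 \<partial>hyp_volume) = (\<integral>x. Fg (gk k) x \<partial>lborel)" by (rule Fi(2)[OF k.cont_g z])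
    also have "\<dots> \<le> (\<integral>x. Fg g x + d * indicator (cball a (2 * r k)) x \<partial>lborel)"
      by (rule integral_mono[OF Fi(1)[OF k.cont_g z] Bochner_Integration.integrable_add[OF Fi(1)[OF cont_g g_0] ii] pw])
    also have "\<dots> = (\<integral>x. Fg g x \<partial>lborel) + (\<integral>x. d * indicator (cball a (2 * r k)) x \<partial>lborel)"
      by (rule Bochner_Integration.integral_add[OF Fi(1)[OF cont_g g_0] ii])
    also have "(\<integral>x. Fg g x \<partial>lborel) = (\<integral>x. (norm (g x) / conf x)\<^sup>2 \<partial>hyp_volume)" by (rule Fi(2)[OF cont_g g_0, symmetric])
    also have "(\<integral>x. d * indicator (cball a (2 * r k)) x \<partial>lborel) = d * (Vn * (2 * r k) ^ CARD('n))"
      using content_cball[of "2 * r k" a] r[of k] by (simp add: Vn_def)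
    also have "d * (Vn * (2 * r k) ^ CARD('n)) \<le> e k"
    proof -
      have "r k ^ CARD('n) \<le> r k ^ 3" using r[of k] dim by (intro power_decreasing) auto
      also have "\<dots> = r k * (r k)\<^sup>2" by (simp add: power3_eq_cube power2_eq_square)
      finally have "r k ^ CARD('n) / (r k)\<^sup>2 \<le> r k" using r[of k] by (simp add: pos_divide_le_eq)
      then have "c * M\<^sup>2 * Vn * 2 ^ CARD('n) * (r k ^ CARD('n) / (r k)\<^sup>2) \<le> c * M\<^sup>2 * Vn * 2 ^ CARD('n) * r k"
        using cn Vn by (intro mult_left_mono mult_nonneg_nonneg) auto
      then show ?thesis by (simp add: d_def e_def power_mult_distrib power_divide mult_ac)
    qed
    finally show ?thesis by simp
  qed
  have "e \<longlonglongrightarrow> c * M\<^sup>2 * Vn * 2 ^ CARD('n) * 0" unfolding e_def[abs_def] by (intro tendsto_intros r0)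
  then have e0: "e \<longlonglongrightarrow> 0" by simp
  show ?thesis by (rule that[OF CC r(1) le ev va en e0])
qed

lemma S_const_nonneg:
  assumes "3 \<le> CARD('n::finite)" "2 < p" "p \<le> 2 * real CARD('n) / (real CARD('n) - 2)"
  shows "0 \<le> S_const TYPE('n) p"
  unfolding S_const_eq by (rule cSup_upper[OF zero_in_Sobolev_bounds exists_Sobolev_upper_bound[OF assms]])

context transplant
begin

text \<open>The inequality for the cut-off functions passes to the limit. The Hardy and weighted
  integrals both stand where a lower bound is enough, so lower sequences for them suffice, and the
  gradient integral is bounded from above by the cutoff estimate.\<close>

theorem deficit_lower:
  fixes v :: "real^'n \<Rightarrow> real"
  assumes C: "compact_C1 v g K" and a: "a \<in> ball 0 1" and K: "K \<subseteq> ball 0 1"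
    and p: "2 < p" "p \<le> 2 * real CARD('n) / (real CARD('n) - 2)"
  shows "(2 * h) powr (- (p + 2) / p) * S_const TYPE('n) p * weighted_term p \<alpha> a v \<le> hardy_deficit a v"
proof -
  interpret compact_C1 v g K by (rule C)
  obtain vk gk r e where A: "\<And>k::nat. compact_C1 (vk k) (gk k) (K - ball a (r k))" "\<And>k. 0 < r k"
    "\<And>k x. \<bar>vk k x\<bar> \<le> \<bar>v x\<bar>" "\<And>x. x \<noteq> a \<Longrightarrow> eventually (\<lambda>k. vk k x = v x) sequentially" "\<And>k. vk k a = 0"
    "\<And>k. (\<integral>x. (norm (gk k x) / conf x)\<^sup>2 \<partial>hyp_volume) \<le> (\<integral>x. (norm (g x) / conf x)\<^sup>2 \<partial>hyp_volume) + e k" "e \<longlonglongrightarrow> 0"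
    by (rule cutoff_sequence[OF C K dim, of a]) (rule that)
  define \<kappa> where "\<kappa> = (2 * h) powr (- (p + 2) / p) * S_const TYPE('n) p"
  have \<kappa>: "0 \<le> \<kappa>" unfolding \<kappa>_def using S_const_nonneg[OF dim p] by simp
  have hh: "(real CARD('n) - 2) / 2 = h" using h by simp
  define EH where "EH = (\<integral>x. (norm (g x) / conf x)\<^sup>2 \<partial>hyp_volume)"
  define H where "H k = (\<integral>x. (vk k x)\<^sup>2 / (hyp_dist x a)\<^sup>2 \<partial>hyp_volume)" for k
  define wd where "wd f x = weighted_density p \<alpha> (hyp_dist x a) CARD('n) (f x)" for f and x :: "real^'n"
  have [measurable_cong]: "sets (hyp_volume :: (real^'n) measure) = sets borel" by (simp add: hyp_volume_def)
  have [measurable]: "vk k \<in> borel_measurable borel" for k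
    using compact_C1.cont_u[OF A(1)] by (rule borel_measurable_continuous_onI)
  have [measurable]: "v \<in> borel_measurable borel" using cont_u by (rule borel_measurable_continuous_onI)
  have [measurable]: "(\<lambda>x. hyp_dist x a) \<in> borel_measurable borel" by (rule hyp_dist_measurable)
  \<comment> \<open>At \<open>x = a\<close> both integrands are 0 for every function, by division by
    zero and by \<open>0 powr\<close>, so the pointwise convergence holds there as well.\<close>
  have da: "hyp_dist a a = 0" by (simp add: hyp_dist_def)
  have bound: "\<kappa> * weighted_term p \<alpha> a (vk k) \<le> EH + e k - h\<^sup>2 * H k" for k
  proof -
    have "K - ball a (r k) \<subseteq> ball 0 1 - {a}" using K A(2)[of k] by auto
    from deficit_lower_off_center[OF A(1) a this p]
    have "\<kappa> * weighted_term p \<alpha> a (vk k) \<le> hardy_deficit a (vk k)" by (simp only: \<kappa>_def)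
    also have "\<dots> \<le> EH + e k - h\<^sup>2 * H k" unfolding hardy_deficit_eq[OF A(1)] hh EH_def H_def using A(6)[of k] by simp
    finally show ?thesis .
  qed
  have m1: "(\<lambda>x. (v x)\<^sup>2 / (hyp_dist x a)\<^sup>2) \<in> borel_measurable hyp_volume" by measurable
  have m2: "(\<lambda>x. (vk k x)\<^sup>2 / (hyp_dist x a)\<^sup>2) \<in> borel_measurable hyp_volume" for k by measurable
  have m3: "wd v \<in> borel_measurable hyp_volume" unfolding wd_def[abs_def] by measurable
  have m4: "wd (vk k) \<in> borel_measurable hyp_volume" for k unfolding wd_def[abs_def] by measurable
  have n1: "0 \<le> (vk k x)\<^sup>2 / (hyp_dist x a)\<^sup>2" for k x by simp
  have l1: "(vk k x)\<^sup>2 / (hyp_dist x a)\<^sup>2 \<le> (v x)\<^sup>2 / (hyp_dist x a)\<^sup>2" for k x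
    using A(3)[of k x] by (intro divide_right_mono) (simp_all add: abs_le_square_iff)
  have n2: "0 \<le> wd (vk k) x" for k x by (simp add: wd_def weighted_density_def)
  have l2: "wd (vk k) x \<le> wd v x" for k x
    unfolding wd_def weighted_density_def using A(3)[of k x] p by (intro mult_left_mono powr_mono2) auto
  have c1: "(\<lambda>k. (vk k x)\<^sup>2 / (hyp_dist x a)\<^sup>2) \<longlonglongrightarrow> (v x)\<^sup>2 / (hyp_dist x a)\<^sup>2" for x
  proof (cases "x = a")
    case False
    show ?thesis by (intro tendsto_eventually) (rule eventually_mono[OF A(4)[OF False]], simp)
  qed (simp add: da)
  have c2: "(\<lambda>k. wd (vk k) x) \<longlonglongrightarrow> wd v x" for x
  proof (cases "x = a")
    case False
    then show ?thesis using A(4)[OF False] by (intro tendsto_eventually) (auto elim: eventually_mono simp: wd_def)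
  qed (simp add: da wd_def weighted_density_def)
  obtain s where s: "\<And>k. s k \<le> (\<integral>x. (vk k x)\<^sup>2 / (hyp_dist x a)\<^sup>2 \<partial>hyp_volume)" "s \<longlonglongrightarrow> (\<integral>x. (v x)\<^sup>2 / (hyp_dist x a)\<^sup>2 \<partial>hyp_volume)" "\<And>k. 0 \<le> s k"
    by (rule exists_lower_sequence[OF m1 m2 n1 l1 c1]) (rule that)
  obtain w where w: "\<And>k. w k \<le> (\<integral>x. wd (vk k) x \<partial>hyp_volume)" "w \<longlonglongrightarrow> (\<integral>x. wd v x \<partial>hyp_volume)" "\<And>k. 0 \<le> w k"
    by (rule exists_lower_sequence[OF m3 m4 n2 l2 c2]) (rule that)
  have "\<kappa> * w k powr (2 / p) \<le> EH + e k - h\<^sup>2 * s k" for k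
  proof -
    have "w k powr (2 / p) \<le> weighted_term p \<alpha> a (vk k)"
      unfolding weighted_term_eq using w(1)[of k] w(3)[of k] p by (intro powr_mono2) (simp_all add: wd_def)
    then have "\<kappa> * w k powr (2 / p) \<le> \<kappa> * weighted_term p \<alpha> a (vk k)" using \<kappa> by (rule mult_left_mono)
    moreover have "h\<^sup>2 * s k \<le> h\<^sup>2 * H k" using s(1)[of k] by (intro mult_left_mono) (simp_all add: H_def)
    ultimately show ?thesis using bound[of k] by linarith
  qed
  moreover have "(\<lambda>k. \<kappa> * w k powr (2 / p)) \<longlonglongrightarrow> \<kappa> * (\<integral>x. wd v x \<partial>hyp_volume) powr (2 / p)"
    using w p by (intro tendsto_intros tendsto_powr') auto
  moreover have "(\<lambda>k. EH + e k - h\<^sup>2 * s k) \<longlonglongrightarrow> EH + 0 - h\<^sup>2 * (\<integral>x. (v x)\<^sup>2 / (hyp_dist x a)\<^sup>2 \<partial>hyp_volume)"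
    by (intro tendsto_intros A(7) s(2))
  ultimately have "\<kappa> * (\<integral>x. wd v x \<partial>hyp_volume) powr (2 / p) \<le> EH + 0 - h\<^sup>2 * (\<integral>x. (v x)\<^sup>2 / (hyp_dist x a)\<^sup>2 \<partial>hyp_volume)"
    by (intro LIMSEQ_le) auto
  then show ?thesis unfolding hardy_deficit_eq[OF C] hh weighted_term_eq by (simp add: EH_def \<kappa>_def wd_def)
qed

section \<open>Scaled radial competitors and sharpness\<close>

text \<open>With \<open>\<tau> = |z|^(2-n)\<close>, the squared radius of \<open>Psi z\<close>
  decays like \<open>exp (- 2 * \<tau>)\<close> and beats the power
  \<open>\<tau> powr ((2 * h + 1) / h)\<close>, whose exponent is at most 4 because
  \<open>h \<ge> 1/2\<close>. The bound \<open>\<tau> \<ge> 2 - ln \<alpha>\<close> puts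
  \<open>Psi z\<close> into the ball of radius 1/2, where \<open>conf\<close> is at most 4. The
  constant is \<open>64 = 2^2 * 4^2\<close>.\<close>

lemma square_weight_bound:
  fixes z :: "real^'n"
  assumes z: "z \<in> Dom" and T: "max 1 (2 - ln \<alpha>) \<le> ((norm z)\<^sup>2) powr (- h)"
  shows "((norm z)\<^sup>2) powr (- (2 * h + 1)) * (norm (Psi z) * conf (Psi z))\<^sup>2 \<le> 64 * exp 2 / \<alpha>\<^sup>2"
proof -
  define q where "q = (norm z)\<^sup>2"
  define \<tau> where "\<tau> = q powr (- h)"
  have q: "0 < q" using z by (simp add: q_def Dom_def)
  have \<tau>: "1 \<le> \<tau>" "2 - ln \<alpha> \<le> \<tau>" using T by (simp_all add: \<tau>_def q_def)
  have nP: "norm (Psi z) = exp (1 - \<tau>) / \<alpha>" using norm_Psi[OF z q_def] by (simp add: \<tau>_def)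
  have "exp (1 - \<tau>) \<le> exp (ln \<alpha> - 1)" using \<tau>(2) by simp
  also have "\<dots> = \<alpha> / exp 1" using \<alpha>(1) by (simp add: exp_diff)
  also have "\<dots> \<le> \<alpha> / 2" using \<alpha>(1) exp_ge_add_one_self[of 1] by (intro divide_left_mono) auto
  finally have n2: "norm (Psi z) \<le> 1/2" unfolding nP using \<alpha>(1) by (simp add: pos_divide_le_eq)
  have "(norm (Psi z))\<^sup>2 \<le> (1/2)\<^sup>2" using n2 by (intro power_mono) auto
  then have n4: "3/4 \<le> 1 - (norm (Psi z))\<^sup>2" by (simp add: power_divide)
  have cf: "0 \<le> conf (Psi z)" "conf (Psi z) \<le> 4"
    using n4 by (simp_all add: conf_def pos_divide_le_eq)
  have "\<tau> powr ((2 * h + 1) / h) = q powr (- (2 * h + 1))" unfolding \<tau>_def powr_powr using h_pos by simp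
  then have "q powr (- (2 * h + 1)) = \<tau> powr ((2 * h + 1) / h)" by (rule sym)
  also have "\<dots> \<le> \<tau> powr 4" using \<tau>(1) h_ge by (intro powr_mono) (simp_all add: pos_divide_le_eq)
  also have "\<dots> = (\<tau>\<^sup>2)\<^sup>2" using \<tau>(1) by simp
  also have "\<dots> \<le> (2 * exp \<tau>)\<^sup>2"
  proof -
    have "1 + \<tau> + \<tau>\<^sup>2 / 2 \<le> exp \<tau>" using \<tau>(1) by (intro exp_lower_Taylor_quadratic) simp
    then have "\<tau>\<^sup>2 \<le> 2 * exp \<tau>" using \<tau>(1) by simp
    then show ?thesis by (intro power_mono) simp_all
  qed
  finally have Q: "q powr (- (2 * h + 1)) \<le> (2 * exp \<tau>)\<^sup>2" .
  have "(norm (Psi z) * conf (Psi z))\<^sup>2 \<le> (exp (1 - \<tau>) / \<alpha> * 4)\<^sup>2"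
    unfolding nP using cf \<alpha>(1) by (intro power_mono mult_left_mono mult_nonneg_nonneg) simp_all
  with Q have "q powr (- (2 * h + 1)) * (norm (Psi z) * conf (Psi z))\<^sup>2 \<le> (2 * exp \<tau>)\<^sup>2 * (exp (1 - \<tau>) / \<alpha> * 4)\<^sup>2"
    by (intro mult_mono) simp_all
  also have "\<dots> = 64 * (exp \<tau> * exp (1 - \<tau>))\<^sup>2 / \<alpha>\<^sup>2" by (simp add: power_mult_distrib power_divide)
  also have "(exp \<tau> * exp (1 - \<tau>))\<^sup>2 = exp 2"
  proof -
    have "exp \<tau> * exp (1 - \<tau>) = exp 1" by (simp flip: exp_add)
    then show ?thesis by (simp add: power2_eq_square flip: exp_add)
  qed
  finally show ?thesis by (simp add: q_def)
qed

context
  fixes G G' :: "real \<Rightarrow> real" and Q1 Q2 lam :: real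
  assumes RT: "radial_test G G' Q1 Q2" and lam: "0 < lam" and big: "max 1 (2 - ln \<alpha>) \<le> (Q2 / lam\<^sup>2) powr (- h)"
begin

text \<open>The transplantation undone for \<open>G (lam^2 * |z|^2)\<close>, as a function of
  \<open>q = |x|^2\<close>: the argument of \<open>G\<close> is \<open>lam^2 * |Theta x|^2\<close>,
  and the remaining factor is \<open>sinh powr (- h)\<close> of the distance. The assumption
  \<open>big\<close> places the support inside \<open>Dom\<close> and in the range of
  \<open>square_weight_bound\<close>.\<close>

definition "V q = (if 0 < q \<and> q < 1 then G (lam\<^sup>2 * ((1 - ln \<alpha>) - (1/2) * ln q) powr (- (1 / h))) *
   (q powr (- (h / 2)) * 2 powr (- h) * (1 - q) powr h) else 0)"

lemma G_support:
  assumes "G (lam\<^sup>2 * q) \<noteq> 0"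
  shows "Q1 / lam\<^sup>2 \<le> q" "q \<le> Q2 / lam\<^sup>2" "0 < q" "max 1 (2 - ln \<alpha>) \<le> q powr (- h)"
proof -
  interpret radial_test G G' Q1 Q2 by (rule RT)
  have s: "Q1 \<le> lam\<^sup>2 * q" "lam\<^sup>2 * q \<le> Q2" using G_0[of "lam\<^sup>2 * q"] assms by auto
  have l: "0 < lam\<^sup>2" using lam by simp
  show a: "Q1 / lam\<^sup>2 \<le> q" "q \<le> Q2 / lam\<^sup>2" using s l by (simp_all add: pos_divide_le_eq pos_le_divide_eq mult.commute)
  have "0 < Q1 / lam\<^sup>2" using Q l by simp
  with a show q: "0 < q" by linarith
  have "(Q2 / lam\<^sup>2) powr (- h) \<le> q powr (- h)" using a q h_pos by (intro powr_mono2') auto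
  then show "max 1 (2 - ln \<alpha>) \<le> q powr (- h)" using big by linarith
qed

text \<open>The squared radius to which \<open>Psi\<close> takes the inner sphere
  \<open>|z|^2 = Q1 / lam^2\<close> of the support.\<close>

definition "q1 = exp (2 * (1 - ln \<alpha> - (Q1 / lam\<^sup>2) powr (- h)))"

lemma tau_pos: "0 < q \<Longrightarrow> q < 1 \<Longrightarrow> 0 < (1 - ln \<alpha>) - (1/2) * ln q"
proof -
  assume "0 < q" "q < 1"
  then have "ln q < 0" by simp
  moreover have "0 < 1 / (2 * h)" using h_pos by simp
  ultimately show ?thesis using ln_\<alpha> by linarith
qed

lemma V_annulus: "V q \<noteq> 0 \<Longrightarrow> q1 \<le> q \<and> q \<le> exp (- 2)"
proof -
  interpret radial_test G G' Q1 Q2 by (rule RT)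
  assume "V q \<noteq> 0"
  then have q: "0 < q" "q < 1" and G: "G (lam\<^sup>2 * ((1 - ln \<alpha>) - (1/2) * ln q) powr (- (1 / h))) \<noteq> 0"
    by (auto simp: V_def split: if_splits)
  define \<tau> where "\<tau> = (1 - ln \<alpha>) - (1/2) * ln q"
  have \<tau>: "0 < \<tau>" using tau_pos[OF q] by (simp add: \<tau>_def)
  define u where "u = \<tau> powr (- (1 / h))"
  have ut: "u powr (- h) = \<tau>" unfolding u_def powr_powr using h_pos \<tau> by simp
  note s = G_support[OF G[folded \<tau>_def, folded u_def]]
  have "2 - ln \<alpha> \<le> \<tau>" using s(4) by (simp add: ut)
  then have "ln q \<le> - 2" by (simp add: \<tau>_def)
  then have 1: "q \<le> exp (- 2)" using q by (metis exp_le_cancel_iff exp_ln)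
  have "u powr (- h) \<le> (Q1 / lam\<^sup>2) powr (- h)" using s Q lam h_pos by (intro powr_mono2') auto
  then have "2 * (1 - ln \<alpha> - (Q1 / lam\<^sup>2) powr (- h)) \<le> ln q" unfolding ut by (simp add: \<tau>_def)
  then have "q1 \<le> q" unfolding q1_def using q by (metis exp_le_cancel_iff exp_ln)
  with 1 show ?thesis by simp
qed

lemma V_smooth: "smooth_on UNIV V"
proof -
  interpret radial_test G G' Q1 Q2 by (rule RT)
  let ?U = "{0<..<1::real}"
  have o: "open ?U" by (rule open_greaterThanLessThan)
  have ln: "smooth_on ?U ln" by (rule smooth_on_subset[OF smooth_on_ln]) auto
  have s1: "smooth_on ?U (\<lambda>q. (1 - ln \<alpha>) - (1/2) * ln q)"
    by (rule smooth_on_diff[OF o smooth_on_const[OF o] smooth_on_mult[OF o smooth_on_const[OF o] ln]])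
  have s2: "smooth_on ?U (\<lambda>q. ((1 - ln \<alpha>) - (1/2) * ln q) powr (- (1 / h)))"
    by (rule smooth_on_compose[OF o open_greaterThan smooth_on_powr s1]) (use tau_pos in auto)
  have s3: "smooth_on ?U (\<lambda>q. G (lam\<^sup>2 * ((1 - ln \<alpha>) - (1/2) * ln q) powr (- (1 / h))))"
    by (rule smooth_on_compose[OF o open_UNIV smooth_G smooth_on_mult[OF o smooth_on_const[OF o] s2]]) simp
  have s4: "smooth_on ?U (\<lambda>q. q powr (- (h / 2)))" by (rule smooth_on_subset[OF smooth_on_powr]) auto
  have s5: "smooth_on ?U (\<lambda>q. 1 - q)"
    by (rule smooth_on_diff[OF o smooth_on_const[OF o] smooth_on_linear[OF o bounded_linear_ident]])
  have s6: "smooth_on ?U (\<lambda>q. (1 - q) powr h)"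
    by (rule smooth_on_compose[OF o open_greaterThan smooth_on_powr s5]) auto
  have s7: "smooth_on ?U (\<lambda>q. G (lam\<^sup>2 * ((1 - ln \<alpha>) - (1/2) * ln q) powr (- (1 / h))) * (q powr (- (h / 2)) * 2 powr (- h) * (1 - q) powr h))"
    by (rule smooth_on_mult[OF o s3 smooth_on_mult[OF o smooth_on_mult[OF o s4 smooth_on_const[OF o]] s6]])
  have s8: "smooth_on ?U V" using s7 smooth_on_cong[OF o, of V "\<lambda>q. G (lam\<^sup>2 * ((1 - ln \<alpha>) - (1/2) * ln q) powr (- (1 / h))) * (q powr (- (h / 2)) * 2 powr (- h) * (1 - q) powr h)"] by (simp add: V_def)
  have o2: "open (- {q1..exp (- 2)})" by (simp add: open_Compl)
  have s9: "smooth_on (- {q1..exp (- 2)}) V"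
    using smooth_on_const[OF o2, of 0] smooth_on_cong[OF o2, of V "\<lambda>_. 0"] V_annulus by (metis Compl_iff atLeastAtMost_iff)
  have "?U \<union> - {q1..exp (- 2)} = UNIV"
  proof -
    have q: "0 < q1" and e: "exp (- 2) < (1::real)" by (simp_all add: q1_def)
    have "x \<in> ?U" if "q1 \<le> x" "x \<le> exp (- 2)" for x
      using less_le_trans[OF q that(1)] le_less_trans[OF that(2) e] by simp
    then show ?thesis by auto
  qed
  then show ?thesis using smooth_on_Un[OF o o2 s8 s9] by simp
qed

lemma w_of_V:
  fixes z :: "real^'n"
  shows "w_of (\<lambda>x. V ((norm x)\<^sup>2)) z = G (lam\<^sup>2 * (norm z)\<^sup>2)"
proof (cases "z \<in> Dom")
  case True
  define q where "q = (norm z)\<^sup>2"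
  define b where "b = (norm (Psi z))\<^sup>2"
  have b: "0 < b" "b < 1" "0 < norm (Psi z)" using punctured_norm[OF Psi_punctured[OF True refl]] by (simp_all add: b_def)
  have "ln b = 2 * ln (norm (Psi z))" using b by (simp add: b_def ln_realpow)
  then have "(1 - ln \<alpha>) - (1/2) * ln b = tau (Psi z)" using b \<alpha>(1) by (simp add: tau_def ln_mult)
  also have "\<dots> = q powr (- h)" by (rule tau_Psi[OF True q_def])
  finally have t: "(1 - ln \<alpha>) - (1/2) * ln b = q powr (- h)" .
  have q: "0 < q" using True by (simp add: q_def Dom_def)
  have t2: "((1 - ln \<alpha>) - (1/2) * ln b) powr (- (1 / h)) = q" unfolding t powr_powr using h_pos q by simp
  have "gs_factor h b * (b powr (- (h / 2)) * 2 powr (- h) * (1 - b) powr h) = exp (h * (ln b / 2 + ln 2 - ln (1 - b)) + (- (h / 2) * ln b + - h * ln 2 + h * ln (1 - b)))"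
    using b by (simp add: gs_factor_def powr_def mult_exp_exp algebra_simps)
  also have "h * (ln b / 2 + ln 2 - ln (1 - b)) + (- (h / 2) * ln b + - h * ln 2 + h * ln (1 - b)) = 0" by (simp add: algebra_simps)
  finally have g1: "gs_factor h b * (b powr (- (h / 2)) * 2 powr (- h) * (1 - b) powr h) = 1" by simp
  have "gs_factor h b * V b = G (lam\<^sup>2 * q) * (gs_factor h b * (b powr (- (h / 2)) * 2 powr (- h) * (1 - b) powr h))"
    unfolding V_def t2 using b by (simp add: mult_ac)
  then show ?thesis using True unfolding g1 by (simp add: w_of_def b_def q_def)
next
  case False
  have "G (lam\<^sup>2 * (norm z)\<^sup>2) = 0"
  proof (rule ccontr)
    assume "G (lam\<^sup>2 * (norm z)\<^sup>2) \<noteq> 0"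
    note s = G_support[OF this]
    have "z \<noteq> 0" using s(3) by auto
    moreover have "1 - ln \<alpha> < ((norm z)\<^sup>2) powr (- h)" using s(4) by simp
    ultimately show False using False by (simp add: Dom_def)
  qed
  then show ?thesis using False by (simp add: w_of_def)
qed

context
  fixes g :: "real^'n \<Rightarrow> real^'n" and K
  assumes C: "compact_C1 (\<lambda>x::real^'n. V ((norm x)\<^sup>2)) g K" and K: "K \<subseteq> punctured"
begin

text \<open>\<open>w_of_V\<close> gives the transplanted function explicitly, and uniqueness of the
  gradient identifies \<open>gw_of\<close> without expanding it. The result is parallel to
  \<open>z\<close>, so the energy identity is exact for the competitor.\<close>

lemma gw_of_V: "gw_of (\<lambda>x. V ((norm x)\<^sup>2)) g z = (2 * (G' (lam\<^sup>2 * (norm z)\<^sup>2) * lam\<^sup>2)) *\<^sub>R z"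
proof -
  interpret radial_test G G' Q1 Q2 by (rule RT)
  have w: "w_of (\<lambda>x::real^'n. V ((norm x)\<^sup>2)) = (\<lambda>z. G (lam\<^sup>2 * (norm z)\<^sup>2))" by (rule ext) (rule w_of_V)
  have 1: "grad (\<lambda>z::real^'n. G (lam\<^sup>2 * (norm z)\<^sup>2)) z = gw_of (\<lambda>x. V ((norm x)\<^sup>2)) g z"
    by (rule grad_eqI) (rule compact_C1.deriv[OF compact_C1_transplant[OF C K], unfolded w])
  have "((\<lambda>q. G (lam\<^sup>2 * q)) has_real_derivative G' (lam\<^sup>2 * (norm z)\<^sup>2) * (lam\<^sup>2 * 1)) (at ((norm z)\<^sup>2))"
    by (rule DERIV_chain2[OF deriv_G DERIV_cmult[OF DERIV_ident]])
  then have "((\<lambda>q. G (lam\<^sup>2 * q)) has_real_derivative G' (lam\<^sup>2 * (norm z)\<^sup>2) * lam\<^sup>2) (at ((norm z)\<^sup>2))" by simp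
  from has_derivative_norm_sq_comp[OF this]
  have 2: "grad (\<lambda>z::real^'n. G (lam\<^sup>2 * (norm z)\<^sup>2)) z = (2 * (G' (lam\<^sup>2 * (norm z)\<^sup>2) * lam\<^sup>2)) *\<^sub>R z"
    by (intro grad_eqI) simp
  show ?thesis using 1 2 by simp
qed

lemma lam_power: "lam\<^sup>2 / lam ^ CARD('n) = lam powr (- (2 * h))" "1 / lam ^ CARD('n) = lam powr (- (2 * h)) / lam\<^sup>2"
proof -
  have "lam ^ CARD('n) = lam powr real CARD('n)" using lam by (simp add: powr_realpow)
  also have "real CARD('n) = 2 * h + 2" using h by simp
  also have "lam powr (2 * h + 2) = lam powr (2 * h) * lam\<^sup>2" using lam by (simp add: powr_add)
  finally have l: "lam ^ CARD('n) = lam powr (2 * h) * lam\<^sup>2" .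
  show "lam\<^sup>2 / lam ^ CARD('n) = lam powr (- (2 * h))" unfolding l using lam by (simp add: powr_minus inverse_eq_divide)
  show "1 / lam ^ CARD('n) = lam powr (- (2 * h)) / lam\<^sup>2" unfolding l using lam by (simp add: powr_minus inverse_eq_divide)
qed

text \<open>Under scaling the Dirichlet integral picks up \<open>lam powr (- (n - 2))\<close> and
  the square integral \<open>lam powr (- n)\<close>. The potential error is therefore smaller by the
  factor \<open>lam^2\<close>, while the weighted term scales like the energy.\<close>

lemma competitor_deficit:
  "hardy_deficit 0 (\<lambda>x::real^'n. V ((norm x)\<^sup>2)) \<le> lam powr (- (2 * h)) *
    ((\<integral>z. (norm ((2 * G' ((norm (z::real^'n))\<^sup>2)) *\<^sub>R z))\<^sup>2 \<partial>lborel) / (2 * h) +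
     (h\<^sup>2 + h) * (2 * h) * (64 * exp 2 / \<alpha>\<^sup>2) * (\<integral>z. (G ((norm (z::real^'n))\<^sup>2))\<^sup>2 \<partial>lborel) / lam\<^sup>2)"
proof -
  interpret radial_test G G' Q1 Q2 by (rule RT)
  interpret W: compact_C1 "w_of (\<lambda>x::real^'n. V ((norm x)\<^sup>2))" "gw_of (\<lambda>x. V ((norm x)\<^sup>2)) g" "Theta ` K" by (rule compact_C1_transplant[OF C K])
  let ?v = "\<lambda>x::real^'n. V ((norm x)\<^sup>2)"
  have hh: "(real CARD('n) - 2) / 2 = h" using h by simp
  have [measurable]: "G' \<in> borel_measurable borel" using cont_G' by (rule borel_measurable_continuous_onI)
  have "continuous_on UNIV G" by (intro continuous_at_imp_continuous_on ballI DERIV_isCont[OF deriv_G])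
  then have [measurable]: "G \<in> borel_measurable borel" by (rule borel_measurable_continuous_onI)
  define f where "f y = (norm ((2 * G' ((norm (y::real^'n))\<^sup>2)) *\<^sub>R y))\<^sup>2" for y
  have mf: "f \<in> borel_measurable borel" unfolding f_def[abs_def] by measurable
  have nl: "(norm (lam *\<^sub>R z))\<^sup>2 = lam\<^sup>2 * (norm z)\<^sup>2" for z :: "real^'n" by (simp add: power_mult_distrib)
  have pe: "(norm (gw_of ?v g z))\<^sup>2 = lam\<^sup>2 * f (lam *\<^sub>R z)" for z
  proof -
    have "(norm (gw_of ?v g z))\<^sup>2 = (2 * (G' (lam\<^sup>2 * (norm z)\<^sup>2) * lam\<^sup>2))\<^sup>2 * (norm z)\<^sup>2"
      unfolding gw_of_V norm_scaleR power_mult_distrib power2_abs ..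
    also have "\<dots> = lam\<^sup>2 * ((2 * G' (lam\<^sup>2 * (norm z)\<^sup>2))\<^sup>2 * (lam\<^sup>2 * (norm z)\<^sup>2))" by (simp add: power2_eq_square)
    also have "(2 * G' (lam\<^sup>2 * (norm z)\<^sup>2))\<^sup>2 * (lam\<^sup>2 * (norm z)\<^sup>2) = f (lam *\<^sub>R z)"
      by (simp add: f_def nl power_mult_distrib)
    finally show ?thesis .
  qed
  have "2 * h * gs_energy ?v g = (\<integral>z. (norm (gw_of ?v g z))\<^sup>2 \<partial>lborel)"
    by (rule energy_transplant(2)[OF C K, symmetric]) (auto simp: gw_of_V)
  also have "\<dots> = lam\<^sup>2 * (\<integral>z. f (lam *\<^sub>R z) \<partial>lborel)" by (simp add: pe)
  also have "\<dots> = (lam\<^sup>2 / lam ^ CARD('n)) * (\<integral>z. f z \<partial>lborel)" unfolding integral_scale[OF mf lam] by simp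
  also have "\<dots> = lam powr (- (2 * h)) * (\<integral>z. f z \<partial>lborel)" by (simp only: lam_power(1))
  finally have E: "gs_energy ?v g = lam powr (- (2 * h)) * ((\<integral>z. f z \<partial>lborel) / (2 * h))" using h_pos by (simp add: field_simps)
  define M where "M = 64 * exp 2 / \<alpha>\<^sup>2"
  have iw: "integrable lborel (\<lambda>z. M * (w_of ?v z)\<^sup>2)"
    by (intro integrable_mult_right W.integrable_continuous) (simp_all add: W.u_0 continuous_on_power W.cont_u)
  have pw: "((norm z)\<^sup>2) powr (- (2 * h + 1)) * (norm (Psi z) * conf (Psi z))\<^sup>2 * (w_of ?v z)\<^sup>2 \<le> M * (w_of ?v z)\<^sup>2" for z
  proof (cases "w_of ?v z = 0")
    case False
    then have zD: "z \<in> Dom" and Gz: "G (lam\<^sup>2 * (norm z)\<^sup>2) \<noteq> 0" using w_of_V[of z] by (auto simp: w_of_def split: if_splits)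
    show ?thesis unfolding M_def by (rule mult_right_mono[OF square_weight_bound[OF zD G_support(4)[OF Gz]]]) simp
  qed simp
  have mG: "(\<lambda>z::real^'n. (G ((norm z)\<^sup>2))\<^sup>2) \<in> borel_measurable borel" by measurable
  have "(\<integral>x. indicator punctured x * (conf x ^ CARD('n) * (?v x)\<^sup>2) \<partial>lborel)
     = 2 * h * (\<integral>z. ((norm z)\<^sup>2) powr (- (2 * h + 1)) * (norm (Psi z) * conf (Psi z))\<^sup>2 * (w_of ?v z)\<^sup>2 \<partial>lborel)"
    by (rule square_transplant[OF C K])
  also have "\<dots> \<le> 2 * h * (\<integral>z. M * (w_of ?v z)\<^sup>2 \<partial>lborel)"
    using h_pos by (intro mult_left_mono integral_mono'[OF iw] pw) (simp_all add: M_def)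
  also have "(\<integral>z. M * (w_of ?v z)\<^sup>2 \<partial>lborel) = M * (\<integral>z. (G ((norm (lam *\<^sub>R (z::real^'n)))\<^sup>2))\<^sup>2 \<partial>lborel)" by (simp only: nl w_of_V integral_mult_right_zero)
  also have "(\<integral>z. (G ((norm (lam *\<^sub>R (z::real^'n)))\<^sup>2))\<^sup>2 \<partial>lborel) = (\<integral>z. (G ((norm (z::real^'n))\<^sup>2))\<^sup>2 \<partial>lborel) * (1 / lam ^ CARD('n))"
    using integral_scale[OF mG lam] by simp
  finally have S: "(\<integral>x. indicator punctured x * (conf x ^ CARD('n) * (?v x)\<^sup>2) \<partial>lborel)
     \<le> 2 * h * (M * ((\<integral>z. (G ((norm (z::real^'n))\<^sup>2))\<^sup>2 \<partial>lborel) * (lam powr (- (2 * h)) / lam\<^sup>2)))" by (simp only: lam_power(2))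
  have "hardy_deficit 0 ?v \<le> gs_energy ?v g + (h\<^sup>2 + h) * (\<integral>x. indicator punctured x * (conf x ^ CARD('n) * (?v x)\<^sup>2) \<partial>lborel)"
    using hardy_deficit_ground_state(2)[OF C K dim] by (simp only: hh gs_energy_def[OF C K])
  also have "\<dots> \<le> gs_energy ?v g + (h\<^sup>2 + h) * (2 * h * (M * ((\<integral>z. (G ((norm (z::real^'n))\<^sup>2))\<^sup>2 \<partial>lborel) * (lam powr (- (2 * h)) / lam\<^sup>2))))"
    using S h_pos by (intro add_left_mono mult_left_mono) simp_all
  also have "\<dots> = lam powr (- (2 * h)) * ((\<integral>z. f z \<partial>lborel) / (2 * h) + (h\<^sup>2 + h) * (2 * h) * M * (\<integral>z. (G ((norm (z::real^'n))\<^sup>2))\<^sup>2 \<partial>lborel) / lam\<^sup>2)"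
    unfolding E by argo
  finally show ?thesis by (simp only: f_def M_def)
qed

lemma competitor_weighted_term:
  assumes p: "0 < p"
  shows "weighted_term p \<alpha> 0 (\<lambda>x::real^'n. V ((norm x)\<^sup>2)) = lam powr (- (2 * h)) * ((2 * h) powr (2 / p) *
    (\<integral>z. norm (z::real^'n) powr (p * (real CARD('n) - 2) / 2 - real CARD('n)) * \<bar>G ((norm z)\<^sup>2)\<bar> powr p \<partial>lborel) powr (2 / p))"
proof -
  interpret radial_test G G' Q1 Q2 by (rule RT)
  have "continuous_on UNIV G" by (intro continuous_at_imp_continuous_on ballI DERIV_isCont[OF deriv_G])
  then have [measurable]: "G \<in> borel_measurable borel" by (rule borel_measurable_continuous_onI)
  define e where "e = p * (real CARD('n) - 2) / 2 - real CARD('n)"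
  have e: "e + real CARD('n) = h * p" unfolding e_def h[symmetric] by simp
  define f where "f y = norm (y::real^'n) powr e * \<bar>G ((norm y)\<^sup>2)\<bar> powr p" for y
  have mf: "f \<in> borel_measurable borel" unfolding f_def[abs_def] by measurable
  define W where "W = (\<integral>y. f y \<partial>lborel)"
  have W: "0 \<le> W" unfolding W_def f_def by (intro integral_nonneg_AE AE_I2) simp
  have pe: "norm z powr e * \<bar>w_of (\<lambda>x. V ((norm x)\<^sup>2)) z\<bar> powr p = lam powr (- e) * f (lam *\<^sub>R z)" for z :: "real^'n"
  proof -
    have "norm (lam *\<^sub>R z) powr e = lam powr e * norm z powr e" using lam by (simp add: powr_mult)
    moreover have "lam powr (- e) * lam powr e = 1" using lam by (simp flip: powr_add)
    moreover have "(norm (lam *\<^sub>R z))\<^sup>2 = lam\<^sup>2 * (norm z)\<^sup>2" by (simp add: power_mult_distrib)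
    ultimately have "lam powr (- e) * f (lam *\<^sub>R z) = 1 * (norm z powr e * \<bar>G (lam\<^sup>2 * (norm z)\<^sup>2)\<bar> powr p)" unfolding f_def by (metis mult.assoc)
    then show ?thesis by (simp add: w_of_V)
  qed
  have "(\<integral>z. norm z powr e * \<bar>w_of (\<lambda>x::real^'n. V ((norm x)\<^sup>2)) z\<bar> powr p \<partial>lborel) = lam powr (- e) * (W / lam ^ CARD('n))"
    unfolding pe W_def using integral_scale[OF mf lam] by simp
  also have "\<dots> = lam powr (- e) / lam powr (real CARD('n)) * W" using lam by (simp add: powr_realpow)
  also have "lam powr (- e) / lam powr (real CARD('n)) = lam powr (- (h * p))" unfolding e[symmetric] by (simp flip: powr_diff)
  finally have I: "(\<integral>z. norm z powr e * \<bar>w_of (\<lambda>x::real^'n. V ((norm x)\<^sup>2)) z\<bar> powr p \<partial>lborel) = lam powr (- (h * p)) * W" .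
  have "weighted_term p \<alpha> 0 (\<lambda>x::real^'n. V ((norm x)\<^sup>2)) = (2 * h * (lam powr (- (h * p)) * W)) powr (2 / p)"
    unfolding weighted_term_eq weighted_transplant[OF C K p] e_def[symmetric] I ..
  also have "\<dots> = (2 * h) powr (2 / p) * ((lam powr (- (h * p))) powr (2 / p) * W powr (2 / p))"
    using h_pos W by (simp add: powr_mult)
  also have "(lam powr (- (h * p))) powr (2 / p) = lam powr (- (2 * h))" unfolding powr_powr using p by (simp add: mult.commute)
  finally show ?thesis by (simp add: W_def f_def e_def)
qed

end

text \<open>The competitor around \<open>a\<close> is \<open>V (|I x|^2)\<close>: smooth because
  \<open>|I x|^2\<close> is, and zero off the image of a closed annulus. Applying the isometry once
  more returns the radial function around the origin, whose deficit and weighted term are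
  known.\<close>

lemma exists_competitor:
  fixes a :: "real^'n"
  assumes a: "a \<in> ball 0 1" and p: "0 < p"
  shows "\<exists>v\<in>test_functions (ball 0 1). hardy_deficit a v \<le> lam powr (- (2 * h)) *
    ((\<integral>z. (norm ((2 * G' ((norm (z::real^'n))\<^sup>2)) *\<^sub>R z))\<^sup>2 \<partial>lborel) / (2 * h) +
     (h\<^sup>2 + h) * (2 * h) * (64 * exp 2 / \<alpha>\<^sup>2) * (\<integral>z. (G ((norm (z::real^'n))\<^sup>2))\<^sup>2 \<partial>lborel) / lam\<^sup>2) \<and>
    weighted_term p \<alpha> a v = lam powr (- (2 * h)) * ((2 * h) powr (2 / p) *
    (\<integral>z. norm (z::real^'n) powr (p * (real CARD('n) - 2) / 2 - real CARD('n)) * \<bar>G ((norm z)\<^sup>2)\<bar> powr p \<partial>lborel) powr (2 / p))"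
proof -
  obtain I where I: "ball_isometry I a" using ball_isometry_exists[OF a] .
  have I1: "I x \<in> ball 0 1" "I (I x) = x" if "x \<in> ball 0 1" for x using I that unfolding ball_isometry_def by blast+
  have I2: "continuous_on (ball 0 1) I" "I a = 0" "smooth_on (ball 0 1) (\<lambda>x. (norm (I x))\<^sup>2)" using I unfolding ball_isometry_def by blast+
  define A where "A = {y::real^'n. q1 \<le> (norm y)\<^sup>2 \<and> (norm y)\<^sup>2 \<le> exp (- 2)}"
  have e2: "exp (- 2) < (1::real)" by simp
  have Aball: "A \<subseteq> ball 0 1"
  proof
    fix y assume "y \<in> A"
    then have "(norm y)\<^sup>2 \<le> exp (- 2)" by (simp add: A_def)
    then have "(norm y)\<^sup>2 < 1" by (rule le_less_trans[OF _ e2])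
    then show "y \<in> ball 0 1" using power2_less_imp_less[of "norm y" 1] by simp
  qed
  have "closed A" unfolding A_def by (intro closed_Collect_conj closed_Collect_le continuous_intros)
  moreover have "bounded A" using Aball bounded_ball bounded_subset by blast
  ultimately have cA: "compact A" by (simp add: compact_eq_bounded_closed)
  have cI: "compact (I ` A)" by (rule compact_continuous_image[OF continuous_on_subset[OF I2(1) Aball] cA])
  have IA: "I ` A \<subseteq> ball 0 1" using I1(1) Aball by blast
  define v where "v x = (if x \<in> ball 0 1 then V ((norm (I x))\<^sup>2) else 0)" for x
  have v0: "v x = 0" if "x \<notin> I ` A" for x
  proof (cases "x \<in> ball 0 1")
    case True
    have "I x \<notin> A" using that I1(2)[OF True] by (metis image_eqI)
    then have "V ((norm (I x))\<^sup>2) = 0" using V_annulus[of "(norm (I x))\<^sup>2"] by (auto simp: A_def)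
    then show ?thesis by (simp add: v_def)
  qed (auto simp: v_def)
  have o: "open (- (I ` A))" using cI by (simp add: compact_imp_closed open_Compl)
  have s1: "smooth_on (ball 0 1) v"
    using smooth_on_compose[OF open_ball open_UNIV V_smooth I2(3)] smooth_on_cong[OF open_ball, of 0 1 v "\<lambda>x. V ((norm (I x))\<^sup>2)"] by (simp add: v_def)
  have s2: "smooth_on (- (I ` A)) v"
    using smooth_on_const[OF o, of 0] smooth_on_cong[OF o, of v "\<lambda>_. 0"] v0 by force
  have "ball 0 1 \<union> - (I ` A) = UNIV" using IA by blast
  then have s: "smooth_on UNIV v" using smooth_on_Un[OF open_ball o s1 s2] by simp
  have vt: "v \<in> test_functions (ball 0 1)" by (rule test_functionI[OF s cI IA v0])
  have Cv: "compact_C1 v (grad v) (closure {x. v x \<noteq> 0})" by (rule test_function_compact_C1[OF vt])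
  have "{x. v x \<noteq> 0} \<subseteq> I ` A" using v0 by blast
  then have cl: "closure {x. v x \<noteq> 0} \<subseteq> I ` A" using cI by (simp add: closure_minimal compact_imp_closed)
  have zA: "0 \<notin> A" by (simp add: A_def q1_def not_le)
  have aI: "a \<notin> I ` A"
  proof
    assume "a \<in> I ` A"
    then obtain y where "a = I y" "y \<in> A" by blast
    then have "y = 0" using I1(2)[of y] I2(2) Aball by auto
    then show False using zA \<open>y \<in> A\<close> by simp
  qed
  have sub: "closure {x. v x \<noteq> 0} \<subseteq> ball 0 1 - {a}" using cl aI IA by blast
  have v': "(\<lambda>x. if x \<in> ball 0 1 then v (I x) else 0) = (\<lambda>x. V ((norm x)\<^sup>2))"
  proof
    fix x :: "real^'n"
    have "V ((norm x)\<^sup>2) = 0" if "x \<notin> ball 0 1"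
    proof -
      have "1\<^sup>2 \<le> (norm x)\<^sup>2" using that by (intro power_mono) auto
      then show ?thesis by (simp add: V_def)
    qed
    then show "(if x \<in> ball 0 1 then v (I x) else 0) = V ((norm x)\<^sup>2)" using I1[of x] by (auto simp: v_def)
  qed
  from I Cv sub obtain g' where g': "compact_C1 (\<lambda>x. if x \<in> ball 0 1 then v (I x) else 0) g' (I ` closure {x. v x \<noteq> 0})"
    and eq: "hardy_deficit a v = hardy_deficit 0 (\<lambda>x. if x \<in> ball 0 1 then v (I x) else 0)" "weighted_term p \<alpha> a v = weighted_term p \<alpha> 0 (\<lambda>x. if x \<in> ball 0 1 then v (I x) else 0)"
    unfolding ball_isometry_def by blast
  have "I ` closure {x. v x \<noteq> 0} \<subseteq> punctured"
  proof
    fix y assume "y \<in> I ` closure {x. v x \<noteq> 0}"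
    then obtain x where x: "y = I (I x)" "x \<in> A" using cl by blast
    then have "y = x" using I1(2)[of x] Aball by auto
    then show "y \<in> punctured" using x zA Aball by (auto simp: punctured_def)
  qed
  from competitor_deficit[OF g'[unfolded v'] this] competitor_weighted_term[OF g'[unfolded v'] this p]
  show ?thesis using vt unfolding eq[unfolded v', symmetric] by blast
qed

end

theorem deficit_sharp:
  fixes a :: "real^'n"
  assumes a: "a \<in> ball 0 1" and p: "2 < p" "p \<le> 2 * real CARD('n) / (real CARD('n) - 2)"
    and less: "(2 * h) powr (- (p + 2) / p) * S_const TYPE('n) p < C"
  shows "\<exists>v\<in>test_functions (ball 0 1). hardy_deficit a v < C * weighted_term p \<alpha> a v"
proof -
  define C' where "C' = C * (2 * h) powr ((p + 2) / p)"
  have h2: "0 < 2 * h" using h_pos by simp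
  have z: "- (p + 2) / p + (p + 2) / p = 0" using p by (simp add: field_simps)
  have "(2 * h) powr (- (p + 2) / p) * (2 * h) powr ((p + 2) / p) = 1" unfolding powr_add[symmetric] z using h2 by simp
  then have e1: "(2 * h) powr (- (p + 2) / p) * S_const TYPE('n) p * (2 * h) powr ((p + 2) / p) = S_const TYPE('n) p" by (simp add: mult_ac)
  have "(2 * h) powr (- (p + 2) / p) * S_const TYPE('n) p * (2 * h) powr ((p + 2) / p) < C * (2 * h) powr ((p + 2) / p)"
    using less h2 by (intro mult_strict_right_mono) auto
  then have "S_const TYPE('n) p < C'" unfolding e1 C'_def .
  then obtain G G' Q1 Q2 where RT: "radial_test G G' Q1 Q2"
    and le: "(\<integral>z. (norm ((2 * G' ((norm (z::real^'n))\<^sup>2)) *\<^sub>R z))\<^sup>2 \<partial>lborel) < C' * (\<integral>z. norm (z::real^'n) powr (p * (real CARD('n) - 2) / 2 - real CARD('n)) * \<bar>G ((norm z)\<^sup>2)\<bar> powr p \<partial>lborel) powr (2 / p)"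
    using S_const_radial_approx[OF dim p] by blast
  define E where "E = (\<integral>z. (norm ((2 * G' ((norm (z::real^'n))\<^sup>2)) *\<^sub>R z))\<^sup>2 \<partial>lborel)"
  define W where "W = (\<integral>z. norm (z::real^'n) powr (p * (real CARD('n) - 2) / 2 - real CARD('n)) * \<bar>G ((norm z)\<^sup>2)\<bar> powr p \<partial>lborel) powr (2 / p)"
  define c where "c = (h\<^sup>2 + h) * (2 * h) * (64 * exp 2 / \<alpha>\<^sup>2) * (\<integral>z. (G ((norm (z::real^'n))\<^sup>2))\<^sup>2 \<partial>lborel)"
  have Q: "0 < Q2" using RT by (simp add: radial_test_def)
  have "0 \<le> (\<integral>z. (G ((norm (z::real^'n))\<^sup>2))\<^sup>2 \<partial>lborel)" by (intro integral_nonneg_AE AE_I2) simp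
  then have c: "0 \<le> c" unfolding c_def using h_pos by (intro mult_nonneg_nonneg) simp_all
  define \<delta> where "\<delta> = C * ((2 * h) powr (2 / p) * W) - E / (2 * h)"
  have "(p + 2) / p = 1 + 2 / p" using p by (simp add: add_divide_distrib)
  then have "(2 * h) powr ((p + 2) / p) = (2 * h) * (2 * h) powr (2 / p)" using h2 by (simp add: powr_add)
  then have "E < (2 * h) * (C * ((2 * h) powr (2 / p) * W))" using le by (simp add: E_def W_def C'_def mult_ac)
  then have "E / (2 * h) < C * ((2 * h) powr (2 / p) * W)" using h2 by (simp add: pos_divide_less_eq mult.commute)
  then have \<delta>: "0 < \<delta>" by (simp add: \<delta>_def)
  define T where "T = max 1 (2 - ln \<alpha>)"
  have T: "1 \<le> T" by (simp add: T_def)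
  \<comment> \<open>\<open>\<Lambda>\<close> is the square of the scale. The summand
    \<open>c / \<delta> + 1\<close> pushes the relative error \<open>c / \<Lambda>\<close> below the
    gap \<open>\<delta>\<close>; the last summand secures the support condition
    \<open>big\<close>.\<close>
  define \<Lambda> where "\<Lambda> = c / \<delta> + 1 + Q2 * T powr (1 / h)"
  have QT: "0 < Q2 * T powr (1 / h)" using Q T by simp
  have cd: "0 \<le> c / \<delta>" using c \<delta> by simp
  have \<Lambda>: "0 < \<Lambda>" "c / \<delta> < \<Lambda>" "Q2 * T powr (1 / h) \<le> \<Lambda>" using QT cd by (simp_all add: \<Lambda>_def)
  define lam where "lam = sqrt \<Lambda>"
  have lam: "0 < lam" "lam\<^sup>2 = \<Lambda>" using \<Lambda>(1) by (simp_all add: lam_def)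
  have "T = (T powr (- (1 / h))) powr (- h)" unfolding powr_powr using T h_pos by simp
  also have "\<dots> \<le> (Q2 / \<Lambda>) powr (- h)"
  proof (rule powr_mono2')
    have "Q2 \<le> \<Lambda> / T powr (1 / h)" using \<Lambda>(3) T by (simp add: pos_le_divide_eq)
    then show "Q2 / \<Lambda> \<le> T powr (- (1 / h))" using \<Lambda>(1) by (simp add: pos_divide_le_eq powr_minus_divide)
  qed (use h_pos Q \<Lambda>(1) in simp_all)
  finally have big: "max 1 (2 - ln \<alpha>) \<le> (Q2 / lam\<^sup>2) powr (- h)" by (simp only: lam(2) T_def)
  have p0: "0 < p" using p by simp
  from exists_competitor[OF RT lam(1) big a p0] obtain v where v: "v \<in> test_functions (ball 0 1)"
    "hardy_deficit a v \<le> lam powr (- (2 * h)) * (E / (2 * h) + c / lam\<^sup>2)" "weighted_term p \<alpha> a v = lam powr (- (2 * h)) * ((2 * h) powr (2 / p) * W)"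
    unfolding E_def[symmetric] W_def[symmetric] c_def[symmetric] by blast
  have "c / \<Lambda> < \<delta>" using \<Lambda>(1,2) \<delta> by (simp add: pos_divide_less_eq mult.commute)
  then have "E / (2 * h) + c / lam\<^sup>2 < C * ((2 * h) powr (2 / p) * W)" unfolding lam(2) \<delta>_def by simp
  then have "lam powr (- (2 * h)) * (E / (2 * h) + c / lam\<^sup>2) < lam powr (- (2 * h)) * (C * ((2 * h) powr (2 / p) * W))"
    using lam(1) by (intro mult_strict_left_mono) auto
  then have "hardy_deficit a v < C * weighted_term p \<alpha> a v" using v(2) unfolding v(3) by (simp add: mult_ac)
  then show ?thesis using v(1) by blast
qed

end

theorem theorem8:
  fixes x0 :: "real^'n" and p \<alpha> :: real
  defines "n \<equiv> real CARD('n)"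
  defines "K \<equiv> (n - 2) powr (- (p + 2) / p) * S_const TYPE('n) p"
  assumes "CARD('n) \<ge> 3"
    and "2 < p" and "p \<le> 2 * n / (n - 2)"
    and "0 < \<alpha>" and "\<alpha> \<le> exp ((n - 3) / (n - 2))"
    and "x0 \<in> ball 0 1"
  shows "(\<forall>v\<in>test_functions (ball 0 1). hardy_deficit x0 v \<ge> K * weighted_term p \<alpha> x0 v) \<and>
         (\<forall>C>K. \<exists>v\<in>test_functions (ball 0 1). hardy_deficit x0 v < C * weighted_term p \<alpha> x0 v)"
proof -
  define h where "h = (real CARD('n) - 2) / 2"
  have h2: "2 * h = real CARD('n) - 2" by (simp add: h_def)
  have d: "3 \<le> CARD('n)" by fact
  have \<alpha>: "0 < \<alpha>" "\<alpha> \<le> exp ((real CARD('n) - 3) / (real CARD('n) - 2))"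
    using \<open>0 < \<alpha>\<close> \<open>\<alpha> \<le> exp ((n - 3) / (n - 2))\<close> unfolding n_def by simp_all
  interpret transplant \<alpha> h "TYPE('n)" by (rule transplant.intro[OF d h2 \<alpha>])
  have p: "2 < p" "p \<le> 2 * real CARD('n) / (real CARD('n) - 2)"
    using \<open>2 < p\<close> \<open>p \<le> 2 * n / (n - 2)\<close> unfolding n_def by simp_all
  have K: "K = (2 * h) powr (- (p + 2) / p) * S_const TYPE('n) p" unfolding K_def n_def h2 ..
  show ?thesis
  proof (intro conjI ballI allI impI)
    fix v :: "real^'n \<Rightarrow> real" assume v: "v \<in> test_functions (ball 0 1)"
    then have "closure {x. v x \<noteq> 0} \<subseteq> ball 0 1" by (simp add: test_functions_def)
    from deficit_lower[OF test_function_compact_C1[OF v] \<open>x0 \<in> ball 0 1\<close> this p]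
    show "K * weighted_term p \<alpha> x0 v \<le> hardy_deficit x0 v" unfolding K .
  next
    fix C assume "K < C"
    then show "\<exists>v\<in>test_functions (ball 0 1). hardy_deficit x0 v < C * weighted_term p \<alpha> x0 v"
      using deficit_sharp[OF \<open>x0 \<in> ball 0 1\<close> p] unfolding K by blast
  qed
qed

end
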